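(* Let the data and noise assumptions and the smoothness assumptions stated in the context hold. Suppose there are constants $R,L$ with $\mathbb{E}[|\Delta\theta^0_i|^4]\le R^4$ ($0\le i\le d$) and $\mathbb{E}[|\Delta\theta^0_i-\Delta\theta^0_{i-1}|^4]\le L^4d^{-4}$ ($1\le i\le d$), and a uniform constant $C_{s,1}$ such that $\max(\eta dT,\sigma\eta T^{1/2})\le C_{s,1}$ for all $d\ge1,T>0$ along the limiting sequence. For $s\in[0,\tau]$ put $$\mathrm{MSE}^{d,T}(s)=\frac1d\sum_{i=1}^d\bar\Theta^{d,T}\Big(\frac{\lfloor sT\rfloor}T,\frac id\Big)^2,$$ $$\mathrm{PE}^{d,T}(s)=\frac1{d^2}\sum_{i,j=1}^dA\Big(\frac id,\frac jd\Big)\bar\Theta^{d,T}\Big(\frac{\lfloor sT\rfloor}T,\frac id\Big)\bar\Theta^{d,T}\Big(\frac{\lfloor sT\rfloor}T,\frac jd\Big),$$ $$\mathrm{MSE}(s)=\int_0^1\Theta(s,x)^2dx,\qquad\mathrm{PE}(s)=\int_0^1\int_0^1\Theta(s,x)A(x,y)\Theta(s,y)\,dx\,dy.$$ Then, as $d,T\to\infty$, (i) $\mathrm{MSE}^{d,T}(s)\to\mathrm{MSE}(s)$ and (ii) $\mathrm{PE}^{d,T}(s)\to\mathrm{PE}(s)$ (in probability in case (1) and in distribution in cases (2) and (3)), provided one of the following holds: (1) (Low noise) $\sigma d^{-1}T^{-1/2}\to0$, $\eta dT\to\alpha\in(0,\infty)$, and $\Theta$ is the solution to $\partial_s\Theta(s,x)=-\alpha\int_0^1A(x,y)\Theta(s,y)\,dy$.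 (2) (Moderate noise) $\sigma d^{-1}T^{-1/2}\to\beta\in(0,\infty)$, $\eta dT\to\alpha\in(0,\infty)$, and $\Theta$ is the solution to $d\Theta(s,x)=-\alpha\int_0^1A(x,y)\Theta(s,y)\,dy\,ds+\alpha\beta\,d\xi_1(s,x)$. (3) (High noise) $\sigma d^{-1}T^{-1/2}\to\infty$, $\eta\sigma T^{1/2}\to\alpha\in(0,\infty)$, and $\Theta$ is the solution to $d\Theta(s,x)=\alpha\,d\xi_1(s,x)$. Here $\xi_1$ is a centered Gaussian random field process on $[0,\tau]\times[0,1]$ with $\mathbb{E}[\xi_1(s_1,x)\xi_1(s_2,y)]=(s_1\wedge s_2)A(x,y)$.
   Context: **SGD and interpolation.** Let $\tau\in(0,\infty)$, $d,T$ positive integers, $[d]=\{1,\dots,d\}$. With data $x^t=(x^t_1,\dots,x^t_d)\in\mathbb{R}^d$, noise $\varepsilon^t\in\mathbb{R}$ ($t=0,1,2,\dots$), $\theta^*\in\mathbb{R}^d$ and $y^t=\langle x^t,\theta^*\rangle+\varepsilon^t$, online least-squares SGD with step size $\eta>0$ and initial guess $\theta^0$ is $\theta^{t+1}=\theta^t+\eta(y^t-\langle x^t,\theta^t\rangle)x^t$. Put $\Delta\theta^t=\theta^t-\theta^*$; thus $\Delta\theta^{t+1}_i=\Delta\theta^t_i-\eta\sum_{j=1}^dx^t_ix^t_j\Delta\theta^t_j+\eta x^t_i\varepsilon^t$ for $i\in[d]$; set $\Delta\theta^t_0:=\Delta\theta^t_1$. The parameters $\eta$ and $\sigma=\sigma_d$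 may vary with $d,T$, and $d,T\to\infty$ jointly along a limiting sequence. Define, for $s\in[0,\tau]$, $x\in[0,1]$, $$\Theta^{d,T}(s,x)=(\lfloor dx\rfloor+1-dx)\Delta\theta^{\lfloor sT\rfloor}_{\lfloor dx\rfloor}+(dx-\lfloor dx\rfloor)\Delta\theta^{\lfloor sT\rfloor}_{\lfloor dx\rfloor+1}$$ (second term $0$ at $x=1$), and $$\bar\Theta^{d,T}(s,x)=(\lfloor sT\rfloor+1-sT)\,\Theta^{d,T}\big(\tfrac{\lfloor sT\rfloor}{T},x\big)+(sT-\lfloor sT\rfloor)\,\Theta^{d,T}\big(\tfrac{\lfloor sT\rfloor+1}{T},x\big),$$ a random element of $C([0,\tau];C([0,1]))$. **Data and noise assumptions.** $A,B,E$ are real symmetric functions on $[0,1]^2,[0,1]^4,[0,1]^8$. $\{W(s,x)\}_{s\ge0,x\in[0,1]}$ is a stochastic process, white in time (independent at distinct times), with, for all $s$ and $x_1,\dots,x_8\in[0,1]$, $\mathbb{E}[W(s,x_1)]=0$, $\mathbb{E}[W(s,x_1)W(s,x_2)]=A(x_1,x_2)$, $\mathbb{E}[\prod_{i=1}^4W(s,x_i)]=B(x_1,\dots,x_4)$, $\mathbb{E}[\prod_{i=1}^8W(s,x_i)]=E(x_1,\dots,x_8)$. The data are $x^t_i=W(t/T,i/d)$. The vectors $x^t$ are i.i.d. in $t$, the $\varepsilon^t$ are i.i.d. in $t$, and $\{x^t\}$ and $\{\varepsilon^t\}$ are independent of each other and of $\theta^0$. There is a universal constant $C_1>0$ with $\mathbb{E}[\varepsilon^t]=0$,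 $\mathbb{E}[|\varepsilon^t|^2]=\sigma^2$, $\mathbb{E}[|\varepsilon^t|^4]=C_1\sigma^4$. **Smoothness assumptions.** There are constants $C_2,\dots,C_9$ such that for all arguments in $[0,1]$: (1) $A(x,\cdot)\in C^1([0,1])$ for every $x$; $|A(x,y)|\le C_2$; $|A(x,z)-A(y,z)|\le C_3|x-y|$; $|A(x,x)+A(y,y)-2A(x,y)|\le C_4^2|x-y|^2$. (2) $|B(x_1,x_2,x_3,x_4)|\le C_5$; $|B(x_1,x_3,x_1,x_3)+B(x_2,x_3,x_2,x_3)-2B(x_1,x_3,x_2,x_3)|\le C_6^2|x_1-x_2|^2$; $|B(x_1,x_1,x_1,x_1)+B(x_2,x_2,x_2,x_2)+6B(x_1,x_1,x_2,x_2)-4B(x_1,x_1,x_1,x_2)-4B(x_1,x_2,x_2,x_2)|\le C_7^4|x_1-x_2|^4$. (3) $E(x_1,\dots,x_8)\le C_8$; with $\tilde x=(x_3,x_4,x_5,x_6)$, $|E(x_1,x_1,x_1,x_1,\tilde x)+E(x_2,x_2,x_2,x_2,\tilde x)+6E(x_1,x_1,x_2,x_2,\tilde x)-4E(x_1,x_1,x_1,x_2,\tilde x)-4E(x_1,x_2,x_2,x_2,\tilde x)|\le C_9^4|x_1-x_2|^4$. **Gaussian random field process.** A time-indexed random field $g$ on $[0,\tau]\times[0,1]$ such that $\{(g(t,x_1),\dots,g(t,x_K))\}_t$ is a multivariate Gaussian process for every finite $K$ and $x_1,\dots,x_K\in[0,1]$. $d\xi(s,x)$ denotes the increment in the time variable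 $s$; SDEs are understood in time-integrated form, with solutions in $C([0,\tau];C([0,1]))$. **Convention on initial conditions.** Let $\Theta^d$ be the piecewise linear spatial interpolation of $\{\Delta\theta^0_i\}$; under the stated hypotheses it has subsequential weak limits in $C([0,1])$. One such subsequential limit $\Theta_0$ is picked and used as the initial condition $\Theta(0,\cdot)=\Theta_0$ of the limiting equation (limits being taken accordingly).
   Formalization: In case (1), convergence in probability is stated when the initial interpolations converge to Θ_0 in probability on the data's space; for a mere weak limit Θ_0 it is convergence in distribution. In cases (2), (3), Θ_0 is assumed independent of ξ_1. *)

theory Defs
  imports "HOL-Probability.Probability"
begin

section \<open>Path spaces, random elements and modes of convergence\<close>

definition C01 :: "(real \<Rightarrow> real) metric" where
  "C01 = cfunspace (top_of_set {0..1}) euclidean_metric"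

definition path_space :: "real \<Rightarrow> (real \<Rightarrow> real \<Rightarrow> real) metric" where
  "path_space \<tau> = cfunspace (top_of_set {0..\<tau>}) C01"

text \<open>Measurability is with respect to the Borel sigma-algebra of the metric space \<open>m\<close>.\<close>

definition random_element :: "'a measure \<Rightarrow> 'b metric \<Rightarrow> ('a \<Rightarrow> 'b) \<Rightarrow> bool" where
  "random_element M m X \<longleftrightarrow>
     X \<in> space M \<rightarrow> mspace m \<and>
     (\<forall>U. openin (mtopology_of m) U \<longrightarrow> X -` U \<inter> space M \<in> sets M)"

text \<open>Weak convergence of random elements of \<open>m\<close>. The limit may live on a different
  probability space.\<close>

definition weak_conv_metric ::
  "'c metric \<Rightarrow> 'a measure \<Rightarrow> (nat \<Rightarrow> 'a \<Rightarrow> 'c) \<Rightarrow> 'b measure \<Rightarrow> ('b \<Rightarrow> 'c) \<Rightarrow> bool" where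
  "weak_conv_metric m M X N Y \<longleftrightarrow>
     (\<forall>F :: 'c \<Rightarrow> real. continuous_map (mtopology_of m) euclideanreal F \<and> bounded (F ` mspace m) \<longrightarrow>
        (\<lambda>k. \<integral>\<omega>. F (X k \<omega>) \<partial>M) \<longlonglongrightarrow> (\<integral>\<omega>. F (Y \<omega>) \<partial>N))"

definition conv_in_distribution ::
  "'a measure \<Rightarrow> (nat \<Rightarrow> 'a \<Rightarrow> real) \<Rightarrow> 'b measure \<Rightarrow> ('b \<Rightarrow> real) \<Rightarrow> bool" where
  "conv_in_distribution M X N Y \<longleftrightarrow> weak_conv_m (\<lambda>k. distr M borel (X k)) (distr N borel Y)"

text \<open>Unlike weak convergence, convergence in probability presupposes that the limit lives on the
  same probability space as the sequence.\<close>

definition conv_in_prob_metric ::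
  "'c metric \<Rightarrow> 'a measure \<Rightarrow> (nat \<Rightarrow> 'a \<Rightarrow> 'c) \<Rightarrow> ('a \<Rightarrow> 'c) \<Rightarrow> bool" where
  "conv_in_prob_metric m M X Y \<longleftrightarrow>
     (\<forall>e>0. (\<lambda>k. measure M {\<omega> \<in> space M. mdist m (X k \<omega>) (Y \<omega>) > e}) \<longlonglongrightarrow> 0)"

definition conv_in_prob :: "'a measure \<Rightarrow> (nat \<Rightarrow> 'a \<Rightarrow> real) \<Rightarrow> ('a \<Rightarrow> real) \<Rightarrow> bool" where
  "conv_in_prob M X Y \<longleftrightarrow> conv_in_prob_metric euclidean_metric M X Y"


section \<open>The random field generating the data\<close>

text \<open>The moments \<open>B\<close> (of order 4) and \<open>E\<close> (of order 8) are functions on \<open>[0,1]\<^sup>4\<close> and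
  \<open>[0,1]\<^sup>8\<close>; their arguments are lists of that length.\<close>

definition points :: "nat \<Rightarrow> real list set" where
  "points k = {xs. length xs = k \<and> set xs \<subseteq> {0..1}}"

locale white_field = prob_space M
  for M :: "'a measure" +
  fixes W :: "real \<Rightarrow> real \<Rightarrow> 'a \<Rightarrow> real"
    and A :: "real \<Rightarrow> real \<Rightarrow> real"
    and B E :: "real list \<Rightarrow> real"
  assumes A_sym: "\<lbrakk>x \<in> {0..1}; y \<in> {0..1}\<rbrakk> \<Longrightarrow> A x y = A y x"
    and B_sym: "\<lbrakk>xs \<in> points 4; ys \<in> points 4; mset xs = mset ys\<rbrakk> \<Longrightarrow> B xs = B ys"
    and E_sym: "\<lbrakk>xs \<in> points 8; ys \<in> points 8; mset xs = mset ys\<rbrakk> \<Longrightarrow> E xs = E ys"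
    and W_measurable: "\<lbrakk>s \<ge> 0; x \<in> {0..1}\<rbrakk> \<Longrightarrow> random_variable borel (W s x)"
    and W_white:
      "indep_vars (\<lambda>_. PiM {0..1} (\<lambda>_. borel)) (\<lambda>s \<omega>. \<lambda>x\<in>{0..1}. W s x \<omega>) {0..}"
    and W_mean: "\<lbrakk>s \<ge> 0; x \<in> {0..1}\<rbrakk> \<Longrightarrow> has_bochner_integral M (W s x) 0"
    and W_moment2: "\<lbrakk>s \<ge> 0; x \<in> {0..1}; y \<in> {0..1}\<rbrakk> \<Longrightarrow>
      has_bochner_integral M (\<lambda>\<omega>. W s x \<omega> * W s y \<omega>) (A x y)"
    and W_moment4: "\<lbrakk>s \<ge> 0; xs \<in> points 4\<rbrakk> \<Longrightarrow>
      has_bochner_integral M (\<lambda>\<omega>. \<Prod>x\<leftarrow>xs. W s x \<omega>) (B xs)"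
    and W_moment8: "\<lbrakk>s \<ge> 0; xs \<in> points 8\<rbrakk> \<Longrightarrow>
      has_bochner_integral M (\<lambda>\<omega>. \<Prod>x\<leftarrow>xs. W s x \<omega>) (E xs)"

definition smooth_A :: "(real \<Rightarrow> real \<Rightarrow> real) \<Rightarrow> bool" where
  "smooth_A A \<longleftrightarrow>
     (\<forall>x\<in>{0..1}. \<exists>D. continuous_on {0..1} D \<and>
        (\<forall>y\<in>{0..1}. (A x has_real_derivative D y) (at y within {0..1}))) \<and>
     (\<exists>C2. \<forall>x\<in>{0..1}. \<forall>y\<in>{0..1}. \<bar>A x y\<bar> \<le> C2) \<and>
     (\<exists>C3. \<forall>x\<in>{0..1}. \<forall>y\<in>{0..1}. \<forall>z\<in>{0..1}. \<bar>A x z - A y z\<bar> \<le> C3 * \<bar>x - y\<bar>) \<and>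
     (\<exists>C4. \<forall>x\<in>{0..1}. \<forall>y\<in>{0..1}. \<bar>A x x + A y y - 2 * A x y\<bar> \<le> C4\<^sup>2 * \<bar>x - y\<bar>\<^sup>2)"

definition smooth_B :: "(real list \<Rightarrow> real) \<Rightarrow> bool" where
  "smooth_B B \<longleftrightarrow>
     (\<exists>C5. \<forall>xs\<in>points 4. \<bar>B xs\<bar> \<le> C5) \<and>
     (\<exists>C6. \<forall>x1\<in>{0..1}. \<forall>x2\<in>{0..1}. \<forall>x3\<in>{0..1}.
        \<bar>B [x1, x3, x1, x3] + B [x2, x3, x2, x3] - 2 * B [x1, x3, x2, x3]\<bar>
          \<le> C6\<^sup>2 * \<bar>x1 - x2\<bar>\<^sup>2) \<and>
     (\<exists>C7. \<forall>x1\<in>{0..1}. \<forall>x2\<in>{0..1}.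
        \<bar>B [x1, x1, x1, x1] + B [x2, x2, x2, x2] + 6 * B [x1, x1, x2, x2]
           - 4 * B [x1, x1, x1, x2] - 4 * B [x1, x2, x2, x2]\<bar>
          \<le> C7 ^ 4 * \<bar>x1 - x2\<bar> ^ 4)"

definition smooth_E :: "(real list \<Rightarrow> real) \<Rightarrow> bool" where
  "smooth_E E \<longleftrightarrow>
     (\<exists>C8. \<forall>xs\<in>points 8. E xs \<le> C8) \<and>
     (\<exists>C9. \<forall>x1\<in>{0..1}. \<forall>x2\<in>{0..1}. \<forall>zs\<in>points 4.
        \<bar>E ([x1, x1, x1, x1] @ zs) + E ([x2, x2, x2, x2] @ zs) + 6 * E ([x1, x1, x2, x2] @ zs)
           - 4 * E ([x1, x1, x1, x2] @ zs) - 4 * E ([x1, x2, x2, x2] @ zs)\<bar>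
          \<le> C9 ^ 4 * \<bar>x1 - x2\<bar> ^ 4)"


section \<open>Online least-squares SGD\<close>

definition sgd_data :: "(real \<Rightarrow> real \<Rightarrow> 'a \<Rightarrow> real) \<Rightarrow> nat \<Rightarrow> nat \<Rightarrow> nat \<Rightarrow> nat \<Rightarrow> 'a \<Rightarrow> real" where
  "sgd_data W d T t i = W (real t / real T) (real i / real d)"

definition generated_sets :: "'a measure \<Rightarrow> ('a \<Rightarrow> 'b) \<Rightarrow> 'b measure \<Rightarrow> 'a set set" where
  "generated_sets M X P = sets (vimage_algebra (space M) X P)"

text \<open>Vectors in \<open>\<real>\<^sup>d\<close> are functions on \<open>{1..d}\<close>, because \<open>d\<close> varies along the limiting
  sequence. The locale describes one member of that sequence; \<open>C1\<close> is a parameter so that it can be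
  the same for all members. By \<open>sources_indep\<close> the data, the noises and the initial guess, as three
  whole families, are mutually independent; measurability of the initial guess is part of it, since
  \<open>indep_sets\<close> requires its members to consist of events.\<close>

locale online_sgd = white_field M W A B E
  for M :: "'a measure" and W A B E +
  fixes d T :: nat
    and \<eta> \<sigma> C1 :: real
    and \<theta>s :: "nat \<Rightarrow> real"
    and \<epsilon> :: "nat \<Rightarrow> 'a \<Rightarrow> real"
    and \<theta> :: "nat \<Rightarrow> nat \<Rightarrow> 'a \<Rightarrow> real"
  assumes d_pos: "d > 0" and T_pos: "T > 0" and \<eta>_pos: "\<eta> > 0" and \<sigma>_nonneg: "\<sigma> \<ge> 0"
    and C1_pos: "C1 > 0"
    and data_indep: "indep_vars (\<lambda>_. PiM {1..d} (\<lambda>_. borel))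
          (\<lambda>t \<omega>. \<lambda>i\<in>{1..d}. sgd_data W d T t i \<omega>) UNIV"
    and data_identical:
      "distr M (PiM {1..d} (\<lambda>_. borel)) (\<lambda>\<omega>. \<lambda>i\<in>{1..d}. sgd_data W d T t i \<omega>) =
       distr M (PiM {1..d} (\<lambda>_. borel)) (\<lambda>\<omega>. \<lambda>i\<in>{1..d}. sgd_data W d T 0 i \<omega>)"
    and noise_indep: "indep_vars (\<lambda>_. borel) \<epsilon> UNIV"
    and noise_identical: "distr M borel (\<epsilon> t) = distr M borel (\<epsilon> 0)"
    and noise_mean: "has_bochner_integral M (\<epsilon> t) 0"
    and noise_moment2: "has_bochner_integral M (\<lambda>\<omega>. \<bar>\<epsilon> t \<omega>\<bar>\<^sup>2) (\<sigma>\<^sup>2)"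
    and noise_moment4: "has_bochner_integral M (\<lambda>\<omega>. \<bar>\<epsilon> t \<omega>\<bar> ^ 4) (C1 * \<sigma> ^ 4)"
    and sources_indep: "indep_sets (\<lambda>k.
          [generated_sets M (\<lambda>\<omega>. \<lambda>(t, i)\<in>UNIV \<times> {1..d}. sgd_data W d T t i \<omega>)
             (PiM (UNIV \<times> {1..d}) (\<lambda>_. borel)),
           generated_sets M (\<lambda>\<omega> t. \<epsilon> t \<omega>) (PiM UNIV (\<lambda>_. borel)),
           generated_sets M (\<lambda>\<omega>. \<lambda>i\<in>{1..d}. \<theta> 0 i \<omega>) (PiM {1..d} (\<lambda>_. borel))] ! k) {..<3}"
    and sgd_step: "\<lbrakk>\<omega> \<in> space M; i \<in> {1..d}\<rbrakk> \<Longrightarrow>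
      (let x = (\<lambda>j. sgd_data W d T t j \<omega>);
           y = (\<Sum>j=1..d. x j * \<theta>s j) + \<epsilon> t \<omega>
       in \<theta> (Suc t) i \<omega> = \<theta> t i \<omega> + \<eta> * (y - (\<Sum>j=1..d. x j * \<theta> t j \<omega>)) * x i)"

text \<open>The error process \<open>\<Delta>\<theta>\<close>, extended to the index 0 by its value at 1.\<close>

definition sgd_err ::
  "(nat \<Rightarrow> real) \<Rightarrow> (nat \<Rightarrow> nat \<Rightarrow> 'a \<Rightarrow> real) \<Rightarrow> 'a \<Rightarrow> nat \<Rightarrow> nat \<Rightarrow> real" where
  "sgd_err \<theta>s \<theta> \<omega> t i = (let j = (if i = 0 then 1 else i) in \<theta> t j \<omega> - \<theta>s j)"

text \<open>At \<open>x = 1\<close> the second summand refers to the meaningless index \<open>d + 1\<close>, but its weight is 0.\<close>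

definition interp :: "nat \<Rightarrow> (nat \<Rightarrow> real) \<Rightarrow> real \<Rightarrow> real" where
  "interp d v x =
     (of_int \<lfloor>d * x\<rfloor> + 1 - d * x) * v (nat \<lfloor>d * x\<rfloor>)
       + (d * x - of_int \<lfloor>d * x\<rfloor>) * v (nat \<lfloor>d * x\<rfloor> + 1)"

text \<open>In the following definitions \<open>\<Delta> t i\<close> is one realisation of the error process.\<close>

definition Theta_dT :: "nat \<Rightarrow> nat \<Rightarrow> (nat \<Rightarrow> nat \<Rightarrow> real) \<Rightarrow> real \<Rightarrow> real \<Rightarrow> real" where
  "Theta_dT d T \<Delta> s x = interp d (\<Delta> (nat \<lfloor>s * T\<rfloor>)) x"

definition Theta_bar :: "nat \<Rightarrow> nat \<Rightarrow> (nat \<Rightarrow> nat \<Rightarrow> real) \<Rightarrow> real \<Rightarrow> real \<Rightarrow> real" where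
  "Theta_bar d T \<Delta> s x =
     (of_int \<lfloor>s * T\<rfloor> + 1 - s * T) * Theta_dT d T \<Delta> (of_int \<lfloor>s * T\<rfloor> / T) x
       + (s * T - of_int \<lfloor>s * T\<rfloor>) * Theta_dT d T \<Delta> ((of_int \<lfloor>s * T\<rfloor> + 1) / T) x"

definition MSE_dT :: "nat \<Rightarrow> nat \<Rightarrow> (nat \<Rightarrow> nat \<Rightarrow> real) \<Rightarrow> real \<Rightarrow> real" where
  "MSE_dT d T \<Delta> s =
     1 / real d * (\<Sum>i=1..d. (Theta_bar d T \<Delta> (of_int \<lfloor>s * T\<rfloor> / T) (real i / real d))\<^sup>2)"

definition PE_dT ::
  "(real \<Rightarrow> real \<Rightarrow> real) \<Rightarrow> nat \<Rightarrow> nat \<Rightarrow> (nat \<Rightarrow> nat \<Rightarrow> real) \<Rightarrow> real \<Rightarrow> real" where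
  "PE_dT A d T \<Delta> s =
     1 / (real d)\<^sup>2 * (\<Sum>i=1..d. \<Sum>j=1..d. A (real i / real d) (real j / real d)
        * Theta_bar d T \<Delta> (of_int \<lfloor>s * T\<rfloor> / T) (real i / real d)
        * Theta_bar d T \<Delta> (of_int \<lfloor>s * T\<rfloor> / T) (real j / real d))"

definition MSE :: "(real \<Rightarrow> real \<Rightarrow> real) \<Rightarrow> real \<Rightarrow> real" where
  "MSE f s = (LBINT x:{0..1}. (f s x)\<^sup>2)"

definition PE :: "(real \<Rightarrow> real \<Rightarrow> real) \<Rightarrow> (real \<Rightarrow> real \<Rightarrow> real) \<Rightarrow> real \<Rightarrow> real" where
  "PE A f s = (LBINT x:{0..1}. LBINT y:{0..1}. f s x * A x y * f s y)"

text \<open>The spatial interpolation of the initial error, as a random element of \<open>C([0,1])\<close>.\<close>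

definition Theta_init ::
  "nat \<Rightarrow> (nat \<Rightarrow> real) \<Rightarrow> (nat \<Rightarrow> nat \<Rightarrow> 'a \<Rightarrow> real) \<Rightarrow> 'a \<Rightarrow> real \<Rightarrow> real" where
  "Theta_init d \<theta>s \<theta> \<omega> = (\<lambda>x\<in>{0..1}. interp d (sgd_err \<theta>s \<theta> \<omega> 0) x)"


section \<open>Gaussian random field processes\<close>

text \<open>Degenerate Gaussians (point masses) are included.\<close>

definition gaussian_rv :: "'b measure \<Rightarrow> ('b \<Rightarrow> real) \<Rightarrow> bool" where
  "gaussian_rv N X \<longleftrightarrow> X \<in> borel_measurable N \<and>
     (\<exists>\<mu>. distr N borel X = return borel \<mu> \<or>
        (\<exists>v>0. distr N borel X = density lborel (normal_density \<mu> v)))"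

definition gaussian_vector :: "'b measure \<Rightarrow> 'i set \<Rightarrow> ('i \<Rightarrow> 'b \<Rightarrow> real) \<Rightarrow> bool" where
  "gaussian_vector N I Y \<longleftrightarrow> (\<forall>c :: 'i \<Rightarrow> real. gaussian_rv N (\<lambda>\<omega>. \<Sum>i\<in>I. c i * Y i \<omega>))"

definition gaussian_field_process ::
  "'b measure \<Rightarrow> real \<Rightarrow> (real \<Rightarrow> real \<Rightarrow> 'b \<Rightarrow> real) \<Rightarrow> bool" where
  "gaussian_field_process N \<tau> g \<longleftrightarrow>
     (\<forall>X S. finite X \<and> X \<subseteq> {0..1} \<and> finite S \<and> S \<subseteq> {0..\<tau>} \<longrightarrow>
        gaussian_vector N (S \<times> X) (\<lambda>(t, x). g t x))"

definition driving_field ::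
  "'b measure \<Rightarrow> real \<Rightarrow> (real \<Rightarrow> real \<Rightarrow> real) \<Rightarrow> (real \<Rightarrow> real \<Rightarrow> 'b \<Rightarrow> real) \<Rightarrow> bool" where
  "driving_field N \<tau> A \<xi> \<longleftrightarrow>
     gaussian_field_process N \<tau> \<xi> \<and>
     (\<forall>s\<in>{0..\<tau>}. \<forall>x\<in>{0..1}. has_bochner_integral N (\<xi> s x) 0) \<and>
     (\<forall>s1\<in>{0..\<tau>}. \<forall>s2\<in>{0..\<tau>}. \<forall>x\<in>{0..1}. \<forall>y\<in>{0..1}.
        has_bochner_integral N (\<lambda>\<omega>. \<xi> s1 x \<omega> * \<xi> s2 y \<omega>) (min s1 s2 * A x y))"

text \<open>The initial guess is independent of data and noise, so the limiting initial condition is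
  independent of the driving field. Without this the law of the solution would not be
  determined.\<close>

definition init_indep_field ::
  "'b measure \<Rightarrow> real \<Rightarrow> ('b \<Rightarrow> real \<Rightarrow> real) \<Rightarrow> (real \<Rightarrow> real \<Rightarrow> 'b \<Rightarrow> real) \<Rightarrow> bool" where
  "init_indep_field N \<tau> \<Theta>0 \<xi> \<longleftrightarrow>
     prob_space.indep_set N
       (generated_sets N \<Theta>0 (PiM {0..1} (\<lambda>_. borel)))
       (generated_sets N (\<lambda>\<omega>. \<lambda>(s, x)\<in>{0..\<tau>} \<times> {0..1}. \<xi> s x \<omega>)
          (PiM ({0..\<tau>} \<times> {0..1}) (\<lambda>_. borel)))"


section \<open>Solutions of the limiting equations\<close>

definition low_noise_solution ::
  "'b measure \<Rightarrow> real \<Rightarrow> real \<Rightarrow> (real \<Rightarrow> real \<Rightarrow> real) \<Rightarrow>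
   ('b \<Rightarrow> real \<Rightarrow> real) \<Rightarrow> ('b \<Rightarrow> real \<Rightarrow> real \<Rightarrow> real) \<Rightarrow> bool" where
  "low_noise_solution N \<tau> \<alpha> A \<Theta>0 \<Theta> \<longleftrightarrow>
     random_element N (path_space \<tau>) \<Theta> \<and>
     (AE \<omega> in N. \<Theta> \<omega> 0 = \<Theta>0 \<omega> \<and>
        (\<forall>s\<in>{0..\<tau>}. \<forall>x\<in>{0..1}.
           ((\<lambda>u. \<Theta> \<omega> u x) has_real_derivative - \<alpha> * (LBINT y:{0..1}. A x y * \<Theta> \<omega> s y))
             (at s within {0..\<tau>})))"

definition moderate_noise_solution ::
  "'b measure \<Rightarrow> real \<Rightarrow> real \<Rightarrow> real \<Rightarrow> (real \<Rightarrow> real \<Rightarrow> real) \<Rightarrow> (real \<Rightarrow> real \<Rightarrow> 'b \<Rightarrow> real) \<Rightarrow>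
   ('b \<Rightarrow> real \<Rightarrow> real) \<Rightarrow> ('b \<Rightarrow> real \<Rightarrow> real \<Rightarrow> real) \<Rightarrow> bool" where
  "moderate_noise_solution N \<tau> \<alpha> \<beta> A \<xi> \<Theta>0 \<Theta> \<longleftrightarrow>
     random_element N (path_space \<tau>) \<Theta> \<and>
     (AE \<omega> in N. \<Theta> \<omega> 0 = \<Theta>0 \<omega> \<and>
        (\<forall>s\<in>{0..\<tau>}. \<forall>x\<in>{0..1}.
           \<Theta> \<omega> s x - \<Theta> \<omega> 0 x =
             - \<alpha> * (LBINT u:{0..s}. LBINT y:{0..1}. A x y * \<Theta> \<omega> u y)
             + \<alpha> * \<beta> * (\<xi> s x \<omega> - \<xi> 0 x \<omega>)))"

definition high_noise_solution ::
  "'b measure \<Rightarrow> real \<Rightarrow> real \<Rightarrow> (real \<Rightarrow> real \<Rightarrow> 'b \<Rightarrow> real) \<Rightarrow>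
   ('b \<Rightarrow> real \<Rightarrow> real) \<Rightarrow> ('b \<Rightarrow> real \<Rightarrow> real \<Rightarrow> real) \<Rightarrow> bool" where
  "high_noise_solution N \<tau> \<alpha> \<xi> \<Theta>0 \<Theta> \<longleftrightarrow>
     random_element N (path_space \<tau>) \<Theta> \<and>
     (AE \<omega> in N. \<Theta> \<omega> 0 = \<Theta>0 \<omega> \<and>
        (\<forall>s\<in>{0..\<tau>}. \<forall>x\<in>{0..1}.
           \<Theta> \<omega> s x - \<Theta> \<omega> 0 x = \<alpha> * (\<xi> s x \<omega> - \<xi> 0 x \<omega>)))"

end

theory Submission
  imports Defs
begin

text \<open>Testing the error at a fixed time against a vector and unrolling the recursion backwards turns
  it into the initial error, tested against the propagated vector, plus the accumulated noise plus a
  martingale created by the fluctuations of \<open>x x\<^sup>T\<close> around its mean. Since \<open>\<eta> d T\<close> is bounded, the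
  martingale is \<open>O(T\<^sup>-\<^sup>1\<^sup>/\<^sup>2)\<close> in \<open>L\<^sup>2\<close>, and by fourth moments the characteristic function of the
  noise is Gaussian up to an error of the same order. The Euler scheme of the limiting equation obeys the
  same backward recursion, so the one-time characteristic functions of the error and of any given solution
  can be compared directly; neither tightness in time nor existence or uniqueness for the limiting equation
  is needed. Second moments of spatial increments reduce \<open>MSE\<close> and \<open>PE\<close> to nonnegative quadratic
  forms in finitely many coordinates. A Gaussian average of characteristic functions is the Laplace
  transform of such a form, and Laplace transforms determine weak convergence on the half-line. With low
  noise, the same expansion shows that the error follows the limiting flow of its initial value in
  \<open>L\<^sup>2\<close>, which gives convergence in probability.\<close>

section \<open>Laplace transforms and weak convergence\<close>

text \<open>Transposing the averaged dynamics onto the test vector gives the same deterministic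
  vectors \<open>dual a d \<eta> v k\<close> for SGD and for the Euler scheme of any solution. Both
  characteristic functions at time s are then, up to vanishing errors, an initial factor tested
  against one and the same vector times a Gaussian factor with the same averaged quadratic form;
  only the scalar in front of that form differs, and it converges. Neither propagator nor form has
  to be passed to the limit. The price: the vectors change along the sequence, in growing dimension,
  so weak convergence of the initial error is needed uniformly over vectors of bounded l1 norm.
  Moving points to a fixed coarse grid and rounding coefficients leaves a finite net. The l1 norm
  fits because coordinate moments and the kernels are bounded uniformly in \<open>d\<close>. The
  three regimes are one statement in the limits \<alpha>' of \<eta> d T and \<gamma> of \<sigma>
  \<eta> T^(1/2): (\<alpha>, 0), (\<alpha>, \<alpha> \<beta>) and (0, \<alpha>). Fourth moments of
  the data bound the fluctuation of x x^T and, with those of the noise, give the rate of Gaussian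
  approximation.\<close>

lemma tendsto_integral_uniform_approx:
  fixes F :: "nat \<Rightarrow> real" and L :: real
  assumes "\<And>e. e > 0 \<Longrightarrow> \<exists>G l. (G \<longlonglongrightarrow> l) \<and> (\<forall>n. \<bar>F n - G n\<bar> \<le> e) \<and> \<bar>L - l\<bar> \<le> e"
  shows "F \<longlonglongrightarrow> L"
proof (rule LIMSEQ_I)
  fix e :: real assume "e > 0"
  then obtain G l where G: "G \<longlonglongrightarrow> l" "\<And>n. \<bar>F n - G n\<bar> \<le> e/4" "\<bar>L - l\<bar> \<le> e/4"
    using assms[of "e/4"] by auto
  obtain n0 where "\<And>n. n \<ge> n0 \<Longrightarrow> norm (G n - l) < e/4"
    using LIMSEQ_D[OF G(1), of "e/4"] \<open>e > 0\<close> by auto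
  then have "norm (F n - L) < e" if "n \<ge> n0" for n
    using G(2)[of n] G(3) that \<open>e > 0\<close> by (force simp: abs_if split: if_splits)
  then show "\<exists>no. \<forall>n\<ge>no. norm (F n - L) < e" by blast
qed

lemma (in prob_space) integrable_bounded_rv:
  fixes f :: "'a \<Rightarrow> 'b::{banach, second_countable_topology}"
  assumes "f \<in> borel_measurable M" "\<And>\<omega>. \<omega> \<in> space M \<Longrightarrow> norm (f \<omega>) \<le> B"
  shows "integrable M f"
  using assms by (intro integrable_const_bound[where B=B]) auto

lemma (in prob_space) abs_expectation_diff_le:
  fixes f g :: "'a \<Rightarrow> real"
  assumes "integrable M f" "integrable M g" "\<And>\<omega>. \<omega> \<in> space M \<Longrightarrow> \<bar>f \<omega> - g \<omega>\<bar> \<le> e"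
  shows "\<bar>expectation f - expectation g\<bar> \<le> e"
proof -
  have "\<bar>expectation f - expectation g\<bar> = \<bar>expectation (\<lambda>\<omega>. f \<omega> - g \<omega>)\<bar>"
    using assms by simp
  also have "\<dots> \<le> expectation (\<lambda>\<omega>. \<bar>f \<omega> - g \<omega>\<bar>)" by (rule integral_abs_bound)
  also have "\<dots> \<le> expectation (\<lambda>_. e)"
    using assms by (intro integral_mono) auto
  finally show ?thesis by (simp add: prob_space)
qed

lemma (in prob_space) norm_expectation_le:
  fixes f :: "'a \<Rightarrow> 'b::{banach, second_countable_topology}"
  assumes "f \<in> borel_measurable M" "\<And>\<omega>. \<omega> \<in> space M \<Longrightarrow> norm (f \<omega>) \<le> B"
  shows "norm (expectation f) \<le> B"
proof -
  have "norm (expectation f) \<le> expectation (\<lambda>\<omega>. norm (f \<omega>))" by (rule integral_norm_bound)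
  also have "\<dots> \<le> expectation (\<lambda>_. B)"
    using assms integrable_bounded_rv[OF assms] by (intro integral_mono) auto
  finally show ?thesis by (simp add: prob_space)
qed

text \<open>With u = exp (- X) in [0, 1], Laplace transforms at integers p are the moments of u, so
  the hypothesis settles polynomials h; Weierstrass approximation on [0, 1] gives the rest.
  Nonnegativity of X keeps u in the unit interval.\<close>

lemma laplace_imp_continuous_conv:
  fixes X :: "nat \<Rightarrow> 'a \<Rightarrow> real" and Y :: "'b \<Rightarrow> real" and h :: "real \<Rightarrow> real"
  assumes M: "prob_space M" and N: "prob_space N"
    and X: "\<And>n. X n \<in> borel_measurable M" and Y: "Y \<in> borel_measurable N"
    and X0: "\<And>n \<omega>. \<omega> \<in> space M \<Longrightarrow> 0 \<le> X n \<omega>" and Y0: "\<And>\<omega>. \<omega> \<in> space N \<Longrightarrow> 0 \<le> Y \<omega>"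
    and lap: "\<And>p::nat. (\<lambda>n. \<integral>\<omega>. exp (- (real p * X n \<omega>)) \<partial>M) \<longlonglongrightarrow> (\<integral>\<omega>. exp (- (real p * Y \<omega>)) \<partial>N)"
    and h: "continuous_on UNIV h"
  shows "(\<lambda>n. \<integral>\<omega>. h (exp (- X n \<omega>)) \<partial>M) \<longlonglongrightarrow> (\<integral>\<omega>. h (exp (- Y \<omega>)) \<partial>N)"
proof (rule tendsto_integral_uniform_approx)
  fix e :: real assume e: "e > 0"
  interpret M: prob_space M by fact
  interpret N: prob_space N by fact
  note [measurable] = X Y borel_measurable_continuous_onI[OF h]
  have hc: "continuous_on {0..1} h" using h continuous_on_subset by blast
  obtain g where g: "real_polynomial_function g" "\<And>u. u \<in> {0..1} \<Longrightarrow> \<bar>h u - g u\<bar> < e"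
    using Stone_Weierstrass_real_polynomial_function[OF compact_Icc hc e] by blast
  then obtain a m where ga: "g = (\<lambda>u. \<Sum>i\<le>m. a i * u ^ i)"
    using real_polynomial_function_iff_sum by blast
  have gm [measurable]: "g \<in> borel_measurable borel" unfolding ga by measurable
  have bdd: "\<exists>B. \<forall>u\<in>{0..1}. \<bar>f u\<bar> \<le> B" if "continuous_on {0..1} f" for f :: "real \<Rightarrow> real"
    using compact_continuous_image[OF that compact_Icc] compact_imp_bounded bounded_iff
    by (metis image_eqI real_norm_def)
  obtain Bh where Bh: "\<And>u. u \<in> {0..1} \<Longrightarrow> \<bar>h u\<bar> \<le> Bh" using bdd[OF hc] by blast
  obtain Bg where Bg: "\<And>u. u \<in> {0..1} \<Longrightarrow> \<bar>g u\<bar> \<le> Bg"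
    proof -
    have "continuous_on {0..1} g" unfolding ga by (intro continuous_intros)
    then show thesis using bdd that by blast
  qed
  have pw: "exp (- x) ^ i = exp (- (real i * x))" for i and x :: real
    by (simp add: exp_of_nat_mult[symmetric])
  have i1: "integrable M (\<lambda>\<omega>. exp (- (real i * X n \<omega>)))" for i n
    by (rule M.integrable_bounded_rv[where B=1]) (use X0 in auto)
  have i2: "integrable N (\<lambda>\<omega>. exp (- (real i * Y \<omega>)))" for i
    by (rule N.integrable_bounded_rv[where B=1]) (use Y0 in auto)
  have "(\<lambda>n. \<integral>\<omega>. g (exp (- X n \<omega>)) \<partial>M) \<longlonglongrightarrow> (\<integral>\<omega>. g (exp (- Y \<omega>)) \<partial>N)"
    unfolding ga pw using i1 i2 by (simp add: tendsto_sum tendsto_mult_left lap)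
  moreover have "\<bar>(\<integral>\<omega>. h (exp (- X n \<omega>)) \<partial>M) - (\<integral>\<omega>. g (exp (- X n \<omega>)) \<partial>M)\<bar> \<le> e" for n
    by (rule M.abs_expectation_diff_le)
      (use X0 Bh Bg g(2)[THEN less_imp_le] in
        \<open>auto intro!: M.integrable_bounded_rv[where B="max Bh Bg"] simp: le_max_iff_disj\<close>)
  moreover have "\<bar>(\<integral>\<omega>. h (exp (- Y \<omega>)) \<partial>N) - (\<integral>\<omega>. g (exp (- Y \<omega>)) \<partial>N)\<bar> \<le> e"
    by (rule N.abs_expectation_diff_le)
      (use Y0 Bh Bg g(2)[THEN less_imp_le] in
        \<open>auto intro!: N.integrable_bounded_rv[where B="max Bh Bg"] simp: le_max_iff_disj\<close>)
  ultimately show "\<exists>G l. (G \<longlonglongrightarrow> l) \<and> (\<forall>n. \<bar>(\<integral>\<omega>. h (exp (- X n \<omega>)) \<partial>M) - G n\<bar> \<le> e) \<and>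
      \<bar>(\<integral>\<omega>. h (exp (- Y \<omega>)) \<partial>N) - l\<bar> \<le> e"
    by blast
qed

text \<open>Weak convergence is tested on the continuous steps \<open>cts_step a b\<close>, which
  vanish beyond b. Such a step, read as a function of u = exp (- y) for nonnegative y, extends to a
  continuous function on the whole line, so the previous lemma applies.\<close>

lemma laplace_imp_conv_in_distribution:
  fixes X :: "nat \<Rightarrow> 'a \<Rightarrow> real" and Y :: "'b \<Rightarrow> real"
  assumes M: "prob_space M" and N: "prob_space N"
    and X: "\<And>n. X n \<in> borel_measurable M" and Y: "Y \<in> borel_measurable N"
    and X0: "\<And>n \<omega>. \<omega> \<in> space M \<Longrightarrow> 0 \<le> X n \<omega>" and Y0: "\<And>\<omega>. \<omega> \<in> space N \<Longrightarrow> 0 \<le> Y \<omega>"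
    and lap: "\<And>p::nat. (\<lambda>n. \<integral>\<omega>. exp (- (real p * X n \<omega>)) \<partial>M) \<longlonglongrightarrow> (\<integral>\<omega>. exp (- (real p * Y \<omega>)) \<partial>N)"
  shows "conv_in_distribution M X N Y"
proof -
  have "prob_space (distr M borel (X n))" for n by (rule prob_space.prob_space_distr[OF M X])
  moreover have "prob_space (distr N borel Y)" by (rule prob_space.prob_space_distr[OF N Y])
  ultimately have rd: "real_distribution (distr M borel (X n))" "real_distribution (distr N borel Y)" for n
    by (auto simp: real_distribution_def real_distribution_axioms_def)
  show ?thesis
    unfolding conv_in_distribution_def
  proof (rule integral_cts_step_conv_imp_weak_conv[OF rd])
    fix a b :: real assume ab: "a < b"
    let ?b = "max b 0"
    \<comment> \<open>Cutting u off at \<open>exp (- ?b)\<close> keeps the logarithm away from its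
      singularity; it replaces y by \<open>min y ?b\<close>, and at \<open>?b\<close> the step
      already has its final value 0.\<close>
    define h where "h u = cts_step a b (- ln (max u (exp (- ?b))))" for u
    have cs: "continuous_on UNIV (cts_step a b)"
      using cts_step_uniformly_continuous[OF ab] uniformly_continuous_imp_continuous by blast
    have "max u (exp (- ?b)) \<noteq> 0" for u
      using exp_gt_zero[of "- ?b"] by (auto simp: max_def simp del: exp_gt_zero)
    then have "continuous_on UNIV (\<lambda>u. - ln (max u (exp (- ?b))))"
      by (intro continuous_intros) auto
    then have hc: "continuous_on UNIV h"
      unfolding h_def using continuous_on_compose2[OF cs] by blast
    have heq: "h (exp (- y)) = cts_step a b y" if "0 \<le> y" for y
    proof -
      have "max (exp (- y)) (exp (- ?b)) = exp (- min y ?b)"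
        by (auto simp: max_def min_def)
      then have "h (exp (- y)) = cts_step a b (min y ?b)" by (simp add: h_def)
      then show ?thesis using that ab by (auto simp: cts_step_def min_def max_def)
    qed
    have csm [measurable]: "cts_step a b \<in> borel_measurable borel"
      by (rule borel_measurable_continuous_onI[OF cs])
    have "(\<integral>\<omega>. h (exp (- X n \<omega>)) \<partial>M) = integral\<^sup>L (distr M borel (X n)) (cts_step a b)" for n
      using X0 X by (subst integral_distr) (auto simp: heq intro!: Bochner_Integration.integral_cong)
    moreover have "(\<integral>\<omega>. h (exp (- Y \<omega>)) \<partial>N) = integral\<^sup>L (distr N borel Y) (cts_step a b)"
      using Y0 Y by (subst integral_distr) (auto simp: heq intro!: Bochner_Integration.integral_cong)
    ultimately show "(\<lambda>n. integral\<^sup>L (distr M borel (X n)) (cts_step a b))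
        \<longlonglongrightarrow> integral\<^sup>L (distr N borel Y) (cts_step a b)"
      using laplace_imp_continuous_conv[OF M N X Y X0 Y0 lap hc] by simp
  qed
qed

section \<open>Quadratic forms\<close>

text \<open>Completing the square in the last variable, by induction on m: for a pivot p =
  \<open>q m m\<close> > 0 the form is (L / sqrt p + sqrt p v_m)^2 plus the form of the Schur
  complement, which is again positive semidefinite. Squares of linear functionals are what a
  Gaussian average can linearise.\<close>

lemma psd_eq_sum_squares:
  fixes q :: "nat \<Rightarrow> nat \<Rightarrow> real"
  assumes "\<And>j k. j < m \<Longrightarrow> k < m \<Longrightarrow> q j k = q k j"
    and "\<And>v. 0 \<le> (\<Sum>j<m. \<Sum>k<m. q j k * v j * v k)"
  shows "\<exists>u. \<forall>v. (\<Sum>j<m. \<Sum>k<m. q j k * v j * v k) = (\<Sum>l<m. (\<Sum>j<m. u l j * v j)\<^sup>2)"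
  using assms
proof (induction m arbitrary: q)
  case 0
  then show ?case by simp
next
  case (Suc m)
  note sym = Suc.prems(1) and psd = Suc.prems(2)
  define p where "p = q m m"
  define L where "L v = (\<Sum>j<m. q j m * v j)" for v :: "nat \<Rightarrow> real"
  have expand: "(\<Sum>j<Suc m. \<Sum>k<Suc m. q j k * v j * v k)
      = (\<Sum>j<m. \<Sum>k<m. q j k * v j * v k) + 2 * v m * L v + p * (v m)\<^sup>2" for v
  proof -
    have "(\<Sum>k<m. q m k * v m * v k) = v m * L v"
      unfolding L_def sum_distrib_left by (rule sum.cong) (use sym[of m] in auto)
    moreover have "(\<Sum>j<m. q j m * v j * v m) = v m * L v"
      unfolding L_def sum_distrib_left by (rule sum.cong) auto
    ultimately show ?thesis
      by (simp add: sum.distrib p_def power2_eq_square algebra_simps)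
  qed
  \<comment> \<open>Positivity with the last coordinate set to an arbitrary c; suitable choices of c
    give everything that follows.\<close>
  have psd': "0 \<le> (\<Sum>j<m. \<Sum>k<m. q j k * v j * v k) + 2 * c * L v + p * c\<^sup>2" for v c
  proof -
    have "L (v(m := c)) = L v"
      unfolding L_def by (intro sum.cong) auto
    moreover have "(\<Sum>j<m. \<Sum>k<m. q j k * (v(m := c)) j * (v(m := c)) k) = (\<Sum>j<m. \<Sum>k<m. q j k * v j * v k)"
      by (intro sum.cong) auto
    ultimately show ?thesis
      using psd[of "v(m := c)"] unfolding expand by (simp del: fun_upd_apply add: fun_upd_same)
  qed
  have p0: "p \<ge> 0" using psd'[of "\<lambda>_. 0" 1] by (simp add: L_def)
  \<comment> \<open>Schur complement of the pivot. If p = 0, division by zero returns 0, so q' = q,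
    and \<open>L0\<close> below shows that the mixed terms vanish as well.\<close>
  define q' where "q' j k = q j k - q j m * q k m / p" for j k
  have q': "(\<Sum>j<m. \<Sum>k<m. q' j k * v j * v k) = (\<Sum>j<m. \<Sum>k<m. q j k * v j * v k) - (L v)\<^sup>2 / p" for v
  proof -
    have "(L v)\<^sup>2 / p = (\<Sum>j<m. \<Sum>k<m. q j m * q k m / p * v j * v k)"
      unfolding L_def power2_eq_square sum_product sum_divide_distrib
      by (intro sum.cong refl) (simp add: field_simps)
    then show ?thesis
      by (simp add: q'_def left_diff_distrib sum_subtractf)
  qed
  have L0: "L v = 0" if "p = 0" for v
  proof (rule ccontr)
    assume L: "L v \<noteq> 0"
    define S where "S = (\<Sum>j<m. \<Sum>k<m. q j k * v j * v k)"
    \<comment> \<open>For p = 0 the form is affine in c; this c makes it equal to -1.\<close>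
    have "0 \<le> S + 2 * (- (S + 1) / (2 * L v)) * L v"
      using psd'[of v "- (S + 1) / (2 * L v)"] that by (simp add: S_def)
    also have "\<dots> = -1" using L by (simp add: field_simps)
    finally show False by simp
  qed
  have "\<exists>u. \<forall>v. (\<Sum>j<m. \<Sum>k<m. q' j k * v j * v k) = (\<Sum>l<m. (\<Sum>j<m. u l j * v j)\<^sup>2)"
  proof (rule Suc.IH)
    show "q' j k = q' k j" if "j < m" "k < m" for j k
      using sym[of j k] that by (simp add: q'_def)
    show "0 \<le> (\<Sum>j<m. \<Sum>k<m. q' j k * v j * v k)" for v
      using psd'[of v "- L v / p"] psd'[of v 0] unfolding q'
      by (cases "p = 0") (auto simp: power2_eq_square field_simps)
  qed
  then obtain u where u: "\<And>v. (\<Sum>j<m. \<Sum>k<m. q' j k * v j * v k) = (\<Sum>l<m. (\<Sum>j<m. u l j * v j)\<^sup>2)"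
    by blast
  define u' where "u' l j = (if l < m then if j < m then u l j else 0
      else if j < m then q j m / sqrt p else sqrt p)" for l j
  have "(\<Sum>j<Suc m. \<Sum>k<Suc m. q j k * v j * v k) = (\<Sum>l<Suc m. (\<Sum>j<Suc m. u' l j * v j)\<^sup>2)" for v
  proof -
    have "(\<Sum>l<m. (\<Sum>j<Suc m. u' l j * v j)\<^sup>2) = (\<Sum>l<m. (\<Sum>j<m. u l j * v j)\<^sup>2)"
      by (intro sum.cong refl) (simp add: u'_def)
    moreover have "(\<Sum>j<Suc m. u' m j * v j) = L v / sqrt p + sqrt p * v m"
      by (simp add: u'_def L_def sum_divide_distrib)
    moreover have "(L v / sqrt p + sqrt p * v m)\<^sup>2 = (L v)\<^sup>2 / p + 2 * v m * L v + p * (v m)\<^sup>2"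
      using p0 L0[of v] by (cases "p = 0") (auto simp: power2_sum power_divide power_mult_distrib)
    ultimately show ?thesis
      unfolding expand using q'[of v] u[of v] by simp
  qed
  then show ?case by blast
qed

lemma exp_neg_half_square_eq:
  "complex_of_real (exp (- (s\<^sup>2) / 2)) = (\<integral>g. iexp (s * g) \<partial>std_normal_distribution)"
  using char_std_normal_distribution by (simp add: char_def fun_eq_iff)

text \<open>By exp (-s^2/2) = E exp (i s g) for a standard normal g, a squared functional in the
  exponent becomes a linear one, averaged over g. Boundedness of \<open>E\<close> permits
  Fubini.\<close>

lemma iexp_integral_sq_swap:
  fixes S Z :: "'a \<Rightarrow> real"
  assumes "prob_space M" and [measurable]: "S \<in> borel_measurable M" "E \<in> borel_measurable M"
    and E: "\<And>\<omega>. \<omega> \<in> space M \<Longrightarrow> norm (E \<omega> :: complex) \<le> 1"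
  shows "(\<integral>\<omega>. E \<omega> * complex_of_real (exp (- ((S \<omega>)\<^sup>2) / 2)) \<partial>M)
      = (\<integral>g. (\<integral>\<omega>. E \<omega> * iexp (g * S \<omega>) \<partial>M) \<partial>std_normal_distribution)"
proof -
  interpret M: prob_space M by fact
  interpret G: real_distribution std_normal_distribution by (rule real_dist_normal_dist)
  interpret P: pair_prob_space M std_normal_distribution ..
  have [measurable]: "(\<lambda>x::real. x) \<in> borel_measurable std_normal_distribution"
    by (simp add: measurable_ident_sets)
  have int: "integrable (M \<Otimes>\<^sub>M std_normal_distribution) (\<lambda>(\<omega>, g). E \<omega> * iexp (g * S \<omega>))"
    by (rule P.integrable_const_bound[where B=1])
       (auto simp: norm_mult split_beta space_pair_measure E)
  have "(\<integral>\<omega>. E \<omega> * complex_of_real (exp (- ((S \<omega>)\<^sup>2) / 2)) \<partial>M)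
      = (\<integral>\<omega>. (\<integral>g. E \<omega> * iexp (g * S \<omega>) \<partial>std_normal_distribution) \<partial>M)"
    by (subst exp_neg_half_square_eq) (simp add: mult.commute)
  also have "\<dots> = (\<integral>g. (\<integral>\<omega>. E \<omega> * iexp (g * S \<omega>) \<partial>M) \<partial>std_normal_distribution)"
    by (rule P.Fubini_integral[symmetric, OF int])
  finally show ?thesis .
qed

text \<open>Induction on the number r of squares. Peeling off one square averages over a standard
  normal g and shifts the linear coefficients to \<open>c j + g * u r j\<close>; therefore c has to
  stay arbitrary in the induction. Dominated convergence in g, with bound 1, passes to the
  limit.\<close>

lemma charfn_conv_imp_gaussian_conv:
  fixes X :: "nat \<Rightarrow> nat \<Rightarrow> 'a \<Rightarrow> real" and Y :: "nat \<Rightarrow> 'b \<Rightarrow> real"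
  assumes M: "prob_space M" and N: "prob_space N"
    and [measurable]: "\<And>n j. j < m \<Longrightarrow> X n j \<in> borel_measurable M" "\<And>j. j < m \<Longrightarrow> Y j \<in> borel_measurable N"
    and conv: "\<And>c. (\<lambda>n. \<integral>\<omega>. iexp (\<Sum>j<m. c j * X n j \<omega>) \<partial>M) \<longlonglongrightarrow> (\<integral>\<omega>. iexp (\<Sum>j<m. c j * Y j \<omega>) \<partial>N)"
  shows "(\<lambda>n. \<integral>\<omega>. iexp (\<Sum>j<m. c j * X n j \<omega>) * exp (- (\<Sum>l<(r::nat). (\<Sum>j<m. u l j * X n j \<omega>)\<^sup>2) / 2) \<partial>M)
    \<longlonglongrightarrow> (\<integral>\<omega>. iexp (\<Sum>j<m. c j * Y j \<omega>) * exp (- (\<Sum>l<r. (\<Sum>j<m. u l j * Y j \<omega>)\<^sup>2) / 2) \<partial>N)"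
proof (induction r arbitrary: c)
  case 0
  then show ?case using conv by simp
next
  case (Suc r)
  interpret M: prob_space M by fact
  interpret N: prob_space N by fact
  interpret G: real_distribution std_normal_distribution by (rule real_dist_normal_dist)
  define FX where "FX c n \<omega> = iexp (\<Sum>j<m. c j * X n j \<omega>) * exp (- (\<Sum>l<r. (\<Sum>j<m. u l j * X n j \<omega>)\<^sup>2) / 2)" for c n \<omega>
  define FY where "FY c \<omega> = iexp (\<Sum>j<m. c j * Y j \<omega>) * exp (- (\<Sum>l<r. (\<Sum>j<m. u l j * Y j \<omega>)\<^sup>2) / 2)" for c \<omega>
  have EXm [measurable]: "FX c n \<in> borel_measurable M" for c n unfolding FX_def by measurable
  have EYm [measurable]: "FY c \<in> borel_measurable N" for c unfolding FY_def by measurable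
  have nX: "norm (FX c n \<omega>) \<le> 1" for c n \<omega> unfolding FX_def norm_mult by (simp add: sum_nonneg)
  have nY: "norm (FY c \<omega>) \<le> 1" for c \<omega> unfolding FY_def norm_mult by (simp add: sum_nonneg)
  have eX: "iexp (\<Sum>j<m. c j * X n j \<omega>) * exp (- (\<Sum>l<Suc r. (\<Sum>j<m. u l j * X n j \<omega>)\<^sup>2) / 2)
      = FX c n \<omega> * complex_of_real (exp (- ((\<Sum>j<m. u r j * X n j \<omega>)\<^sup>2) / 2))" for n \<omega>
    unfolding FX_def by (simp add: exp_add[symmetric] add_divide_distrib flip: of_real_mult)
  have eY: "iexp (\<Sum>j<m. c j * Y j \<omega>) * exp (- (\<Sum>l<Suc r. (\<Sum>j<m. u l j * Y j \<omega>)\<^sup>2) / 2)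
      = FY c \<omega> * complex_of_real (exp (- ((\<Sum>j<m. u r j * Y j \<omega>)\<^sup>2) / 2))" for \<omega>
    unfolding FY_def by (simp add: exp_add[symmetric] add_divide_distrib flip: of_real_mult)
  have sX: "FX c n \<omega> * iexp (g * (\<Sum>j<m. u r j * X n j \<omega>)) = FX (\<lambda>j. c j + g * u r j) n \<omega>" for g n \<omega>
    unfolding FX_def by (simp add: exp_add algebra_simps sum.distrib sum_distrib_left)
  have sY: "FY c \<omega> * iexp (g * (\<Sum>j<m. u r j * Y j \<omega>)) = FY (\<lambda>j. c j + g * u r j) \<omega>" for g \<omega>
    unfolding FY_def by (simp add: exp_add algebra_simps sum.distrib sum_distrib_left)
  have X1: "(\<integral>\<omega>. FX c n \<omega> * complex_of_real (exp (- ((\<Sum>j<m. u r j * X n j \<omega>)\<^sup>2) / 2)) \<partial>M)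
      = (\<integral>g. (\<integral>\<omega>. FX (\<lambda>j. c j + g * u r j) n \<omega> \<partial>M) \<partial>std_normal_distribution)" for n
    unfolding sX[symmetric] by (rule iexp_integral_sq_swap[OF M]) (auto simp: nX)
  have Y1: "(\<integral>\<omega>. FY c \<omega> * complex_of_real (exp (- ((\<Sum>j<m. u r j * Y j \<omega>)\<^sup>2) / 2)) \<partial>N)
      = (\<integral>g. (\<integral>\<omega>. FY (\<lambda>j. c j + g * u r j) \<omega> \<partial>N) \<partial>std_normal_distribution)"
    unfolding sY[symmetric] by (rule iexp_integral_sq_swap[OF N]) (auto simp: nY)
  have idm [measurable]: "(\<lambda>x::real. x) \<in> borel_measurable std_normal_distribution"
    by (simp add: measurable_ident_sets)
  have "(\<lambda>n. \<integral>g. (\<integral>\<omega>. FX (\<lambda>j. c j + g * u r j) n \<omega> \<partial>M) \<partial>std_normal_distribution)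
      \<longlonglongrightarrow> (\<integral>g. (\<integral>\<omega>. FY (\<lambda>j. c j + g * u r j) \<omega> \<partial>N) \<partial>std_normal_distribution)"
  proof (rule integral_dominated_convergence[where w="\<lambda>_. 1"])
    show "(\<lambda>g. \<integral>\<omega>. FY (\<lambda>j. c j + g * u r j) \<omega> \<partial>N) \<in> borel_measurable std_normal_distribution"
      by (rule N.borel_measurable_lebesgue_integral) (unfold FY_def, measurable)
    show "(\<lambda>g. \<integral>\<omega>. FX (\<lambda>j. c j + g * u r j) n \<omega> \<partial>M) \<in> borel_measurable std_normal_distribution" for n
      by (rule M.borel_measurable_lebesgue_integral) (unfold FX_def, measurable)
    show "AE g in std_normal_distribution. (\<lambda>n. \<integral>\<omega>. FX (\<lambda>j. c j + g * u r j) n \<omega> \<partial>M) \<longlonglongrightarrow> (\<integral>\<omega>. FY (\<lambda>j. c j + g * u r j) \<omega> \<partial>N)"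
      using Suc.IH unfolding FX_def FY_def by (intro AE_I2)
    have "norm (\<integral>\<omega>. FX d n \<omega> \<partial>M) \<le> 1" for d n
      by (rule M.norm_expectation_le) (auto simp: nX)
    then show "AE g in std_normal_distribution. norm (\<integral>\<omega>. FX (\<lambda>j. c j + g * u r j) n \<omega> \<partial>M) \<le> 1" for n
      by simp
  qed simp
  then show ?case unfolding eX eY X1 Y1 .
qed

text \<open>The form is written as a sum of m squares; scaling the functionals by sqrt (2 p) absorbs
  both p and the factor 1/2 of the Gaussian transform. The oscillating factor disappears for c =
  0.\<close>

lemma charfn_conv_imp_quadratic_laplace_conv:
  fixes X :: "nat \<Rightarrow> nat \<Rightarrow> 'a \<Rightarrow> real" and Y :: "nat \<Rightarrow> 'b \<Rightarrow> real"
  assumes M: "prob_space M" and N: "prob_space N"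
    and X: "\<And>n j. j < m \<Longrightarrow> X n j \<in> borel_measurable M" and Y: "\<And>j. j < m \<Longrightarrow> Y j \<in> borel_measurable N"
    and conv: "\<And>c. (\<lambda>n. \<integral>\<omega>. iexp (\<Sum>j<m. c j * X n j \<omega>) \<partial>M) \<longlonglongrightarrow> (\<integral>\<omega>. iexp (\<Sum>j<m. c j * Y j \<omega>) \<partial>N)"
    and sym: "\<And>j k. j < m \<Longrightarrow> k < m \<Longrightarrow> q j k = q k j"
    and psd: "\<And>v. 0 \<le> (\<Sum>j<m. \<Sum>k<m. q j k * v j * v k)"
    and p: "p \<ge> 0"
  shows "(\<lambda>n. \<integral>\<omega>. exp (- (p * (\<Sum>j<m. \<Sum>k<m. q j k * X n j \<omega> * X n k \<omega>))) \<partial>M)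
    \<longlonglongrightarrow> (\<integral>\<omega>. exp (- (p * (\<Sum>j<m. \<Sum>k<m. q j k * Y j \<omega> * Y k \<omega>))) \<partial>N)"
proof -
  obtain u where u: "\<And>v. (\<Sum>j<m. \<Sum>k<m. q j k * v j * v k) = (\<Sum>l<m. (\<Sum>j<m. u l j * v j)\<^sup>2)"
    using psd_eq_sum_squares[of m q, OF sym psd] by blast
  have "p * (\<Sum>j<m. \<Sum>k<m. q j k * v j * v k) = (\<Sum>l<m. (\<Sum>j<m. (sqrt (2 * p) * u l j) * v j)\<^sup>2) / 2" for v
    using p unfolding u[of v] mult.assoc[of "sqrt (2 * p)"] sum_distrib_left[symmetric] power_mult_distrib
    by simp
  note eq = this[of "\<lambda>j. X n j \<omega>" for n \<omega>] this[of "\<lambda>j. Y j \<omega>" for \<omega>]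
  have cr: "iexp (\<Sum>j<m. 0 * f j) * exp (- a / 2) = complex_of_real (exp (- (a / 2)))" for f a
    by (simp add: exp_of_real[symmetric] del: exp_of_real)
  have "(\<lambda>n. complex_of_real (\<integral>\<omega>. exp (- (p * (\<Sum>j<m. \<Sum>k<m. q j k * X n j \<omega> * X n k \<omega>))) \<partial>M))
      \<longlonglongrightarrow> complex_of_real (\<integral>\<omega>. exp (- (p * (\<Sum>j<m. \<Sum>k<m. q j k * Y j \<omega> * Y k \<omega>))) \<partial>N)"
    using charfn_conv_imp_gaussian_conv[OF M N X Y conv, where c="\<lambda>_. 0" and r=m and u="\<lambda>l j. sqrt (2 * p) * u l j"]
    unfolding eq cr integral_complex_of_real by simp
  then show ?thesis by (simp only: tendsto_of_real_iff)
qed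

section \<open>Square-integrable random variables and independent sub-sigma-algebras\<close>

definition square_integrable :: "'a measure \<Rightarrow> ('a \<Rightarrow> real) \<Rightarrow> bool" where
  "square_integrable M f \<longleftrightarrow> f \<in> borel_measurable M \<and> integrable M (\<lambda>\<omega>. (f \<omega>)\<^sup>2)"

lemma square_integrable_measurable [dest]: "square_integrable M f \<Longrightarrow> f \<in> borel_measurable M"
  by (simp add: square_integrable_def)

lemma square_integrable_mult:
  assumes "square_integrable M f" "square_integrable M g"
  shows "integrable M (\<lambda>\<omega>. f \<omega> * g \<omega>)"
proof (rule Bochner_Integration.integrable_bound)
  show "integrable M (\<lambda>\<omega>. (f \<omega>)\<^sup>2 + (g \<omega>)\<^sup>2)"
    using assms by (auto simp: square_integrable_def)
  show "(\<lambda>\<omega>. f \<omega> * g \<omega>) \<in> borel_measurable M"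
    using assms by (auto simp: square_integrable_def)
  have "\<bar>a * b\<bar> \<le> a\<^sup>2 + b\<^sup>2" for a b :: real
    using sum_squares_bound[of "\<bar>a\<bar>" "\<bar>b\<bar>"] abs_ge_zero[of "a * b"]
    unfolding abs_mult power2_abs mult.assoc by linarith
  then show "AE \<omega> in M. norm (f \<omega> * g \<omega>) \<le> norm ((f \<omega>)\<^sup>2 + (g \<omega>)\<^sup>2)"
    by (intro AE_I2) (simp add: abs_of_nonneg)
qed

lemma square_integrable_cmult:
  "square_integrable M f \<Longrightarrow> square_integrable M (\<lambda>\<omega>. c * f \<omega>)"
  by (auto simp: square_integrable_def power_mult_distrib)

lemma square_integrable_add:
  assumes "square_integrable M f" "square_integrable M g"
  shows "square_integrable M (\<lambda>\<omega>. f \<omega> + g \<omega>)"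
  using assms square_integrable_mult[OF assms]
  by (auto simp: square_integrable_def power2_sum mult.assoc)

lemma square_integrable_diff:
  assumes "square_integrable M f" "square_integrable M g"
  shows "square_integrable M (\<lambda>\<omega>. f \<omega> - g \<omega>)"
  using square_integrable_add[OF assms(1) square_integrable_cmult[OF assms(2), of "-1"]] by simp

lemma square_integrable_sum:
  assumes "\<And>i. i \<in> I \<Longrightarrow> square_integrable M (f i)"
  shows "square_integrable M (\<lambda>\<omega>. \<Sum>i\<in>I. f i \<omega>)"
  using assms
proof (induction I rule: infinite_finite_induct)
  case (insert i I)
  then show ?case using square_integrable_add[of M "f i" "\<lambda>\<omega>. \<Sum>i\<in>I. f i \<omega>"] by simp
qed (auto simp: square_integrable_def)

lemma (in prob_space) square_integrable_integrable:
  assumes "square_integrable M f" shows "integrable M f"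
  using square_integrable_mult[OF assms, of "\<lambda>_. 1"] by (simp add: square_integrable_def)

text \<open>Jensen's inequality for the square, read off from the nonnegative variance of
  |f|.\<close>

lemma (in prob_space) expectation_abs_le_sqrt:
  assumes "square_integrable M f" "expectation (\<lambda>\<omega>. (f \<omega>)\<^sup>2) \<le> c\<^sup>2" "c \<ge> 0"
  shows "expectation (\<lambda>\<omega>. \<bar>f \<omega>\<bar>) \<le> c"
proof -
  let ?a = "\<lambda>\<omega>. \<bar>f \<omega>\<bar>"
  have i: "integrable M ?a" "integrable M (\<lambda>\<omega>. (f \<omega>)\<^sup>2)"
    using square_integrable_integrable[OF assms(1)] assms(1) by (auto simp: square_integrable_def)
  have "0 \<le> expectation (\<lambda>\<omega>. (?a \<omega> - expectation ?a)\<^sup>2)" by simp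
  also have "\<dots> = expectation (\<lambda>\<omega>. (f \<omega>)\<^sup>2) - (expectation ?a)\<^sup>2"
    using variance_eq[of ?a] i by simp
  finally have "(expectation ?a)\<^sup>2 \<le> c\<^sup>2" using assms(2) by simp
  then show ?thesis using assms(3) power2_le_imp_le by blast
qed

lemma (in prob_space) abs_expectation_mult_le:
  assumes "square_integrable M f" "square_integrable M g"
  shows "2 * \<bar>expectation (\<lambda>\<omega>. f \<omega> * g \<omega>)\<bar> \<le> expectation (\<lambda>\<omega>. (f \<omega>)\<^sup>2) + expectation (\<lambda>\<omega>. (g \<omega>)\<^sup>2)"
proof -
  have "2 * \<bar>expectation (\<lambda>\<omega>. f \<omega> * g \<omega>)\<bar> \<le> 2 * expectation (\<lambda>\<omega>. \<bar>f \<omega> * g \<omega>\<bar>)"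
    using integral_abs_bound[of M "\<lambda>\<omega>. f \<omega> * g \<omega>"] by simp
  also have "\<dots> = expectation (\<lambda>\<omega>. 2 * \<bar>f \<omega> * g \<omega>\<bar>)" by simp
  also have "\<dots> \<le> expectation (\<lambda>\<omega>. (f \<omega>)\<^sup>2 + (g \<omega>)\<^sup>2)"
  proof (rule integral_mono)
    show "2 * \<bar>f \<omega> * g \<omega>\<bar> \<le> (f \<omega>)\<^sup>2 + (g \<omega>)\<^sup>2" for \<omega>
      using sum_squares_bound[of "\<bar>f \<omega>\<bar>" "\<bar>g \<omega>\<bar>"] by (simp add: abs_mult)
  qed (use square_integrable_mult[OF assms] assms in \<open>auto simp: square_integrable_def\<close>)
  finally show ?thesis using assms by (simp add: square_integrable_def)
qed

text \<open>\<open>F\<close> and \<open>H\<close> enter only through their sigma-algebras;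
  \<open>M\<close> supplies the measure. In this form the rule applies directly to products of
  functions of many sources, without naming the underlying vectors.\<close>

lemma (in prob_space) indep_set_expectation_mult:
  fixes f g :: "'a \<Rightarrow> 'b::{real_normed_field, banach, second_countable_topology}"
  assumes ind: "indep_set (sets F) (sets H)"
    and sp: "space F = space M" "space H = space M"
    and f: "f \<in> borel_measurable F" "integrable M f" and g: "g \<in> borel_measurable H" "integrable M g"
  shows "integrable M (\<lambda>\<omega>. f \<omega> * g \<omega>)"
    and "expectation (\<lambda>\<omega>. f \<omega> * g \<omega>) = expectation f * expectation g"
proof -
  have "indep_var borel f borel g"
    unfolding indep_var_def indep_vars_def2
  proof
    show "\<forall>i\<in>UNIV. random_variable (case_bool borel borel i) (case_bool f g i)"
      using f g by (auto split: bool.split)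
    show "indep_sets (\<lambda>i. {case_bool f g i -` A \<inter> space M |A. A \<in> sets (case_bool borel borel i)}) UNIV"
      using ind unfolding indep_set_def
    proof (rule indep_sets_mono_sets)
      fix i :: bool
      show "{case_bool f g i -` A \<inter> space M |A. A \<in> sets (case_bool borel borel i)} \<subseteq> (case i of True \<Rightarrow> sets F | False \<Rightarrow> sets H)"
        using measurable_sets[OF f(1)] measurable_sets[OF g(1)] sp by (auto split: bool.split)
    qed
  qed
  from indep_var_integrable[OF this f(2) g(2)] indep_var_lebesgue_integral[OF this f(2) g(2)]
  show "integrable M (\<lambda>\<omega>. f \<omega> * g \<omega>)"
    "expectation (\<lambda>\<omega>. f \<omega> * g \<omega>) = expectation f * expectation g" .
qed

section \<open>Sigma-algebras generated by random elements\<close>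

lemma generated_sets_eq:
  "X \<in> space M \<rightarrow> space P \<Longrightarrow> generated_sets M X P = {X -` C \<inter> space M |C. C \<in> sets P}"
  unfolding generated_sets_def by (rule sets_vimage_algebra2)

text \<open>Embeds the information of one time step into that of the whole data or noise family, for
  which the joint independence assumption is formulated.\<close>

lemma generated_sets_comp_subset:
  assumes "X \<in> space M \<rightarrow> space P" "f \<in> measurable P Q" "\<And>\<omega>. \<omega> \<in> space M \<Longrightarrow> Y \<omega> = f (X \<omega>)"
  shows "generated_sets M Y Q \<subseteq> generated_sets M X P"
proof -
  have "Y \<in> space M \<rightarrow> space Q"
    using assms(1,3) measurable_space[OF assms(2)] by (simp add: Pi_iff)
  moreover have "\<exists>D. Y -` C \<inter> space M = X -` D \<inter> space M \<and> D \<in> sets P" if "C \<in> sets Q" for C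
    using assms measurable_sets[OF assms(2) that]
    by (intro exI[of _ "f -` C \<inter> space P"]) (auto simp: Pi_iff)
  ultimately show ?thesis
    by (auto simp: generated_sets_eq[OF assms(1)] generated_sets_eq)
qed

lemma Int_stable_generated_sets: "Int_stable (generated_sets M X P)"
  unfolding generated_sets_def Int_stable_def by auto

lemma space_in_generated_sets: "space M \<in> generated_sets M X P"
  unfolding generated_sets_def using sets.top[of "vimage_algebra (space M) X P"] by simp

section \<open>Sums of squares, inner products and a discrete Gronwall inequality\<close>

definition ip :: "nat \<Rightarrow> (nat \<Rightarrow> real) \<Rightarrow> (nat \<Rightarrow> real) \<Rightarrow> real" where
  "ip d v y = (\<Sum>i=1..d. v i * y i)"

text \<open>Size of test vectors. Being dual to uniform bounds on coordinates, it yields estimates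
  free of the dimension d; coordinate functionals have norm 1 for every d.\<close>

definition l1 :: "nat \<Rightarrow> (nat \<Rightarrow> real) \<Rightarrow> real" where
  "l1 d v = (\<Sum>i=1..d. \<bar>v i\<bar>)"

lemma l1_nonneg: "0 \<le> l1 d v"
  by (simp add: l1_def sum_nonneg)

lemma ip_square_le: "(ip d v y)\<^sup>2 \<le> real d * (\<Sum>j=1..d. (v j)\<^sup>2 * (y j)\<^sup>2)"
  using sum_squared_le_sum_of_squares[of "\<lambda>j. v j * y j" "{1..d}"]
  by (simp add: ip_def power_mult_distrib mult.commute)

lemma abs_ip_le:
  assumes "\<And>i. i \<in> {1..d} \<Longrightarrow> \<bar>y i\<bar> \<le> c"
  shows "\<bar>ip d v y\<bar> \<le> l1 d v * c"
proof -
  have "\<bar>ip d v y\<bar> \<le> (\<Sum>i=1..d. \<bar>v i * y i\<bar>)" unfolding ip_def by (rule sum_abs)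
  also have "\<dots> \<le> (\<Sum>i=1..d. \<bar>v i\<bar> * c)"
    by (intro sum_mono) (simp add: abs_mult assms mult_left_mono)
  finally show ?thesis by (simp add: l1_def sum_distrib_right)
qed

lemma ip_ip_le:
  assumes "\<And>i j. i \<in> {1..d} \<Longrightarrow> j \<in> {1..d} \<Longrightarrow> \<bar>c i j\<bar> \<le> b"
  shows "\<bar>\<Sum>i=1..d. \<Sum>j=1..d. v i * w j * c i j\<bar> \<le> l1 d v * l1 d w * b"
proof -
  have "(\<Sum>i=1..d. \<Sum>j=1..d. v i * w j * c i j) = ip d v (\<lambda>i. ip d w (c i))"
    by (simp add: ip_def sum_distrib_left mult.assoc)
  moreover have "\<bar>ip d w (c i)\<bar> \<le> l1 d w * b" if "i \<in> {1..d}" for i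
    using assms that by (intro abs_ip_le) auto
  ultimately show ?thesis
    using abs_ip_le[of d "\<lambda>i. ip d w (c i)" "l1 d w * b" v] by (simp add: mult.assoc)
qed

lemma discrete_gronwall:
  fixes m :: "nat \<Rightarrow> real"
  assumes step: "\<And>k. m (Suc k) \<le> (1 + p) * m k + q" and "p \<ge> 0" "q \<ge> 0"
  shows "m k \<le> (1 + p) ^ k * (m 0 + k * q)"
proof (induction k)
  case (Suc k)
  have "m (Suc k) \<le> (1 + p) * ((1 + p) ^ k * (m 0 + k * q)) + 1 * q"
    using step[of k] Suc assms by (smt (verit) mult_left_mono)
  also have "\<dots> \<le> (1 + p) * ((1 + p) ^ k * (m 0 + k * q)) + (1 + p) ^ Suc k * q"
    using assms by (intro add_left_mono mult_right_mono one_le_power) auto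
  also have "\<dots> = (1 + p) ^ Suc k * (m 0 + Suc k * q)"
    by (simp add: algebra_simps)
  finally show ?case .
qed simp

lemma power_one_plus_le_exp:
  assumes "p \<ge> 0" "real k * p \<le> c"
  shows "(1 + p) ^ k \<le> exp (c::real)"
proof -
  have "(1 + p) ^ k \<le> exp p ^ k" using assms by (intro power_mono) (auto simp: exp_ge_add_one_self)
  also have "\<dots> = exp (k * p)" by (simp add: exp_of_nat_mult)
  finally show ?thesis using assms by (meson exp_le_cancel_iff order_trans)
qed

section \<open>Independence structure of online SGD\<close>

text \<open>One index type for all random inputs lets a single independent family \<open>G\<close>
  carry every factorisation below: disjoint sets of labels give independent sigma-algebras.\<close>

datatype source = Init | Data nat | Noise nat

context online_sgd
begin

definition x :: "nat \<Rightarrow> nat \<Rightarrow> 'a \<Rightarrow> real" where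
  "x t i \<omega> = sgd_data W d T t i \<omega>"

definition D :: "nat \<Rightarrow> nat \<Rightarrow> 'a \<Rightarrow> real" where
  "D t i \<omega> = \<theta> t i \<omega> - \<theta>s i"

definition a :: "nat \<Rightarrow> nat \<Rightarrow> real" where
  "a i j = A (real i / real d) (real j / real d)"

fun G :: "source \<Rightarrow> 'a set set" where
  "G Init = generated_sets M (\<lambda>\<omega>. \<lambda>i\<in>{1..d}. \<theta> 0 i \<omega>) (PiM {1..d} (\<lambda>_. borel))"
| "G (Data t) = generated_sets M (\<lambda>\<omega>. \<lambda>i\<in>{1..d}. sgd_data W d T t i \<omega>) (PiM {1..d} (\<lambda>_. borel))"
| "G (Noise t) = generated_sets M (\<epsilon> t) borel"

lemma Int_stable_G: "Int_stable (G j)"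
  by (cases j) (simp_all add: Int_stable_generated_sets)

lemma space_in_G: "space M \<in> G j"
  by (cases j) (simp_all add: space_in_generated_sets)

lemma prob_Inter_Data:
  assumes "\<And>t. t < n \<Longrightarrow> C t \<in> G (Data t)" "n > 0"
  shows "prob (\<Inter>t<n. C t) = (\<Prod>t<n. prob (C t))"
proof -
  let ?X = "\<lambda>t \<omega>. \<lambda>i\<in>{1..d}. sgd_data W d T t i \<omega>"
  have "indep_sets (\<lambda>t. {?X t -` A \<inter> space M |A. A \<in> sets (PiM {1..d} (\<lambda>_. borel))}) UNIV"
    using data_indep unfolding indep_vars_def2 by blast
  moreover have "G (Data t) = {?X t -` A \<inter> space M |A. A \<in> sets (PiM {1..d} (\<lambda>_. borel))}" for t
    unfolding G.simps by (rule generated_sets_eq) (auto simp: space_PiM)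
  ultimately show ?thesis
    using assms by (intro indep_setsD[where I=UNIV]) auto
qed

lemma prob_Inter_Noise:
  assumes "\<And>t. t < n \<Longrightarrow> C t \<in> G (Noise t)" "n > 0"
  shows "prob (\<Inter>t<n. C t) = (\<Prod>t<n. prob (C t))"
proof -
  have "indep_sets (\<lambda>t. {\<epsilon> t -` A \<inter> space M |A. A \<in> sets borel}) UNIV"
    using noise_indep unfolding indep_vars_def2 by blast
  moreover have "G (Noise t) = {\<epsilon> t -` A \<inter> space M |A. A \<in> sets borel}" for t
    unfolding G.simps by (rule generated_sets_eq) auto
  ultimately show ?thesis
    using assms by (intro indep_setsD[where I=UNIV]) auto
qed

lemma prob_sources:
  assumes "U \<in> generated_sets M (\<lambda>\<omega>. \<lambda>(t, i)\<in>UNIV \<times> {1..d}. sgd_data W d T t i \<omega>) (PiM (UNIV \<times> {1..d}) (\<lambda>_. borel))"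
    and "V \<in> generated_sets M (\<lambda>\<omega> t. \<epsilon> t \<omega>) (PiM UNIV (\<lambda>_. borel))" and "I \<in> G Init"
  shows "prob (U \<inter> V \<inter> I) = prob U * prob V * prob I"
proof -
  have l: "{..<3::nat} = {0, 1, 2}" by auto
  have "prob (\<Inter>k\<in>{..<3}. [U, V, I] ! k) = (\<Prod>k\<in>{..<3::nat}. prob ([U, V, I] ! k))"
    by (rule indep_setsD[OF sources_indep]) (use assms in \<open>auto simp: l\<close>)
  then show ?thesis by (simp add: l Int_assoc mult.assoc)
qed

lemma G_Data_subset:
  "G (Data t) \<subseteq> generated_sets M (\<lambda>\<omega>. \<lambda>(t, i)\<in>UNIV \<times> {1..d}. sgd_data W d T t i \<omega>) (PiM (UNIV \<times> {1..d}) (\<lambda>_. borel))"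
  unfolding G.simps
  by (rule generated_sets_comp_subset[where f="\<lambda>y. \<lambda>i\<in>{1..d}. y (t, i)"])
     (auto simp: space_PiM PiE_iff extensional_def)

lemma G_Noise_subset: "G (Noise t) \<subseteq> generated_sets M (\<lambda>\<omega> t. \<epsilon> t \<omega>) (PiM UNIV (\<lambda>_. borel))"
  unfolding G.simps
  by (rule generated_sets_comp_subset[where f="\<lambda>y. y t"]) (auto simp: space_PiM PiE_iff)

lemma G_events: "G j \<subseteq> events"
proof -
  have s: "k < 3 \<Longrightarrow> [generated_sets M (\<lambda>\<omega>. \<lambda>(t, i)\<in>UNIV \<times> {1..d}. sgd_data W d T t i \<omega>)
             (PiM (UNIV \<times> {1..d}) (\<lambda>_. borel)),
           generated_sets M (\<lambda>\<omega> t. \<epsilon> t \<omega>) (PiM UNIV (\<lambda>_. borel)),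
           generated_sets M (\<lambda>\<omega>. \<lambda>i\<in>{1..d}. \<theta> 0 i \<omega>) (PiM {1..d} (\<lambda>_. borel))] ! k \<subseteq> events" for k
    using sources_indep unfolding indep_sets_def by blast
  show ?thesis
  proof (cases j)
    case Init then show ?thesis using s[of 2] by simp
  next
    case (Data t) then show ?thesis using s[of 0] G_Data_subset[of t] by simp
  next
    case (Noise t) then show ?thesis using s[of 1] G_Noise_subset[of t] by simp
  qed
qed

text \<open>The hypotheses give independence of the three families as wholes, and independence over
  time within the data and within the noise. Factoring a finite intersection first over the families
  and then over times gives independence of all sources together.\<close>

lemma indep_sets_G: "indep_sets G UNIV"
proof (rule indep_setsI)
  show "G j \<subseteq> events" for j by (rule G_events)
  fix C J assume J: "J \<noteq> {}" "finite J" and C: "\<forall>j\<in>J. C j \<in> G j"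
  \<comment> \<open>Padding with the whole space turns J into a full block of all sources with times
    below n, without changing the intersection or the product.\<close>
  define C' where "C' j = (if j \<in> J then C j else space M)" for j
  have C'G: "C' j \<in> G j" for j using C space_in_G by (simp add: C'_def)
  have C'sub: "C' j \<subseteq> space M" for j using C'G G_events sets.sets_into_space by blast
  \<comment> \<open>Positivity of n matters: an intersection over an empty set of times would be
    \<open>UNIV\<close> rather than the sample space.\<close>
  obtain n where n: "n > 0" "J \<subseteq> insert Init (Data ` {..<n} \<union> Noise ` {..<n})"
  proof -
    define idx where "idx j = (case j of Init \<Rightarrow> 0 | Data t \<Rightarrow> t | Noise t \<Rightarrow> t)" for j
    have "idx j < Suc (Max (idx ` J))" if "j \<in> J" for j
      using J that by (simp add: le_imp_less_Suc)
    then have "J \<subseteq> insert Init (Data ` {..<Suc (Max (idx ` J))} \<union> Noise ` {..<Suc (Max (idx ` J))})"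
      by (force simp: idx_def image_iff split: source.splits)
    then show thesis using that by blast
  qed
  let ?S = "insert Init (Data ` {..<n} \<union> Noise ` {..<n})"
  have fin: "finite ?S" by simp
  have "(\<Inter>j\<in>J. C j) = (\<Inter>j\<in>?S. C' j)"
  proof -
    have "(\<Inter>j\<in>J. C j) = (\<Inter>j\<in>J. C' j)" by (simp add: C'_def)
    also have "\<dots> = (\<Inter>j\<in>?S. C' j)"
    proof (intro equalityI subsetI)
      fix y assume "y \<in> (\<Inter>j\<in>J. C' j)"
      moreover then have "y \<in> space M" using J C'sub by blast
      ultimately show "y \<in> (\<Inter>j\<in>?S. C' j)" by (auto simp: C'_def)
    qed (use n in blast)
    finally show ?thesis .
  qed
  also have "\<dots> = (\<Inter>t<n. C' (Data t)) \<inter> (\<Inter>t<n. C' (Noise t)) \<inter> C' Init"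
    by auto
  also have "prob \<dots> = prob (\<Inter>t<n. C' (Data t)) * prob (\<Inter>t<n. C' (Noise t)) * prob (C' Init)"
  proof (rule prob_sources)
    show "(\<Inter>t<n. C' (Data t)) \<in> generated_sets M (\<lambda>\<omega>. \<lambda>(t, i)\<in>UNIV \<times> {1..d}. sgd_data W d T t i \<omega>) (PiM (UNIV \<times> {1..d}) (\<lambda>_. borel))"
      using C'G G_Data_subset n(1) unfolding generated_sets_def
      by (intro sets.finite_INT) blast+
    show "(\<Inter>t<n. C' (Noise t)) \<in> generated_sets M (\<lambda>\<omega> t. \<epsilon> t \<omega>) (PiM UNIV (\<lambda>_. borel))"
      using C'G G_Noise_subset n(1) unfolding generated_sets_def
      by (intro sets.finite_INT) blast+
  qed (rule C'G)
  also have "\<dots> = (\<Prod>t<n. prob (C' (Data t))) * (\<Prod>t<n. prob (C' (Noise t))) * prob (C' Init)"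
    using prob_Inter_Data[of n "\<lambda>t. C' (Data t)"] prob_Inter_Noise[of n "\<lambda>t. C' (Noise t)"] C'G n(1)
    by (simp del: G.simps)
  also have "\<dots> = (\<Prod>j\<in>?S. prob (C' j))"
  proof -
    have "(\<Prod>j\<in>?S. prob (C' j)) = prob (C' Init) * (\<Prod>j\<in>Data ` {..<n} \<union> Noise ` {..<n}. prob (C' j))"
      by (subst prod.insert) auto
    also have "(\<Prod>j\<in>Data ` {..<n} \<union> Noise ` {..<n}. prob (C' j))
        = (\<Prod>j\<in>Data ` {..<n}. prob (C' j)) * (\<Prod>j\<in>Noise ` {..<n}. prob (C' j))"
      by (rule prod.union_disjoint) auto
    also have "(\<Prod>j\<in>Data ` {..<n}. prob (C' j)) = (\<Prod>t<n. prob (C' (Data t)))"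
      by (simp add: prod.reindex inj_on_def)
    also have "(\<Prod>j\<in>Noise ` {..<n}. prob (C' j)) = (\<Prod>t<n. prob (C' (Noise t)))"
      by (simp add: prod.reindex inj_on_def)
    finally show ?thesis by simp
  qed
  also have "\<dots> = (\<Prod>j\<in>J. prob (C' j))"
    by (rule prod.mono_neutral_right[OF fin n(2)]) (auto simp: C'_def prob_space)
  also have "\<dots> = (\<Prod>j\<in>J. prob (C j))"
    by (intro prod.cong) (auto simp: C'_def)
  finally show "prob (\<Inter>j\<in>J. C j) = (\<Prod>j\<in>J. prob (C j))" .
qed

text \<open>Only its sets are used, to say which sources a variable depends on; expectations are
  always taken in \<open>M\<close>.\<close>

definition alg :: "source set \<Rightarrow> 'a measure" where
  "alg S = sigma (space M) (\<Union>j\<in>S. G j)"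

lemma UN_G_Pow: "(\<Union>j\<in>S. G j) \<subseteq> Pow (space M)"
  using G_events sets.sets_into_space by blast

lemma space_alg [simp]: "space (alg S) = space M"
  unfolding alg_def using UN_G_Pow by (rule space_measure_of)

lemma sets_alg: "sets (alg S) = sigma_sets (space M) (\<Union>j\<in>S. G j)"
  unfolding alg_def using UN_G_Pow by (rule sets_measure_of)

lemma alg_mono: "S \<subseteq> S' \<Longrightarrow> sets (alg S) \<subseteq> sets (alg S')"
  unfolding sets_alg by (rule sigma_sets_mono') blast

lemma alg_events: "sets (alg S) \<subseteq> events"
  unfolding sets_alg using G_events by (intro sets.sigma_sets_subset) blast

lemma alg_measurable_mono:
  "f \<in> measurable (alg S) P \<Longrightarrow> S \<subseteq> S' \<Longrightarrow> f \<in> measurable (alg S') P"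
  by (rule measurable_from_subalg[OF _, rotated]) (use alg_mono[of S S'] in \<open>auto simp: subalgebra_def\<close>)

lemma alg_measurable:
  "f \<in> measurable (alg S) P \<Longrightarrow> f \<in> measurable M P"
  by (rule measurable_from_subalg[OF _, rotated]) (use alg_events in \<open>auto simp: subalgebra_def dest: subsetD\<close>)

text \<open>Each generator \<open>G j\<close> is stable under intersection, so independence extends
  from the sources to the sigma-algebras generated by disjoint groups of them.\<close>

lemma indep_set_alg:
  assumes "S \<inter> S' = {}"
  shows "indep_set (sets (alg S)) (sets (alg S'))"
proof -
  have "indep_sets (\<lambda>b. sigma_sets (space M) (\<Union>i\<in>(case_bool S S' b). G i)) UNIV"
  proof (rule indep_sets_collect_sigma)
    show "indep_sets G (\<Union>j\<in>UNIV. case_bool S S' j)"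
      using indep_sets_G by (rule indep_sets_mono_index[rotated]) simp
    show "disjoint_family (case_bool S S')"
      using assms by (auto simp: disjoint_family_on_def split: bool.splits)
  qed (rule Int_stable_G)
  then show ?thesis
    unfolding indep_set_def sets_alg by (rule indep_sets_mono_sets) (auto split: bool.splits)
qed

lemmas alg_expectation_mult =
  indep_set_expectation_mult[OF indep_set_alg space_alg space_alg]

lemma coordinate_measurable_generated:
  assumes "i \<in> I" "j \<in> S" "G j = generated_sets M (\<lambda>\<omega>. \<lambda>i\<in>I. X i \<omega>) (PiM I (\<lambda>_. borel))"
  shows "(X i :: 'a \<Rightarrow> real) \<in> borel_measurable (alg S)"
proof (rule measurableI)
  fix C :: "real set" assume C: "C \<in> sets borel"
  have "G j \<subseteq> sets (alg S)" unfolding sets_alg using assms(2) by auto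
  moreover have "X i -` C \<inter> space M \<in> G j"
  proof -
    have "(\<lambda>y. y i) -` C \<inter> space (PiM I (\<lambda>_. borel)) \<in> sets (PiM I (\<lambda>_. borel))"
      by (rule measurable_sets[OF measurable_component_singleton[OF assms(1)] C])
    moreover have "X i -` C \<inter> space M = (\<lambda>\<omega>. \<lambda>i\<in>I. X i \<omega>) -` ((\<lambda>y. y i) -` C \<inter> space (PiM I (\<lambda>_. borel))) \<inter> space M"
      using assms(1) by (auto simp: space_PiM)
    moreover have "G j = {(\<lambda>\<omega>. \<lambda>i\<in>I. X i \<omega>) -` C \<inter> space M |C. C \<in> sets (PiM I (\<lambda>_. borel))}"
      unfolding assms(3) by (rule generated_sets_eq) (auto simp: space_PiM)
    ultimately show ?thesis by blast
  qed
  ultimately show "X i -` C \<inter> space (alg S) \<in> sets (alg S)" by auto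
qed simp

lemma x_measurable_alg: "i \<in> {1..d} \<Longrightarrow> Data t \<in> S \<Longrightarrow> x t i \<in> borel_measurable (alg S)"
  using coordinate_measurable_generated[of i "{1..d}" "Data t" S "sgd_data W d T t"]
  by (simp add: x_def[abs_def])

lemma D0_measurable_alg: "i \<in> {1..d} \<Longrightarrow> Init \<in> S \<Longrightarrow> D 0 i \<in> borel_measurable (alg S)"
  using coordinate_measurable_generated[of i "{1..d}" Init S "\<theta> 0"]
  by (simp add: D_def[abs_def] del: One_nat_def)

lemma \<epsilon>_measurable_alg: "Noise t \<in> S \<Longrightarrow> \<epsilon> t \<in> borel_measurable (alg S)"
proof (rule measurableI)
  fix C :: "real set" assume C: "C \<in> sets borel" and S: "Noise t \<in> S"
  have "G (Noise t) \<subseteq> sets (alg S)" unfolding sets_alg using S by blast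
  moreover have "\<epsilon> t -` C \<inter> space M \<in> G (Noise t)"
    unfolding G.simps using C by (subst generated_sets_eq) auto
  ultimately show "\<epsilon> t -` C \<inter> space (alg S) \<in> sets (alg S)" by auto
qed simp

text \<open>Filtration of the recursion: the error \<open>D k\<close> is measurable with respect to
  it, while data and noise of step k are fresh. This separation drives every factorisation of
  expectations below.\<close>

definition past :: "nat \<Rightarrow> source set" where
  "past k = insert Init (Data ` {..<k} \<union> Noise ` {..<k})"

lemma past_Suc: "past (Suc k) = insert (Data k) (insert (Noise k) (past k))"
  by (auto simp: past_def lessThan_Suc)

lemma past_disjoint: "Data k \<notin> past k" "Noise k \<notin> past k"
  by (auto simp: past_def)

lemma D_Suc:
  assumes "\<omega> \<in> space M" "i \<in> {1..d}"
  shows "D (Suc t) i \<omega> = D t i \<omega> - \<eta> * x t i \<omega> * ip d (\<lambda>j. x t j \<omega>) (\<lambda>j. D t j \<omega>) + \<eta> * \<epsilon> t \<omega> * x t i \<omega>"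
  using sgd_step[OF assms, of t]
  by (simp add: D_def ip_def x_def Let_def algebra_simps sum_subtractf sum_distrib_left)

lemma D_measurable_alg: "i \<in> {1..d} \<Longrightarrow> D t i \<in> borel_measurable (alg (past t))"
proof (induction t arbitrary: i)
  case 0
  then show ?case by (intro D0_measurable_alg) (auto simp: past_def)
next
  case (Suc t)
  have [measurable]: "D t j \<in> borel_measurable (alg (past (Suc t)))" if "j \<in> {1..d}" for j
    using Suc.IH[OF that] by (rule alg_measurable_mono) (auto simp: past_Suc)
  have [measurable]: "x t j \<in> borel_measurable (alg (past (Suc t)))" if "j \<in> {1..d}" for j
    using that by (rule x_measurable_alg) (auto simp: past_Suc)
  have [measurable]: "\<epsilon> t \<in> borel_measurable (alg (past (Suc t)))"
    by (rule \<epsilon>_measurable_alg) (auto simp: past_Suc)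
  have "(\<lambda>\<omega>. D t i \<omega> - \<eta> * x t i \<omega> * ip d (\<lambda>j. x t j \<omega>) (\<lambda>j. D t j \<omega>) + \<eta> * \<epsilon> t \<omega> * x t i \<omega>)
      \<in> borel_measurable (alg (past (Suc t)))"
    using Suc.prems unfolding ip_def by measurable
  then show ?case
    by (rule measurable_cong[THEN iffD2, rotated]) (simp add: D_Suc[OF _ Suc.prems])
qed

end

section \<open>Moment bounds for online SGD\<close>

text \<open>A single constant \<open>K\<close> dominates all the constants of the hypotheses, so that every bound
  below depends on \<open>K\<close> only.\<close>

locale bounded_sgd = online_sgd M W A B E d T \<eta> \<sigma> C1 \<theta>s \<epsilon> \<theta>
  for M :: "'a measure" and W A B E d T \<eta> \<sigma> C1 \<theta>s \<epsilon> \<theta> +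
  fixes K :: real
  assumes K_ge_1: "K \<ge> 1"
    and A_bound: "\<lbrakk>y \<in> {0..1}; z \<in> {0..1}\<rbrakk> \<Longrightarrow> \<bar>A y z\<bar> \<le> K"
    and A_lip: "\<lbrakk>y \<in> {0..1}; y' \<in> {0..1}; z \<in> {0..1}\<rbrakk> \<Longrightarrow> \<bar>A y z - A y' z\<bar> \<le> K * \<bar>y - y'\<bar>"
    and A_incr: "\<lbrakk>y \<in> {0..1}; z \<in> {0..1}\<rbrakk> \<Longrightarrow> \<bar>A y y + A z z - 2 * A y z\<bar> \<le> K * \<bar>y - z\<bar>\<^sup>2"
    and B_bound: "ys \<in> points 4 \<Longrightarrow> \<bar>B ys\<bar> \<le> K"
    and B_incr: "\<lbrakk>y \<in> {0..1}; y' \<in> {0..1}; z \<in> {0..1}\<rbrakk> \<Longrightarrow>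
      \<bar>B [y, z, y, z] + B [y', z, y', z] - 2 * B [y, z, y', z]\<bar> \<le> K * \<bar>y - y'\<bar>\<^sup>2"
    and drift_le: "\<eta> * d * T \<le> K" and noise_le: "\<sigma> * \<eta> * sqrt T \<le> K" and C1_le: "C1 \<le> K"
    and init_square_integrable: "i \<in> {1..d} \<Longrightarrow> square_integrable M (D 0 i)"
    and init_moment: "i \<in> {1..d} \<Longrightarrow> expectation (\<lambda>\<omega>. (D 0 i \<omega>)\<^sup>2) \<le> K"
    and init_incr: "\<lbrakk>i \<in> {1..d}; j \<in> {1..d}\<rbrakk> \<Longrightarrow>
      expectation (\<lambda>\<omega>. (D 0 i \<omega> - D 0 j \<omega>)\<^sup>2) \<le> K * ((real i - real j) / d)\<^sup>2"

text \<open>Gronwall factor times initial moment plus accumulated noise: over t \<le> K T steps the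
  growth rate 3 K^4 / T contributes 3 K^5 to the exponent, and noise of size K^4 / T per step adds
  up to K^5.\<close>

definition second_moment_const :: "real \<Rightarrow> real" where
  "second_moment_const K = exp (3 * K ^ 5) * (K + K ^ 5)"

text \<open>exp (K^2) is the Gronwall factor of the rate \<eta> d \<le> K / T; the bracket collects
  the initial increments, the feedback of the second moments through the drift, and the noise, each
  in units of squared spatial distance.\<close>

definition increment_const :: "real \<Rightarrow> real" where
  "increment_const K = exp (K\<^sup>2) * (K + (2 * K ^ 5 * second_moment_const K + K ^ 5))"

section \<open>Moments of the data, of its linear functionals and of one step of the error\<close>

context online_sgd
begin

lemma grid_point: "i \<in> {1..d} \<Longrightarrow> real i / real d \<in> {0..1}"
  using d_pos by auto

lemma a_sym: "i \<in> {1..d} \<Longrightarrow> j \<in> {1..d} \<Longrightarrow> a i j = a j i"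
  unfolding a_def by (intro A_sym grid_point)

lemma x_moment2:
  assumes "i \<in> {1..d}" "j \<in> {1..d}"
  shows "integrable M (\<lambda>\<omega>. x t i \<omega> * x t j \<omega>)" "expectation (\<lambda>\<omega>. x t i \<omega> * x t j \<omega>) = a i j"
  using W_moment2[of "real t / real T" "real i / d" "real j / d"] grid_point[OF assms(1)] grid_point[OF assms(2)]
  by (auto simp: x_def a_def sgd_data_def has_bochner_integral_iff)

lemma points4: "{i, j, k, l} \<subseteq> {1..d} \<Longrightarrow> [real i / d, real j / d, real k / d, real l / d] \<in> points 4"
  using grid_point[of i] grid_point[of j] grid_point[of k] grid_point[of l] by (auto simp: points_def)

lemma x_moment4:
  assumes "{i, j, k, l} \<subseteq> {1..d}"
  shows "integrable M (\<lambda>\<omega>. x t i \<omega> * x t j \<omega> * x t k \<omega> * x t l \<omega>)"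
    "expectation (\<lambda>\<omega>. x t i \<omega> * x t j \<omega> * x t k \<omega> * x t l \<omega>) = B [real i / d, real j / d, real k / d, real l / d]"
  using W_moment4[OF _ points4[OF assms], of "real t / real T"]
  by (auto simp: x_def sgd_data_def has_bochner_integral_iff mult.assoc)

lemma x_measurable: "i \<in> {1..d} \<Longrightarrow> x t i \<in> borel_measurable M"
  by (rule alg_measurable[OF x_measurable_alg[of i t "{Data t}"]]) auto

lemma x_square_integrable: "i \<in> {1..d} \<Longrightarrow> square_integrable M (x t i)"
  using x_moment2(1)[of i i t] x_measurable by (simp add: square_integrable_def power2_eq_square del: One_nat_def)

lemma \<epsilon>_square_integrable: "square_integrable M (\<epsilon> t)"
  using noise_moment2[of t] alg_measurable[OF \<epsilon>_measurable_alg[of t "{Noise t}"]]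
  by (auto simp: square_integrable_def has_bochner_integral_iff)

lemma \<epsilon>_moments:
  "expectation (\<epsilon> t) = 0" "expectation (\<lambda>\<omega>. (\<epsilon> t \<omega>)\<^sup>2) = \<sigma>\<^sup>2"
  "integrable M (\<lambda>\<omega>. \<epsilon> t \<omega> ^ 4)" "expectation (\<lambda>\<omega>. \<epsilon> t \<omega> ^ 4) = C1 * \<sigma> ^ 4"
  using noise_mean[of t] noise_moment2[of t] noise_moment4[of t] by (auto simp: has_bochner_integral_iff)

definition ipx :: "(nat \<Rightarrow> real) \<Rightarrow> nat \<Rightarrow> 'a \<Rightarrow> real" where
  "ipx v t \<omega> = ip d v (\<lambda>i. x t i \<omega>)"

definition ipD :: "(nat \<Rightarrow> real) \<Rightarrow> nat \<Rightarrow> 'a \<Rightarrow> real" where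
  "ipD v t \<omega> = ip d v (\<lambda>i. D t i \<omega>)"

definition quad_a :: "(nat \<Rightarrow> real) \<Rightarrow> real" where
  "quad_a v = (\<Sum>i=1..d. \<Sum>j=1..d. v i * v j * a i j)"

lemma ipx_measurable_alg: "Data t \<in> S \<Longrightarrow> ipx v t \<in> borel_measurable (alg S)"
  unfolding ipx_def[abs_def] ip_def
  by (intro borel_measurable_sum borel_measurable_times borel_measurable_const x_measurable_alg) auto

lemma ipD_measurable_alg: "ipD v t \<in> borel_measurable (alg (past t))"
  unfolding ipD_def[abs_def] ip_def
  by (intro borel_measurable_sum borel_measurable_times borel_measurable_const D_measurable_alg) auto

lemma ipx_square_integrable: "square_integrable M (ipx v t)"
  unfolding ipx_def[abs_def] ip_def
  by (intro square_integrable_sum square_integrable_cmult x_square_integrable) auto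

lemma ipD_square_integrable:
  "(\<And>i. i \<in> {1..d} \<Longrightarrow> square_integrable M (D t i)) \<Longrightarrow> square_integrable M (ipD v t)"
  unfolding ipD_def[abs_def] ip_def
  by (intro square_integrable_sum square_integrable_cmult) auto

lemma ipx_x_expectation:
  assumes "j \<in> {1..d}" shows "expectation (\<lambda>\<omega>. ipx v t \<omega> * x t j \<omega>) = ip d v (\<lambda>i. a i j)"
proof -
  have "expectation (\<lambda>\<omega>. ipx v t \<omega> * x t j \<omega>) = expectation (\<lambda>\<omega>. \<Sum>i=1..d. v i * (x t i \<omega> * x t j \<omega>))"
    by (simp add: ipx_def ip_def sum_distrib_right mult.assoc)
  also have "\<dots> = (\<Sum>i=1..d. expectation (\<lambda>\<omega>. v i * (x t i \<omega> * x t j \<omega>)))"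
    by (intro Bochner_Integration.integral_sum integrable_mult_right x_moment2) (use assms in auto)
  also have "\<dots> = ip d v (\<lambda>i. a i j)"
    using x_moment2(2)[OF _ assms] by (simp add: ip_def)
  finally show ?thesis .
qed

lemma ipx_square_expectation: "expectation (\<lambda>\<omega>. (ipx v t \<omega>)\<^sup>2) = quad_a v"
proof -
  have "(ipx v t \<omega>)\<^sup>2 = (\<Sum>j=1..d. v j * (ipx v t \<omega> * x t j \<omega>))" for \<omega>
    unfolding power2_eq_square by (subst (2) ipx_def) (simp add: ip_def sum_distrib_left algebra_simps)
  then have "expectation (\<lambda>\<omega>. (ipx v t \<omega>)\<^sup>2) = expectation (\<lambda>\<omega>. \<Sum>j=1..d. v j * (ipx v t \<omega> * x t j \<omega>))"
    by simp
  also have "\<dots> = (\<Sum>j=1..d. expectation (\<lambda>\<omega>. v j * (ipx v t \<omega> * x t j \<omega>)))"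
    by (intro Bochner_Integration.integral_sum integrable_mult_right
        square_integrable_mult ipx_square_integrable x_square_integrable) auto
  also have "\<dots> = (\<Sum>j=1..d. v j * ip d v (\<lambda>i. a i j))"
    using ipx_x_expectation by simp
  also have "\<dots> = quad_a v"
    unfolding quad_a_def ip_def sum_distrib_left by (subst sum.swap) (simp add: algebra_simps)
  finally show ?thesis .
qed

text \<open>The covariance \<open>A\<close> is positive semidefinite on the grid, since the form is
  the second moment of a linear functional of the data.\<close>

lemma quad_a_nonneg: "0 \<le> quad_a v"
  unfolding ipx_square_expectation[of v 0, symmetric] by simp

text \<open>The square of this product has degree four in the data; this is where the kernel
  \<open>B\<close> enters the energy estimate.\<close>

lemma ipx_x_square:
  assumes j: "j \<in> {1..d}"
  shows "square_integrable M (\<lambda>\<omega>. ipx v t \<omega> * x t j \<omega>)"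
    and "expectation (\<lambda>\<omega>. (ipx v t \<omega> * x t j \<omega>)\<^sup>2)
      = (\<Sum>i=1..d. \<Sum>k=1..d. v i * v k * B [real i / d, real j / d, real k / d, real j / d])"
proof -
  have eq: "(ipx v t \<omega> * x t j \<omega>)\<^sup>2
      = (\<Sum>i=1..d. \<Sum>k=1..d. v i * v k * (x t i \<omega> * x t j \<omega> * x t k \<omega> * x t j \<omega>))" for \<omega>
    by (simp add: ipx_def ip_def power2_eq_square sum_distrib_left sum_distrib_right algebra_simps)
  have int: "integrable M (\<lambda>\<omega>. v i * v k * (x t i \<omega> * x t j \<omega> * x t k \<omega> * x t j \<omega>))"
    if "i \<in> {1..d}" "k \<in> {1..d}" for i k
    using x_moment4(1)[of i j k j t] that j by (intro integrable_mult_right) auto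
  show "square_integrable M (\<lambda>\<omega>. ipx v t \<omega> * x t j \<omega>)"
    unfolding square_integrable_def eq
    by (intro conjI Bochner_Integration.integrable_sum int borel_measurable_times x_measurable j)
       (use ipx_square_integrable in auto)
  have "expectation (\<lambda>\<omega>. (ipx v t \<omega> * x t j \<omega>)\<^sup>2)
      = (\<Sum>i=1..d. expectation (\<lambda>\<omega>. \<Sum>k=1..d. v i * v k * (x t i \<omega> * x t j \<omega> * x t k \<omega> * x t j \<omega>)))"
    unfolding eq by (intro Bochner_Integration.integral_sum Bochner_Integration.integrable_sum int)
  also have "\<dots> = (\<Sum>i=1..d. \<Sum>k=1..d. expectation (\<lambda>\<omega>. v i * v k * (x t i \<omega> * x t j \<omega> * x t k \<omega> * x t j \<omega>)))"
    by (intro sum.cong refl Bochner_Integration.integral_sum int)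
  also have "\<dots> = (\<Sum>i=1..d. \<Sum>k=1..d. v i * v k * B [real i / d, real j / d, real k / d, real j / d])"
    by (intro sum.cong refl) (use x_moment4(2)[of _ j _ j t] j in simp)
  finally show "expectation (\<lambda>\<omega>. (ipx v t \<omega> * x t j \<omega>)\<^sup>2)
      = (\<Sum>i=1..d. \<Sum>k=1..d. v i * v k * B [real i / d, real j / d, real k / d, real j / d])" .
qed

text \<open>The data of step t are independent of \<open>D t\<close>, so the expectation of each
  product of squares factors. Passing from the square of a sum over d coordinates to the sum of
  squares costs one factor d, the summation costs the other.\<close>

lemma ipx_ipD_square:
  assumes D: "\<And>j. j \<in> {1..d} \<Longrightarrow> square_integrable M (D t j)"
    and m: "\<And>j. j \<in> {1..d} \<Longrightarrow> expectation (\<lambda>\<omega>. (D t j \<omega>)\<^sup>2) \<le> m"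
    and \<kappa>: "\<And>j. j \<in> {1..d} \<Longrightarrow> expectation (\<lambda>\<omega>. (ipx v t \<omega> * x t j \<omega>)\<^sup>2) \<le> \<kappa>"
  shows "square_integrable M (\<lambda>\<omega>. ipx v t \<omega> * ip d (\<lambda>j. x t j \<omega>) (\<lambda>j. D t j \<omega>))"
    and "expectation (\<lambda>\<omega>. (ipx v t \<omega> * ip d (\<lambda>j. x t j \<omega>) (\<lambda>j. D t j \<omega>))\<^sup>2) \<le> (real d)\<^sup>2 * (\<kappa> * m)"
proof -
  have ind: "integrable M (\<lambda>\<omega>. (ipx v t \<omega> * x t j \<omega>)\<^sup>2 * (D t j \<omega>)\<^sup>2)"
    "expectation (\<lambda>\<omega>. (ipx v t \<omega> * x t j \<omega>)\<^sup>2 * (D t j \<omega>)\<^sup>2) \<le> \<kappa> * m" if j: "j \<in> {1..d}" for j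
  proof -
    have m1: "(\<lambda>\<omega>. (ipx v t \<omega> * x t j \<omega>)\<^sup>2) \<in> borel_measurable (alg {Data t})"
      by (intro borel_measurable_power borel_measurable_times ipx_measurable_alg x_measurable_alg j) auto
    have m2: "(\<lambda>\<omega>. (D t j \<omega>)\<^sup>2) \<in> borel_measurable (alg (past t))"
      by (intro borel_measurable_power D_measurable_alg j)
    have i1: "integrable M (\<lambda>\<omega>. (ipx v t \<omega> * x t j \<omega>)\<^sup>2)" "integrable M (\<lambda>\<omega>. (D t j \<omega>)\<^sup>2)"
      using ipx_x_square(1)[OF j] D[OF j] by (auto simp: square_integrable_def)
    note * = alg_expectation_mult[OF _ m1 i1(1) m2 i1(2)]
    show "integrable M (\<lambda>\<omega>. (ipx v t \<omega> * x t j \<omega>)\<^sup>2 * (D t j \<omega>)\<^sup>2)"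
      using past_disjoint by (intro *) auto
    have "expectation (\<lambda>\<omega>. (ipx v t \<omega> * x t j \<omega>)\<^sup>2 * (D t j \<omega>)\<^sup>2)
        = expectation (\<lambda>\<omega>. (ipx v t \<omega> * x t j \<omega>)\<^sup>2) * expectation (\<lambda>\<omega>. (D t j \<omega>)\<^sup>2)"
      using past_disjoint by (intro *) auto
    also have "\<dots> \<le> \<kappa> * m"
      using \<kappa>[OF j] m[OF j] order_trans[OF _ \<kappa>[OF j], of 0] by (intro mult_mono) simp_all
    finally show "expectation (\<lambda>\<omega>. (ipx v t \<omega> * x t j \<omega>)\<^sup>2 * (D t j \<omega>)\<^sup>2) \<le> \<kappa> * m" .
  qed
  have eq: "ipx v t \<omega> * ip d (\<lambda>j. x t j \<omega>) (\<lambda>j. D t j \<omega>) = (\<Sum>j=1..d. (ipx v t \<omega> * x t j \<omega>) * D t j \<omega>)" for \<omega>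
    by (simp add: ip_def sum_distrib_left mult.assoc)
  show sq: "square_integrable M (\<lambda>\<omega>. ipx v t \<omega> * ip d (\<lambda>j. x t j \<omega>) (\<lambda>j. D t j \<omega>))"
    unfolding eq
  proof (rule square_integrable_sum)
    fix j assume j: "j \<in> {1..d}"
    show "square_integrable M (\<lambda>\<omega>. (ipx v t \<omega> * x t j \<omega>) * D t j \<omega>)"
      using ind(1)[OF j] ipx_square_integrable[of v t, THEN square_integrable_measurable]
        x_measurable[OF j, of t] D[OF j, THEN square_integrable_measurable]
      by (simp add: square_integrable_def power_mult_distrib)
  qed
  have "expectation (\<lambda>\<omega>. (ipx v t \<omega> * ip d (\<lambda>j. x t j \<omega>) (\<lambda>j. D t j \<omega>))\<^sup>2)
      \<le> expectation (\<lambda>\<omega>. real d * (\<Sum>j=1..d. (ipx v t \<omega> * x t j \<omega>)\<^sup>2 * (D t j \<omega>)\<^sup>2))"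
  proof (rule integral_mono)
    show "integrable M (\<lambda>\<omega>. (ipx v t \<omega> * ip d (\<lambda>j. x t j \<omega>) (\<lambda>j. D t j \<omega>))\<^sup>2)"
      using sq by (simp add: square_integrable_def)
    show "integrable M (\<lambda>\<omega>. real d * (\<Sum>j=1..d. (ipx v t \<omega> * x t j \<omega>)\<^sup>2 * (D t j \<omega>)\<^sup>2))"
      by (intro integrable_mult_right Bochner_Integration.integrable_sum ind(1))
    show "(ipx v t \<omega> * ip d (\<lambda>j. x t j \<omega>) (\<lambda>j. D t j \<omega>))\<^sup>2
        \<le> real d * (\<Sum>j=1..d. (ipx v t \<omega> * x t j \<omega>)\<^sup>2 * (D t j \<omega>)\<^sup>2)" for \<omega>
      using ip_square_le[of d "\<lambda>j. ipx v t \<omega> * x t j \<omega>" "\<lambda>j. D t j \<omega>"]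
      unfolding eq ip_def[of d "\<lambda>j. ipx v t \<omega> * x t j \<omega>"] .
  qed
  also have "\<dots> = real d * (\<Sum>j=1..d. expectation (\<lambda>\<omega>. (ipx v t \<omega> * x t j \<omega>)\<^sup>2 * (D t j \<omega>)\<^sup>2))"
    using ind(1) by (simp add: Bochner_Integration.integral_sum)
  also have "\<dots> \<le> real d * (\<Sum>j=1..d. \<kappa> * m)"
    by (intro mult_left_mono sum_mono ind(2)) auto
  finally show "expectation (\<lambda>\<omega>. (ipx v t \<omega> * ip d (\<lambda>j. x t j \<omega>) (\<lambda>j. D t j \<omega>))\<^sup>2) \<le> (real d)\<^sup>2 * (\<kappa> * m)"
    by (simp add: power2_eq_square)
qed

text \<open>Against anything measurable in the past, the matrix x x^T may be replaced by its mean.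
  This gives the drift cross term in the energy estimate and, later, the orthogonality of the
  martingale terms.\<close>

lemma ipx_ipD_expectation:
  assumes D: "\<And>j. j \<in> {1..d} \<Longrightarrow> square_integrable M (D t j)"
    and R: "square_integrable M R" "R \<in> borel_measurable (alg (past t))"
  shows "expectation (\<lambda>\<omega>. R \<omega> * (ipx v t \<omega> * ip d (\<lambda>j. x t j \<omega>) (\<lambda>j. D t j \<omega>)))
    = (\<Sum>j=1..d. ip d v (\<lambda>i. a i j) * expectation (\<lambda>\<omega>. R \<omega> * D t j \<omega>))"
proof -
  have ind: "integrable M (\<lambda>\<omega>. (ipx v t \<omega> * x t j \<omega>) * (R \<omega> * D t j \<omega>))"
    "expectation (\<lambda>\<omega>. (ipx v t \<omega> * x t j \<omega>) * (R \<omega> * D t j \<omega>))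
      = ip d v (\<lambda>i. a i j) * expectation (\<lambda>\<omega>. R \<omega> * D t j \<omega>)" if j: "j \<in> {1..d}" for j
  proof -
    have m1: "(\<lambda>\<omega>. ipx v t \<omega> * x t j \<omega>) \<in> borel_measurable (alg {Data t})"
      by (intro borel_measurable_times ipx_measurable_alg x_measurable_alg j) auto
    have m2: "(\<lambda>\<omega>. R \<omega> * D t j \<omega>) \<in> borel_measurable (alg (past t))"
      by (intro borel_measurable_times D_measurable_alg j R)
    have i: "integrable M (\<lambda>\<omega>. ipx v t \<omega> * x t j \<omega>)" "integrable M (\<lambda>\<omega>. R \<omega> * D t j \<omega>)"
      by (intro square_integrable_mult ipx_square_integrable x_square_integrable R D j)+
    note * = alg_expectation_mult[OF _ m1 i(1) m2 i(2)]
    show "integrable M (\<lambda>\<omega>. (ipx v t \<omega> * x t j \<omega>) * (R \<omega> * D t j \<omega>))"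
      using past_disjoint by (intro *) auto
    show "expectation (\<lambda>\<omega>. (ipx v t \<omega> * x t j \<omega>) * (R \<omega> * D t j \<omega>))
      = ip d v (\<lambda>i. a i j) * expectation (\<lambda>\<omega>. R \<omega> * D t j \<omega>)"
      unfolding ipx_x_expectation[OF j, of v t, symmetric] using past_disjoint by (intro *) auto
  qed
  have "R \<omega> * (ipx v t \<omega> * ip d (\<lambda>j. x t j \<omega>) (\<lambda>j. D t j \<omega>))
      = (\<Sum>j=1..d. (ipx v t \<omega> * x t j \<omega>) * (R \<omega> * D t j \<omega>))" for \<omega>
    by (simp add: ip_def sum_distrib_left algebra_simps)
  then show ?thesis
    using ind by (simp add: Bochner_Integration.integral_sum)
qed

text \<open>The noise is independent even of the data of its own step, hence the enlarged
  sigma-algebra over \<open>insert (Data t) (past t)\<close>.\<close>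

lemma noise_expectation:
  assumes "f \<in> borel_measurable (alg (insert (Data t) (past t)))" "integrable M f"
  shows "integrable M (\<lambda>\<omega>. f \<omega> * \<epsilon> t \<omega>)" "expectation (\<lambda>\<omega>. f \<omega> * \<epsilon> t \<omega>) = 0"
proof -
  have d: "insert (Data t) (past t) \<inter> {Noise t} = {}" using past_disjoint by auto
  have e: "\<epsilon> t \<in> borel_measurable (alg {Noise t})" "integrable M (\<epsilon> t)"
    using \<epsilon>_measurable_alg \<epsilon>_square_integrable square_integrable_integrable by auto
  from alg_expectation_mult[OF d assms e]
  show "integrable M (\<lambda>\<omega>. f \<omega> * \<epsilon> t \<omega>)" "expectation (\<lambda>\<omega>. f \<omega> * \<epsilon> t \<omega>) = 0"
    by (simp_all add: \<epsilon>_moments)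
qed

lemma noise_square:
  "square_integrable M (\<lambda>\<omega>. ipx v t \<omega> * \<epsilon> t \<omega>)"
  "expectation (\<lambda>\<omega>. (ipx v t \<omega> * \<epsilon> t \<omega>)\<^sup>2) = \<sigma>\<^sup>2 * quad_a v"
proof -
  have d: "{Data t} \<inter> {Noise t} = {}" by auto
  have m: "(\<lambda>\<omega>. (ipx v t \<omega>)\<^sup>2) \<in> borel_measurable (alg {Data t})" "integrable M (\<lambda>\<omega>. (ipx v t \<omega>)\<^sup>2)"
    "(\<lambda>\<omega>. (\<epsilon> t \<omega>)\<^sup>2) \<in> borel_measurable (alg {Noise t})" "integrable M (\<lambda>\<omega>. (\<epsilon> t \<omega>)\<^sup>2)"
    using ipx_measurable_alg[of t "{Data t}"] \<epsilon>_measurable_alg[of t "{Noise t}"]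
      ipx_square_integrable \<epsilon>_square_integrable
    by (auto simp: square_integrable_def intro!: borel_measurable_power)
  note * = alg_expectation_mult[OF d m]
  show "square_integrable M (\<lambda>\<omega>. ipx v t \<omega> * \<epsilon> t \<omega>)"
    using *(1) ipx_square_integrable[of v t, THEN square_integrable_measurable]
      \<epsilon>_square_integrable[of t, THEN square_integrable_measurable]
    by (simp add: square_integrable_def power_mult_distrib)
  show "expectation (\<lambda>\<omega>. (ipx v t \<omega> * \<epsilon> t \<omega>)\<^sup>2) = \<sigma>\<^sup>2 * quad_a v"
    using *(2) by (simp add: power_mult_distrib \<epsilon>_moments ipx_square_expectation)
qed

lemma ipD_Suc:
  assumes "\<omega> \<in> space M"
  shows "ipD v (Suc t) \<omega> = ipD v t \<omega> - \<eta> * (ipx v t \<omega> * ip d (\<lambda>j. x t j \<omega>) (\<lambda>j. D t j \<omega>)) + \<eta> * (ipx v t \<omega> * \<epsilon> t \<omega>)"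
proof -
  have "ipD v (Suc t) \<omega> = (\<Sum>i=1..d. v i * D t i \<omega> - \<eta> * (v i * x t i \<omega>) * ip d (\<lambda>j. x t j \<omega>) (\<lambda>j. D t j \<omega>)
      + \<eta> * \<epsilon> t \<omega> * (v i * x t i \<omega>))"
    unfolding ipD_def ip_def[of d v] by (intro sum.cong refl) (simp add: D_Suc[OF assms] algebra_simps)
  also have "\<dots> = ipD v t \<omega> - \<eta> * (ipx v t \<omega> * ip d (\<lambda>j. x t j \<omega>) (\<lambda>j. D t j \<omega>)) + \<eta> * (ipx v t \<omega> * \<epsilon> t \<omega>)"
    unfolding ipD_def ipx_def ip_def[of d v]
    by (simp add: sum.distrib sum_subtractf sum_distrib_left sum_distrib_right algebra_simps)
  finally show ?thesis .
qed

text \<open>Coordinate functionals \<open>v\<close> yield bounds on second moments, their differences yield spatial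
  regularity.\<close>

lemma energy_step:
  assumes D: "\<And>j. j \<in> {1..d} \<Longrightarrow> square_integrable M (D t j)"
    and m: "\<And>j. j \<in> {1..d} \<Longrightarrow> expectation (\<lambda>\<omega>. (D t j \<omega>)\<^sup>2) \<le> m"
    and \<kappa>1: "quad_a v \<le> \<kappa>"
    and \<kappa>2: "\<And>j. j \<in> {1..d} \<Longrightarrow> expectation (\<lambda>\<omega>. (ipx v t \<omega> * x t j \<omega>)\<^sup>2) \<le> \<kappa>"
    and \<kappa>3: "\<And>j. j \<in> {1..d} \<Longrightarrow> (ip d v (\<lambda>i. a i j))\<^sup>2 \<le> \<kappa>"
  shows "square_integrable M (ipD v (Suc t))"
    and "expectation (\<lambda>\<omega>. (ipD v (Suc t) \<omega>)\<^sup>2) \<le>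
      (1 + \<eta> * d) * expectation (\<lambda>\<omega>. (ipD v t \<omega>)\<^sup>2) + ((\<eta> * d + (\<eta> * d)\<^sup>2) * (\<kappa> * m) + (\<eta> * \<sigma>)\<^sup>2 * \<kappa>)"
proof -
  define P where "P = ipD v t"
  define Q where "Q \<omega> = ipx v t \<omega> * ip d (\<lambda>j. x t j \<omega>) (\<lambda>j. D t j \<omega>)" for \<omega>
  define N where "N \<omega> = ipx v t \<omega> * \<epsilon> t \<omega>" for \<omega>
  have Psq: "square_integrable M P" unfolding P_def by (rule ipD_square_integrable[OF D])
  have Qsq: "square_integrable M Q" and EQ: "expectation (\<lambda>\<omega>. (Q \<omega>)\<^sup>2) \<le> (real d)\<^sup>2 * (\<kappa> * m)"
    unfolding Q_def by (rule ipx_ipD_square[OF D m \<kappa>2]; assumption)+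
  have Nsq: "square_integrable M N" and EN: "expectation (\<lambda>\<omega>. (N \<omega>)\<^sup>2) = \<sigma>\<^sup>2 * quad_a v"
    unfolding N_def by (rule noise_square)+
  have step: "ipD v (Suc t) \<omega> = (P \<omega> - \<eta> * Q \<omega>) + \<eta> * N \<omega>" if "\<omega> \<in> space M" for \<omega>
    unfolding P_def Q_def N_def by (rule ipD_Suc[OF that])
  \<comment> \<open>The step before noise is added: it depends on the data of step t but not on its
    noise, which kills the cross term with \<open>N\<close>.\<close>
  define U where "U \<omega> = P \<omega> - \<eta> * Q \<omega>" for \<omega>
  have Usq: "square_integrable M U" unfolding U_def
    by (intro square_integrable_diff square_integrable_cmult Psq Qsq)
  have Um: "U \<in> borel_measurable (alg (insert (Data t) (past t)))"
  proof -
    have "P \<in> borel_measurable (alg (insert (Data t) (past t)))"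
      unfolding P_def by (rule alg_measurable_mono[OF ipD_measurable_alg]) auto
    moreover have "D t j \<in> borel_measurable (alg (insert (Data t) (past t)))" if "j \<in> {1..d}" for j
      by (rule alg_measurable_mono[OF D_measurable_alg[OF that]]) auto
    then have "Q \<in> borel_measurable (alg (insert (Data t) (past t)))"
      unfolding Q_def[abs_def] ip_def
      by (intro borel_measurable_times borel_measurable_sum ipx_measurable_alg x_measurable_alg) auto
    ultimately show ?thesis unfolding U_def[abs_def] by measurable
  qed
  have D1sq: "square_integrable M (\<lambda>\<omega>. U \<omega> + \<eta> * N \<omega>)"
    by (intro square_integrable_add square_integrable_cmult Usq Nsq)
  have mcong: "ipD v (Suc t) \<in> borel_measurable M"
    by (rule alg_measurable[OF ipD_measurable_alg])
  show "square_integrable M (ipD v (Suc t))"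
    unfolding square_integrable_def
  proof (intro conjI mcong)
    show "integrable M (\<lambda>\<omega>. (ipD v (Suc t) \<omega>)\<^sup>2)"
      using D1sq by (subst Bochner_Integration.integrable_cong[OF refl, where g="\<lambda>\<omega>. (U \<omega> + \<eta> * N \<omega>)\<^sup>2"])
        (auto simp: step U_def square_integrable_def)
  qed
  have UN: "expectation (\<lambda>\<omega>. U \<omega> * N \<omega>) = 0"
  proof -
    have "expectation (\<lambda>\<omega>. (U \<omega> * ipx v t \<omega>) * \<epsilon> t \<omega>) = 0"
      by (rule noise_expectation(2))
        (auto intro!: borel_measurable_times Um ipx_measurable_alg square_integrable_mult Usq ipx_square_integrable)
    then show ?thesis by (simp add: N_def mult.assoc)
  qed
  have PQ: "expectation (\<lambda>\<omega>. P \<omega> * Q \<omega>) = (\<Sum>j=1..d. ip d v (\<lambda>i. a i j) * expectation (\<lambda>\<omega>. P \<omega> * D t j \<omega>))"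
    unfolding Q_def by (rule ipx_ipD_expectation[OF D Psq]) (auto simp: P_def ipD_measurable_alg)
  \<comment> \<open>The term of first order in \<eta>. Young's inequality in every coordinate leaves
    d copies of E P^2, so multiplication by \<eta> produces the growth rate \<eta> d.\<close>
  have "- (2 * expectation (\<lambda>\<omega>. P \<omega> * Q \<omega>)) \<le> (\<Sum>j=1..d. expectation (\<lambda>\<omega>. (P \<omega>)\<^sup>2) + \<kappa> * m)"
    unfolding PQ sum_distrib_left sum_negf[symmetric]
  proof (rule sum_mono)
    fix j assume j: "j \<in> {1..d}"
    let ?b = "ip d v (\<lambda>i. a i j)"
    have "- (2 * (?b * expectation (\<lambda>\<omega>. P \<omega> * D t j \<omega>))) \<le> 2 * \<bar>expectation (\<lambda>\<omega>. P \<omega> * (?b * D t j \<omega>))\<bar>"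
    proof -
      have "expectation (\<lambda>\<omega>. P \<omega> * (?b * D t j \<omega>)) = ?b * expectation (\<lambda>\<omega>. P \<omega> * D t j \<omega>)"
        unfolding mult.left_commute[of "P _"] by simp
      then show ?thesis by linarith
    qed
    also have "\<dots> \<le> expectation (\<lambda>\<omega>. (P \<omega>)\<^sup>2) + expectation (\<lambda>\<omega>. (?b * D t j \<omega>)\<^sup>2)"
      by (intro abs_expectation_mult_le Psq square_integrable_cmult D j)
    also have "expectation (\<lambda>\<omega>. (?b * D t j \<omega>)\<^sup>2) = ?b\<^sup>2 * expectation (\<lambda>\<omega>. (D t j \<omega>)\<^sup>2)"
      by (simp add: power_mult_distrib)
    also have "\<dots> \<le> \<kappa> * m"
      using \<kappa>3[OF j] m[OF j] order_trans[OF _ \<kappa>3[OF j], of 0] by (intro mult_mono) simp_all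
    finally show "- (2 * (?b * expectation (\<lambda>\<omega>. P \<omega> * D t j \<omega>))) \<le> expectation (\<lambda>\<omega>. (P \<omega>)\<^sup>2) + \<kappa> * m" by simp
  qed
  then have PQ': "- (2 * expectation (\<lambda>\<omega>. P \<omega> * Q \<omega>)) \<le> d * (expectation (\<lambda>\<omega>. (P \<omega>)\<^sup>2) + \<kappa> * m)" by simp
  have i: "integrable M (\<lambda>\<omega>. (P \<omega>)\<^sup>2)" "integrable M (\<lambda>\<omega>. (Q \<omega>)\<^sup>2)" "integrable M (\<lambda>\<omega>. P \<omega> * Q \<omega>)"
    "integrable M (\<lambda>\<omega>. (N \<omega>)\<^sup>2)" "integrable M (\<lambda>\<omega>. (U \<omega>)\<^sup>2)" "integrable M (\<lambda>\<omega>. U \<omega> * N \<omega>)"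
    using Psq Qsq Nsq Usq square_integrable_mult[OF Psq Qsq] square_integrable_mult[OF Usq Nsq]
    by (auto simp: square_integrable_def)
  have "expectation (\<lambda>\<omega>. (ipD v (Suc t) \<omega>)\<^sup>2) = expectation (\<lambda>\<omega>. (U \<omega>)\<^sup>2 + 2 * \<eta> * (U \<omega> * N \<omega>) + \<eta>\<^sup>2 * (N \<omega>)\<^sup>2)"
    by (intro Bochner_Integration.integral_cong refl) (simp add: step U_def power2_eq_square algebra_simps)
  also have "\<dots> = expectation (\<lambda>\<omega>. (U \<omega>)\<^sup>2) + \<eta>\<^sup>2 * (\<sigma>\<^sup>2 * quad_a v)"
    using i by (simp add: UN EN)
  also have "expectation (\<lambda>\<omega>. (U \<omega>)\<^sup>2) = expectation (\<lambda>\<omega>. (P \<omega>)\<^sup>2 - 2 * \<eta> * (P \<omega> * Q \<omega>) + \<eta>\<^sup>2 * (Q \<omega>)\<^sup>2)"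
    by (intro Bochner_Integration.integral_cong refl) (simp add: U_def power2_eq_square algebra_simps)
  also have "\<dots> = expectation (\<lambda>\<omega>. (P \<omega>)\<^sup>2) + \<eta> * (- (2 * expectation (\<lambda>\<omega>. P \<omega> * Q \<omega>))) + \<eta>\<^sup>2 * expectation (\<lambda>\<omega>. (Q \<omega>)\<^sup>2)"
    using i by simp
  also have "\<dots> \<le> expectation (\<lambda>\<omega>. (P \<omega>)\<^sup>2) + \<eta> * (d * (expectation (\<lambda>\<omega>. (P \<omega>)\<^sup>2) + \<kappa> * m)) + \<eta>\<^sup>2 * ((real d)\<^sup>2 * (\<kappa> * m))"
    by (intro add_mono mult_left_mono PQ' EQ) (use \<eta>_pos in auto)
  finally have "expectation (\<lambda>\<omega>. (ipD v (Suc t) \<omega>)\<^sup>2)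
      \<le> expectation (\<lambda>\<omega>. (P \<omega>)\<^sup>2) + \<eta> * (d * (expectation (\<lambda>\<omega>. (P \<omega>)\<^sup>2) + \<kappa> * m)) + \<eta>\<^sup>2 * ((real d)\<^sup>2 * (\<kappa> * m)) + \<eta>\<^sup>2 * (\<sigma>\<^sup>2 * quad_a v)"
    by simp
  also have "\<dots> \<le> expectation (\<lambda>\<omega>. (P \<omega>)\<^sup>2) + \<eta> * (d * (expectation (\<lambda>\<omega>. (P \<omega>)\<^sup>2) + \<kappa> * m)) + \<eta>\<^sup>2 * ((real d)\<^sup>2 * (\<kappa> * m)) + \<eta>\<^sup>2 * (\<sigma>\<^sup>2 * \<kappa>)"
    by (intro add_left_mono mult_left_mono \<kappa>1) auto
  also have "\<dots> = (1 + \<eta> * d) * expectation (\<lambda>\<omega>. (P \<omega>)\<^sup>2) + ((\<eta> * d + (\<eta> * d)\<^sup>2) * (\<kappa> * m) + (\<eta> * \<sigma>)\<^sup>2 * \<kappa>)"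
    by (simp add: power2_eq_square algebra_simps)
  finally show "expectation (\<lambda>\<omega>. (ipD v (Suc t) \<omega>)\<^sup>2) \<le>
      (1 + \<eta> * d) * expectation (\<lambda>\<omega>. (ipD v t \<omega>)\<^sup>2) + ((\<eta> * d + (\<eta> * d)\<^sup>2) * (\<kappa> * m) + (\<eta> * \<sigma>)\<^sup>2 * \<kappa>)"
    by (simp add: P_def)
qed

end

definition coord :: "nat \<Rightarrow> nat \<Rightarrow> real" where
  "coord i j = (if j = i then 1 else 0)"

lemma ip_coord: "i \<in> {1..d} \<Longrightarrow> ip d (coord i) y = y i"
  by (simp add: ip_def coord_def if_distrib[of "\<lambda>c. c * _"] cong: if_cong)

lemma l1_coord: "i \<in> {1..d} \<Longrightarrow> l1 d (coord i) = 1"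
  by (simp add: l1_def coord_def if_distrib cong: if_cong)

lemma ip_diff_left: "ip d (\<lambda>k. v k - w k) y = ip d v y - ip d w y"
  by (simp add: ip_def left_diff_distrib sum_subtractf)

section \<open>Bounds uniform over at most K T steps\<close>

context bounded_sgd
begin

lemma K_nonneg: "0 \<le> K"
  using K_ge_1 by auto

lemma second_moment_const_nonneg: "0 \<le> second_moment_const K"
  unfolding second_moment_const_def using K_nonneg by simp

lemma T_real_pos: "real T > 0" using T_pos by simp

lemma drift_step_le: "\<eta> * d \<le> K / T"
  using drift_le T_real_pos by (simp add: field_simps)

lemma drift_step_nonneg: "0 \<le> \<eta> * d"
  using \<eta>_pos by simp

lemma noise_step_le: "(\<eta> * \<sigma>)\<^sup>2 \<le> K\<^sup>2 / T"
proof -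
  have "(\<sigma> * \<eta> * sqrt T)\<^sup>2 \<le> K\<^sup>2"
    using noise_le \<sigma>_nonneg \<eta>_pos by (intro power_mono) auto
  then show ?thesis
    using T_real_pos by (simp add: power_mult_distrib field_simps)
qed

lemma drift_step_square_le: "(\<eta> * d)\<^sup>2 \<le> K\<^sup>2 / T"
proof -
  have "(\<eta> * d)\<^sup>2 \<le> (K / T)\<^sup>2" using drift_step_le drift_step_nonneg by (rule power_mono)
  also have "\<dots> = K\<^sup>2 / T / T" by (simp add: power2_eq_square)
  also have "\<dots> \<le> K\<^sup>2 / T / 1" using T_pos by (intro divide_left_mono) auto
  finally show ?thesis by simp
qed

lemma abs_a_le: "i \<in> {1..d} \<Longrightarrow> j \<in> {1..d} \<Longrightarrow> \<bar>a i j\<bar> \<le> K"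
  unfolding a_def by (intro A_bound grid_point)

lemma K_power_mono: "m \<le> n \<Longrightarrow> K ^ m \<le> K ^ n"
  using K_ge_1 by (rule power_increasing[rotated])

lemma quad_a_le: "quad_a v \<le> K * (l1 d v)\<^sup>2"
  using ip_ip_le[of d a K v v] abs_a_le unfolding quad_a_def
  by (auto simp: power2_eq_square mult.commute)

lemma ip_a_square_le:
  assumes "j \<in> {1..d}" shows "(ip d v (\<lambda>i. a i j))\<^sup>2 \<le> K\<^sup>2 * (l1 d v)\<^sup>2"
proof -
  have "\<bar>ip d v (\<lambda>i. a i j)\<bar> \<le> l1 d v * K" using abs_a_le assms by (intro abs_ip_le) auto
  then have "(ip d v (\<lambda>i. a i j))\<^sup>2 \<le> (l1 d v * K)\<^sup>2" by (rule abs_le_square_iff[THEN iffD1, OF order_trans]) simp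
  then show ?thesis by (simp add: power_mult_distrib mult.commute)
qed

lemma ipx_x_square_le:
  assumes "j \<in> {1..d}" shows "expectation (\<lambda>\<omega>. (ipx v t \<omega> * x t j \<omega>)\<^sup>2) \<le> K * (l1 d v)\<^sup>2"
  unfolding ipx_x_square(2)[OF assms]
  using ip_ip_le[of d "\<lambda>i k. B [real i / d, real j / d, real k / d, real j / d]" K v v] assms
    B_bound[OF points4]
  by (auto simp: power2_eq_square mult.commute)

text \<open>The three quantities of the energy estimate get one common bound; K \<le> K^2 lets those
  that are linear in K fit in.\<close>

lemma functional_bounds:
  assumes "l1 d v \<le> c"
  shows "quad_a v \<le> K\<^sup>2 * c\<^sup>2"
    and "j \<in> {1..d} \<Longrightarrow> expectation (\<lambda>\<omega>. (ipx v t \<omega> * x t j \<omega>)\<^sup>2) \<le> K\<^sup>2 * c\<^sup>2"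
    and "j \<in> {1..d} \<Longrightarrow> (ip d v (\<lambda>i. a i j))\<^sup>2 \<le> K\<^sup>2 * c\<^sup>2"
proof -
  have c: "(l1 d v)\<^sup>2 \<le> c\<^sup>2" using assms l1_nonneg by (rule power_mono)
  have K: "K \<le> K\<^sup>2" using K_power_mono[of 1 2] by simp
  have 1: "K * (l1 d v)\<^sup>2 \<le> K\<^sup>2 * c\<^sup>2" using c K K_nonneg by (intro mult_mono) auto
  have 2: "K\<^sup>2 * (l1 d v)\<^sup>2 \<le> K\<^sup>2 * c\<^sup>2" using c by (intro mult_left_mono) auto
  show "quad_a v \<le> K\<^sup>2 * c\<^sup>2" using quad_a_le 1 by (rule order_trans)
  show "j \<in> {1..d} \<Longrightarrow> expectation (\<lambda>\<omega>. (ipx v t \<omega> * x t j \<omega>)\<^sup>2) \<le> K\<^sup>2 * c\<^sup>2"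
    using ipx_x_square_le 1 by (rule order_trans)
  show "j \<in> {1..d} \<Longrightarrow> (ip d v (\<lambda>i. a i j))\<^sup>2 \<le> K\<^sup>2 * c\<^sup>2"
    using ip_a_square_le 2 by (rule order_trans)
qed

lemma ipD_coord: "i \<in> {1..d} \<Longrightarrow> ipD (coord i) t = D t i"
  by (simp add: fun_eq_iff ipD_def ip_coord)

text \<open>The energy estimate for a coordinate functional, of l1 norm 1. Since the drift couples
  all coordinates, the induction has to propagate a bound valid for every coordinate at once; p
  collects all terms multiplying it.\<close>

lemma D_moment_power:
  defines "p \<equiv> \<eta> * d + (\<eta> * d + (\<eta> * d)\<^sup>2) * K\<^sup>2"
  assumes "i \<in> {1..d}"
  shows "square_integrable M (D t i) \<and>
    expectation (\<lambda>\<omega>. (D t i \<omega>)\<^sup>2) \<le> (1 + p) ^ t * (K + t * ((\<eta> * \<sigma>)\<^sup>2 * K\<^sup>2))"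
  using assms(2)
proof (induction t arbitrary: i)
  case 0
  then show ?case using init_square_integrable init_moment by simp
next
  case (Suc t)
  let ?q = "(\<eta> * \<sigma>)\<^sup>2 * K\<^sup>2"
  define m where "m = (1 + p) ^ t * (K + t * ?q)"
  have p0: "p \<ge> 0" unfolding p_def using drift_step_nonneg by simp
  have IH: "square_integrable M (D t j)" "expectation (\<lambda>\<omega>. (D t j \<omega>)\<^sup>2) \<le> m" if "j \<in> {1..d}" for j
    using Suc.IH[OF that] by (simp_all add: m_def)
  have l: "l1 d (coord i) \<le> 1" using l1_coord Suc.prems by simp
  note b = functional_bounds[OF l, simplified]
  note step = energy_step[where v="coord i" and t=t and m=m and \<kappa>="K\<^sup>2", OF IH b(1)]
  have "expectation (\<lambda>\<omega>. (D (Suc t) i \<omega>)\<^sup>2)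
      \<le> (1 + \<eta> * d) * expectation (\<lambda>\<omega>. (D t i \<omega>)\<^sup>2) + ((\<eta> * d + (\<eta> * d)\<^sup>2) * (K\<^sup>2 * m) + ?q)"
    using step(2) b(2,3) unfolding ipD_coord[OF Suc.prems] by simp
  also have "\<dots> \<le> (1 + \<eta> * d) * m + ((\<eta> * d + (\<eta> * d)\<^sup>2) * (K\<^sup>2 * m) + ?q)"
    using IH(2)[OF Suc.prems] drift_step_nonneg by (intro add_right_mono mult_left_mono) auto
  also have "\<dots> = (1 + p) * m + 1 * ?q" by (simp add: p_def algebra_simps)
  also have "\<dots> \<le> (1 + p) * m + (1 + p) ^ Suc t * ?q"
    using p0 by (intro add_left_mono mult_right_mono one_le_power) auto
  also have "\<dots> = (1 + p) ^ Suc t * (K + Suc t * ?q)" by (simp add: m_def algebra_simps)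
  finally show ?case
    using step(1) b(2,3) unfolding ipD_coord[OF Suc.prems] by simp
qed

lemma D_square_integrable: "i \<in> {1..d} \<Longrightarrow> square_integrable M (D t i)"
  using D_moment_power by blast

lemma steps_mult_le: "real t \<le> K * T \<Longrightarrow> real t * (c / T) \<le> K * c" if "c \<ge> 0" for c
  using mult_right_mono[of "real t" "K * T" c] that T_real_pos by (simp add: field_simps)

lemma D_moment:
  assumes "i \<in> {1..d}" "real t \<le> K * T"
  shows "expectation (\<lambda>\<omega>. (D t i \<omega>)\<^sup>2) \<le> second_moment_const K"
proof -
  let ?p = "\<eta> * d + (\<eta> * d + (\<eta> * d)\<^sup>2) * K\<^sup>2"
  have "?p \<le> K / T + (K / T + K\<^sup>2 / T) * K\<^sup>2"
    by (intro add_mono mult_right_mono drift_step_le drift_step_square_le) auto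
  also have "\<dots> = (K + (K + K\<^sup>2) * K\<^sup>2) / T" by (simp add: algebra_simps add_divide_distrib)
  also have "\<dots> \<le> (3 * K ^ 4) / T"
    using K_power_mono[of 1 4] K_power_mono[of 3 4] T_real_pos
    by (intro divide_right_mono) (simp_all add: algebra_simps power2_eq_square power4_eq_xxxx power3_eq_cube)
  finally have "real t * ?p \<le> real t * ((3 * K ^ 4) / T)" by (intro mult_left_mono) auto
  also have "\<dots> \<le> K * (3 * K ^ 4)" using K_nonneg by (intro steps_mult_le assms) auto
  finally have p: "real t * ?p \<le> 3 * K ^ 5" by (simp add: power_numeral_reduce mult_ac)
  have "real t * ((\<eta> * \<sigma>)\<^sup>2 * K\<^sup>2) \<le> real t * ((K\<^sup>2 * K\<^sup>2) / T)"
    using mult_right_mono[OF noise_step_le, of "K\<^sup>2"] by (intro mult_left_mono) auto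
  also have "\<dots> \<le> K * (K\<^sup>2 * K\<^sup>2)" using K_nonneg by (intro steps_mult_le assms) auto
  finally have q: "real t * ((\<eta> * \<sigma>)\<^sup>2 * K\<^sup>2) \<le> K ^ 5" by (simp add: power_numeral_reduce mult_ac)
  have "(1 + ?p) ^ t * (K + t * ((\<eta> * \<sigma>)\<^sup>2 * K\<^sup>2)) \<le> exp (3 * K ^ 5) * (K + K ^ 5)"
    using q drift_step_nonneg K_nonneg
    by (intro mult_mono[OF power_one_plus_le_exp[OF _ p] add_left_mono]) auto
  then show ?thesis
    using D_moment_power[OF assms(1), of t] unfolding second_moment_const_def by linarith
qed

text \<open>For v the difference of two coordinate functionals, the inputs of the energy estimate
  are second differences of \<open>A\<close> and \<open>B\<close> and the square of a Lipschitz
  difference of \<open>A\<close>, all proportional to the squared distance. The second moments,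
  already bounded, act as a source term, and Gronwall closes the estimate.\<close>

lemma D_increment:
  assumes i: "i \<in> {1..d}" and j: "j \<in> {1..d}" and t: "real t \<le> K * T"
  shows "expectation (\<lambda>\<omega>. (D t i \<omega> - D t j \<omega>)\<^sup>2) \<le> increment_const K * ((real i - real j) / d)\<^sup>2"
proof -
  define v where "v = (\<lambda>k. coord i k - coord j k)"
  define \<delta> where "\<delta> = ((real i - real j) / d)\<^sup>2"
  define C where "C = second_moment_const K"
  define \<kappa> where "\<kappa> = K\<^sup>2 * \<delta>"
  define q where "q = (\<eta> * d + (\<eta> * d)\<^sup>2) * (\<kappa> * C) + (\<eta> * \<sigma>)\<^sup>2 * \<kappa>"
  have \<delta>0: "\<delta> \<ge> 0" by (simp add: \<delta>_def)
  have \<kappa>0: "\<kappa> \<ge> 0" by (simp add: \<kappa>_def \<delta>0)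
  have q0: "q \<ge> 0" unfolding q_def using \<kappa>0 second_moment_const_nonneg drift_step_nonneg by (simp add: C_def)
  have \<delta>': "(real i / d - real j / d)\<^sup>2 = \<delta>" by (simp add: \<delta>_def diff_divide_distrib)
  have vy: "ip d v y = y i - y j" for y
    unfolding v_def ip_diff_left using i j by (simp add: ip_coord)
  have ipDv: "ipD v n \<omega> = D n i \<omega> - D n j \<omega>" for n \<omega> by (simp add: ipD_def vy)
  have K2: "K * \<delta> \<le> \<kappa>" unfolding \<kappa>_def using K_power_mono[of 1 2] \<delta>0 by (intro mult_right_mono) auto
  have \<kappa>1: "quad_a v \<le> \<kappa>"
  proof -
    have "quad_a v = ip d v (\<lambda>k. ip d v (a k))"
      by (simp add: quad_a_def ip_def sum_distrib_left mult.assoc)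
    also have "\<dots> = a i i + a j j - 2 * a i j" by (simp add: vy a_sym[OF j i])
    also have "\<dots> \<le> K * \<delta>"
      using A_incr[OF grid_point[OF i] grid_point[OF j]] by (simp add: a_def \<delta>')
    finally show ?thesis using K2 by simp
  qed
  have \<kappa>2: "expectation (\<lambda>\<omega>. (ipx v n \<omega> * x n k \<omega>)\<^sup>2) \<le> \<kappa>" if k: "k \<in> {1..d}" for n k
  proof -
    let ?g = "\<lambda>i. real i / real d"
    have "expectation (\<lambda>\<omega>. (ipx v n \<omega> * x n k \<omega>)\<^sup>2) = ip d v (\<lambda>l. ip d v (\<lambda>m. B [?g l, ?g k, ?g m, ?g k]))"
      by (simp add: ipx_x_square(2)[OF k] ip_def sum_distrib_left mult.assoc)
    also have "\<dots> = B [?g i, ?g k, ?g i, ?g k] + B [?g j, ?g k, ?g j, ?g k] - 2 * B [?g i, ?g k, ?g j, ?g k]"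
    proof -
      have "B [?g j, ?g k, ?g i, ?g k] = B [?g i, ?g k, ?g j, ?g k]"
        using i j k by (intro B_sym points4) auto
      then show ?thesis by (simp add: vy)
    qed
    also have "\<dots> \<le> K * \<delta>"
      using B_incr[OF grid_point[OF i] grid_point[OF j] grid_point[OF k]] by (simp add: \<delta>')
    finally show ?thesis using K2 by simp
  qed
  have \<kappa>3: "(ip d v (\<lambda>l. a l k))\<^sup>2 \<le> \<kappa>" if k: "k \<in> {1..d}" for k
  proof -
    have "\<bar>a i k - a j k\<bar> \<le> K * \<bar>real i / d - real j / d\<bar>"
      unfolding a_def by (intro A_lip grid_point i j k)
    then have "(a i k - a j k)\<^sup>2 \<le> (K * \<bar>real i / d - real j / d\<bar>)\<^sup>2"
      by (rule abs_le_square_iff[THEN iffD1, OF order_trans]) simp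
    then show ?thesis unfolding \<kappa>_def vy power_mult_distrib power2_abs \<delta>' .
  qed
  define m where "m n = expectation (\<lambda>\<omega>. (ipD v n \<omega>)\<^sup>2)" for n
  have step: "m (Suc n) \<le> (1 + \<eta> * d) * m n + q" if "real n \<le> K * T" for n
    unfolding m_def q_def C_def
    by (rule energy_step(2)[OF D_square_integrable D_moment \<kappa>1 \<kappa>2 \<kappa>3]) (use that in auto)
  \<comment> \<open>Past time t the sequence is set to 0: the one-step bound is available only
    within the horizon, whereas \<open>discrete_gronwall\<close> asks for it at every index.\<close>
  define m' where "m' n = (if n \<le> t then m n else 0)" for n
  have "m' (Suc n) \<le> (1 + \<eta> * d) * m' n + q" for n
  proof (cases "Suc n \<le> t")
    case True
    then have "real n \<le> K * T" using t by linarith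
    then show ?thesis using step[of n] True by (simp add: m'_def)
  next
    case False
    have "0 \<le> m n" unfolding m_def by simp
    then show ?thesis using False q0 drift_step_nonneg by (simp add: m'_def)
  qed
  from discrete_gronwall[of m', OF this drift_step_nonneg q0, of t]
  have "m t \<le> (1 + \<eta> * d) ^ t * (m 0 + t * q)" by (simp add: m'_def)
  also have "\<dots> \<le> exp (K\<^sup>2) * (K * \<delta> + (2 * K ^ 5 * C + K ^ 5) * \<delta>)"
  proof (rule mult_mono[OF _ add_mono])
    have "real t * (\<eta> * d) \<le> real t * (K / T)" using drift_step_le by (intro mult_left_mono) auto
    also have "\<dots> \<le> K * K" using K_nonneg by (intro steps_mult_le t)
    finally show "(1 + \<eta> * d) ^ t \<le> exp (K\<^sup>2)"
      using drift_step_nonneg by (intro power_one_plus_le_exp) (auto simp: power2_eq_square)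
    show "m 0 \<le> K * \<delta>"
      using init_incr[OF i j] by (simp add: m_def ipDv \<delta>_def)
    have "q \<le> (K / T + K\<^sup>2 / T) * (\<kappa> * C) + K\<^sup>2 / T * \<kappa>"
      unfolding q_def using \<kappa>0 second_moment_const_nonneg
      by (intro add_mono mult_right_mono drift_step_le drift_step_square_le noise_step_le) (auto simp: C_def)
    also have "\<dots> = ((K + K\<^sup>2) * (\<kappa> * C) + K\<^sup>2 * \<kappa>) / T" by (simp add: algebra_simps add_divide_distrib)
    finally have "real t * q \<le> real t * (((K + K\<^sup>2) * (\<kappa> * C) + K\<^sup>2 * \<kappa>) / T)" by (intro mult_left_mono) auto
    also have "\<dots> \<le> K * ((K + K\<^sup>2) * (\<kappa> * C) + K\<^sup>2 * \<kappa>)"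
      using K_nonneg \<kappa>0 second_moment_const_nonneg by (intro steps_mult_le t) (auto simp: C_def)
    also have "\<dots> \<le> K * ((K\<^sup>2 + K\<^sup>2) * (\<kappa> * C) + K\<^sup>2 * \<kappa>)"
      using K_nonneg \<kappa>0 second_moment_const_nonneg K_power_mono[of 1 2]
      by (intro mult_left_mono add_right_mono mult_right_mono) (auto simp: C_def)
    also have "\<dots> = (2 * K ^ 5 * C + K ^ 5) * \<delta>"
      by (simp add: \<kappa>_def power_numeral_reduce algebra_simps)
    finally show "real t * q \<le> (2 * K ^ 5 * C + K ^ 5) * \<delta>" .
    show "0 \<le> m 0 + real t * q" using q0 by (simp add: m_def)
  qed simp
  also have "\<dots> = increment_const K * \<delta>"
    by (simp add: increment_const_def C_def algebra_simps)
  finally show ?thesis by (simp add: m_def ipDv \<delta>_def)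
qed

end

section \<open>Duhamel expansion along the dual recursion\<close>

text \<open>Instead of the propagator acting on the error process, its transpose acts on the test functional;
  the linearised dynamics then never has to be solved.\<close>

primrec dual :: "(nat \<Rightarrow> nat \<Rightarrow> real) \<Rightarrow> nat \<Rightarrow> real \<Rightarrow> (nat \<Rightarrow> real) \<Rightarrow> nat \<Rightarrow> nat \<Rightarrow> real" where
  "dual a d \<eta> v 0 = v"
| "dual a d \<eta> v (Suc k) = (\<lambda>i. dual a d \<eta> v k i - \<eta> * ip d (dual a d \<eta> v k) (a i))"

lemma l1_dual_le:
  assumes "\<And>i j. i \<in> {1..d} \<Longrightarrow> j \<in> {1..d} \<Longrightarrow> \<bar>a i j\<bar> \<le> K" "\<eta> \<ge> 0"
  shows "l1 d (dual a d \<eta> v k) \<le> (1 + \<eta> * d * K) ^ k * l1 d v"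
proof (induction k)
  case (Suc k)
  let ?w = "dual a d \<eta> v k"
  have "l1 d (dual a d \<eta> v (Suc k)) \<le> (\<Sum>i=1..d. \<bar>?w i\<bar> + \<eta> * (l1 d ?w * K))"
    unfolding l1_def[of d "dual a d \<eta> v (Suc k)"]
  proof (rule sum_mono)
    fix i assume i: "i \<in> {1..d}"
    have "\<bar>ip d ?w (a i)\<bar> \<le> l1 d ?w * K" using assms(1)[OF i] by (intro abs_ip_le) auto
    then have "\<bar>\<eta> * ip d ?w (a i)\<bar> \<le> \<eta> * (l1 d ?w * K)"
      using assms(2) by (simp add: abs_mult mult_left_mono)
    then show "\<bar>dual a d \<eta> v (Suc k) i\<bar> \<le> \<bar>?w i\<bar> + \<eta> * (l1 d ?w * K)"
      by (simp add: abs_diff_le_iff) linarith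
  qed
  also have "\<dots> = (1 + \<eta> * d * K) * l1 d ?w"
    by (simp add: sum.distrib l1_def algebra_simps)
  also have "\<dots> \<le> (1 + \<eta> * d * K) * ((1 + \<eta> * d * K) ^ k * l1 d v)"
  proof (intro mult_left_mono Suc)
    show "0 \<le> 1 + \<eta> * d * K"
    proof (cases "d = 0")
      case False
      then have "0 \<le> K" using assms(1)[of 1 1] abs_ge_zero[of "a 1 1"] by auto
      then show ?thesis using assms(2) by simp
    qed simp
  qed
  finally show ?case by (simp add: mult.assoc)
qed simp

text \<open>The exponent K^3 multiplies three bounds: at most K T steps, \<eta> d T at most K,
  kernel at most K.\<close>

lemma l1_dual_bound:
  assumes "\<And>i j. i \<in> {1..d} \<Longrightarrow> j \<in> {1..d} \<Longrightarrow> \<bar>a i j\<bar> \<le> K" "\<eta> \<ge> 0" "K \<ge> 0"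
    and "\<eta> * d * T \<le> K" "real k \<le> K * T"
  shows "l1 d (dual a d \<eta> v k) \<le> exp (K ^ 3) * l1 d v"
proof -
  have "l1 d (dual a d \<eta> v k) \<le> (1 + \<eta> * d * K) ^ k * l1 d v"
    by (rule l1_dual_le[OF assms(1,2)])
  also have "\<dots> \<le> exp (K ^ 3) * l1 d v"
  proof (intro mult_right_mono power_one_plus_le_exp l1_nonneg)
    have "real k * (\<eta> * d * K) \<le> (K * T) * (\<eta> * d * K)" using assms by (intro mult_right_mono) auto
    also have "\<dots> = (\<eta> * d * T) * (K * K)" by (simp add: mult_ac)
    also have "\<dots> \<le> K * (K * K)" using assms by (intro mult_right_mono) auto
    finally show "real k * (\<eta> * d * K) \<le> K ^ 3" by (simp add: power3_eq_cube)
    show "0 \<le> \<eta> * d * K" using assms by simp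
  qed
  finally show ?thesis .
qed

text \<open>Symmetry of \<open>a\<close> allows one step of the averaged dynamics to act on either
  side of the pairing.\<close>

lemma ip_dual_Suc:
  assumes "\<And>i j. i \<in> {1..d} \<Longrightarrow> j \<in> {1..d} \<Longrightarrow> a i j = a j i"
  shows "ip d (dual a d \<eta> v (Suc k)) y
    = ip d (dual a d \<eta> v k) y - \<eta> * (\<Sum>j=1..d. ip d (dual a d \<eta> v k) (\<lambda>i. a i j) * y j)"
proof -
  have "ip d (dual a d \<eta> v (Suc k)) y = ip d (dual a d \<eta> v k) y - (\<Sum>j=1..d. \<eta> * ip d (dual a d \<eta> v k) (a j) * y j)"
    by (simp add: ip_def[of d _ y] left_diff_distrib sum_subtractf)
  also have "(\<Sum>j=1..d. \<eta> * ip d (dual a d \<eta> v k) (a j) * y j)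
      = \<eta> * (\<Sum>j=1..d. ip d (dual a d \<eta> v k) (\<lambda>i. a i j) * y j)"
    unfolding sum_distrib_left mult.assoc
  proof (intro sum.cong refl)
    fix j assume "j \<in> {1..d}"
    then have "ip d (dual a d \<eta> v k) (a j) = ip d (dual a d \<eta> v k) (\<lambda>i. a i j)"
      unfolding ip_def by (intro sum.cong refl) (simp add: assms)
    then show "\<eta> * (ip d (dual a d \<eta> v k) (a j) * y j) = \<eta> * (ip d (dual a d \<eta> v k) (\<lambda>i. a i j) * y j)"
      by simp
  qed
  finally show ?thesis .
qed

section \<open>Decomposition into propagated start, noise and martingale\<close>

context bounded_sgd
begin

lemma l1_dual_le_exp:
  assumes "real k \<le> K * T"
  shows "l1 d (dual a d \<eta> v k) \<le> exp (K ^ 3) * l1 d v"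
  using abs_a_le \<eta>_pos K_nonneg drift_le assms by (intro l1_dual_bound[where T="real T"]) auto

definition noise_term :: "(nat \<Rightarrow> real) \<Rightarrow> nat \<Rightarrow> 'a \<Rightarrow> real" where
  "noise_term v t \<omega> = \<eta> * (ipx v t \<omega> * \<epsilon> t \<omega>)"

text \<open>Mean minus realised value of the drift; the sign comes from the minus in front of the
  drift in the recursion. Given the past, the expectation vanishes.\<close>

definition mart_term :: "(nat \<Rightarrow> real) \<Rightarrow> nat \<Rightarrow> 'a \<Rightarrow> real" where
  "mart_term v t \<omega> = \<eta> * ((\<Sum>j=1..d. ip d v (\<lambda>i. a i j) * D t j \<omega>)
     - ipx v t \<omega> * ip d (\<lambda>j. x t j \<omega>) (\<lambda>j. D t j \<omega>))"

text \<open>The dual index t - n counts the steps still to come. Raising n by one spends one dual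
  step, and what the averaged dynamics does not reproduce is exactly one noise term and one
  martingale term. At n = t the left side is \<open>ipD v t\<close>.\<close>

lemma duhamel:
  assumes "\<omega> \<in> space M" "n \<le> t"
  shows "ipD (dual a d \<eta> v (t - n)) n \<omega> = ipD (dual a d \<eta> v t) 0 \<omega>
    + (\<Sum>k<n. noise_term (dual a d \<eta> v (t - Suc k)) k \<omega>)
    + (\<Sum>k<n. mart_term (dual a d \<eta> v (t - Suc k)) k \<omega>)"
  using assms(2)
proof (induction n)
  case (Suc n)
  let ?w = "dual a d \<eta> v (t - Suc n)"
  have eq: "t - n = Suc (t - Suc n)" using Suc.prems by simp
  have "ipD (dual a d \<eta> v (t - n)) n \<omega> = ipD ?w n \<omega> - \<eta> * (\<Sum>j=1..d. ip d ?w (\<lambda>i. a i j) * D n j \<omega>)"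
    unfolding ipD_def eq by (rule ip_dual_Suc[OF a_sym])
  moreover have "ipD ?w (Suc n) \<omega> = ipD ?w n \<omega>
      - \<eta> * (ipx ?w n \<omega> * ip d (\<lambda>j. x n j \<omega>) (\<lambda>j. D n j \<omega>)) + noise_term ?w n \<omega>"
    unfolding noise_term_def by (rule ipD_Suc[OF assms(1)])
  ultimately show ?case
    using Suc.IH Suc.prems by (simp add: mart_term_def right_diff_distrib)
qed simp

lemma mart_term_measurable_alg: "mart_term v t \<in> borel_measurable (alg (past (Suc t)))"
proof -
  have "D t j \<in> borel_measurable (alg (past (Suc t)))" if "j \<in> {1..d}" for j
    by (rule alg_measurable_mono[OF D_measurable_alg[OF that]]) (auto simp: past_Suc)
  then show ?thesis
    unfolding mart_term_def[abs_def] ip_def[of d "\<lambda>j. x t j _"]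
    by (intro borel_measurable_times borel_measurable_diff borel_measurable_sum borel_measurable_const
        ipx_measurable_alg x_measurable_alg) (auto simp: past_Suc)
qed

lemma noise_term_measurable_alg: "Data t \<in> S \<Longrightarrow> Noise t \<in> S \<Longrightarrow> noise_term v t \<in> borel_measurable (alg S)"
  unfolding noise_term_def[abs_def]
  by (intro borel_measurable_times borel_measurable_const ipx_measurable_alg \<epsilon>_measurable_alg)

lemma noise_term_square:
  "square_integrable M (noise_term v t)"
  "expectation (\<lambda>\<omega>. (noise_term v t \<omega>)\<^sup>2) = (\<eta> * \<sigma>)\<^sup>2 * quad_a v"
  using square_integrable_cmult[OF noise_square(1)[of v t], of \<eta>] noise_square(2)[of v t]
  by (simp_all add: noise_term_def[abs_def] power_mult_distrib)

lemma noise_term_orthogonal: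
  assumes "square_integrable M R" "R \<in> borel_measurable (alg (past t))"
  shows "expectation (\<lambda>\<omega>. R \<omega> * noise_term v t \<omega>) = 0"
proof -
  have "R \<in> borel_measurable (alg (insert (Data t) (past t)))"
    by (rule alg_measurable_mono[OF assms(2)]) auto
  then have "expectation (\<lambda>\<omega>. (\<eta> * (R \<omega> * ipx v t \<omega>)) * \<epsilon> t \<omega>) = 0"
    by (intro noise_expectation(2) borel_measurable_times borel_measurable_const ipx_measurable_alg
        integrable_mult_right square_integrable_mult assms ipx_square_integrable) auto
  then show ?thesis by (simp add: noise_term_def mult_ac)
qed

text \<open>Both parts have second moment at most d^2 times the same quantity, the realised part by
  independence and the mean part by Cauchy-Schwarz; with the prefactor \<eta>^2 a single term is of
  order T^(-2).\<close>

lemma mart_term_square: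
  assumes v: "l1 d v \<le> c" and t: "real t \<le> K * T"
  shows "square_integrable M (mart_term v t)"
    and "expectation (\<lambda>\<omega>. (mart_term v t \<omega>)\<^sup>2) \<le> 4 * (\<eta> * d)\<^sup>2 * (K\<^sup>2 * c\<^sup>2 * second_moment_const K)"
proof -
  define m where "m = second_moment_const K"
  define \<kappa> where "\<kappa> = K\<^sup>2 * c\<^sup>2"
  define P where "P \<omega> = (\<Sum>j=1..d. ip d v (\<lambda>i. a i j) * D t j \<omega>)" for \<omega>
  define Q where "Q \<omega> = ipx v t \<omega> * ip d (\<lambda>j. x t j \<omega>) (\<lambda>j. D t j \<omega>)" for \<omega>
  note D = D_square_integrable[of _ t] D_moment[OF _ t, folded m_def]
  note b = functional_bounds[OF v, folded \<kappa>_def]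
  have Q: "square_integrable M Q" "expectation (\<lambda>\<omega>. (Q \<omega>)\<^sup>2) \<le> (real d)\<^sup>2 * (\<kappa> * m)"
    unfolding Q_def by (rule ipx_ipD_square[OF D b(2)]; assumption)+
  have P: "square_integrable M P"
    unfolding P_def by (intro square_integrable_sum square_integrable_cmult D)
  have EP: "expectation (\<lambda>\<omega>. (P \<omega>)\<^sup>2) \<le> (real d)\<^sup>2 * (\<kappa> * m)"
  proof -
    have "expectation (\<lambda>\<omega>. (P \<omega>)\<^sup>2) \<le> expectation (\<lambda>\<omega>. real d * (\<Sum>j=1..d. (ip d v (\<lambda>i. a i j))\<^sup>2 * (D t j \<omega>)\<^sup>2))"
    proof (rule integral_mono)
      show "(P \<omega>)\<^sup>2 \<le> real d * (\<Sum>j=1..d. (ip d v (\<lambda>i. a i j))\<^sup>2 * (D t j \<omega>)\<^sup>2)" for \<omega>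
        using ip_square_le[of d "\<lambda>j. ip d v (\<lambda>i. a i j)" "\<lambda>j. D t j \<omega>"] by (simp add: P_def ip_def)
      show "integrable M (\<lambda>\<omega>. real d * (\<Sum>j=1..d. (ip d v (\<lambda>i. a i j))\<^sup>2 * (D t j \<omega>)\<^sup>2))"
        using D(1) by (intro integrable_mult_right Bochner_Integration.integrable_sum) (auto simp: square_integrable_def)
    qed (use P in \<open>simp add: square_integrable_def\<close>)
    also have "\<dots> = real d * (\<Sum>j=1..d. (ip d v (\<lambda>i. a i j))\<^sup>2 * expectation (\<lambda>\<omega>. (D t j \<omega>)\<^sup>2))"
      using D(1) by (simp add: Bochner_Integration.integral_sum square_integrable_def)
    also have "\<dots> \<le> real d * (\<Sum>j=1..d. \<kappa> * m)"
      by (intro mult_left_mono sum_mono mult_mono b(3) D(2)) (auto simp: \<kappa>_def)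
    finally show ?thesis by (simp add: power2_eq_square)
  qed
  have eq: "mart_term v t = (\<lambda>\<omega>. \<eta> * (P \<omega> - Q \<omega>))" by (simp add: fun_eq_iff mart_term_def P_def Q_def)
  show "square_integrable M (mart_term v t)"
    unfolding eq by (intro square_integrable_cmult square_integrable_diff P Q)
  have "expectation (\<lambda>\<omega>. (P \<omega> - Q \<omega>)\<^sup>2) \<le> expectation (\<lambda>\<omega>. 2 * (P \<omega>)\<^sup>2 + 2 * (Q \<omega>)\<^sup>2)"
  proof (rule integral_mono)
    show "(P \<omega> - Q \<omega>)\<^sup>2 \<le> 2 * (P \<omega>)\<^sup>2 + 2 * (Q \<omega>)\<^sup>2" for \<omega>
      using zero_le_power2[of "P \<omega> + Q \<omega>"] unfolding power2_sum power2_diff by linarith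
  qed (use P Q square_integrable_diff[OF P Q(1)] in \<open>auto simp: square_integrable_def\<close>)
  also have "\<dots> = 2 * expectation (\<lambda>\<omega>. (P \<omega>)\<^sup>2) + 2 * expectation (\<lambda>\<omega>. (Q \<omega>)\<^sup>2)"
    using P Q by (simp add: square_integrable_def)
  also have "\<dots> \<le> 4 * ((real d)\<^sup>2 * (\<kappa> * m))" using EP Q(2) by linarith
  finally have "\<eta>\<^sup>2 * expectation (\<lambda>\<omega>. (P \<omega> - Q \<omega>)\<^sup>2) \<le> \<eta>\<^sup>2 * (4 * ((real d)\<^sup>2 * (\<kappa> * m)))"
    by (intro mult_left_mono) auto
  then show "expectation (\<lambda>\<omega>. (mart_term v t \<omega>)\<^sup>2) \<le> 4 * (\<eta> * d)\<^sup>2 * (K\<^sup>2 * c\<^sup>2 * second_moment_const K)"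
    by (simp only: eq power_mult_distrib integral_mult_right_zero \<kappa>_def m_def mult_ac)
qed

text \<open>By \<open>ipx_ipD_expectation\<close> the realised drift and its mean have the same
  inner product with any square-integrable variable of the past.\<close>

lemma mart_term_orthogonal:
  assumes "square_integrable M R" "R \<in> borel_measurable (alg (past t))"
  shows "expectation (\<lambda>\<omega>. R \<omega> * mart_term v t \<omega>) = 0"
proof -
  define Q where "Q \<omega> = ipx v t \<omega> * ip d (\<lambda>j. x t j \<omega>) (\<lambda>j. D t j \<omega>)" for \<omega>
  have Q: "square_integrable M Q"
    unfolding Q_def
    by (rule ipx_ipD_square(1)[OF D_square_integrable conjunct2[OF D_moment_power]
          functional_bounds(2)[OF order_refl]])
  have i: "integrable M (\<lambda>\<omega>. R \<omega> * Q \<omega>)" "\<And>j. j \<in> {1..d} \<Longrightarrow> integrable M (\<lambda>\<omega>. R \<omega> * D t j \<omega>)"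
    by (intro square_integrable_mult assms Q D_square_integrable; assumption)+
  have s: "integrable M (\<lambda>\<omega>. \<Sum>j=1..d. ip d v (\<lambda>i. a i j) * (R \<omega> * D t j \<omega>))"
    by (intro Bochner_Integration.integrable_sum integrable_mult_right i)
  have "expectation (\<lambda>\<omega>. R \<omega> * mart_term v t \<omega>)
      = expectation (\<lambda>\<omega>. \<eta> * ((\<Sum>j=1..d. ip d v (\<lambda>i. a i j) * (R \<omega> * D t j \<omega>)) - R \<omega> * Q \<omega>))"
    by (simp add: mart_term_def Q_def algebra_simps sum_distrib_left)
  also have "\<dots> = \<eta> * ((\<Sum>j=1..d. ip d v (\<lambda>i. a i j) * expectation (\<lambda>\<omega>. R \<omega> * D t j \<omega>)) - expectation (\<lambda>\<omega>. R \<omega> * Q \<omega>))"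
    using i s by (simp add: Bochner_Integration.integral_sum del: One_nat_def)
  also have "expectation (\<lambda>\<omega>. R \<omega> * Q \<omega>) = (\<Sum>j=1..d. ip d v (\<lambda>i. a i j) * expectation (\<lambda>\<omega>. R \<omega> * D t j \<omega>))"
    unfolding Q_def by (rule ipx_ipD_expectation[OF D_square_integrable assms])
  finally show ?thesis by simp
qed

text \<open>Pythagoras for increments that are orthogonal to every square-integrable variable of the
  past; orthogonality takes the place of conditional expectations.\<close>

lemma orthogonal_sum_square:
  assumes sq: "\<And>k. k < n \<Longrightarrow> square_integrable M (Y k)"
    and m: "\<And>k. k < n \<Longrightarrow> Y k \<in> borel_measurable (alg (past (Suc k)))"
    and le: "\<And>k. k < n \<Longrightarrow> expectation (\<lambda>\<omega>. (Y k \<omega>)\<^sup>2) \<le> q"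
    and orth: "\<And>k R. k < n \<Longrightarrow> square_integrable M R \<Longrightarrow> R \<in> borel_measurable (alg (past k)) \<Longrightarrow>
      expectation (\<lambda>\<omega>. R \<omega> * Y k \<omega>) = 0"
  shows "square_integrable M (\<lambda>\<omega>. \<Sum>k<n. Y k \<omega>)" "expectation (\<lambda>\<omega>. (\<Sum>k<n. Y k \<omega>)\<^sup>2) \<le> n * q"
proof -
  show "square_integrable M (\<lambda>\<omega>. \<Sum>k<n. Y k \<omega>)" using sq by (intro square_integrable_sum) auto
  have "expectation (\<lambda>\<omega>. (\<Sum>k<j. Y k \<omega>)\<^sup>2) \<le> j * q" if "j \<le> n" for j
    using that
  proof (induction j)
    case (Suc j)
    let ?R = "\<lambda>\<omega>. \<Sum>k<j. Y k \<omega>"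
    have Rm: "?R \<in> borel_measurable (alg (past j))"
    proof (rule borel_measurable_sum)
      fix k assume "k \<in> {..<j}"
      then show "Y k \<in> borel_measurable (alg (past j))"
        using Suc.prems by (intro alg_measurable_mono[OF m]) (auto simp: past_def)
    qed
    have Rsq: "square_integrable M ?R" using sq Suc.prems by (intro square_integrable_sum) auto
    have Ysq: "square_integrable M (Y j)" using sq Suc.prems by simp
    have i: "integrable M (\<lambda>\<omega>. (?R \<omega>)\<^sup>2)" "integrable M (\<lambda>\<omega>. ?R \<omega> * Y j \<omega>)" "integrable M (\<lambda>\<omega>. (Y j \<omega>)\<^sup>2)"
      using Rsq Ysq square_integrable_mult[OF Rsq Ysq] by (auto simp: square_integrable_def)
    have "expectation (\<lambda>\<omega>. (\<Sum>k<Suc j. Y k \<omega>)\<^sup>2) = expectation (\<lambda>\<omega>. (?R \<omega>)\<^sup>2 + 2 * (?R \<omega> * Y j \<omega>) + (Y j \<omega>)\<^sup>2)"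
      by (simp add: power2_sum algebra_simps)
    also have "\<dots> = expectation (\<lambda>\<omega>. (?R \<omega>)\<^sup>2) + expectation (\<lambda>\<omega>. (Y j \<omega>)\<^sup>2)"
      using i orth[OF _ Rsq Rm] Suc.prems by simp
    also have "\<dots> \<le> j * q + q" using Suc le[of j] by (intro add_mono) auto
    finally show ?case by (simp add: algebra_simps)
  qed simp
  then show "expectation (\<lambda>\<omega>. (\<Sum>k<n. Y k \<omega>)\<^sup>2) \<le> n * q" by simp
qed

text \<open>At most K T orthogonal terms of size T^(-2) leave a second moment of order 1 / T: the
  martingale part is negligible in every regime.\<close>

lemma mart_sum_square:
  assumes v: "l1 d v \<le> c" and t: "real t \<le> K * T"
  shows "square_integrable M (\<lambda>\<omega>. \<Sum>k<t. mart_term (dual a d \<eta> v (t - Suc k)) k \<omega>)"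
    and "expectation (\<lambda>\<omega>. (\<Sum>k<t. mart_term (dual a d \<eta> v (t - Suc k)) k \<omega>)\<^sup>2)
      \<le> 4 * K ^ 5 * (exp (K ^ 3) * c)\<^sup>2 * second_moment_const K / T"
proof -
  define c' where "c' = exp (K ^ 3) * c"
  have w: "l1 d (dual a d \<eta> v (t - Suc k)) \<le> c'" for k
  proof -
    have "l1 d (dual a d \<eta> v (t - Suc k)) \<le> exp (K ^ 3) * l1 d v"
      using t by (intro l1_dual_le_exp) linarith
    also have "\<dots> \<le> c'" unfolding c'_def using v by (intro mult_left_mono) auto
    finally show ?thesis .
  qed
  have t': "real k \<le> K * T" if "k < t" for k using that t by linarith
  note * = orthogonal_sum_square[of t "\<lambda>k. mart_term (dual a d \<eta> v (t - Suc k)) k",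
      OF mart_term_square(1)[OF w t'] mart_term_measurable_alg mart_term_square(2)[OF w t'] mart_term_orthogonal]
  show "square_integrable M (\<lambda>\<omega>. \<Sum>k<t. mart_term (dual a d \<eta> v (t - Suc k)) k \<omega>)" by (rule *(1))
  have "expectation (\<lambda>\<omega>. (\<Sum>k<t. mart_term (dual a d \<eta> v (t - Suc k)) k \<omega>)\<^sup>2)
      \<le> t * (4 * (\<eta> * d)\<^sup>2 * (K\<^sup>2 * c'\<^sup>2 * second_moment_const K))" by (rule *(2))
  also have "\<dots> \<le> t * (4 * (K / T)\<^sup>2 * (K\<^sup>2 * c'\<^sup>2 * second_moment_const K))"
    using drift_step_le drift_step_nonneg second_moment_const_nonneg
    by (intro mult_left_mono mult_right_mono power_mono) auto
  also have "\<dots> = t * ((4 * K ^ 4 * c'\<^sup>2 * second_moment_const K / T) / T)"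
    by (simp add: power_numeral_reduce divide_simps)
  also have "\<dots> \<le> K * (4 * K ^ 4 * c'\<^sup>2 * second_moment_const K / T)"
    using K_nonneg second_moment_const_nonneg by (intro steps_mult_le t) auto
  also have "\<dots> = 4 * K ^ 5 * c'\<^sup>2 * second_moment_const K / T"
    by (simp add: power_numeral_reduce)
  finally show "expectation (\<lambda>\<omega>. (\<Sum>k<t. mart_term (dual a d \<eta> v (t - Suc k)) k \<omega>)\<^sup>2)
      \<le> 4 * K ^ 5 * (exp (K ^ 3) * c)\<^sup>2 * second_moment_const K / T" unfolding c'_def .
qed

text \<open>The factor \<open>(\<sigma> * \<eta> * sqrt T)\<^sup>2\<close> is kept explicit instead
  of being bounded by K^2, since it tends to 0 with low noise.\<close>

lemma noise_sum_square:
  assumes v: "l1 d v \<le> c" and t: "real t \<le> K * T"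
  shows "square_integrable M (\<lambda>\<omega>. \<Sum>k<t. noise_term (dual a d \<eta> v (t - Suc k)) k \<omega>)"
    and "expectation (\<lambda>\<omega>. (\<Sum>k<t. noise_term (dual a d \<eta> v (t - Suc k)) k \<omega>)\<^sup>2)
      \<le> K ^ 3 * (exp (K ^ 3) * c)\<^sup>2 * (\<sigma> * \<eta> * sqrt T)\<^sup>2"
proof -
  define c' where "c' = exp (K ^ 3) * c"
  have w: "l1 d (dual a d \<eta> v (t - Suc k)) \<le> c'" for k
  proof -
    have "l1 d (dual a d \<eta> v (t - Suc k)) \<le> exp (K ^ 3) * l1 d v"
      using t by (intro l1_dual_le_exp) linarith
    also have "\<dots> \<le> c'" unfolding c'_def using v by (intro mult_left_mono) auto
    finally show ?thesis .
  qed
  have le: "expectation (\<lambda>\<omega>. (noise_term (dual a d \<eta> v (t - Suc k)) k \<omega>)\<^sup>2) \<le> (\<eta> * \<sigma>)\<^sup>2 * (K\<^sup>2 * c'\<^sup>2)" for k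
    unfolding noise_term_square(2) by (intro mult_left_mono functional_bounds(1) w) auto
  note * = orthogonal_sum_square[of t "\<lambda>k. noise_term (dual a d \<eta> v (t - Suc k)) k",
      OF noise_term_square(1) noise_term_measurable_alg le noise_term_orthogonal]
  show "square_integrable M (\<lambda>\<omega>. \<Sum>k<t. noise_term (dual a d \<eta> v (t - Suc k)) k \<omega>)"
    by (rule *(1)) (auto simp: past_Suc)
  have "expectation (\<lambda>\<omega>. (\<Sum>k<t. noise_term (dual a d \<eta> v (t - Suc k)) k \<omega>)\<^sup>2)
      \<le> t * ((\<eta> * \<sigma>)\<^sup>2 * (K\<^sup>2 * c'\<^sup>2))" by (rule *(2)) (auto simp: past_Suc)
  also have "\<dots> = t * (((\<eta> * \<sigma>)\<^sup>2 * T * (K\<^sup>2 * c'\<^sup>2)) / T)" using T_pos by simp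
  also have "\<dots> \<le> K * ((\<eta> * \<sigma>)\<^sup>2 * T * (K\<^sup>2 * c'\<^sup>2))"
    by (intro steps_mult_le t) auto
  also have "\<dots> = K ^ 3 * c'\<^sup>2 * (\<sigma> * \<eta> * sqrt T)\<^sup>2"
    by (simp add: power_mult_distrib power2_eq_square power3_eq_cube)
  finally show "expectation (\<lambda>\<omega>. (\<Sum>k<t. noise_term (dual a d \<eta> v (t - Suc k)) k \<omega>)\<^sup>2)
      \<le> K ^ 3 * (exp (K ^ 3) * c)\<^sup>2 * (\<sigma> * \<eta> * sqrt T)\<^sup>2" unfolding c'_def .
qed

end

section \<open>Central limit theorem for the accumulated noise\<close>

text \<open>Third-order Taylor remainder with |y|^3 traded for even powers, as second and fourth
  moments are the ones at hand. The parameter \<delta> is chosen later to balance the two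
  terms.\<close>

lemma norm_iexp_quadratic_approx:
  assumes "\<delta> > 0"
  shows "norm (iexp y - (1 + \<i> * y - (y\<^sup>2) / 2)) \<le> \<delta> * y\<^sup>2 + y ^ 4 / \<delta>"
proof -
  have "(\<Sum>k\<le>2. (\<i> * complex_of_real y) ^ k / fact k) = 1 + \<i> * y - (y\<^sup>2) / 2"
    by (simp add: numeral_2_eq_2 power_mult_distrib)
  then have "norm (iexp y - (1 + \<i> * y - (y\<^sup>2) / 2)) \<le> \<bar>y\<bar> ^ 3 / fact 3"
    using iexp_approx1[of y 2] by (simp add: numeral_3_eq_3 numeral_2_eq_2)
  also have "\<dots> \<le> \<bar>y\<bar> ^ 3 / 1" by (intro divide_left_mono) auto
  also have "\<dots> \<le> \<delta> * y\<^sup>2 + y ^ 4 / \<delta>"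
  proof -
    have "0 \<le> (\<delta> - \<bar>y\<bar>)\<^sup>2 * y\<^sup>2 + \<delta> * \<bar>y\<bar> ^ 3" using assms by simp
    also have "\<dots> = \<delta>\<^sup>2 * y\<^sup>2 + y ^ 4 - \<delta> * \<bar>y\<bar> ^ 3"
      by (cases "y \<ge> 0") (simp_all add: power2_eq_square power3_eq_cube power4_eq_xxxx algebra_simps)
    also have "\<dots> = \<delta> * (\<delta> * y\<^sup>2 + y ^ 4 / \<delta> - \<bar>y\<bar> ^ 3)"
      using assms by (simp add: power2_eq_square algebra_simps)
    finally show ?thesis using assms by (simp add: zero_le_mult_iff)
  qed
  finally show ?thesis .
qed

lemma iexp_lipschitz: "norm (iexp y - iexp z) \<le> \<bar>y - z\<bar>"
proof -
  have "iexp y - iexp z = iexp z * (iexp (y - z) - 1)"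
    by (simp add: algebra_simps exp_diff)
  then have "norm (iexp y - iexp z) = norm (iexp (y - z) - 1)" by (simp add: norm_mult)
  also have "\<dots> \<le> \<bar>y - z\<bar>" using iexp_approx1[of "y - z" 0] by simp
  finally show ?thesis .
qed

lemma (in prob_space) integrable_iexp_rv:
  fixes Y :: "'a \<Rightarrow> real"
  assumes [measurable]: "Y \<in> borel_measurable M" shows "integrable M (\<lambda>\<omega>. iexp (Y \<omega>))"
  by (rule integrable_bounded_rv[where B=1]) auto

lemma (in prob_space) norm_charfn_le_1:
  fixes Y :: "'a \<Rightarrow> real"
  assumes [measurable]: "Y \<in> borel_measurable M" shows "norm (expectation (\<lambda>\<omega>. iexp (Y \<omega>))) \<le> 1"
  by (rule norm_expectation_le) auto

lemma exp_neg_half_approx: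
  assumes "v \<ge> (0::real)"
  shows "\<bar>exp (- v / 2) - (1 - v / 2)\<bar> \<le> v\<^sup>2"
proof -
  have 1: "1 - v / 2 \<le> exp (- v / 2)" using exp_ge_add_one_self[of "- v / 2"] by simp
  have "exp (- v / 2) = 1 / exp (v / 2)" by (simp add: exp_minus field_simps)
  also have "\<dots> \<le> 1 / (1 + v / 2)"
    using assms exp_ge_add_one_self[of "v / 2"] by (intro divide_left_mono mult_pos_pos) auto
  also have "\<dots> \<le> 1 - v / 2 + v\<^sup>2"
  proof -
    have "(1 - v / 2 + v\<^sup>2) * (1 + v / 2) = 1 + 3 / 4 * v\<^sup>2 + v ^ 3 / 2"
      by (simp add: field_simps power2_eq_square power3_eq_cube)
    then have "1 \<le> (1 - v / 2 + v\<^sup>2) * (1 + v / 2)" using assms by simp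
    then show ?thesis using assms by (simp add: divide_le_eq)
  qed
  finally show ?thesis using 1 by linarith
qed

text \<open>Second-order expansion of both the characteristic function and exp (-v/2): the linear
  term vanishes with the mean, and the quadratic ones coincide.\<close>

lemma (in prob_space) charfn_gaussian_approx:
  assumes Y: "square_integrable M Y" and 0: "expectation Y = 0" and v: "expectation (\<lambda>\<omega>. (Y \<omega>)\<^sup>2) = v"
    and 4: "integrable M (\<lambda>\<omega>. Y \<omega> ^ 4)" "expectation (\<lambda>\<omega>. Y \<omega> ^ 4) \<le> q" and "\<delta> > 0"
  shows "norm (expectation (\<lambda>\<omega>. iexp (Y \<omega>)) - exp (- v / 2)) \<le> \<delta> * v + q / \<delta> + v\<^sup>2"
proof -
  have [measurable]: "Y \<in> borel_measurable M" using Y by auto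
  have i: "integrable M Y" "integrable M (\<lambda>\<omega>. (Y \<omega>)\<^sup>2)"
    using Y square_integrable_integrable[OF Y] by (auto simp: square_integrable_def)
  have ie: "integrable M (\<lambda>\<omega>. iexp (Y \<omega>))" by (rule integrable_iexp_rv) fact
  have i2: "integrable M (\<lambda>\<omega>. (complex_of_real (Y \<omega>))\<^sup>2 / 2)"
    using i(2) integrable_of_real[of M "\<lambda>\<omega>. (Y \<omega>)\<^sup>2 / 2", where 'a=complex] by simp
  have ip: "integrable M (\<lambda>\<omega>. 1 + \<i> * Y \<omega> - ((Y \<omega>)\<^sup>2) / 2)"
    using i i2 by (intro Bochner_Integration.integrable_diff Bochner_Integration.integrable_add) auto
  have "expectation (\<lambda>\<omega>. 1 + \<i> * Y \<omega> - ((Y \<omega>)\<^sup>2) / 2) = 1 - v / 2"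
  proof -
    have "expectation (\<lambda>\<omega>. 1 + \<i> * Y \<omega> - ((Y \<omega>)\<^sup>2) / 2)
        = expectation (\<lambda>\<omega>. 1 + \<i> * Y \<omega>) - expectation (\<lambda>\<omega>. complex_of_real ((Y \<omega>)\<^sup>2 / 2))"
      using i i2 by (subst Bochner_Integration.integral_diff[symmetric]) auto
    also have "expectation (\<lambda>\<omega>. complex_of_real ((Y \<omega>)\<^sup>2 / 2)) = v / 2"
      by (subst integral_complex_of_real) (simp add: v)
    also have "expectation (\<lambda>\<omega>. 1 + \<i> * Y \<omega>) = 1 + \<i> * complex_of_real (expectation Y)"
      using i by (simp add: prob_space)
    finally show ?thesis by (simp add: 0)
  qed
  then have "norm (expectation (\<lambda>\<omega>. iexp (Y \<omega>)) - (1 - v / 2))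
      = norm (expectation (\<lambda>\<omega>. iexp (Y \<omega>) - (1 + \<i> * Y \<omega> - ((Y \<omega>)\<^sup>2) / 2)))"
    using ie ip by (subst Bochner_Integration.integral_diff) auto
  also have "\<dots> \<le> expectation (\<lambda>\<omega>. norm (iexp (Y \<omega>) - (1 + \<i> * Y \<omega> - ((Y \<omega>)\<^sup>2) / 2)))"
    by (rule integral_norm_bound)
  also have "\<dots> \<le> expectation (\<lambda>\<omega>. \<delta> * (Y \<omega>)\<^sup>2 + Y \<omega> ^ 4 / \<delta>)"
    using ie ip i 4 norm_iexp_quadratic_approx[OF \<open>\<delta> > 0\<close>] by (intro integral_mono) auto
  also have "\<dots> \<le> \<delta> * v + q / \<delta>"
    using i 4 v \<open>\<delta> > 0\<close> by (simp add: divide_right_mono)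
  finally have 1: "norm (expectation (\<lambda>\<omega>. iexp (Y \<omega>)) - (1 - v / 2)) \<le> \<delta> * v + q / \<delta>" .
  have "v \<ge> 0" unfolding v[symmetric] by simp
  then have "norm (complex_of_real (1 - v / 2) - exp (- v / 2)) \<le> v\<^sup>2"
    using exp_neg_half_approx[of v] by (simp add: abs_minus_commute del: of_real_diff of_real_exp flip: of_real_diff)
  then show ?thesis
    using 1 norm_triangle_ineq[of "expectation (\<lambda>\<omega>. iexp (Y \<omega>)) - (1 - v / 2)" "complex_of_real (1 - v / 2) - exp (- v / 2)"]
    by (simp add: algebra_simps)
qed

text \<open>First summand: the L1 norm of the discarded martingale sum, in units of T^(-1/2). Second
  summand: K T replacement errors of size 3 K^8 c'^4 T^(-3/2), where c' = exp (K^3) c bounds all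
  propagated test vectors.\<close>

definition charfn_error :: "real \<Rightarrow> real \<Rightarrow> real" where
  "charfn_error K c = 2 * K\<^sup>2 * K * (exp (K ^ 3) * c) * sqrt (K * second_moment_const K)
     + 3 * K ^ 9 * (exp (K ^ 3) * c) ^ 4"

context bounded_sgd
begin

text \<open>Read as four nested pairings, the fourfold sum is bounded by four factors of the l1
  norm, independently of d.\<close>

lemma ipx_fourth:
  shows "integrable M (\<lambda>\<omega>. ipx v t \<omega> ^ 4)" and "expectation (\<lambda>\<omega>. ipx v t \<omega> ^ 4) \<le> K * l1 d v ^ 4"
proof -
  let ?g = "\<lambda>i. real i / real d"
  let ?X = "\<lambda>i j k l \<omega>. x t i \<omega> * x t j \<omega> * x t k \<omega> * x t l \<omega>"
  have eq: "ipx v t \<omega> ^ 4 = (\<Sum>i=1..d. \<Sum>j=1..d. \<Sum>k=1..d. \<Sum>l=1..d. v i * v j * v k * v l * ?X i j k l \<omega>)" for \<omega>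
    by (simp add: ipx_def ip_def power4_eq_xxxx sum_distrib_left sum_distrib_right mult_ac)
  have int: "integrable M (\<lambda>\<omega>. v i * v j * v k * v l * ?X i j k l \<omega>)"
    if "i \<in> {1..d}" "j \<in> {1..d}" "k \<in> {1..d}" "l \<in> {1..d}" for i j k l
    using that by (intro integrable_mult_right x_moment4(1)) auto
  show "integrable M (\<lambda>\<omega>. ipx v t \<omega> ^ 4)"
    unfolding eq by (intro Bochner_Integration.integrable_sum int)
  have "expectation (\<lambda>\<omega>. ipx v t \<omega> ^ 4)
      = (\<Sum>i=1..d. \<Sum>j=1..d. \<Sum>k=1..d. \<Sum>l=1..d. expectation (\<lambda>\<omega>. v i * v j * v k * v l * ?X i j k l \<omega>))"
    unfolding eq
    by (intro Bochner_Integration.integral_sum[THEN trans] sum.cong refl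
        Bochner_Integration.integrable_sum Bochner_Integration.integral_sum int)
  also have "\<dots> = (\<Sum>i=1..d. \<Sum>j=1..d. \<Sum>k=1..d. \<Sum>l=1..d. v i * v j * v k * v l * B [?g i, ?g j, ?g k, ?g l])"
    by (intro sum.cong refl) (simp add: x_moment4(2))
  also have "\<dots> = ip d v (\<lambda>i. ip d v (\<lambda>j. ip d v (\<lambda>k. ip d v (\<lambda>l. B [?g i, ?g j, ?g k, ?g l]))))"
    by (simp add: ip_def sum_distrib_left mult.assoc)
  also have "\<dots> \<le> l1 d v * (l1 d v * (l1 d v * (l1 d v * K)))"
    by (rule order_trans[OF abs_ge_self]) (intro abs_ip_le B_bound points4, simp)
  finally show "expectation (\<lambda>\<omega>. ipx v t \<omega> ^ 4) \<le> K * l1 d v ^ 4"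
    by (simp add: power4_eq_xxxx mult_ac)
qed

text \<open>Boundedness of the noise scale makes (\<eta> \<sigma>)^4 of order T^(-2), as the
  Gaussian replacement requires.\<close>

lemma noise_term_fourth:
  assumes v: "l1 d v \<le> c"
  shows "integrable M (\<lambda>\<omega>. noise_term v t \<omega> ^ 4)"
    and "expectation (\<lambda>\<omega>. noise_term v t \<omega> ^ 4) \<le> K ^ 6 * c ^ 4 / T / T"
proof -
  have d: "{Data t} \<inter> {Noise t} = {}" by auto
  have m: "(\<lambda>\<omega>. ipx v t \<omega> ^ 4) \<in> borel_measurable (alg {Data t})" "(\<lambda>\<omega>. \<epsilon> t \<omega> ^ 4) \<in> borel_measurable (alg {Noise t})"
    by (auto intro!: borel_measurable_power ipx_measurable_alg \<epsilon>_measurable_alg)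
  note * = alg_expectation_mult[OF d m(1) ipx_fourth(1) m(2) \<epsilon>_moments(3)]
  have eq: "noise_term v t \<omega> ^ 4 = \<eta> ^ 4 * (ipx v t \<omega> ^ 4 * \<epsilon> t \<omega> ^ 4)" for \<omega>
    by (simp add: noise_term_def power_mult_distrib)
  show "integrable M (\<lambda>\<omega>. noise_term v t \<omega> ^ 4)" unfolding eq using *(1) by simp
  have "(\<eta> * \<sigma>) ^ 4 \<le> (K\<^sup>2 / T)\<^sup>2"
    using power_mono[OF noise_step_le, of 2] by (simp flip: power_mult)
  have "expectation (\<lambda>\<omega>. noise_term v t \<omega> ^ 4) = \<eta> ^ 4 * (expectation (\<lambda>\<omega>. ipx v t \<omega> ^ 4) * (C1 * \<sigma> ^ 4))"
    unfolding eq using *(2) by (simp add: \<epsilon>_moments)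
  also have "\<dots> \<le> \<eta> ^ 4 * ((K * l1 d v ^ 4) * (K * \<sigma> ^ 4))"
    using C1_le C1_pos K_nonneg l1_nonneg by (intro mult_left_mono mult_mono ipx_fourth mult_right_mono) auto
  also have "\<dots> = (\<eta> * \<sigma>) ^ 4 * (K\<^sup>2 * l1 d v ^ 4)" by (simp add: power_mult_distrib power2_eq_square)
  also have "\<dots> \<le> (K\<^sup>2 / T)\<^sup>2 * (K\<^sup>2 * c ^ 4)"
    using \<open>(\<eta> * \<sigma>) ^ 4 \<le> (K\<^sup>2 / T)\<^sup>2\<close> v l1_nonneg by (intro mult_mono mult_left_mono power_mono) auto
  also have "\<dots> = K ^ 6 * c ^ 4 / T / T" by (simp add: power_divide power_numeral_reduce)
  finally show "expectation (\<lambda>\<omega>. noise_term v t \<omega> ^ 4) \<le> K ^ 6 * c ^ 4 / T / T" .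
qed

text \<open>With \<delta> = T^(-1/2), a variance of order 1 / T and a fourth moment of order T^(-2)
  give errors T^(-3/2), T^(-3/2) and T^(-2); hence the factor 3, and a total of order T^(-1/2) over
  order T steps.\<close>

lemma noise_term_charfn:
  assumes v: "l1 d v \<le> c" and c: "1 \<le> c"
  shows "norm (expectation (\<lambda>\<omega>. iexp (noise_term v t \<omega>)) - exp (- ((\<eta> * \<sigma>)\<^sup>2 * quad_a v) / 2))
    \<le> 3 * K ^ 8 * c ^ 4 / (T * sqrt T)"
proof -
  let ?v = "(\<eta> * \<sigma>)\<^sup>2 * quad_a v"
  let ?\<delta> = "1 / sqrt T"
  have e0: "expectation (noise_term v t) = 0"
  proof -
    have "expectation (\<lambda>\<omega>. 1 * noise_term v t \<omega>) = 0"
      by (rule noise_term_orthogonal) (auto simp: square_integrable_def)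
    then show ?thesis by simp
  qed
  have vle: "?v \<le> K ^ 4 * c\<^sup>2 / T"
  proof -
    have "?v \<le> (K\<^sup>2 / T) * (K\<^sup>2 * c\<^sup>2)"
      by (intro mult_mono noise_step_le functional_bounds(1)[OF v] quad_a_nonneg) auto
    then show ?thesis by (simp add: power_numeral_reduce mult_ac)
  qed
  have v0: "0 \<le> ?v" using quad_a_nonneg by simp
  have c24: "c\<^sup>2 \<le> c ^ 4" using c by (intro power_increasing) auto
  have sT: "sqrt T > 0" "sqrt T * sqrt T = T" using T_pos by auto
  have "norm (expectation (\<lambda>\<omega>. iexp (noise_term v t \<omega>)) - exp (- ?v / 2))
      \<le> ?\<delta> * ?v + (K ^ 6 * c ^ 4 / T / T) / ?\<delta> + ?v\<^sup>2"
    using sT by (intro charfn_gaussian_approx noise_term_square noise_term_fourth v e0) auto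
  also have "\<dots> \<le> K ^ 8 * c ^ 4 / (T * sqrt T) + K ^ 8 * c ^ 4 / (T * sqrt T) + K ^ 8 * c ^ 4 / (T * sqrt T)"
  proof (intro add_mono)
    have "?\<delta> * ?v \<le> ?\<delta> * (K ^ 4 * c\<^sup>2 / T)" by (intro mult_left_mono vle) auto
    also have "\<dots> = (K ^ 4 * c\<^sup>2) / (T * sqrt T)" by (simp add: mult.commute)
    also have "\<dots> \<le> (K ^ 8 * c ^ 4) / (T * sqrt T)"
      by (intro divide_right_mono mult_mono K_power_mono c24) (use K_nonneg sT in auto)
    finally show "?\<delta> * ?v \<le> K ^ 8 * c ^ 4 / (T * sqrt T)" .
    have "(K ^ 6 * c ^ 4 / T / T) / ?\<delta> = (K ^ 6 * c ^ 4) / (T * sqrt T)"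
      using sT by (simp add: field_simps)
    also have "\<dots> \<le> (K ^ 8 * c ^ 4) / (T * sqrt T)"
      by (intro divide_right_mono mult_right_mono K_power_mono) (use c sT in auto)
    finally show "(K ^ 6 * c ^ 4 / T / T) / ?\<delta> \<le> K ^ 8 * c ^ 4 / (T * sqrt T)" .
    have "?v\<^sup>2 \<le> (K ^ 4 * c\<^sup>2 / T)\<^sup>2" using vle v0 by (rule power_mono)
    also have "\<dots> = (K ^ 8 * c ^ 4) / (T * T)"
      by (simp add: power_divide power_mult_distrib power_numeral_reduce)
    also have "\<dots> \<le> (K ^ 8 * c ^ 4) / (T * sqrt T)"
    proof (rule divide_left_mono)
      have "sqrt T \<le> T" using T_pos sT by (intro real_le_lsqrt) (auto simp: self_le_power)
      then show "T * sqrt T \<le> real (T * T)" by (simp add: mult_left_mono)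
    qed (use K_nonneg sT c in auto)
    finally show "?v\<^sup>2 \<le> K ^ 8 * c ^ 4 / (T * sqrt T)" by simp
  qed
  also have "\<dots> = 3 * K ^ 8 * c ^ 4 / (T * sqrt T)" by (simp add: mult_ac)
  finally show ?thesis .
qed

text \<open>Replacement of one noise term after another by its Gaussian factor. Each term is
  independent of the start and of all earlier terms, so expectations factor, and since every factor
  has modulus at most 1 the errors simply add up. The law of the initial part remains
  untouched.\<close>

lemma noise_sum_charfn:
  assumes w: "\<And>k. k < n \<Longrightarrow> l1 d (u k) \<le> c" and c: "1 \<le> c"
  shows "norm (expectation (\<lambda>\<omega>. iexp (ipD v 0 \<omega> + (\<Sum>k<n. noise_term (u k) k \<omega>)))
      - expectation (\<lambda>\<omega>. iexp (ipD v 0 \<omega>)) * exp (- ((\<eta> * \<sigma>)\<^sup>2 * (\<Sum>k<n. quad_a (u k))) / 2))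
    \<le> n * (3 * K ^ 8 * c ^ 4 / (T * sqrt T))"
  using w
proof (induction n)
  case (Suc n)
  let ?e = "3 * K ^ 8 * c ^ 4 / (T * sqrt T)"
  let ?\<Phi> = "expectation (\<lambda>\<omega>. iexp (ipD v 0 \<omega>))"
  define R where "R \<omega> = ipD v 0 \<omega> + (\<Sum>k<n. noise_term (u k) k \<omega>)" for \<omega>
  define g where "g = exp (- ((\<eta> * \<sigma>)\<^sup>2 * (\<Sum>k<n. quad_a (u k))) / 2)"
  define h where "h = exp (- ((\<eta> * \<sigma>)\<^sup>2 * quad_a (u n)) / 2)"
  define N where "N = expectation (\<lambda>\<omega>. iexp (noise_term (u n) n \<omega>))"
  have Rm: "R \<in> borel_measurable (alg (past n))"
    unfolding R_def
    by (intro borel_measurable_add borel_measurable_sum noise_term_measurable_alg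
        alg_measurable_mono[OF ipD_measurable_alg]) (auto simp: past_def)
  have Nm: "noise_term (u n) n \<in> borel_measurable (alg {Data n, Noise n})"
    by (rule noise_term_measurable_alg) auto
  have ec: "(\<lambda>y. iexp y) \<in> borel_measurable borel" by measurable
  have disj: "past n \<inter> {Data n, Noise n} = {}" using past_disjoint by auto
  have fac: "expectation (\<lambda>\<omega>. iexp (R \<omega>) * iexp (noise_term (u n) n \<omega>))
      = expectation (\<lambda>\<omega>. iexp (R \<omega>)) * N"
    unfolding N_def
    by (rule alg_expectation_mult(2)[OF disj measurable_compose[OF Rm ec] _ measurable_compose[OF Nm ec]])
       (intro integrable_iexp_rv alg_measurable[OF Rm] alg_measurable[OF Nm])+
  have IH: "norm (expectation (\<lambda>\<omega>. iexp (R \<omega>)) - ?\<Phi> * g) \<le> n * ?e"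
    unfolding R_def g_def by (rule Suc.IH) (use Suc.prems in auto)
  have N1: "norm N \<le> 1" unfolding N_def by (rule norm_charfn_le_1[OF alg_measurable[OF Nm]])
  have \<Phi>1: "norm ?\<Phi> \<le> 1"
    by (rule norm_charfn_le_1[OF alg_measurable[OF ipD_measurable_alg]])
  have g1: "norm (complex_of_real g) \<le> 1" unfolding g_def using quad_a_nonneg by (simp add: sum_nonneg)
  have Nh: "norm (N - h) \<le> ?e"
    unfolding N_def h_def using noise_term_charfn[OF Suc.prems[of n] c] by simp
  have "exp (- ((\<eta> * \<sigma>)\<^sup>2 * (\<Sum>k<Suc n. quad_a (u k))) / 2) = g * h"
    unfolding g_def h_def exp_add[symmetric] by (simp add: field_simps)
  then have "expectation (\<lambda>\<omega>. iexp (ipD v 0 \<omega> + (\<Sum>k<Suc n. noise_term (u k) k \<omega>)))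
      - ?\<Phi> * exp (- ((\<eta> * \<sigma>)\<^sup>2 * (\<Sum>k<Suc n. quad_a (u k))) / 2)
      = (expectation (\<lambda>\<omega>. iexp (R \<omega>)) - ?\<Phi> * g) * N + ?\<Phi> * g * (N - h)"
    using fac by (simp add: R_def exp_add algebra_simps)
  then have "norm (expectation (\<lambda>\<omega>. iexp (ipD v 0 \<omega> + (\<Sum>k<Suc n. noise_term (u k) k \<omega>)))
      - ?\<Phi> * exp (- ((\<eta> * \<sigma>)\<^sup>2 * (\<Sum>k<Suc n. quad_a (u k))) / 2))
      = norm ((expectation (\<lambda>\<omega>. iexp (R \<omega>)) - ?\<Phi> * g) * N + ?\<Phi> * g * (N - h))"
    by (rule arg_cong)
  also have "\<dots> \<le> norm ((expectation (\<lambda>\<omega>. iexp (R \<omega>)) - ?\<Phi> * g) * N) + norm (?\<Phi> * g * (N - h))"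
    by (rule norm_triangle_ineq)
  also have "\<dots> \<le> (n * ?e) * 1 + 1 * ?e"
  proof (intro add_mono)
    show "norm ((expectation (\<lambda>\<omega>. iexp (R \<omega>)) - ?\<Phi> * g) * N) \<le> (n * ?e) * 1"
      unfolding norm_mult by (intro mult_mono IH N1) (use order_trans[OF norm_ge_zero IH] in auto)
    have "norm (?\<Phi> * g) \<le> 1 * 1" unfolding norm_mult by (intro mult_mono \<Phi>1 g1) auto
    then show "norm (?\<Phi> * g * (N - h)) \<le> 1 * ?e"
      unfolding norm_mult[of "?\<Phi> * g"] using Nh by (intro mult_mono) auto
  qed
  also have "\<dots> = real (Suc n) * ?e"
    by (simp only: of_nat_Suc distrib_right mult_1 mult_1_right add.commute)
  finally show ?case .
qed simp

text \<open>The martingale sum is dropped at the cost of its L1 norm, because \<open>iexp\<close> is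
  1-Lipschitz; to the rest the Gaussian replacement applies.\<close>

lemma ipD_charfn:
  assumes v: "l1 d v \<le> c" and c: "1 \<le> c" and t: "real t \<le> K * T"
  shows "norm (expectation (\<lambda>\<omega>. iexp (ipD v t \<omega>))
      - expectation (\<lambda>\<omega>. iexp (ipD (dual a d \<eta> v t) 0 \<omega>))
        * exp (- ((\<eta> * \<sigma>)\<^sup>2 * (\<Sum>k<t. quad_a (dual a d \<eta> v k))) / 2))
    \<le> charfn_error K c / sqrt T"
proof -
  define c' where "c' = exp (K ^ 3) * c"
  define m where "m = second_moment_const K"
  let ?w = "dual a d \<eta> v"
  let ?R = "\<lambda>\<omega>. \<Sum>k<t. mart_term (?w (t - Suc k)) k \<omega>"
  let ?S = "\<lambda>\<omega>. ipD (?w t) 0 \<omega> + (\<Sum>k<t. noise_term (?w (t - Suc k)) k \<omega>)"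
  have c'1: "1 \<le> c'"
    unfolding c'_def using c K_nonneg mult_mono[of 1 "exp (K ^ 3)" 1 c] by simp
  have w: "l1 d (?w (t - Suc k)) \<le> c'" for k
  proof -
    have "l1 d (?w (t - Suc k)) \<le> exp (K ^ 3) * l1 d v"
      using t by (intro l1_dual_le_exp) linarith
    also have "\<dots> \<le> c'" unfolding c'_def using v by (intro mult_left_mono) auto
    finally show ?thesis .
  qed
  have Sm: "?S \<in> borel_measurable M"
    by (intro borel_measurable_add borel_measurable_sum alg_measurable[OF ipD_measurable_alg]
        noise_term_square(1)[THEN square_integrable_measurable])
  have Dm: "ipD v t \<in> borel_measurable M" by (rule alg_measurable[OF ipD_measurable_alg])
  define b where "b = 2 * K\<^sup>2 * K * c' * sqrt (K * m) / sqrt T"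
  have b0: "b \<ge> 0" unfolding b_def m_def using K_nonneg c'1 second_moment_const_nonneg by simp
  have R: "square_integrable M ?R" "expectation (\<lambda>\<omega>. (?R \<omega>)\<^sup>2) \<le> b\<^sup>2"
  proof -
    show "square_integrable M ?R" by (rule mart_sum_square(1)[OF v t])
    have "expectation (\<lambda>\<omega>. (?R \<omega>)\<^sup>2) \<le> 4 * K ^ 5 * c'\<^sup>2 * m / T"
      unfolding c'_def m_def by (rule mart_sum_square(2)[OF v t])
    \<comment> \<open>K^5 is enlarged to K^7 so that the bound becomes exactly b^2.\<close>
    also have "\<dots> \<le> 4 * K ^ 7 * c'\<^sup>2 * m / T"
      using second_moment_const_nonneg
      by (intro divide_right_mono mult_right_mono mult_left_mono K_power_mono) (auto simp: m_def)
    also have "\<dots> = b\<^sup>2"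
      using K_nonneg second_moment_const_nonneg
      by (simp add: b_def m_def power_divide power_mult_distrib power_numeral_reduce)
    finally show "expectation (\<lambda>\<omega>. (?R \<omega>)\<^sup>2) \<le> b\<^sup>2" .
  qed
  have "norm (expectation (\<lambda>\<omega>. iexp (ipD v t \<omega>)) - expectation (\<lambda>\<omega>. iexp (?S \<omega>)))
      = norm (expectation (\<lambda>\<omega>. iexp (ipD v t \<omega>) - iexp (?S \<omega>)))"
    using integrable_iexp_rv[OF Dm] integrable_iexp_rv[OF Sm]
    by (subst Bochner_Integration.integral_diff) auto
  also have "\<dots> \<le> expectation (\<lambda>\<omega>. norm (iexp (ipD v t \<omega>) - iexp (?S \<omega>)))" by (rule integral_norm_bound)
  also have "\<dots> \<le> expectation (\<lambda>\<omega>. \<bar>?R \<omega>\<bar>)"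
  proof (rule integral_mono)
    fix \<omega> assume "\<omega> \<in> space M"
    then have "ipD v t \<omega> - ?S \<omega> = ?R \<omega>" using duhamel[of \<omega> t t v] by simp
    then show "norm (iexp (ipD v t \<omega>) - iexp (?S \<omega>)) \<le> \<bar>?R \<omega>\<bar>"
      using iexp_lipschitz[of "ipD v t \<omega>" "?S \<omega>"] by (simp only:)
  next
    show "integrable M (\<lambda>\<omega>. norm (iexp (ipD v t \<omega>) - iexp (?S \<omega>)))"
      using integrable_iexp_rv[OF Dm] integrable_iexp_rv[OF Sm]
      by (intro integrable_norm Bochner_Integration.integrable_diff) auto
    show "integrable M (\<lambda>\<omega>. \<bar>?R \<omega>\<bar>)" using square_integrable_integrable[OF R(1)] by simp
  qed
  also have "\<dots> \<le> b" by (rule expectation_abs_le_sqrt[OF R b0])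
  finally have 1: "norm (expectation (\<lambda>\<omega>. iexp (ipD v t \<omega>)) - expectation (\<lambda>\<omega>. iexp (?S \<omega>))) \<le> b" .
  \<comment> \<open>Steps still to come and steps already done run through the same indices in
    opposite order.\<close>
  have "(\<Sum>k<t. quad_a (?w (t - Suc k))) = (\<Sum>k<t. quad_a (?w k))"
    by (rule sum.nat_diff_reindex)
  then have "norm (expectation (\<lambda>\<omega>. iexp (?S \<omega>))
      - expectation (\<lambda>\<omega>. iexp (ipD (?w t) 0 \<omega>)) * exp (- ((\<eta> * \<sigma>)\<^sup>2 * (\<Sum>k<t. quad_a (?w k))) / 2))
    \<le> t * (3 * K ^ 8 * c' ^ 4 / (T * sqrt T))"
    using noise_sum_charfn[of t "\<lambda>k. ?w (t - Suc k)" c' "?w t", OF w c'1] by simp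
  also have "\<dots> = t * ((3 * K ^ 8 * c' ^ 4 / sqrt T) / T)" by (simp add: mult.commute)
  also have "\<dots> \<le> K * (3 * K ^ 8 * c' ^ 4 / sqrt T)"
    using K_nonneg c'1 by (intro steps_mult_le t) auto
  also have "\<dots> = 3 * K ^ 9 * c' ^ 4 / sqrt T" by (simp add: power_numeral_reduce)
  finally have 2: "norm (expectation (\<lambda>\<omega>. iexp (?S \<omega>))
      - expectation (\<lambda>\<omega>. iexp (ipD (?w t) 0 \<omega>)) * exp (- ((\<eta> * \<sigma>)\<^sup>2 * (\<Sum>k<t. quad_a (?w k))) / 2))
    \<le> 3 * K ^ 9 * c' ^ 4 / sqrt T" .
  have "b + 3 * K ^ 9 * c' ^ 4 / sqrt T = charfn_error K c / sqrt T"
    by (simp add: b_def c'_def m_def charfn_error_def add_divide_distrib mult_ac)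
  then show ?thesis using norm_triangle_le[OF add_mono[OF 1 2]] by simp
qed

end

section \<open>Random continuous functions\<close>

text \<open>\<open>cfunspace\<close> demands bounded images, which compactness of the unit interval
  makes automatic.\<close>

lemma mspace_C01: "mspace C01 = {f. f \<in> extensional {0..1} \<and> continuous_on {0..1} f}"
  unfolding C01_def by (subst compactin_mspace_cfunspace) (auto simp: compactin_subtopology)

lemma mdist_C01_ge:
  assumes "f \<in> mspace C01" "g \<in> mspace C01" "x \<in> {0..1}"
  shows "\<bar>f x - g x\<bar> \<le> mdist C01 f g"
  using mdist_cfunspace_imp_mdist_le[OF assms(1,2)[unfolded C01_def] order_refl, of x] assms(3)
  by (simp add: C01_def dist_real_def)

lemma mdist_C01_le:
  assumes "0 \<le> B" "\<And>x. x \<in> {0..1} \<Longrightarrow> \<bar>f x - g x\<bar> \<le> B"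
  shows "mdist C01 f g \<le> B"
  unfolding C01_def by (rule mdist_cfunspace_le) (use assms in \<open>auto simp: dist_real_def\<close>)

lemma continuous_map_real_lipschitz:
  fixes F :: "'a \<Rightarrow> real"
  assumes "\<And>f g. f \<in> mspace m \<Longrightarrow> g \<in> mspace m \<Longrightarrow> \<bar>F f - F g\<bar> \<le> mdist m f g"
  shows "continuous_map (mtopology_of m) euclideanreal F"
proof -
  have "Lipschitz_continuous_map m euclidean_metric F"
    unfolding Lipschitz_continuous_map_def
    by (intro conjI exI[of _ 1]) (auto simp: dist_real_def assms)
  from Lipschitz_continuous_imp_continuous_map[OF this] show ?thesis by simp
qed

lemma continuous_map_C01_eval:
  "x \<in> {0..1} \<Longrightarrow> continuous_map (mtopology_of C01) euclideanreal (\<lambda>f. f x)"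
  by (rule continuous_map_real_lipschitz) (rule mdist_C01_ge)

lemma random_element_measurable:
  assumes X: "random_element M m X" and F: "continuous_map (mtopology_of m) euclideanreal F"
  shows "(\<lambda>\<omega>. F (X \<omega>)) \<in> borel_measurable M"
proof (rule borel_measurableI)
  fix U :: "real set" assume "open U"
  then have "openin (mtopology_of m) {f \<in> mspace m. F f \<in> U}"
    using openin_continuous_map_preimage[OF F, of U] by simp
  then have "X -` {f \<in> mspace m. F f \<in> U} \<inter> space M \<in> sets M"
    using X unfolding random_element_def by blast
  moreover have "X -` {f \<in> mspace m. F f \<in> U} \<inter> space M = (\<lambda>\<omega>. F (X \<omega>)) -` U \<inter> space M"
    using X unfolding random_element_def by auto
  ultimately show "(\<lambda>\<omega>. F (X \<omega>)) -` U \<inter> space M \<in> sets M" by simp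
qed

lemma C01_eval_measurable:
  "random_element M C01 X \<Longrightarrow> x \<in> {0..1} \<Longrightarrow> (\<lambda>\<omega>. X \<omega> x) \<in> borel_measurable M"
  by (rule random_element_measurable[OF _ continuous_map_C01_eval])

lemma path_space_mem:
  assumes f: "f \<in> mspace (path_space \<tau>)" and s: "s \<in> {0..\<tau>}"
  shows "f s \<in> mspace C01"
  using f s unfolding path_space_def mspace_cfunspace by auto

lemma mdist_path_space_ge:
  assumes "f \<in> mspace (path_space \<tau>)" "g \<in> mspace (path_space \<tau>)" "s \<in> {0..\<tau>}" "x \<in> {0..1}"
  shows "\<bar>f s x - g s x\<bar> \<le> mdist (path_space \<tau>) f g"
proof -
  have "\<bar>f s x - g s x\<bar> \<le> mdist C01 (f s) (g s)"
    using assms by (intro mdist_C01_ge path_space_mem)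
  also have "\<dots> \<le> mdist (path_space \<tau>) f g"
    using mdist_cfunspace_imp_mdist_le[OF assms(1,2)[unfolded path_space_def] order_refl, of s] assms(3)
    by (simp add: path_space_def)
  finally show ?thesis .
qed

lemma path_eval_measurable:
  assumes "random_element M (path_space \<tau>) X" "s \<in> {0..\<tau>}" "x \<in> {0..1}"
  shows "(\<lambda>\<omega>. X \<omega> s x) \<in> borel_measurable M"
  by (rule random_element_measurable[OF assms(1) continuous_map_real_lipschitz])
     (rule mdist_path_space_ge[OF _ _ assms(2,3)])

text \<open>The values of a path are compared in the supremum metric over space, so the time modulus
  \<delta> does not depend on x.\<close>

lemma path_space_continuous_in_time:
  assumes f: "f \<in> mspace (path_space \<tau>)" and s: "s \<in> {0..\<tau>}" and "e > 0"
  obtains \<delta> where "\<delta> > 0" "\<And>u x. u \<in> {0..\<tau>} \<Longrightarrow> \<bar>u - s\<bar> < \<delta> \<Longrightarrow> x \<in> {0..1} \<Longrightarrow> \<bar>f u x - f s x\<bar> < e"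
proof -
  have "continuous_map (top_of_set {0..\<tau>}) (mtopology_of C01) f"
    using f unfolding path_space_def mspace_cfunspace by auto
  moreover have "openin (mtopology_of C01) (Metric_space.mball (mspace C01) (mdist C01) (f s) e)"
    unfolding mtopology_of_def by (rule Metric_space.openin_mball) (rule Metric_space_mspace_mdist)
  ultimately have "openin (top_of_set {0..\<tau>}) {u \<in> {0..\<tau>}. f u \<in> Metric_space.mball (mspace C01) (mdist C01) (f s) e}"
    using openin_continuous_map_preimage by fastforce
  moreover have "s \<in> {u \<in> {0..\<tau>}. f u \<in> Metric_space.mball (mspace C01) (mdist C01) (f s) e}"
    using s path_space_mem[OF f s] \<open>e > 0\<close>
    by (simp add: Metric_space.in_mball[OF Metric_space_mspace_mdist] Metric_space.mdist_zero[OF Metric_space_mspace_mdist])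
  ultimately obtain \<delta> where \<delta>: "\<delta> > 0"
    "\<And>u. u \<in> {0..\<tau>} \<Longrightarrow> dist u s < \<delta> \<Longrightarrow> f u \<in> Metric_space.mball (mspace C01) (mdist C01) (f s) e"
    unfolding openin_euclidean_subtopology_iff by blast
  have "\<bar>f u x - f s x\<bar> < e" if "u \<in> {0..\<tau>}" "\<bar>u - s\<bar> < \<delta>" "x \<in> {0..1}" for u x
  proof -
    have "mdist C01 (f s) (f u) < e"
      using \<delta>(2)[OF that(1)] that(2)
      by (simp add: dist_real_def Metric_space.in_mball[OF Metric_space_mspace_mdist])
    then show ?thesis
      using mdist_C01_ge[OF path_space_mem[OF f s] path_space_mem[OF f that(1)] that(3)] by (simp add: abs_minus_commute)
  qed
  with \<delta>(1) show thesis using that by blast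
qed

lemma path_space_jointly_continuous:
  assumes f: "f \<in> mspace (path_space \<tau>)"
  shows "continuous_on ({0..\<tau>} \<times> {0..1}) (\<lambda>p. f (fst p) (snd p))"
  unfolding continuous_on_iff
proof (intro ballI allI impI)
  fix p :: "real \<times> real" and e :: real assume p: "p \<in> {0..\<tau>} \<times> {0..1}" and e: "e > 0"
  obtain s x where sx: "p = (s, x)" "s \<in> {0..\<tau>}" "x \<in> {0..1}" using p by auto
  obtain \<delta>1 where \<delta>1: "\<delta>1 > 0" "\<And>u y. u \<in> {0..\<tau>} \<Longrightarrow> \<bar>u - s\<bar> < \<delta>1 \<Longrightarrow> y \<in> {0..1} \<Longrightarrow> \<bar>f u y - f s y\<bar> < e / 2"
    using path_space_continuous_in_time[OF f sx(2), of "e / 2"] e by auto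
  have "continuous_on {0..1} (f s)" using path_space_mem[OF f sx(2)] by (simp add: mspace_C01)
  then obtain \<delta>2 where \<delta>2: "\<delta>2 > 0" "\<And>y. y \<in> {0..1} \<Longrightarrow> \<bar>y - x\<bar> < \<delta>2 \<Longrightarrow> \<bar>f s y - f s x\<bar> < e / 2"
    unfolding continuous_on_iff dist_real_def using sx(3) e half_gt_zero by metis
  have "dist (f (fst q) (snd q)) (f (fst p) (snd p)) < e"
    if q: "q \<in> {0..\<tau>} \<times> {0..1}" "dist q p < min \<delta>1 \<delta>2" for q
  proof -
    obtain u y where uy: "q = (u, y)" "u \<in> {0..\<tau>}" "y \<in> {0..1}" using q(1) by auto
    have "\<bar>u - s\<bar> < \<delta>1" "\<bar>y - x\<bar> < \<delta>2"
      using q(2) dist_fst_le[of q p] dist_snd_le[of q p] by (auto simp: uy sx dist_real_def)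
    from \<delta>1(2)[OF uy(2) this(1) uy(3)] \<delta>2(2)[OF uy(3) this(2)]
    have "\<bar>f u y - f s x\<bar> < e" by linarith
    then show ?thesis by (simp add: uy sx dist_real_def)
  qed
  then show "\<exists>\<delta>>0. \<forall>q\<in>{0..\<tau>} \<times> {0..1}. dist q p < \<delta> \<longrightarrow> dist (f (fst q) (snd q)) (f (fst p) (snd p)) < e"
    using \<delta>1(1) \<delta>2(1) by (intro exI[of _ "min \<delta>1 \<delta>2"]) auto
qed

text \<open>Evaluation at finitely many points is continuous for the supremum metric. Weak
  convergence is formulated with real test functions, hence the passage through cosine and
  sine.\<close>

lemma weak_conv_C01_charfn:
  assumes wc: "weak_conv_metric C01 M X N Y" and M: "prob_space M" and N: "prob_space N"
    and X: "\<And>k x. x \<in> {0..1} \<Longrightarrow> (\<lambda>\<omega>. X k \<omega> x) \<in> borel_measurable M"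
    and Y: "\<And>x. x \<in> {0..1} \<Longrightarrow> (\<lambda>\<omega>. Y \<omega> x) \<in> borel_measurable N"
    and p: "finite J" "\<And>j. j \<in> J \<Longrightarrow> p j \<in> {0..1}"
  shows "(\<lambda>k. \<integral>\<omega>. iexp (\<Sum>j\<in>J. c j * X k \<omega> (p j)) \<partial>M) \<longlonglongrightarrow> (\<integral>\<omega>. iexp (\<Sum>j\<in>J. c j * Y \<omega> (p j)) \<partial>N)"
proof -
  interpret M: prob_space M by fact
  interpret N: prob_space N by fact
  let ?S = "\<lambda>f. \<Sum>j\<in>J. c j * f (p j)"
  have cS: "continuous_map (mtopology_of C01) euclideanreal ?S"
    by (intro continuous_map_sum continuous_map_real_mult continuous_map_C01_eval p) auto
  have conv: "(\<lambda>k. \<integral>\<omega>. h (?S (X k \<omega>)) \<partial>M) \<longlonglongrightarrow> (\<integral>\<omega>. h (?S (Y \<omega>)) \<partial>N)"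
    if h: "continuous_on UNIV h" "\<And>y. \<bar>h y\<bar> \<le> 1" for h :: "real \<Rightarrow> real"
  proof -
    have 1: "continuous_map (mtopology_of C01) euclideanreal (h \<circ> ?S)"
      by (rule continuous_map_compose[OF cS]) (use h(1) in simp)
    have 2: "bounded ((h \<circ> ?S) ` mspace C01)"
      unfolding bounded_iff by (intro exI[of _ 1]) (auto simp: h(2))
    show ?thesis
      using wc[unfolded weak_conv_metric_def, rule_format, OF conjI[OF 1 2]] unfolding comp_def .
  qed
  have split: "(\<integral>\<omega>. iexp (Z \<omega>) \<partial>Q) = complex_of_real (\<integral>\<omega>. cos (Z \<omega>) \<partial>Q) + \<i> * complex_of_real (\<integral>\<omega>. sin (Z \<omega>) \<partial>Q)"
    if "prob_space Q" and [measurable]: "Z \<in> borel_measurable Q" for Q :: "'q measure" and Z :: "'q \<Rightarrow> real"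
  proof -
    interpret Q: prob_space Q by fact
    have i: "integrable Q (\<lambda>\<omega>. cos (Z \<omega>))" "integrable Q (\<lambda>\<omega>. sin (Z \<omega>))"
      by (auto intro!: Q.integrable_bounded_rv[where B=1])
    have "(\<integral>\<omega>. iexp (Z \<omega>) \<partial>Q)
        = (\<integral>\<omega>. complex_of_real (cos (Z \<omega>)) + \<i> * complex_of_real (sin (Z \<omega>)) \<partial>Q)"
      by (intro Bochner_Integration.integral_cong refl) (simp only: exp_Euler cos_of_real sin_of_real)
    also have "\<dots> = (\<integral>\<omega>. complex_of_real (cos (Z \<omega>)) \<partial>Q) + \<i> * (\<integral>\<omega>. complex_of_real (sin (Z \<omega>)) \<partial>Q)"
      using integrable_of_real[OF i(1), where 'a=complex] integrable_of_real[OF i(2), where 'a=complex] by simp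
    finally show ?thesis by (simp only: integral_complex_of_real)
  qed
  have SX: "(\<lambda>\<omega>. ?S (X k \<omega>)) \<in> borel_measurable M" for k
    by (intro borel_measurable_sum borel_measurable_times borel_measurable_const X p)
  have SY: "(\<lambda>\<omega>. ?S (Y \<omega>)) \<in> borel_measurable N"
    by (intro borel_measurable_sum borel_measurable_times borel_measurable_const Y p)
  show ?thesis
    unfolding split[OF M SX] split[OF N SY]
    by (intro tendsto_add tendsto_mult tendsto_const tendsto_of_real conv continuous_intros)
       (simp_all add: abs_cos_le_one abs_sin_le_one)
qed

text \<open>Truncations are bounded, so bounds on their expectations survive weak limits; monotone
  convergence then yields integrability of Z itself.\<close>

lemma (in prob_space) integrable_truncation_bound:
  fixes Z :: "'a \<Rightarrow> real"
  assumes [measurable]: "Z \<in> borel_measurable M" and le: "\<And>n::nat. expectation (\<lambda>\<omega>. min \<bar>Z \<omega>\<bar> (real n)) \<le> c"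
  shows "integrable M Z" "expectation (\<lambda>\<omega>. \<bar>Z \<omega>\<bar>) \<le> c"
proof -
  have c0: "0 \<le> c" using le[of 0] by simp
  have "(\<integral>\<^sup>+\<omega>. ennreal \<bar>Z \<omega>\<bar> \<partial>M) = (\<integral>\<^sup>+\<omega>. (SUP n::nat. ennreal (min \<bar>Z \<omega>\<bar> (real n))) \<partial>M)"
  proof (intro nn_integral_cong antisym)
    fix \<omega>
    obtain n :: nat where "\<bar>Z \<omega>\<bar> \<le> real n" using real_arch_simple by blast
    then show "ennreal \<bar>Z \<omega>\<bar> \<le> (SUP n::nat. ennreal (min \<bar>Z \<omega>\<bar> (real n)))"
      by (intro SUP_upper2[of n]) auto
    show "(SUP n::nat. ennreal (min \<bar>Z \<omega>\<bar> (real n))) \<le> ennreal \<bar>Z \<omega>\<bar>"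
      by (intro SUP_least ennreal_leI) auto
  qed
  also have "\<dots> = (SUP n::nat. \<integral>\<^sup>+\<omega>. ennreal (min \<bar>Z \<omega>\<bar> (real n)) \<partial>M)"
    by (rule nn_integral_monotone_convergence_SUP)
       (auto simp: incseq_def le_fun_def intro!: ennreal_leI)
  also have "\<dots> \<le> ennreal c"
  proof (rule SUP_least)
    fix n :: nat
    have "integrable M (\<lambda>\<omega>. min \<bar>Z \<omega>\<bar> (real n))"
      by (rule integrable_bounded_rv[where B="real n"]) auto
    then show "(\<integral>\<^sup>+\<omega>. ennreal (min \<bar>Z \<omega>\<bar> (real n)) \<partial>M) \<le> ennreal c"
      by (subst nn_integral_eq_integral) (auto intro!: ennreal_leI le)
  qed
  finally have nn: "(\<integral>\<^sup>+\<omega>. ennreal \<bar>Z \<omega>\<bar> \<partial>M) \<le> ennreal c" .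
  then show i: "integrable M Z"
    by (intro integrableI_bounded) (auto simp: top.extremum_strict order.strict_trans1)
  then have "(\<integral>\<^sup>+\<omega>. ennreal \<bar>Z \<omega>\<bar> \<partial>M) = ennreal (expectation (\<lambda>\<omega>. \<bar>Z \<omega>\<bar>))"
    by (intro nn_integral_eq_integral) auto
  then show "expectation (\<lambda>\<omega>. \<bar>Z \<omega>\<bar>) \<le> c" using nn c0 by simp
qed

text \<open>Fatou's lemma for weak convergence: \<open>F\<close> is continuous but possibly
  unbounded, so the limit inherits the bound, and with it integrability, through truncation.\<close>

lemma weak_conv_C01_moment:
  assumes wc: "weak_conv_metric C01 M X N Y" and M: "prob_space M" and N: "prob_space N"
    and X: "\<And>k. (\<lambda>\<omega>. F (X k \<omega>)) \<in> borel_measurable M" and Y: "(\<lambda>\<omega>. F (Y \<omega>)) \<in> borel_measurable N"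
    and F: "continuous_map (mtopology_of C01) euclideanreal F"
    and int: "\<And>k. integrable M (\<lambda>\<omega>. F (X k \<omega>))"
    and le: "\<And>k. (\<integral>\<omega>. \<bar>F (X k \<omega>)\<bar> \<partial>M) \<le> b k" and b: "b \<longlonglongrightarrow> c"
  shows "integrable N (\<lambda>\<omega>. F (Y \<omega>))" "(\<integral>\<omega>. \<bar>F (Y \<omega>)\<bar> \<partial>N) \<le> c"
proof -
  interpret M: prob_space M by fact
  interpret N: prob_space N by fact
  have "(\<integral>\<omega>. min \<bar>F (Y \<omega>)\<bar> (real n) \<partial>N) \<le> c" for n :: nat
  proof (rule LIMSEQ_le[OF _ b])
    have 1: "continuous_map (mtopology_of C01) euclideanreal ((\<lambda>y. min \<bar>y\<bar> (real n)) \<circ> F)"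
      by (rule continuous_map_compose[OF F]) (auto intro!: continuous_intros)
    have 2: "bounded (((\<lambda>y. min \<bar>y\<bar> (real n)) \<circ> F) ` mspace C01)"
      unfolding bounded_iff by (intro exI[of _ "real n"]) auto
    show "(\<lambda>k. \<integral>\<omega>. min \<bar>F (X k \<omega>)\<bar> (real n) \<partial>M) \<longlonglongrightarrow> (\<integral>\<omega>. min \<bar>F (Y \<omega>)\<bar> (real n) \<partial>N)"
      using wc[unfolded weak_conv_metric_def, rule_format, OF conjI[OF 1 2]] unfolding comp_def .
    have "(\<integral>\<omega>. min \<bar>F (X k \<omega>)\<bar> (real n) \<partial>M) \<le> b k" for k
    proof -
      have "(\<integral>\<omega>. min \<bar>F (X k \<omega>)\<bar> (real n) \<partial>M) \<le> (\<integral>\<omega>. \<bar>F (X k \<omega>)\<bar> \<partial>M)"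
      proof (rule integral_mono)
        show "integrable M (\<lambda>\<omega>. min \<bar>F (X k \<omega>)\<bar> (real n))"
          using X[of k] by (intro M.integrable_bounded_rv[where B="real n"]) auto
      qed (use int[of k] in auto)
      then show ?thesis using le[of k] by simp
    qed
    then show "\<exists>K. \<forall>k\<ge>K. (\<integral>\<omega>. min \<bar>F (X k \<omega>)\<bar> (real n) \<partial>M) \<le> b k" by blast
  qed
  from N.integrable_truncation_bound[OF Y this]
  show "integrable N (\<lambda>\<omega>. F (Y \<omega>))" "(\<integral>\<omega>. \<bar>F (Y \<omega>)\<bar> \<partial>N) \<le> c" .
qed

section \<open>Convergence of characteristic functions of varying linear functionals\<close>

definition coarse :: "nat \<Rightarrow> real \<Rightarrow> nat" where
  "coarse m x = nat \<lfloor>m * x\<rfloor>"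

lemma coarse_bounds:
  assumes "x \<in> {0..1}" "m > 0"
  shows "coarse m x \<le> m" "\<bar>x - coarse m x / m\<bar> \<le> 1 / m"
proof -
  have mx: "0 \<le> real m * x" "real m * x \<le> m" using assms by (auto simp: mult_left_le)
  then have c: "real (coarse m x) = of_int \<lfloor>m * x\<rfloor>" by (simp add: coarse_def)
  have "real (coarse m x) \<le> m" using mx(2) unfolding c by linarith
  then show "coarse m x \<le> m" by simp
  have "\<bar>m * x - real (coarse m x)\<bar> \<le> 1" unfolding c by linarith
  moreover have "x - coarse m x / m = (m * x - coarse m x) / m" using assms by (simp add: field_simps)
  ultimately show "\<bar>x - coarse m x / m\<bar> \<le> 1 / m" using assms by (simp add: divide_right_mono)
qed

text \<open>All weights whose grid point lies in one cell of mesh 1 / m are merged. A functional on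
  d coordinates thereby becomes one on m + 1 fixed points, with m independent of d.\<close>

definition aggregate :: "nat \<Rightarrow> nat \<Rightarrow> (nat \<Rightarrow> real) \<Rightarrow> nat \<Rightarrow> real" where
  "aggregate m d w j = (\<Sum>i | i \<in> {1..d} \<and> coarse m (real i / real d) = j. w i)"

lemma sum_aggregate:
  assumes "d > 0" "m > 0"
  shows "(\<Sum>j\<le>m. aggregate m d w j * y j) = (\<Sum>i=1..d. w i * y (coarse m (i / d)))"
proof -
  have "(\<Sum>j\<le>m. aggregate m d w j * y j)
      = (\<Sum>j\<le>m. \<Sum>i | i \<in> {1..d} \<and> coarse m (real i / real d) = j. w i * y (coarse m (i / d)))"
    unfolding aggregate_def sum_distrib_right by (intro sum.cong refl) auto
  also have "\<dots> = (\<Sum>i\<in>{1..d}. w i * y (coarse m (i / d)))"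
    by (rule sum.group) (use assms coarse_bounds in auto)
  finally show ?thesis .
qed

lemma abs_aggregate_le: "\<bar>aggregate m d w j\<bar> \<le> l1 d w"
proof -
  have "\<bar>aggregate m d w j\<bar> \<le> (\<Sum>i | i \<in> {1..d} \<and> coarse m (real i / real d) = j. \<bar>w i\<bar>)"
    unfolding aggregate_def by (rule sum_abs)
  also have "\<dots> \<le> l1 d w" unfolding l1_def by (rule sum_mono2) auto
  finally show ?thesis .
qed

definition round_to :: "real \<Rightarrow> real \<Rightarrow> real" where
  "round_to \<delta> b = \<delta> * of_int \<lfloor>b / \<delta>\<rfloor>"

lemma round_to_error: "\<delta> > 0 \<Longrightarrow> \<bar>b - round_to \<delta> b\<bar> \<le> \<delta>"
proof -
  assume \<delta>: "\<delta> > 0"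
  have "b - round_to \<delta> b = \<delta> * (b / \<delta> - of_int \<lfloor>b / \<delta>\<rfloor>)"
    using \<delta> by (simp add: round_to_def right_diff_distrib)
  moreover have "\<bar>b / \<delta> - of_int \<lfloor>b / \<delta>\<rfloor>\<bar> \<le> 1" by linarith
  ultimately show ?thesis using \<delta> by (simp add: abs_mult)
qed

text \<open>The rounded coefficients lie in a finite set that depends on the bound c and the mesh
  \<delta>, not on the dimension.\<close>

lemma round_to_range:
  assumes "\<delta> > 0" "\<bar>b\<bar> \<le> c"
  shows "round_to \<delta> b \<in> (\<lambda>k. \<delta> * of_int k) ` {\<lfloor>- c / \<delta>\<rfloor>..\<lfloor>c / \<delta>\<rfloor>}"
proof -
  have "- c / \<delta> \<le> b / \<delta>" "b / \<delta> \<le> c / \<delta>" using assms by (intro divide_right_mono; simp)+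
  then have "\<lfloor>b / \<delta>\<rfloor> \<in> {\<lfloor>- c / \<delta>\<rfloor>..\<lfloor>c / \<delta>\<rfloor>}" by (auto intro: floor_mono)
  then show ?thesis unfolding round_to_def by blast
qed

lemma (in prob_space) charfn_diff_le:
  fixes Y Z :: "'a \<Rightarrow> real"
  assumes Y: "Y \<in> borel_measurable M" and Z: "Z \<in> borel_measurable M"
    and i: "integrable M (\<lambda>\<omega>. Y \<omega> - Z \<omega>)" and le: "expectation (\<lambda>\<omega>. \<bar>Y \<omega> - Z \<omega>\<bar>) \<le> e"
  shows "norm (expectation (\<lambda>\<omega>. iexp (Y \<omega>)) - expectation (\<lambda>\<omega>. iexp (Z \<omega>))) \<le> e"
proof -
  have "norm (expectation (\<lambda>\<omega>. iexp (Y \<omega>)) - expectation (\<lambda>\<omega>. iexp (Z \<omega>)))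
      = norm (expectation (\<lambda>\<omega>. iexp (Y \<omega>) - iexp (Z \<omega>)))"
    by (simp add: integrable_iexp_rv Y Z)
  also have "\<dots> \<le> expectation (\<lambda>\<omega>. norm (iexp (Y \<omega>) - iexp (Z \<omega>)))" by (rule integral_norm_bound)
  also have "\<dots> \<le> expectation (\<lambda>\<omega>. \<bar>Y \<omega> - Z \<omega>\<bar>)"
    by (intro integral_mono integrable_norm Bochner_Integration.integrable_diff integrable_iexp_rv
        Y Z iexp_lipschitz integrable_abs i)
  finally show ?thesis using le by linarith
qed

text \<open>Two errors: moving every point to the left end of its coarse cell, weighted by the l1
  norm of w, and rounding m + 1 coefficients by at most \<delta> each. The term \<rho> allows for
  processes that are Lipschitz in mean only down to the grid scale; it will be 1 / d for the
  interpolated error and 0 for its limit.\<close>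

lemma (in prob_space) charfn_coarse_approx:
  fixes Z :: "'a \<Rightarrow> real \<Rightarrow> real"
  assumes int: "\<And>x. x \<in> {0..1} \<Longrightarrow> integrable M (\<lambda>\<omega>. Z \<omega> x)"
    and m1: "\<And>x. x \<in> {0..1} \<Longrightarrow> expectation (\<lambda>\<omega>. \<bar>Z \<omega> x\<bar>) \<le> C"
    and m2: "\<And>x y. x \<in> {0..1} \<Longrightarrow> y \<in> {0..1} \<Longrightarrow> expectation (\<lambda>\<omega>. \<bar>Z \<omega> x - Z \<omega> y\<bar>) \<le> C * (\<bar>x - y\<bar> + \<rho>)"
    and w: "l1 d w \<le> c" and d: "d > 0" and m: "m > 0" and \<delta>: "\<delta> > 0" and C: "C \<ge> 0" and \<rho>: "\<rho> \<ge> 0"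
  shows "norm (expectation (\<lambda>\<omega>. iexp (ip d w (\<lambda>i. Z \<omega> (i / d))))
      - expectation (\<lambda>\<omega>. iexp (\<Sum>j\<le>m. round_to \<delta> (aggregate m d w j) * Z \<omega> (j / m))))
    \<le> c * (C * (1 / m + \<rho>)) + real (m + 1) * (\<delta> * C)"
proof -
  let ?b = "\<lambda>j. aggregate m d w j"
  let ?b' = "\<lambda>j. round_to \<delta> (?b j)"
  let ?r = "\<lambda>i. real (coarse m (real i / d)) / m"
  have g: "real i / d \<in> {0..1}" if "i \<in> {1..d}" for i using that by auto
  have r: "?r i \<in> {0..1}" if "i \<in> {1..d}" for i
    using coarse_bounds(1)[OF g[OF that] m] m by auto
  have jm: "real j / m \<in> {0..1}" if "j \<le> m" for j using that m by auto
  have iY: "integrable M (\<lambda>\<omega>. ip d w (\<lambda>i. Z \<omega> (i / d)))"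
    unfolding ip_def using g by (intro Bochner_Integration.integrable_sum integrable_mult_right int) auto
  have iZ: "integrable M (\<lambda>\<omega>. \<Sum>j\<le>m. ?b' j * Z \<omega> (j / m))"
    using jm by (intro Bochner_Integration.integrable_sum integrable_mult_right int) auto
  have pw: "\<bar>ip d w (\<lambda>i. Z \<omega> (i / d)) - (\<Sum>j\<le>m. ?b' j * Z \<omega> (j / m))\<bar>
      \<le> (\<Sum>i=1..d. \<bar>w i\<bar> * \<bar>Z \<omega> (i / d) - Z \<omega> (?r i)\<bar>) + (\<Sum>j\<le>m. \<delta> * \<bar>Z \<omega> (j / m)\<bar>)" for \<omega>
  proof -
    have eq: "ip d w (\<lambda>i. Z \<omega> (i / d)) - (\<Sum>j\<le>m. ?b' j * Z \<omega> (j / m))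
        = (\<Sum>i=1..d. w i * (Z \<omega> (i / d) - Z \<omega> (?r i))) + (\<Sum>j\<le>m. (?b j - ?b' j) * Z \<omega> (j / m))"
      using sum_aggregate[OF d m, of w "\<lambda>j. Z \<omega> (j / m)"]
      by (simp add: ip_def right_diff_distrib left_diff_distrib sum_subtractf)
    have "\<bar>ip d w (\<lambda>i. Z \<omega> (i / d)) - (\<Sum>j\<le>m. ?b' j * Z \<omega> (j / m))\<bar> \<le> \<bar>\<Sum>i=1..d. w i * (Z \<omega> (i / d) - Z \<omega> (?r i))\<bar> + \<bar>\<Sum>j\<le>m. (?b j - ?b' j) * Z \<omega> (j / m)\<bar>"
      unfolding eq by (rule abs_triangle_ineq)
    also have "\<dots> \<le> (\<Sum>i=1..d. \<bar>w i * (Z \<omega> (i / d) - Z \<omega> (?r i))\<bar>) + (\<Sum>j\<le>m. \<bar>(?b j - ?b' j) * Z \<omega> (j / m)\<bar>)"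
      by (intro add_mono sum_abs)
    also have "\<dots> \<le> (\<Sum>i=1..d. \<bar>w i\<bar> * \<bar>Z \<omega> (i / d) - Z \<omega> (?r i)\<bar>) + (\<Sum>j\<le>m. \<delta> * \<bar>Z \<omega> (j / m)\<bar>)"
      using round_to_error[OF \<delta>] by (intro add_mono sum_mono) (auto simp: abs_mult intro!: mult_right_mono)
    finally show ?thesis .
  qed
  have i1: "integrable M (\<lambda>\<omega>. \<bar>w i\<bar> * \<bar>Z \<omega> (i / d) - Z \<omega> (?r i)\<bar>)" if "i \<in> {1..d}" for i
    using g[OF that] r[OF that] by (intro integrable_mult_right integrable_abs Bochner_Integration.integrable_diff int)
  have i2: "integrable M (\<lambda>\<omega>. \<delta> * \<bar>Z \<omega> (j / m)\<bar>)" if "j \<le> m" for j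
    using jm[OF that] by (intro integrable_mult_right integrable_abs int)
  have "expectation (\<lambda>\<omega>. \<bar>ip d w (\<lambda>i. Z \<omega> (i / d)) - (\<Sum>j\<le>m. ?b' j * Z \<omega> (j / m))\<bar>)
      \<le> expectation (\<lambda>\<omega>. (\<Sum>i=1..d. \<bar>w i\<bar> * \<bar>Z \<omega> (i / d) - Z \<omega> (?r i)\<bar>) + (\<Sum>j\<le>m. \<delta> * \<bar>Z \<omega> (j / m)\<bar>))"
    by (rule integral_mono[OF integrable_abs[OF Bochner_Integration.integrable_diff[OF iY iZ]] _ pw])
      (intro Bochner_Integration.integrable_add Bochner_Integration.integrable_sum i1 i2, auto)
  also have "\<dots> = (\<Sum>i=1..d. \<bar>w i\<bar> * expectation (\<lambda>\<omega>. \<bar>Z \<omega> (i / d) - Z \<omega> (?r i)\<bar>)) + (\<Sum>j\<le>m. \<delta> * expectation (\<lambda>\<omega>. \<bar>Z \<omega> (j / m)\<bar>))"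
    using i1 i2 by (subst Bochner_Integration.integral_add)
      (auto intro!: Bochner_Integration.integrable_sum simp: Bochner_Integration.integral_sum)
  also have "\<dots> \<le> (\<Sum>i=1..d. \<bar>w i\<bar> * (C * (1 / m + \<rho>))) + (\<Sum>j\<le>m. \<delta> * C)"
  proof (intro add_mono sum_mono mult_left_mono)
    fix i assume i: "i \<in> {1..d}"
    have "expectation (\<lambda>\<omega>. \<bar>Z \<omega> (i / d) - Z \<omega> (?r i)\<bar>) \<le> C * (\<bar>i / d - ?r i\<bar> + \<rho>)"
      by (rule m2[OF g[OF i] r[OF i]])
    also have "\<dots> \<le> C * (1 / m + \<rho>)"
      using coarse_bounds(2)[OF g[OF i] m] C by (intro mult_left_mono) auto
    finally show "expectation (\<lambda>\<omega>. \<bar>Z \<omega> (i / d) - Z \<omega> (?r i)\<bar>) \<le> C * (1 / m + \<rho>)" .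
  qed (use m1 jm \<delta> in auto)
  also have "\<dots> = l1 d w * (C * (1 / m + \<rho>)) + real (m + 1) * (\<delta> * C)"
    by (simp add: l1_def sum_distrib_right add.commute)
  also have "\<dots> \<le> c * (C * (1 / m + \<rho>)) + real (m + 1) * (\<delta> * C)"
    using C \<rho> w by (intro add_right_mono mult_right_mono) auto
  finally show ?thesis
    by (rule charfn_diff_le[OF borel_measurable_integrable[OF iY] borel_measurable_integrable[OF iZ]
          Bochner_Integration.integrable_diff[OF iY iZ]])
qed

text \<open>The test vectors \<open>w k\<close> vary with k in growing dimension, so weak
  convergence cannot be applied to them one by one. After coarsening and rounding only finitely many
  functionals remain, and over those the convergence is uniform. The limit inherits its moment
  bounds from the sequence.\<close>

lemma charfn_varying_functional_conv:
  assumes wc: "weak_conv_metric C01 M X N Y" and M: "prob_space M" and N: "prob_space N"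
    and Y: "\<And>x. x \<in> {0..1} \<Longrightarrow> (\<lambda>\<omega>. Y \<omega> x) \<in> borel_measurable N"
    and int: "\<And>k x. x \<in> {0..1} \<Longrightarrow> integrable M (\<lambda>\<omega>. X k \<omega> x)"
    and m1: "\<And>k x. x \<in> {0..1} \<Longrightarrow> (\<integral>\<omega>. \<bar>X k \<omega> x\<bar> \<partial>M) \<le> C"
    and m2: "\<And>k x y. x \<in> {0..1} \<Longrightarrow> y \<in> {0..1} \<Longrightarrow> (\<integral>\<omega>. \<bar>X k \<omega> x - X k \<omega> y\<bar> \<partial>M) \<le> C * (\<bar>x - y\<bar> + 1 / d k)"
    and d: "filterlim d at_top sequentially" and dpos: "\<And>k. d k > 0"
    and w: "\<And>k. l1 (d k) (w k) \<le> c"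
  shows "(\<lambda>k. (\<integral>\<omega>. iexp (ip (d k) (w k) (\<lambda>i. X k \<omega> (i / d k))) \<partial>M)
     - (\<integral>\<omega>. iexp (ip (d k) (w k) (\<lambda>i. Y \<omega> (i / d k))) \<partial>N)) \<longlonglongrightarrow> 0"
proof (rule LIMSEQ_I)
  fix e :: real assume e: "e > 0"
  interpret M: prob_space M by fact
  interpret N: prob_space N by fact
  have X: "(\<lambda>\<omega>. X k \<omega> x) \<in> borel_measurable M" if "x \<in> {0..1}" for k x
    using int[OF that] by (rule borel_measurable_integrable)
  have C0: "C \<ge> 0" using order_trans[OF _ m1[of 0 0], of 0] by simp
  have dlim: "(\<lambda>k. 1 / real (d k)) \<longlonglongrightarrow> 0"
    by (rule tendsto_divide_0[OF tendsto_const filterlim_at_top_imp_at_infinity[OF filterlim_compose[OF filterlim_real_sequentially d]]])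
  have Y1: "integrable N (\<lambda>\<omega>. Y \<omega> x)" "(\<integral>\<omega>. \<bar>Y \<omega> x\<bar> \<partial>N) \<le> C" if x: "x \<in> {0..1}" for x
    by (rule weak_conv_C01_moment[OF wc M N X[OF x] Y[OF x] continuous_map_C01_eval[OF x] int[OF x] m1[OF x] tendsto_const])+
  have Y2: "(\<integral>\<omega>. \<bar>Y \<omega> x - Y \<omega> y\<bar> \<partial>N) \<le> C * (\<bar>x - y\<bar> + 0)" if x: "x \<in> {0..1}" and y: "y \<in> {0..1}" for x y
  proof (rule weak_conv_C01_moment(2)[OF wc M N, where F="\<lambda>f. f x - f y"])
    show "(\<lambda>k. C * (\<bar>x - y\<bar> + 1 / real (d k))) \<longlonglongrightarrow> C * (\<bar>x - y\<bar> + 0)"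
      by (intro tendsto_intros dlim)
  qed (intro continuous_map_diff continuous_map_C01_eval borel_measurable_diff X Y
      Bochner_Integration.integrable_diff int m2 x y)+
  \<comment> \<open>Budget: 3 E for the sequence, E for the finite net and 2 E for the limit, less
    than 8 E = e.\<close>
  define E where "E = e / 8"
  have E: "E > 0" using e by (simp add: E_def)
  obtain m :: nat where m: "m > 0" "c * C / m < E"
  proof -
    obtain m :: nat where "c * C / E < real m" using reals_Archimedean2 by blast
    then have "c * C / E < real (Suc m)" by simp
    then have "c * C / real (Suc m) < E" using E by (simp add: field_simps del: of_nat_Suc)
    then show thesis using that[of "Suc m"] by simp
  qed
  \<comment> \<open>Chosen after m, because m + 1 rounding errors accumulate; C + 1 avoids division
    by 0.\<close>
  define \<delta> where "\<delta> = E / (real (m + 1) * (C + 1))"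
  have \<delta>: "\<delta> > 0" using E C0 by (simp add: \<delta>_def)
  have \<delta>C: "real (m + 1) * (\<delta> * C) \<le> E"
  proof -
    have "real (m + 1) * (\<delta> * C) \<le> real (m + 1) * (\<delta> * (C + 1))" using \<delta> by (intro mult_left_mono) auto
    also have "\<dots> = (real (m + 1) * (C + 1)) * \<delta>" by (simp add: mult_ac)
    also have "\<dots> = E"
    proof -
      have cancel: "y * (E / y) = E" if "y \<noteq> 0" for y using that by simp
      show ?thesis unfolding \<delta>_def by (rule cancel) (use C0 in auto)
    qed
    finally show ?thesis .
  qed
  let ?b = "\<lambda>k j. round_to \<delta> (aggregate m (d k) (w k) j)"
  let ?net = "PiE {..m} (\<lambda>_. (\<lambda>i. \<delta> * of_int i) ` {\<lfloor>- c / \<delta>\<rfloor>..\<lfloor>c / \<delta>\<rfloor>})"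
  let ?\<phi>X = "\<lambda>k b. \<integral>\<omega>. iexp (\<Sum>j\<le>m. b j * X k \<omega> (j / m)) \<partial>M"
  let ?\<phi>Y = "\<lambda>b. \<integral>\<omega>. iexp (\<Sum>j\<le>m. b j * Y \<omega> (j / m)) \<partial>N"
  have jm: "real j / m \<in> {0..1}" if "j \<le> m" for j using that m by auto
  have "finite ?net" by (intro finite_PiE) auto
  moreover have "\<forall>\<^sub>F k in sequentially. norm (?\<phi>X k b - ?\<phi>Y b) < E" for b
  proof -
    have "(\<lambda>k. ?\<phi>X k b) \<longlonglongrightarrow> ?\<phi>Y b"
      using jm by (intro weak_conv_C01_charfn[OF wc M N X Y]) auto
    from tendstoD[OF this E] show ?thesis by (simp only: dist_norm)
  qed
  ultimately have ev1: "\<forall>\<^sub>F k in sequentially. \<forall>b\<in>?net. norm (?\<phi>X k b - ?\<phi>Y b) < E"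
    by (intro eventually_ball_finite) auto
  have ev2: "\<forall>\<^sub>F k in sequentially. c * C * (1 / d k) < E"
  proof -
    have "(\<lambda>k. c * C * (1 / real (d k))) \<longlonglongrightarrow> c * C * 0" by (intro tendsto_intros dlim)
    then show ?thesis using E by (intro order_tendstoD(2)) auto
  qed
  have "\<forall>\<^sub>F k in sequentially. norm ((\<integral>\<omega>. iexp (ip (d k) (w k) (\<lambda>i. X k \<omega> (i / d k))) \<partial>M)
     - (\<integral>\<omega>. iexp (ip (d k) (w k) (\<lambda>i. Y \<omega> (i / d k))) \<partial>N) - 0) < e"
    using ev1 ev2
  proof eventually_elim
    case (elim k)
    \<comment> \<open>Restricted to the index set, since members of \<open>PiE\<close> must take the
      default value outside it.\<close>
    let ?r = "\<lambda>j\<in>{..m}. ?b k j"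
    have net: "?r \<in> ?net"
      using round_to_range[OF \<delta> order_trans[OF abs_aggregate_le w]] by (auto simp del: image_eqI)
    have rs: "(\<Sum>j\<le>m. ?r j * y j) = (\<Sum>j\<le>m. ?b k j * y j)" for y :: "nat \<Rightarrow> real" by (intro sum.cong) auto
    have aX: "norm ((\<integral>\<omega>. iexp (ip (d k) (w k) (\<lambda>i. X k \<omega> (i / d k))) \<partial>M) - ?\<phi>X k (?b k))
        \<le> c * (C * (1 / m + 1 / d k)) + real (m + 1) * (\<delta> * C)"
      by (rule M.charfn_coarse_approx[OF int m1 m2 w dpos m(1) \<delta> C0]) auto
    have aY: "norm ((\<integral>\<omega>. iexp (ip (d k) (w k) (\<lambda>i. Y \<omega> (i / d k))) \<partial>N) - ?\<phi>Y (?b k))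
        \<le> c * (C * (1 / m + 0)) + real (m + 1) * (\<delta> * C)"
      by (rule N.charfn_coarse_approx[OF Y1 Y2 w dpos m(1) \<delta> C0]) auto
    have mid: "norm (?\<phi>X k (?b k) - ?\<phi>Y (?b k)) < E"
      using elim(1)[rule_format, OF net] unfolding rs .
    have bX: "c * (C * (1 / m + 1 / d k)) + real (m + 1) * (\<delta> * C) \<le> 3 * E"
      using m(2) elim(2) \<delta>C by (simp add: distrib_left)
    have bY: "c * (C * (1 / m + 0)) + real (m + 1) * (\<delta> * C) \<le> 2 * E"
      using m(2) \<delta>C by simp
    have tri: "norm (u - v) \<le> norm (u - u') + norm (u' - v') + norm (v - v')" for u v u' v' :: complex
      using norm_triangle_ineq[of "u - u'" "u' - v"] norm_triangle_ineq[of "u' - v'" "v' - v"]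
      by (simp add: norm_minus_commute)
    show ?case
      using tri[of "\<integral>\<omega>. iexp (ip (d k) (w k) (\<lambda>i. X k \<omega> (i / d k))) \<partial>M"
          "\<integral>\<omega>. iexp (ip (d k) (w k) (\<lambda>i. Y \<omega> (i / d k))) \<partial>N" "?\<phi>X k (?b k)" "?\<phi>Y (?b k)"]
        aX aY mid bX bY E e unfolding E_def by (simp only: diff_0_right)
  qed
  then show "\<exists>no. \<forall>k\<ge>no. norm ((\<integral>\<omega>. iexp (ip (d k) (w k) (\<lambda>i. X k \<omega> (i / d k))) \<partial>M)
     - (\<integral>\<omega>. iexp (ip (d k) (w k) (\<lambda>i. Y \<omega> (i / d k))) \<partial>N) - 0) < e"
    by (simp add: eventually_sequentially)
qed

section \<open>Riemann sums\<close>

lemma LBINT_eq_integral: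
  fixes f :: "real \<Rightarrow> real"
  assumes "continuous_on {a..b} f" shows "(LBINT x:{a..b}. f x) = integral {a..b} f"
  by (rule set_borel_integral_eq_integral(2)[OF borel_integrable_atLeastAtMost'[OF assms]])

lemma integral_minus_sample_le:
  fixes f :: "real \<Rightarrow> real"
  assumes f: "continuous_on {a..b} f" and "a \<le> b" and e: "\<And>y. y \<in> {a..b} \<Longrightarrow> \<bar>f y - c\<bar> \<le> e"
  shows "\<bar>integral {a..b} f - (b - a) * c\<bar> \<le> e * (b - a)"
proof -
  have "integral {a..b} (\<lambda>y. f y - c) = integral {a..b} f - (b - a) * c"
    using assms by (subst Henstock_Kurzweil_Integration.integral_diff)
      (auto intro: integrable_continuous_interval)
  moreover have "norm (integral {a..b} (\<lambda>y. f y - c)) \<le> e * (b - a)"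
    by (rule integral_bound[OF \<open>a \<le> b\<close>]) (auto intro!: continuous_intros f simp: e)
  ultimately show ?thesis by simp
qed

text \<open>Sample points are arbitrary within their cells: left ends occur in the coarse forms,
  right ends in the sums over the data grid. The error is a single modulus of continuity, so it can
  be used uniformly in parameters.\<close>

lemma riemann_sum_error:
  fixes f :: "real \<Rightarrow> real" and p :: "nat \<Rightarrow> real" and d :: nat
  assumes f: "continuous_on {0..1} f" and d: "d > 0"
    and p: "\<And>j. j < d \<Longrightarrow> p j \<in> {j / d..(real j + 1) / d}"
    and e: "\<And>y z. y \<in> {0..1} \<Longrightarrow> z \<in> {0..1} \<Longrightarrow> \<bar>y - z\<bar> \<le> 1 / d \<Longrightarrow> \<bar>f y - f z\<bar> \<le> e"
  shows "\<bar>(1 / real d) * (\<Sum>j<d. f (p j)) - (LBINT x:{0..1}. f x)\<bar> \<le> e"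
proof -
  have dpos: "real d > 0" using d by simp
  have cont: "continuous_on {a..b} f" if "0 \<le> a" "b \<le> 1" for a b
    using that by (intro continuous_on_subset[OF f]) auto
  have "\<bar>integral {0..real k / d} f - (\<Sum>j<k. (1 / real d) * f (p j))\<bar> \<le> e * (real k / d)" if "k \<le> d" for k
    using that
  proof (induction k)
    case (Suc k)
    let ?a = "real k / d" and ?b = "(real k + 1) / d"
    have ab: "0 \<le> ?a" "?a \<le> ?b" "?b \<le> 1" "?b - ?a = 1 / d" using Suc.prems dpos by (auto simp: field_simps)
    have "\<bar>integral {?a..?b} f - (?b - ?a) * f (p k)\<bar> \<le> e * (?b - ?a)"
    proof (rule integral_minus_sample_le)
      fix y assume y: "y \<in> {?a..?b}"
      have pk: "p k \<in> {?a..?b}" using p[of k] Suc.prems by simp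
      have "\<bar>y - p k\<bar> \<le> ?b - ?a" using y pk by (auto simp: abs_le_iff)
      moreover have "y \<in> {0..1}" "p k \<in> {0..1}"
        using y pk ab(1,3) unfolding atLeastAtMost_iff by linarith+
      ultimately show "\<bar>f y - f (p k)\<bar> \<le> e" using ab(4) by (intro e) auto
    qed (use ab in \<open>auto intro!: cont\<close>)
    moreover have "integral {0..?b} f = integral {0..?a} f + integral {?a..?b} f"
      using ab by (intro Henstock_Kurzweil_Integration.integral_combine[symmetric] integrable_continuous_interval cont) auto
    ultimately show ?case
      using Suc ab(4) by (simp add: add_divide_distrib distrib_left add.commute)
  qed simp
  from this[of d] show ?thesis
    using d by (simp add: LBINT_eq_integral[OF f] sum_divide_distrib abs_minus_commute)
qed

lemma riemann_sum_tendsto: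
  fixes f :: "real \<Rightarrow> real" and p :: "nat \<Rightarrow> nat \<Rightarrow> real"
  assumes f: "continuous_on {0..1} f"
    and p: "\<And>m j. j < m \<Longrightarrow> p m j \<in> {real j / real m..(real j + 1) / real m}"
  shows "(\<lambda>m. (1 / real m) * (\<Sum>j<m. f (p m j))) \<longlonglongrightarrow> (LBINT x:{0..1}. f x)"
proof (rule LIMSEQ_I)
  fix e :: real assume e: "e > 0"
  obtain \<delta> where \<delta>: "\<delta> > 0" "\<And>y z. y \<in> {0..1} \<Longrightarrow> z \<in> {0..1} \<Longrightarrow> dist z y < \<delta> \<Longrightarrow> dist (f z) (f y) < e / 2"
    using compact_uniformly_continuous[OF f] e half_gt_zero[OF e] unfolding uniformly_continuous_on_def by (metis compact_Icc)
  obtain n :: nat where n: "1 / \<delta> < n" using reals_Archimedean2 by blast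
  have "norm ((1 / real m) * (\<Sum>j<m. f (p m j)) - (LBINT x:{0..1}. f x)) < e" if m: "m \<ge> n" for m
  proof -
    have mpos: "real m > 0" "1 / m < \<delta>"
    proof -
      have "1 / \<delta> < m" using n m by linarith
      moreover have "0 < 1 / \<delta>" using \<delta>(1) by simp
      ultimately show "real m > 0" by linarith
      then show "1 / m < \<delta>" using \<open>1 / \<delta> < m\<close> \<delta>(1) by (simp add: field_simps)
    qed
    have "\<bar>(1 / real m) * (\<Sum>j<m. f (p m j)) - (LBINT x:{0..1}. f x)\<bar> \<le> e / 2"
    proof (rule riemann_sum_error[OF f])
      show "\<bar>f y - f z\<bar> \<le> e / 2" if "y \<in> {0..1}" "z \<in> {0..1}" "\<bar>y - z\<bar> \<le> 1 / m" for y z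
        using \<delta>(2)[of z y] that mpos(2) by (simp add: dist_real_def)
    qed (use mpos p in auto)
    then show ?thesis using e by simp
  qed
  then show "\<exists>no. \<forall>m\<ge>no. norm ((1 / real m) * (\<Sum>j<m. f (p m j)) - (LBINT x:{0..1}. f x)) < e" by blast
qed

text \<open>The inner sum is replaced by its integral with an error uniform in the outer variable,
  by uniform continuity on the square; the single sum then handles the outer variable.\<close>

lemma double_riemann_sum_tendsto:
  fixes F :: "real \<Rightarrow> real \<Rightarrow> real" and p :: "nat \<Rightarrow> nat \<Rightarrow> real"
  assumes F: "continuous_on ({0..1} \<times> {0..1}) (\<lambda>q. F (fst q) (snd q))"
    and p: "\<And>m j. j < m \<Longrightarrow> p m j \<in> {real j / real m..(real j + 1) / real m}"
  shows "(\<lambda>m. 1 / (real m)\<^sup>2 * (\<Sum>j<m. \<Sum>k<m. F (p m j) (p m k))) \<longlonglongrightarrow> (LBINT x:{0..1}. LBINT y:{0..1}. F x y)"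
proof -
  define h where "h x = (LBINT y:{0..1}. F x y)" for x
  have Fx: "continuous_on {0..1} (F x)" if "x \<in> {0..1}" for x
  proof -
    have "continuous_on {0..1} (\<lambda>y. (\<lambda>q. F (fst q) (snd q)) (x, y))"
      by (rule continuous_on_compose2[OF F])
         (use that in \<open>auto intro!: continuous_on_Pair continuous_on_const continuous_on_id\<close>)
    then show ?thesis by simp
  qed
  have hc: "continuous_on {0..1} h"
  proof -
    have "continuous_on {0..1} (\<lambda>x. integral (cbox 0 1) (F x))"
      using F by (intro integral_continuous_on_param) (simp add: case_prod_unfold)
    then show ?thesis
      unfolding h_def by (rule continuous_on_cong[THEN iffD1, OF refl, rotated]) (simp add: LBINT_eq_integral[OF Fx])
  qed
  have p01: "p m j \<in> {0..1}" if "j < m" for m j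
  proof -
    have "0 \<le> real j / real m" "(real j + 1) / real m \<le> 1" using that by (auto simp: field_simps)
    then show ?thesis using p[OF that] unfolding atLeastAtMost_iff by linarith
  qed
  have "(\<lambda>m. 1 / (real m)\<^sup>2 * (\<Sum>j<m. \<Sum>k<m. F (p m j) (p m k)) - 1 / real m * (\<Sum>j<m. h (p m j))) \<longlonglongrightarrow> 0"
  proof (rule LIMSEQ_I)
    fix e :: real assume e: "e > 0"
    have "compact ({0..1::real} \<times> {0..1::real})" by (intro compact_Times compact_Icc)
    from compact_uniformly_continuous[OF F this] obtain \<delta> where \<delta>: "\<delta> > 0"
      "\<And>q q'. q \<in> {0..1} \<times> {0..1} \<Longrightarrow> q' \<in> {0..1} \<times> {0..1} \<Longrightarrow> dist q' q < \<delta> \<Longrightarrow> dist (F (fst q') (snd q')) (F (fst q) (snd q)) < e / 2"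
      unfolding uniformly_continuous_on_def using half_gt_zero[OF e] by metis
    obtain n :: nat where n: "1 / \<delta> < n" using reals_Archimedean2 by blast
    have "norm (1 / (real m)\<^sup>2 * (\<Sum>j<m. \<Sum>k<m. F (p m j) (p m k)) - 1 / real m * (\<Sum>j<m. h (p m j)) - 0) < e" if m: "m \<ge> n" for m
    proof -
      have "1 / \<delta> < m" using n m by linarith
      moreover have "0 < 1 / \<delta>" using \<delta>(1) by simp
      ultimately have mpos: "real m > 0" by linarith
      then have m\<delta>: "1 / m < \<delta>" using \<open>1 / \<delta> < m\<close> \<delta>(1) by (simp add: field_simps)
      have inner: "\<bar>1 / real m * (\<Sum>k<m. F (p m j) (p m k)) - h (p m j)\<bar> \<le> e / 2" if j: "j < m" for j
        unfolding h_def
      proof (rule riemann_sum_error[OF Fx[OF p01[OF j]]])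
        show "\<bar>F (p m j) y - F (p m j) z\<bar> \<le> e / 2" if "y \<in> {0..1}" "z \<in> {0..1}" "\<bar>y - z\<bar> \<le> 1 / m" for y z
          using \<delta>(2)[of "(p m j, z)" "(p m j, y)"] that m\<delta> p01[OF j] by (simp add: dist_Pair_Pair dist_real_def)
      qed (use mpos p in auto)
      have "1 / (real m)\<^sup>2 * (\<Sum>j<m. \<Sum>k<m. F (p m j) (p m k)) - 1 / real m * (\<Sum>j<m. h (p m j))
          = 1 / real m * (\<Sum>j<m. 1 / real m * (\<Sum>k<m. F (p m j) (p m k)) - h (p m j))"
        by (simp add: sum_subtractf sum_distrib_left[symmetric] right_diff_distrib power2_eq_square sum_divide_distrib[symmetric])
      also have "\<bar>\<dots>\<bar> \<le> 1 / real m * (\<Sum>j<m. e / 2)"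
        unfolding abs_mult using inner by (intro mult_mono order_trans[OF sum_abs] sum_mono) (auto simp: sum_nonneg)
      also have "\<dots> < e" using mpos e by simp
      finally show ?thesis by simp
    qed
    then show "\<exists>no. \<forall>m\<ge>no. norm (1 / (real m)\<^sup>2 * (\<Sum>j<m. \<Sum>k<m. F (p m j) (p m k)) - 1 / real m * (\<Sum>j<m. h (p m j)) - 0) < e" by blast
  qed
  from tendsto_add[OF this riemann_sum_tendsto[OF hc p]] show ?thesis by (simp add: h_def)
qed

section \<open>Euler scheme for the limiting equation\<close>

text \<open>Deterministic counterpart of \<open>duhamel\<close>: an Euler scheme with forcing f
  obeys the same backward expansion with the same dual vectors.\<close>

lemma dual_telescope:
  fixes z f :: "nat \<Rightarrow> nat \<Rightarrow> real"
  assumes sym: "\<And>i j. i \<in> {1..d} \<Longrightarrow> j \<in> {1..d} \<Longrightarrow> a i j = a j i"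
    and step: "\<And>k i. k < t \<Longrightarrow> i \<in> {1..d} \<Longrightarrow> z (Suc k) i = z k i - \<eta> * ip d (a i) (z k) + f k i"
    and n: "n \<le> t"
  shows "ip d (dual a d \<eta> v (t - n)) (z n) = ip d (dual a d \<eta> v t) (z 0) + (\<Sum>k<n. ip d (dual a d \<eta> v (t - Suc k)) (f k))"
  using n
proof (induction n)
  case (Suc n)
  let ?w = "dual a d \<eta> v (t - Suc n)"
  have eq: "t - n = Suc (t - Suc n)" using Suc.prems by simp
  have "ip d ?w (z (Suc n)) = (\<Sum>i=1..d. ?w i * z n i - \<eta> * (?w i * ip d (a i) (z n)) + ?w i * f n i)"
  proof (unfold ip_def[of d ?w], intro sum.cong refl)
    fix i assume "i \<in> {1..d}"
    then have "z (Suc n) i = z n i - \<eta> * ip d (a i) (z n) + f n i" using Suc.prems by (intro step) auto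
    then show "?w i * z (Suc n) i = ?w i * z n i - \<eta> * (?w i * ip d (a i) (z n)) + ?w i * f n i"
      by (simp only:) (simp add: algebra_simps)
  qed
  also have "\<dots> = ip d ?w (z n) - \<eta> * (\<Sum>i=1..d. ?w i * ip d (a i) (z n)) + ip d ?w (f n)"
    by (simp add: ip_def[of d ?w] sum.distrib sum_subtractf sum_distrib_left)
  also have "(\<Sum>i=1..d. ?w i * ip d (a i) (z n)) = (\<Sum>j=1..d. ip d ?w (\<lambda>i. a i j) * z n j)"
    unfolding ip_def sum_distrib_left sum_distrib_right by (subst sum.swap) (simp add: mult_ac)
  also have "ip d ?w (z n) - \<eta> * \<dots> = ip d (dual a d \<eta> v (t - n)) (z n)"
    unfolding eq by (rule ip_dual_Suc[OF sym, symmetric])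
  finally show ?case using Suc by simp
qed simp

text \<open>The integrated limiting equation; \<open>\<alpha>'\<close> is the limit of \<open>\<eta> d T\<close>, which vanishes
  in the high-noise case, and \<open>\<gamma>\<close> is the limit of \<open>\<eta> \<sigma> T\<^sup>1\<^sup>/\<^sup>2\<close>, which vanishes in the low-noise case.\<close>

definition limit_path :: "real \<Rightarrow> (real \<Rightarrow> real \<Rightarrow> real) \<Rightarrow> real \<Rightarrow> real \<Rightarrow>
    (real \<Rightarrow> real \<Rightarrow> real) \<Rightarrow> (real \<Rightarrow> real \<Rightarrow> real) \<Rightarrow> bool" where
  "limit_path \<tau> A \<alpha>' \<gamma> \<xi> z \<longleftrightarrow> z \<in> mspace (path_space \<tau>) \<and>
     (\<forall>s\<in>{0..\<tau>}. \<forall>y\<in>{0..1}. z s y - z 0 y =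
        - \<alpha>' * (LBINT u:{0..s}. LBINT y':{0..1}. A y y' * z u y') + \<gamma> * (\<xi> s y - \<xi> 0 y))"

lemma drift_continuous:
  fixes f :: "real \<Rightarrow> real" and z :: "real \<Rightarrow> real \<Rightarrow> real"
  assumes z: "z \<in> mspace (path_space \<tau>)" and f: "continuous_on {0..1} f"
  shows "continuous_on {0..\<tau>} (\<lambda>u. LBINT y':{0..1}. f y' * z u y')"
proof -
  have c: "continuous_on {0..1} (\<lambda>y'. f y' * z u y')" if "u \<in> {0..\<tau>}" for u
    using f path_space_mem[OF z that] by (intro continuous_on_mult) (auto simp: mspace_C01)
  have "continuous_on ({0..\<tau>} \<times> {0..1}) (\<lambda>p. f (snd p))"
    by (rule continuous_on_compose2[OF f]) (auto intro!: continuous_intros)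
  then have "continuous_on ({0..\<tau>} \<times> {0..1}) (\<lambda>p. f (snd p) * z (fst p) (snd p))"
    by (intro continuous_on_mult path_space_jointly_continuous[OF z])
  then have "continuous_on {0..\<tau>} (\<lambda>u. integral (cbox 0 1) (\<lambda>y'. f y' * z u y'))"
    by (intro integral_continuous_on_param) (simp add: case_prod_unfold)
  then show ?thesis
    by (rule continuous_on_cong[THEN iffD1, OF refl, rotated]) (simp add: LBINT_eq_integral[OF c])
qed

text \<open>Local consistency with an error o(h), so that the sum over order 1 / h steps vanishes.
  \<kappa> stands for the step size \<eta> and h for 1 / T; the condition on \<kappa> says that
  \<eta> d T is close to \<alpha>'. Uniformity in s and y comes from compactness.\<close>

lemma euler_local_error:
  fixes A z :: "real \<Rightarrow> real \<Rightarrow> real"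
  assumes z: "z \<in> mspace (path_space \<tau>)" and K: "K \<ge> 0" and e: "e > 0"
    and A_bound: "\<And>y z. \<lbrakk>y \<in> {0..1}; z \<in> {0..1}\<rbrakk> \<Longrightarrow> \<bar>A y z\<bar> \<le> K"
    and A_lip: "\<And>x y z. \<lbrakk>x \<in> {0..1}; y \<in> {0..1}; z \<in> {0..1}\<rbrakk> \<Longrightarrow> \<bar>A z x - A z y\<bar> \<le> K * \<bar>x - y\<bar>"
  obtains \<delta> where "\<delta> > 0"
    "\<And>d h \<kappa> s y. \<lbrakk>d > 0; 1 / real d < \<delta>; 0 < h; h < \<delta>; \<bar>\<kappa> * d - \<alpha>' * h\<bar> \<le> \<delta> * h; 0 \<le> s; s + h \<le> \<tau>; y \<in> {0..1}\<rbrakk> \<Longrightarrow>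
      \<bar>\<kappa> * (\<Sum>j=1..d. A y (real j / real d) * z s (real j / real d))
        - \<alpha>' * ((LBINT u:{0..s + h}. LBINT y':{0..1}. A y y' * z u y') - (LBINT u:{0..s}. LBINT y':{0..1}. A y y' * z u y'))\<bar> \<le> e * h"
proof -
  define g :: "real \<Rightarrow> real \<Rightarrow> real \<Rightarrow> real" where "g y u y' = A y y' * z u y'" for y u y'
  have zc: "continuous_on ({0..\<tau>} \<times> {0..1}) (\<lambda>p. z (fst p) (snd p))"
    by (rule path_space_jointly_continuous[OF z])
  have cpt: "compact ({0..\<tau>} \<times> {0..1::real})" by (intro compact_Times compact_Icc)
  obtain Z where Z: "Z > 0" "\<And>u y. u \<in> {0..\<tau>} \<Longrightarrow> y \<in> {0..1} \<Longrightarrow> \<bar>z u y\<bar> \<le> Z"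
  proof -
    obtain B where "B > 0" "\<forall>p \<in> {0..\<tau>} \<times> {0..1}. norm (z (fst p) (snd p)) \<le> B"
      using compact_imp_bounded[OF compact_continuous_image[OF zc cpt]] unfolding bounded_pos by auto
    then show thesis by (intro that[of B]) auto
  qed
  \<comment> \<open>Final budget: e' h K Z for the mismatch of \<kappa> d with \<alpha>' h, and
    |\<alpha>'| e' h each for the space sum and the time integral.\<close>
  define e' where "e' = e / (1 + 2 * \<bar>\<alpha>'\<bar> + K * Z)"
  have den: "1 + 2 * \<bar>\<alpha>'\<bar> + K * Z > 0" using K Z(1) by (simp add: add_pos_nonneg)
  have e': "e' > 0" using e den by (simp add: e'_def)
  \<comment> \<open>Half of e' pays for the change of z, the other half, through \<delta>2, for the
    change of the kernel.\<close>
  define e1 where "e1 = e' / (2 * (K + 1))"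
  have e1: "e1 > 0" using e' K by (simp add: e1_def)
  obtain \<delta>1 where \<delta>1: "\<delta>1 > 0"
    "\<And>p q. p \<in> {0..\<tau>} \<times> {0..1} \<Longrightarrow> q \<in> {0..\<tau>} \<times> {0..1} \<Longrightarrow> dist q p < \<delta>1 \<Longrightarrow> dist (z (fst q) (snd q)) (z (fst p) (snd p)) < e1"
    using compact_uniformly_continuous[OF zc cpt] e1 unfolding uniformly_continuous_on_def by metis
  define \<delta>2 where "\<delta>2 = e' / (2 * (K * Z + 1))"
  have KZ: "K * Z \<ge> 0" using K Z(1) by simp
  have \<delta>2: "\<delta>2 > 0" using e' KZ by (simp add: \<delta>2_def)
  have half_cancel: "c * (e' / (2 * c)) = e' / 2" if "c > 0" for c using that by simp
  have gdiff: "\<bar>g y u x - g y u' x'\<bar> \<le> e'"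
    if "y \<in> {0..1}" "u \<in> {0..\<tau>}" "u' \<in> {0..\<tau>}" "x \<in> {0..1}" "x' \<in> {0..1}" "dist (u, x) (u', x') < \<delta>1" "\<bar>x - x'\<bar> \<le> \<delta>2" for y u x u' x'
  proof -
    have "g y u x - g y u' x' = A y x * (z u x - z u' x') + (A y x - A y x') * z u' x'"
      by (simp add: g_def algebra_simps)
    then have "\<bar>g y u x - g y u' x'\<bar> \<le> \<bar>A y x\<bar> * \<bar>z u x - z u' x'\<bar> + \<bar>A y x - A y x'\<bar> * \<bar>z u' x'\<bar>"
      by (metis abs_mult abs_triangle_ineq)
    also have "\<dots> \<le> K * e1 + (K * \<delta>2) * Z"
    proof (intro add_mono mult_mono)
      show "\<bar>z u x - z u' x'\<bar> \<le> e1"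
        using \<delta>1(2)[of "(u', x')" "(u, x)"] that by (simp add: dist_real_def)
      have "\<bar>A y x - A y x'\<bar> \<le> K * \<bar>x - x'\<bar>" using that by (intro A_lip)
      also have "\<dots> \<le> K * \<delta>2" using that K by (intro mult_left_mono)
      finally show "\<bar>A y x - A y x'\<bar> \<le> K * \<delta>2" .
    qed (use A_bound Z that K \<delta>2 in auto)
    also have "\<dots> \<le> (K + 1) * e1 + (K * Z + 1) * \<delta>2" using e1 \<delta>2 by (simp add: algebra_simps)
    also have "(K + 1) * e1 = e' / 2" unfolding e1_def using K by (intro half_cancel) auto
    also have "(K * Z + 1) * \<delta>2 = e' / 2" unfolding \<delta>2_def using KZ by (intro half_cancel) auto
    finally show ?thesis by simp
  qed
  define F where "F y u = (LBINT y':{0..1}. g y u y')" for y u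
  define \<delta> where "\<delta> = min \<delta>1 (min \<delta>2 e')"
  have \<delta>: "\<delta> > 0" using \<delta>1(1) \<delta>2 e' by (simp add: \<delta>_def)
  have Ac: "continuous_on {0..1} (A y)" if "y \<in> {0..1}" for y
    by (rule lipschitz_on_continuous_on[of K]) (use A_lip that K in \<open>auto simp: lipschitz_on_def dist_real_def\<close>)
  have gc: "continuous_on {0..1} (g y u)" if "y \<in> {0..1}" "u \<in> {0..\<tau>}" for y u
  proof -
    have "continuous_on {0..1} (A y)" by (rule Ac[OF that(1)])
    moreover have "continuous_on {0..1} (z u)" using path_space_mem[OF z that(2)] by (simp add: mspace_C01)
    ultimately show ?thesis unfolding g_def by (intro continuous_intros)
  qed
  have F_diff: "\<bar>F y u - F y u'\<bar> \<le> e'" if "y \<in> {0..1}" "u \<in> {0..\<tau>}" "u' \<in> {0..\<tau>}" "\<bar>u - u'\<bar> < \<delta>" for y u u'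
  proof -
    have "F y u - F y u' = integral {0..1} (\<lambda>x. g y u x - g y u' x)"
      unfolding F_def using gc that
      by (simp add: LBINT_eq_integral Henstock_Kurzweil_Integration.integral_diff integrable_continuous_interval)
    also have "norm \<dots> \<le> e' * (1 - 0)"
    proof (rule integral_bound)
      show "continuous_on {0..1} (\<lambda>x. g y u x - g y u' x)" using gc that by (intro continuous_intros)
      show "norm (g y u x - g y u' x) \<le> e'" if "x \<in> {0..1}" for x
        using gdiff[of y u u' x x] that \<open>y \<in> {0..1}\<close> \<open>u \<in> {0..\<tau>}\<close> \<open>u' \<in> {0..\<tau>}\<close> \<open>\<bar>u - u'\<bar> < \<delta>\<close> \<delta>2
        by (simp add: dist_Pair_Pair dist_real_def \<delta>_def)
    qed simp
    finally show ?thesis by simp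
  qed
  have Fc: "continuous_on {0..\<tau>} (F y)" if "y \<in> {0..1}" for y
    unfolding F_def g_def by (rule drift_continuous[OF z Ac[OF that]])
  show thesis
  proof (rule that[OF \<delta>])
    fix d :: nat and h \<kappa> s y :: real
    assume d: "d > 0" "1 / real d < \<delta>" and h: "0 < h" "h < \<delta>" and \<kappa>: "\<bar>\<kappa> * d - \<alpha>' * h\<bar> \<le> \<delta> * h"
      and s: "0 \<le> s" "s + h \<le> \<tau>" and y: "y \<in> {0..1}"
    have sin: "s \<in> {0..\<tau>}" using s h by auto
    define S where "S = (1 / real d) * (\<Sum>j=1..d. g y s (real j / real d))"
    define I where "I = integral {s..s + h} (F y)"
    have S1: "\<bar>S - F y s\<bar> \<le> e'"
    proof -
      \<comment> \<open>The sum uses right end points; shifting its index turns it into a Riemann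
        sum over the cells j < d.\<close>
      have "(\<Sum>j=1..d. g y s (real j / real d)) = (\<Sum>j<d. g y s ((real j + 1) / d))"
        by (rule sum.reindex_bij_witness[of _ Suc "\<lambda>j. j - 1"]) (auto simp: of_nat_diff)
      moreover have "\<bar>(1 / real d) * (\<Sum>j<d. g y s ((real j + 1) / d)) - (LBINT x:{0..1}. g y s x)\<bar> \<le> e'"
      proof (rule riemann_sum_error[OF gc[OF y sin] d(1)])
        show "\<bar>g y s x - g y s x'\<bar> \<le> e'" if "x \<in> {0..1}" "x' \<in> {0..1}" "\<bar>x - x'\<bar> \<le> 1 / d" for x x'
          using gdiff[OF y sin sin that(1,2)] that(3) d(2) by (simp add: dist_Pair_Pair dist_real_def \<delta>_def)
      qed (auto simp: divide_right_mono)
      ultimately show ?thesis by (simp add: S_def F_def)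
    qed
    have SKZ: "\<bar>S\<bar> \<le> K * Z"
    proof -
      have "\<bar>\<Sum>j=1..d. g y s (real j / real d)\<bar> \<le> (\<Sum>j=1..d. K * Z)"
      proof (rule order_trans[OF sum_abs sum_mono])
        fix j assume "j \<in> {1..d}"
        then have "real j / d \<in> {0..1}" by auto
        then show "\<bar>g y s (real j / real d)\<bar> \<le> K * Z"
          unfolding g_def abs_mult using A_bound y Z sin K by (intro mult_mono) auto
      qed
      then show ?thesis using d(1) by (simp add: S_def abs_mult field_simps)
    qed
    have I1: "\<bar>I - (s + h - s) * F y s\<bar> \<le> e' * (s + h - s)"
      unfolding I_def
    proof (rule integral_minus_sample_le)
      show "continuous_on {s..s + h} (F y)" by (rule continuous_on_subset[OF Fc[OF y]]) (use s in auto)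
      show "\<bar>F y u - F y s\<bar> \<le> e'" if "u \<in> {s..s + h}" for u
        using that s h sin by (intro F_diff y) auto
    qed (use h in auto)
    have cs: "continuous_on {0..s} (F y)" "continuous_on {0..s + h} (F y)"
      by (rule continuous_on_subset[OF Fc[OF y]]; use s h in auto)+
    have I2: "(LBINT u:{0..s + h}. F y u) - (LBINT u:{0..s}. F y u) = I"
      unfolding I_def LBINT_eq_integral[OF cs(1)] LBINT_eq_integral[OF cs(2)]
      using Henstock_Kurzweil_Integration.integral_combine[of 0 s "s + h" "F y"] s h
        integrable_continuous_interval[OF cs(2)] by simp
    have S2: "\<kappa> * (\<Sum>j=1..d. A y (real j / real d) * z s (real j / real d)) = (\<kappa> * d) * S"
      using d(1) by (simp add: S_def g_def)
    have "\<bar>(\<kappa> * d) * S - \<alpha>' * I\<bar> \<le> e * h"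
    proof -
      have "(\<kappa> * d) * S - \<alpha>' * I = (\<kappa> * d - \<alpha>' * h) * S + (\<alpha>' * h) * (S - F y s) - \<alpha>' * (I - h * F y s)"
        by (simp add: algebra_simps)
      then have "\<bar>(\<kappa> * d) * S - \<alpha>' * I\<bar> \<le> \<bar>(\<kappa> * d - \<alpha>' * h) * S\<bar> + \<bar>(\<alpha>' * h) * (S - F y s)\<bar> + \<bar>\<alpha>' * (I - h * F y s)\<bar>"
        by linarith
      also have "\<dots> = \<bar>\<kappa> * d - \<alpha>' * h\<bar> * \<bar>S\<bar> + \<bar>\<alpha>'\<bar> * h * \<bar>S - F y s\<bar> + \<bar>\<alpha>'\<bar> * \<bar>I - h * F y s\<bar>"
        using h by (simp add: abs_mult)
      also have "\<dots> \<le> (e' * h) * (K * Z) + \<bar>\<alpha>'\<bar> * h * e' + \<bar>\<alpha>'\<bar> * (e' * h)"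
      proof (intro add_mono mult_left_mono mult_mono)
        show "\<bar>\<kappa> * d - \<alpha>' * h\<bar> \<le> e' * h"
          using \<kappa> by (rule order_trans) (use h in \<open>auto simp: \<delta>_def intro!: mult_right_mono\<close>)
        show "\<bar>I - h * F y s\<bar> \<le> e' * h" using I1 by simp
      qed (use SKZ S1 h e' KZ in auto)
      also have "\<dots> \<le> e' * h * (1 + 2 * \<bar>\<alpha>'\<bar> + K * Z)" using e' h by (simp add: algebra_simps)
      also have "\<dots> = e * h" using den by (simp add: e'_def)
      finally show ?thesis .
    qed
    then show "\<bar>\<kappa> * (\<Sum>j=1..d. A y (real j / real d) * z s (real j / real d))
        - \<alpha>' * ((LBINT u:{0..s + h}. LBINT y':{0..1}. A y y' * z u y') - (LBINT u:{0..s}. LBINT y':{0..1}. A y y' * z u y'))\<bar> \<le> e * h"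
      unfolding S2 using I2 by (simp add: F_def g_def)
  qed
qed

text \<open>The threshold in n is uniform over all v of l1 norm at most c, since the local errors do
  not depend on v and the dual vectors stay bounded. Later v varies with n and, for low noise, runs
  through all coordinates at once. The increments of \<xi> are carried along exactly and never
  estimated.\<close>

lemma euler_functional_conv:
  fixes d T :: "nat \<Rightarrow> nat" and \<eta> :: "nat \<Rightarrow> real"
  assumes lp: "limit_path \<tau> A \<alpha>' \<gamma> \<xi> z"
    and K: "K \<ge> 1" "\<tau> \<le> K"
    and A_sym: "\<And>y z. \<lbrakk>y \<in> {0..1}; z \<in> {0..1}\<rbrakk> \<Longrightarrow> A y z = A z y"
    and A_bound: "\<And>y z. \<lbrakk>y \<in> {0..1}; z \<in> {0..1}\<rbrakk> \<Longrightarrow> \<bar>A y z\<bar> \<le> K"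
    and A_lip: "\<And>x y z. \<lbrakk>x \<in> {0..1}; y \<in> {0..1}; z \<in> {0..1}\<rbrakk> \<Longrightarrow> \<bar>A x z - A y z\<bar> \<le> K * \<bar>x - y\<bar>"
    and dT: "filterlim d at_top sequentially" "filterlim T at_top sequentially"
    and pos: "\<And>n. d n > 0" "\<And>n. T n > 0" "\<And>n. \<eta> n \<ge> 0"
    and \<eta>: "(\<lambda>n. \<eta> n * d n * T n) \<longlonglongrightarrow> \<alpha>'" "\<And>n. \<eta> n * d n * T n \<le> K"
    and s: "s \<in> {0..\<tau>}" and c: "c \<ge> 0" and e: "e > 0"
  defines "t \<equiv> \<lambda>n. nat \<lfloor>s * T n\<rfloor>"
    and "w \<equiv> \<lambda>n. dual (\<lambda>i j. A (real i / d n) (real j / d n)) (d n) (\<eta> n)"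
  shows "\<forall>\<^sub>F n in sequentially. \<forall>v. l1 (d n) v \<le> c \<longrightarrow>
    \<bar>ip (d n) v (\<lambda>i. z (real (t n) / real (T n)) (real i / real (d n))) -
      (ip (d n) (w n v (t n)) (\<lambda>i. z 0 (real i / real (d n)))
       + \<gamma> * (\<Sum>k<t n. ip (d n) (w n v (t n - Suc k)) (\<lambda>i. \<xi> (real (Suc k) / real (T n)) (real i / real (d n)) - \<xi> (real k / real (T n)) (real i / real (d n)))))\<bar> \<le> e"
proof -
  have zm: "z \<in> mspace (path_space \<tau>)" and zeq: "\<And>s y. s \<in> {0..\<tau>} \<Longrightarrow> y \<in> {0..1} \<Longrightarrow> z s y - z 0 y =
        - \<alpha>' * (LBINT u:{0..s}. LBINT y':{0..1}. A y y' * z u y') + \<gamma> * (\<xi> s y - \<xi> 0 y)"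
    using lp unfolding limit_path_def by auto
  define c' where "c' = exp (K ^ 3) * c"
  have c': "c' \<ge> 0" using c by (simp add: c'_def)
  \<comment> \<open>At most K / h steps, each contributing at most c' e' h; the added 1 guards
    against c' = 0.\<close>
  define e' where "e' = e / (K * (c' + 1))"
  have e': "e' > 0" using e K c' by (simp add: e'_def)
  have A_lip2: "\<bar>A z x - A z y\<bar> \<le> K * \<bar>x - y\<bar>" if "x \<in> {0..1}" "y \<in> {0..1}" "z \<in> {0..1}" for x y z
    using A_lip[of x y z] A_sym that by simp
  have K0: "K \<ge> 0" using K by simp
  obtain \<delta> where \<delta>: "\<delta> > 0"
    "\<And>d h \<kappa> s y. \<lbrakk>d > 0; 1 / real d < \<delta>; 0 < h; h < \<delta>; \<bar>\<kappa> * d - \<alpha>' * h\<bar> \<le> \<delta> * h; 0 \<le> s; s + h \<le> \<tau>; y \<in> {0..1}\<rbrakk> \<Longrightarrow>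
      \<bar>\<kappa> * (\<Sum>j=1..d. A y (real j / real d) * z s (real j / real d))
        - \<alpha>' * ((LBINT u:{0..s + h}. LBINT y':{0..1}. A y y' * z u y') - (LBINT u:{0..s}. LBINT y':{0..1}. A y y' * z u y'))\<bar> \<le> e' * h"
    using euler_local_error[where A=A and K=K and \<alpha>'=\<alpha>', OF zm K0 e' A_bound A_lip2] by blast
  have inv: "(\<lambda>n. 1 / real (f n)) \<longlonglongrightarrow> 0" if "filterlim f at_top sequentially" for f :: "nat \<Rightarrow> nat"
    by (rule tendsto_divide_0[OF tendsto_const filterlim_at_top_imp_at_infinity[OF filterlim_compose[OF filterlim_real_sequentially that]]])
  have "\<forall>\<^sub>F n in sequentially. 1 / real (d n) < \<delta>" "\<forall>\<^sub>F n in sequentially. 1 / real (T n) < \<delta>"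
    using order_tendstoD(2)[OF inv \<delta>(1)] dT by auto
  moreover have "\<forall>\<^sub>F n in sequentially. dist (\<eta> n * d n * T n) \<alpha>' < \<delta>"
    using tendstoD[OF \<eta>(1) \<delta>(1)] .
  ultimately show ?thesis
  proof eventually_elim
    case (elim n)
    define a where "a = (\<lambda>i j. A (real i / d n) (real j / d n))"
    define h where "h = 1 / real (T n)"
    define E where "E k i = \<eta> n * (\<Sum>j=1..d n. A (real i / real (d n)) (real j / real (d n)) * z (real k / real (T n)) (real j / real (d n)))
        - \<alpha>' * ((LBINT u:{0..k / T n + h}. LBINT y':{0..1}. A (real i / real (d n)) y' * z u y')
          - (LBINT u:{0..k / T n}. LBINT y':{0..1}. A (real i / real (d n)) y' * z u y'))" for k i :: nat
    have h: "h > 0" using pos by (simp add: h_def)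
    have g: "real i / d n \<in> {0..1}" if "i \<in> {1..d n}" for i using that by auto
    have tT: "real (t n) \<le> s * T n" using s unfolding t_def by (simp add: of_nat_nat)
    have kT: "real k / T n + h \<le> \<tau>" if "k < t n" for k
    proof -
      have "real k + 1 \<le> s * T n" using that tT by linarith
      then have "(real k + 1) / T n \<le> s" using pos[of n] by (simp add: divide_le_eq)
      then show ?thesis using s by (simp add: h_def add_divide_distrib)
    qed
    have Suc_div: "real (Suc k) / T n = real k / T n + h" for k by (simp add: h_def add_divide_distrib)
    have E: "\<bar>E k i\<bar> \<le> e' * h" if k: "k < t n" and i: "i \<in> {1..d n}" for k i
      unfolding E_def
    proof (rule \<delta>(2))
      have "\<eta> n * d n - \<alpha>' * h = (\<eta> n * d n * T n - \<alpha>') * h" using pos[of n] by (simp add: h_def field_simps)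
      then show "\<bar>\<eta> n * d n - \<alpha>' * h\<bar> \<le> \<delta> * h" using elim(3) h by (simp add: abs_mult dist_real_def)
    qed (use pos elim h kT[OF k] g[OF i] in \<open>auto simp: h_def\<close>)
    \<comment> \<open>The exact solution is viewed as a perturbed Euler scheme; its forcing is the
      field increment plus the local error.\<close>
    define f where "f k i = \<gamma> * (\<xi> (real (Suc k) / real (T n)) (real i / real (d n)) - \<xi> (real k / real (T n)) (real i / real (d n))) + E k i" for k i :: nat
    have step: "z (real (Suc k) / real (T n)) (real i / real (d n)) = z (real k / real (T n)) (real i / real (d n)) - \<eta> n * ip (d n) (a i) (\<lambda>j. z (real k / real (T n)) (real j / real (d n))) + f k i"
      if k: "k < t n" and i: "i \<in> {1..d n}" for k i
    proof -
      have "real k / T n \<in> {0..\<tau>}" "real k / T n + h \<in> {0..\<tau>}" using kT[OF k] h by auto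
      note z1 = zeq[OF this(1) g[OF i]] and z2 = zeq[OF this(2) g[OF i]]
      show ?thesis
        using z1 z2 unfolding f_def E_def Suc_div ip_def a_def by (simp add: algebra_simps)
    qed
    have asym: "a i j = a j i" if "i \<in> {1..d n}" "j \<in> {1..d n}" for i j
      unfolding a_def using g[OF that(1)] g[OF that(2)] by (rule A_sym)
    show ?case
    proof (intro allI impI)
      fix v assume v: "l1 (d n) v \<le> c"
      have wn: "w n = dual a (d n) (\<eta> n)" by (simp add: w_def a_def)
      have tel: "ip (d n) v (\<lambda>i. z (real (t n) / real (T n)) (real i / real (d n)))
          = ip (d n) (w n v (t n)) (\<lambda>i. z 0 (real i / real (d n))) + (\<Sum>k<t n. ip (d n) (w n v (t n - Suc k)) (f k))"
        using dual_telescope[of "d n" a "t n" "\<lambda>k i. z (real k / real (T n)) (real i / real (d n))" "\<eta> n" f "t n" v, OF asym step]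
        by (simp add: wn)
      have "ip (d n) (w n v (t n - Suc k)) (f k)
          = \<gamma> * ip (d n) (w n v (t n - Suc k)) (\<lambda>i. \<xi> (real (Suc k) / real (T n)) (real i / real (d n)) - \<xi> (real k / real (T n)) (real i / real (d n)))
            + ip (d n) (w n v (t n - Suc k)) (E k)" for k
        by (simp add: ip_def f_def distrib_left sum.distrib sum_distrib_left mult_ac)
      then have "ip (d n) v (\<lambda>i. z (real (t n) / real (T n)) (real i / real (d n))) -
        (ip (d n) (w n v (t n)) (\<lambda>i. z 0 (real i / real (d n)))
         + \<gamma> * (\<Sum>k<t n. ip (d n) (w n v (t n - Suc k)) (\<lambda>i. \<xi> (real (Suc k) / real (T n)) (real i / real (d n)) - \<xi> (real k / real (T n)) (real i / real (d n)))))
        = (\<Sum>k<t n. ip (d n) (w n v (t n - Suc k)) (E k))"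
        unfolding tel by (simp add: sum.distrib sum_distrib_left)
      moreover have "\<bar>\<Sum>k<t n. ip (d n) (w n v (t n - Suc k)) (E k)\<bar> \<le> (\<Sum>k<t n. c' * (e' * h))"
      proof (rule order_trans[OF sum_abs sum_mono])
        fix k assume "k \<in> {..<t n}"
        then have k: "k < t n" by simp
        have "real (t n - Suc k) \<le> K * T n"
          using tT s K mult_right_mono[of s K "real (T n)"] by simp
        then have "l1 (d n) (w n v (t n - Suc k)) \<le> exp (K ^ 3) * l1 (d n) v"
          unfolding wn using A_bound g pos K \<eta>(2)[of n]
          by (intro l1_dual_bound[where T="real (T n)"]) (auto simp: a_def)
        also have "\<dots> \<le> c'" unfolding c'_def using v by (intro mult_left_mono) auto
        finally have l: "l1 (d n) (w n v (t n - Suc k)) \<le> c'" .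
        have "\<bar>ip (d n) (w n v (t n - Suc k)) (E k)\<bar> \<le> l1 (d n) (w n v (t n - Suc k)) * (e' * h)"
          using E[OF k] by (rule abs_ip_le)
        also have "\<dots> \<le> c' * (e' * h)" using l e' h by (intro mult_right_mono) auto
        finally show "\<bar>ip (d n) (w n v (t n - Suc k)) (E k)\<bar> \<le> c' * (e' * h)" .
      qed
      moreover have "(\<Sum>k<t n. c' * (e' * h)) \<le> e"
      proof -
        have "t n * h \<le> K"
        proof -
          have "t n * h \<le> (s * T n) * h" using tT h by (intro mult_right_mono) auto
          also have "\<dots> = s" using pos[of n] by (simp add: h_def)
          finally show ?thesis using s K by simp
        qed
        then have "(t n * h) * (c' * e') \<le> K * (c' * e')" using c' e' by (intro mult_right_mono) auto
        also have "\<dots> \<le> (K * (c' + 1)) * e'" using K e' by (simp add: algebra_simps)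
        also have "\<dots> = e"
        proof -
          have cancel: "y * (e / y) = e" if "y > 0" for y using that by simp
          show ?thesis unfolding e'_def by (rule cancel) (use K c' in auto)
        qed
        finally show ?thesis by (simp add: mult_ac)
      qed
      ultimately show "\<bar>ip (d n) v (\<lambda>i. z (real (t n) / real (T n)) (real i / real (d n))) -
        (ip (d n) (w n v (t n)) (\<lambda>i. z 0 (real i / real (d n)))
         + \<gamma> * (\<Sum>k<t n. ip (d n) (w n v (t n - Suc k)) (\<lambda>i. \<xi> (real (Suc k) / real (T n)) (real i / real (d n)) - \<xi> (real k / real (T n)) (real i / real (d n)))))\<bar> \<le> e"
        by linarith
    qed
  qed
qed

section \<open>Characteristic function of the Gaussian increments\<close>

text \<open>In the degenerate case a point mass with mean 0 sits at 0 and has v = 0; otherwise the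
  variable is rescaled to a standard normal one.\<close>

lemma gaussian_rv_charfn:
  assumes N: "prob_space N" and Y: "gaussian_rv N Y" and m: "has_bochner_integral N Y 0"
    and v: "has_bochner_integral N (\<lambda>\<omega>. (Y \<omega>)\<^sup>2) v"
  shows "(\<integral>\<omega>. iexp (g * Y \<omega>) \<partial>N) = exp (- (g\<^sup>2 * v) / 2)"
proof -
  interpret N: prob_space N by fact
  have Ym [measurable]: "Y \<in> borel_measurable N" using Y by (simp add: gaussian_rv_def)
  have m0: "N.expectation Y = 0" using m by (rule has_bochner_integral_integral_eq)
  have v0: "N.expectation (\<lambda>\<omega>. (Y \<omega>)\<^sup>2) = v" using v by (rule has_bochner_integral_integral_eq)
  have dist: "N.expectation (\<lambda>\<omega>. f (Y \<omega>)) = (\<integral>y. f y \<partial>distr N borel Y)"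
    if [measurable]: "f \<in> borel_measurable borel" for f :: "real \<Rightarrow> 'c::{banach, second_countable_topology}"
    by (rule integral_distr[symmetric]) measurable
  from Y consider \<mu> where "distr N borel Y = return borel \<mu>"
    | \<mu> s where "s > 0" "distr N borel Y = density lborel (normal_density \<mu> s)"
    unfolding gaussian_rv_def by blast
  then show ?thesis
  proof cases
    case 1
    have "\<mu> = 0" using dist[of "\<lambda>y. y"] m0 unfolding 1 by (simp add: integral_return)
    moreover have "v = \<mu>\<^sup>2" using dist[of "\<lambda>y. y\<^sup>2"] v0 unfolding 1 by (simp add: integral_return)
    ultimately show ?thesis using dist[of "\<lambda>y. iexp (g * y)"] unfolding 1 by (simp add: integral_return)
  next
    case 2
    have D: "distributed N lborel Y (normal_density \<mu> s)"
      unfolding distributed_def using 2 by (simp cong: distr_cong)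
    have "\<mu> = 0" using N.normal_distributed_expectation[OF 2(1) D] m0 by simp
    moreover have "s\<^sup>2 = v" using N.normal_distributed_variance[OF 2(1) D] m0 v0 by simp
    moreover have "(\<integral>\<omega>. iexp (g * Y \<omega>) \<partial>N) = char std_normal_distribution (g * s)" if "\<mu> = 0"
    proof -
      have "distributed N lborel (\<lambda>\<omega>. (Y \<omega> - \<mu>) / s) std_normal_density"
        using N.normal_standard_normal_convert[OF 2(1)] D by simp
      then have ds: "distr N lborel (\<lambda>\<omega>. Y \<omega> / s) = std_normal_distribution"
        by (simp add: distributed_def that)
      have "char (distr N lborel (\<lambda>\<omega>. Y \<omega> / s)) (g * s) = (\<integral>\<omega>. iexp (g * s * (Y \<omega> / s)) \<partial>N)"
        unfolding char_def by (rule integral_distr) measurable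
      then show ?thesis unfolding ds using 2(1) by (simp add: mult.commute)
    qed
    ultimately show ?thesis
      by (simp add: char_std_normal_distribution power_mult_distrib)
  qed
qed

text \<open>Increments of the field over distinct time steps are uncorrelated, and over one step
  have covariance A / T, so the variance of \<open>Y\<close> is a sum of quadratic forms of
  \<open>A\<close>. As a finite linear combination of field values, \<open>Y\<close> is
  Gaussian.\<close>

lemma driving_field_charfn:
  fixes t T d :: nat and u :: "nat \<Rightarrow> nat \<Rightarrow> real"
  assumes N: "prob_space N" and \<xi>: "driving_field N \<tau> A \<xi>" and T: "T > 0" and t: "real t / T \<le> \<tau>"
  defines "Y \<equiv> \<lambda>\<omega>. \<Sum>k<t. ip d (u k) (\<lambda>i. \<xi> (real (Suc k) / real T) (real i / real d) \<omega> - \<xi> (real k / real T) (real i / real d) \<omega>)"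
  shows "Y \<in> borel_measurable N"
    and "(\<integral>\<omega>. iexp (g * Y \<omega>) \<partial>N)
      = exp (- (g\<^sup>2 * (1 / T * (\<Sum>k<t. \<Sum>i=1..d. \<Sum>j=1..d. u k i * u k j * A (real i / real d) (real j / real d)))) / 2)"
proof -
  interpret N: prob_space N by fact
  let ?s = "\<lambda>k. real k / T" and ?x = "\<lambda>i. real i / d"
  have s: "?s k \<in> {0..\<tau>}" if "k \<le> t" for k
  proof -
    have "?s k \<le> ?s t" using that by (intro divide_right_mono) auto
    then show ?thesis using t by auto
  qed
  have x: "?x i \<in> {0..1}" if "i \<in> {1..d}" for i using that by auto
  have mean: "has_bochner_integral N (\<xi> a b) 0" if "a \<in> {0..\<tau>}" "b \<in> {0..1}" for a b
    using \<xi> that unfolding driving_field_def by blast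
  have cov: "has_bochner_integral N (\<lambda>\<omega>. \<xi> a b \<omega> * \<xi> a' b' \<omega>) (min a a' * A b b')"
    if "a \<in> {0..\<tau>}" "a' \<in> {0..\<tau>}" "b \<in> {0..1}" "b' \<in> {0..1}" for a a' b b'
    using \<xi> that unfolding driving_field_def by blast
  define \<Delta> where "\<Delta> k i \<omega> = \<xi> (?s (Suc k)) (?x i) \<omega> - \<xi> (?s k) (?x i) \<omega>" for k i \<omega>
  have Y: "Y \<omega> = (\<Sum>k<t. \<Sum>i=1..d. u k i * \<Delta> k i \<omega>)" for \<omega>
    unfolding Y_def \<Delta>_def ip_def ..
  have \<Delta>m: "has_bochner_integral N (\<Delta> k i) 0" if "k < t" "i \<in> {1..d}" for k i
    using has_bochner_integral_diff[OF mean[OF s x] mean[OF s x], of "Suc k" i k i] that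
    unfolding \<Delta>_def by simp
  have \<Delta>c: "has_bochner_integral N (\<lambda>\<omega>. \<Delta> k i \<omega> * \<Delta> l j \<omega>) (if k = l then A (?x i) (?x j) / T else 0)"
    if k: "k < t" and l: "l < t" and i: "i \<in> {1..d}" and j: "j \<in> {1..d}" for k l i j
  proof -
    note c = cov[OF s s x[OF i] x[OF j]]
    have "has_bochner_integral N (\<lambda>\<omega>. (\<xi> (?s (Suc k)) (?x i) \<omega> * \<xi> (?s (Suc l)) (?x j) \<omega> - \<xi> (?s (Suc k)) (?x i) \<omega> * \<xi> (?s l) (?x j) \<omega>)
        - (\<xi> (?s k) (?x i) \<omega> * \<xi> (?s (Suc l)) (?x j) \<omega> - \<xi> (?s k) (?x i) \<omega> * \<xi> (?s l) (?x j) \<omega>))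
      ((min (?s (Suc k)) (?s (Suc l)) * A (?x i) (?x j) - min (?s (Suc k)) (?s l) * A (?x i) (?x j))
        - (min (?s k) (?s (Suc l)) * A (?x i) (?x j) - min (?s k) (?s l) * A (?x i) (?x j)))"
      using k l by (intro has_bochner_integral_diff c) auto
    \<comment> \<open>The mixed second difference of min vanishes off the diagonal and equals the
      step length 1 / T on it.\<close>
    moreover have "(min (?s (Suc k)) (?s (Suc l)) * A (?x i) (?x j) - min (?s (Suc k)) (?s l) * A (?x i) (?x j))
        - (min (?s k) (?s (Suc l)) * A (?x i) (?x j) - min (?s k) (?s l) * A (?x i) (?x j))
        = (if k = l then A (?x i) (?x j) / T else 0)"
    proof -
      have mn: "min (?s a) (?s b) = ?s (min a b)" for a b
        using T by (cases "a \<le> b") (auto simp: min_def divide_right_mono field_simps)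
      consider "k = l" | "k < l" | "l < k" by linarith
      then show ?thesis
        unfolding mn by cases (simp_all add: min.absorb1 min.absorb2 Suc_le_eq add_divide_distrib algebra_simps)
    qed
    ultimately show ?thesis unfolding \<Delta>_def by (simp add: algebra_simps)
  qed
  have EY: "has_bochner_integral N Y 0"
  proof -
    have "has_bochner_integral N (\<lambda>\<omega>. \<Sum>k<t. \<Sum>i=1..d. u k i * \<Delta> k i \<omega>) (\<Sum>k<t. \<Sum>i=1..d. u k i * 0)"
      by (intro has_bochner_integral_sum has_bochner_integral_mult_right \<Delta>m) auto
    then show ?thesis unfolding Y[abs_def] by simp
  qed
  then show Ym: "Y \<in> borel_measurable N" by (rule borel_measurable_has_bochner_integral)
  let ?v = "1 / T * (\<Sum>k<t. \<Sum>i=1..d. \<Sum>j=1..d. u k i * u k j * A (?x i) (?x j))"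
  have EY2: "has_bochner_integral N (\<lambda>\<omega>. (Y \<omega>)\<^sup>2) ?v"
  proof -
    have "has_bochner_integral N (\<lambda>\<omega>. \<Sum>k<t. \<Sum>l<t. \<Sum>i=1..d. \<Sum>j=1..d. (u k i * u l j) * (\<Delta> k i \<omega> * \<Delta> l j \<omega>))
      (\<Sum>k<t. \<Sum>l<t. \<Sum>i=1..d. \<Sum>j=1..d. (u k i * u l j) * (if k = l then A (?x i) (?x j) / T else 0))"
      by (intro has_bochner_integral_sum has_bochner_integral_mult_right \<Delta>c) auto
    moreover have "(Y \<omega>)\<^sup>2 = (\<Sum>k<t. \<Sum>l<t. \<Sum>i=1..d. \<Sum>j=1..d. (u k i * u l j) * (\<Delta> k i \<omega> * \<Delta> l j \<omega>))" for \<omega>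
      unfolding Y power2_eq_square sum_product by (intro sum.cong refl) (simp add: mult_ac)
    moreover have "(\<Sum>k<t. \<Sum>l<t. \<Sum>i=1..d. \<Sum>j=1..d. (u k i * u l j) * (if k = l then A (?x i) (?x j) / T else 0)) = ?v"
    proof -
      have "(\<Sum>l<t. \<Sum>i=1..d. \<Sum>j=1..d. (u k i * u l j) * (if k = l then A (?x i) (?x j) / T else 0))
          = (\<Sum>i=1..d. \<Sum>j=1..d. u k i * u k j * A (?x i) (?x j)) / T" if "k < t" for k
      proof -
        have "(\<Sum>l<t. \<Sum>i=1..d. \<Sum>j=1..d. (u k i * u l j) * (if k = l then A (?x i) (?x j) / T else 0))
          = (\<Sum>l<t. if k = l then (\<Sum>i=1..d. \<Sum>j=1..d. u k i * u k j * A (?x i) (?x j)) / T else 0)"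
          by (intro sum.cong refl) (auto simp: sum_divide_distrib)
        then show ?thesis using that by simp
      qed
      then show ?thesis by (simp add: sum_divide_distrib)
    qed
    ultimately show ?thesis by simp
  qed
  have "gaussian_rv N Y"
  proof -
    define S where "S = ?s ` {..t}"
    define X where "X = ?x ` {1..d}"
    \<comment> \<open>Membership in the span of finitely many field values. Closure under linear
      operations spares an explicit formula for the coefficients of \<open>Y\<close>.\<close>
    define lin where "lin f \<longleftrightarrow> (\<exists>c. \<forall>\<omega>. f \<omega> = (\<Sum>p\<in>S \<times> X. c p * (case p of (a, b) \<Rightarrow> \<xi> a b) \<omega>))" for f :: "'a \<Rightarrow> real"
    have fin: "finite (S \<times> X)" by (simp add: S_def X_def)
    have lin_diff: "lin (\<lambda>\<omega>. f \<omega> - f' \<omega>)" if "lin f" "lin f'" for f f'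
    proof -
      from that obtain c c' where "\<forall>\<omega>. f \<omega> = (\<Sum>p\<in>S \<times> X. c p * (case p of (a, b) \<Rightarrow> \<xi> a b) \<omega>)"
        "\<forall>\<omega>. f' \<omega> = (\<Sum>p\<in>S \<times> X. c' p * (case p of (a, b) \<Rightarrow> \<xi> a b) \<omega>)" unfolding lin_def by blast
      then show ?thesis unfolding lin_def
        by (intro exI[of _ "\<lambda>p. c p - c' p"]) (simp add: left_diff_distrib sum_subtractf)
    qed
    have lin_scale: "lin (\<lambda>\<omega>. b * f \<omega>)" if "lin f" for f b
    proof -
      from that obtain c where "\<forall>\<omega>. f \<omega> = (\<Sum>p\<in>S \<times> X. c p * (case p of (a, b) \<Rightarrow> \<xi> a b) \<omega>)" unfolding lin_def by blast
      then show ?thesis unfolding lin_def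
        by (intro exI[of _ "\<lambda>p. b * c p"]) (simp add: sum_distrib_left mult.assoc)
    qed
    have lin0: "lin (\<lambda>_. 0)" unfolding lin_def by (intro exI[of _ "\<lambda>_. 0"]) simp
    have lin_add: "lin (\<lambda>\<omega>. f \<omega> + f' \<omega>)" if "lin f" "lin f'" for f f'
      using lin_diff[OF that(1) lin_scale[OF that(2), of "-1"]] by simp
    have lin_sum: "lin (\<lambda>\<omega>. \<Sum>i\<in>I. f i \<omega>)" if "finite I" "\<And>i. i \<in> I \<Longrightarrow> lin (f i)" for I :: "nat set" and f
      using that by (induction I rule: finite_induct) (auto intro: lin0 lin_add)
    have lin1: "lin (\<xi> (?s k) (?x i))" if "k \<le> t" "i \<in> {1..d}" for k i
    proof -
      have "(?s k, ?x i) \<in> S \<times> X" using that by (auto simp: S_def X_def)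
      then have "(\<Sum>p\<in>S \<times> X. (if p = (?s k, ?x i) then 1 else 0) * (case p of (a, b) \<Rightarrow> \<xi> a b) \<omega>) = \<xi> (?s k) (?x i) \<omega>" for \<omega>
        using fin by (simp add: if_distrib[of "\<lambda>c. c * _"] sum.delta cong: if_cong)
      then show ?thesis unfolding lin_def
        by (intro exI[of _ "\<lambda>p. if p = (?s k, ?x i) then 1 else 0"]) simp
    qed
    have "lin Y"
      unfolding Y[abs_def] \<Delta>_def by (intro lin_sum lin_scale lin_diff lin1) auto
    then obtain c where c: "\<And>\<omega>. Y \<omega> = (\<Sum>p\<in>S \<times> X. c p * (case p of (a, b) \<Rightarrow> \<xi> a b) \<omega>)"
      unfolding lin_def by blast
    have "gaussian_field_process N \<tau> \<xi>" using \<xi> by (simp add: driving_field_def)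
    moreover have "finite X" "X \<subseteq> {0..1}" "finite S" "S \<subseteq> {0..\<tau>}"
      using s x unfolding X_def S_def by blast+
    ultimately have "gaussian_vector N (S \<times> X) (\<lambda>(t, x). \<xi> t x)"
      unfolding gaussian_field_process_def by blast
    then show ?thesis unfolding gaussian_vector_def c[abs_def] by blast
  qed
  from gaussian_rv_charfn[OF N this EY EY2]
  show "(\<integral>\<omega>. iexp (g * Y \<omega>) \<partial>N) = exp (- (g\<^sup>2 * ?v) / 2)" .
qed

text \<open>Independence of the limiting initial condition and the field splits off the Gaussian
  factor. The alternative \<gamma> = 0 covers low noise, where no field is given.\<close>

lemma limit_charfn:
  fixes t T d :: nat and u :: "nat \<Rightarrow> nat \<Rightarrow> real"
  assumes N: "prob_space N" and \<Theta>0: "random_element N C01 \<Theta>0" and T: "T > 0" and t: "real t / T \<le> \<tau>"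
    and \<gamma>: "\<gamma> = 0 \<or> driving_field N \<tau> A \<xi> \<and> init_indep_field N \<tau> \<Theta>0 \<xi>"
  defines "Y \<equiv> \<lambda>\<omega>. \<Sum>k<t. ip d (u k) (\<lambda>i. \<xi> (real (Suc k) / real T) (real i / real d) \<omega> - \<xi> (real k / real T) (real i / real d) \<omega>)"
  shows "(\<integral>\<omega>. iexp (ip d w (\<lambda>i. \<Theta>0 \<omega> (real i / real d)) + \<gamma> * Y \<omega>) \<partial>N)
      = (\<integral>\<omega>. iexp (ip d w (\<lambda>i. \<Theta>0 \<omega> (real i / real d))) \<partial>N)
        * exp (- (\<gamma>\<^sup>2 * (1 / T * (\<Sum>k<t. \<Sum>i=1..d. \<Sum>j=1..d. u k i * u k j * A (real i / real d) (real j / real d)))) / 2)"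
proof (cases "\<gamma> = 0")
  case False
  with \<gamma> have \<xi>: "driving_field N \<tau> A \<xi>" and ind: "init_indep_field N \<tau> \<Theta>0 \<xi>" by auto
  interpret N: prob_space N by fact
  define F where "F = vimage_algebra (space N) \<Theta>0 (PiM {0..1} (\<lambda>_. borel))"
  define H where "H = vimage_algebra (space N) (\<lambda>\<omega>. \<lambda>(s, x)\<in>{0..\<tau>} \<times> {0..1}. \<xi> s x \<omega>) (PiM ({0..\<tau>} \<times> {0..1}) (\<lambda>_. borel))"
  have ind': "N.indep_set (sets F) (sets H)"
    using ind unfolding init_indep_field_def generated_sets_def F_def H_def .
  have \<Theta>0m: "\<Theta>0 \<in> measurable F (PiM {0..1} (\<lambda>_. borel))"
    unfolding F_def
    by (rule measurable_vimage_algebra1) (use \<Theta>0 in \<open>auto simp: random_element_def space_PiM mspace_C01 PiE_def Pi_iff\<close>)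
  have \<Theta>0x: "(\<lambda>\<omega>. \<Theta>0 \<omega> x) \<in> borel_measurable F" if "x \<in> {0..1}" for x
    by (rule measurable_compose[OF \<Theta>0m measurable_component_singleton[OF that]])
  have \<xi>m: "(\<lambda>\<omega>. \<lambda>(s, x)\<in>{0..\<tau>} \<times> {0..1}. \<xi> s x \<omega>) \<in> measurable H (PiM ({0..\<tau>} \<times> {0..1}) (\<lambda>_. borel))"
    unfolding H_def by (rule measurable_vimage_algebra1) (auto simp: space_PiM)
  have \<xi>x: "\<xi> s x \<in> borel_measurable H" if "s \<in> {0..\<tau>}" "x \<in> {0..1}" for s x
    using measurable_compose[OF \<xi>m measurable_component_singleton[of "(s, x)"]] that by simp
  have s: "real k / T \<in> {0..\<tau>}" if "k \<le> t" for k
  proof -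
    have "real k / T \<le> real t / T" using that by (intro divide_right_mono) auto
    then show ?thesis using t by auto
  qed
  have x: "real i / d \<in> {0..1}" if "i \<in> {1..d}" for i using that by auto
  have m1: "(\<lambda>\<omega>. ip d w (\<lambda>i. \<Theta>0 \<omega> (real i / real d))) \<in> borel_measurable F"
    unfolding ip_def by (intro borel_measurable_sum borel_measurable_times borel_measurable_const \<Theta>0x x)
  have m2: "Y \<in> borel_measurable H"
    unfolding Y_def ip_def
    by (intro borel_measurable_sum borel_measurable_times borel_measurable_diff borel_measurable_const \<xi>x s x) auto
  have m3: "(\<lambda>\<omega>. ip d w (\<lambda>i. \<Theta>0 \<omega> (real i / real d))) \<in> borel_measurable N"
    unfolding ip_def by (intro borel_measurable_sum borel_measurable_times borel_measurable_const C01_eval_measurable[OF \<Theta>0] x)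
  have m4: "Y \<in> borel_measurable N" unfolding Y_def by (rule driving_field_charfn(1)[OF N \<xi> T t])
  have ec: "(\<lambda>y. iexp y) \<in> borel_measurable borel" "(\<lambda>y. iexp (\<gamma> * y)) \<in> borel_measurable borel" by measurable
  have "(\<integral>\<omega>. iexp (ip d w (\<lambda>i. \<Theta>0 \<omega> (real i / real d)) + \<gamma> * Y \<omega>) \<partial>N)
      = (\<integral>\<omega>. iexp (ip d w (\<lambda>i. \<Theta>0 \<omega> (real i / real d))) * iexp (\<gamma> * Y \<omega>) \<partial>N)"
    by (simp add: exp_add distrib_left)
  also have "\<dots> = (\<integral>\<omega>. iexp (ip d w (\<lambda>i. \<Theta>0 \<omega> (real i / real d))) \<partial>N) * (\<integral>\<omega>. iexp (\<gamma> * Y \<omega>) \<partial>N)"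
  proof (rule N.indep_set_expectation_mult(2)[OF ind'])
    show "(\<lambda>\<omega>. iexp (ip d w (\<lambda>i. \<Theta>0 \<omega> (real i / real d)))) \<in> borel_measurable F" by (rule measurable_compose[OF m1 ec(1)])
    show "(\<lambda>\<omega>. iexp (\<gamma> * Y \<omega>)) \<in> borel_measurable H" by (rule measurable_compose[OF m2 ec(2)])
    show "integrable N (\<lambda>\<omega>. iexp (ip d w (\<lambda>i. \<Theta>0 \<omega> (real i / real d))))" by (rule N.integrable_iexp_rv[OF m3])
    show "integrable N (\<lambda>\<omega>. iexp (\<gamma> * Y \<omega>))"
      by (rule N.integrable_iexp_rv) (intro borel_measurable_times borel_measurable_const m4)
  qed (simp_all add: F_def H_def)
  also have "(\<integral>\<omega>. iexp (\<gamma> * Y \<omega>) \<partial>N)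
      = exp (- (\<gamma>\<^sup>2 * (1 / T * (\<Sum>k<t. \<Sum>i=1..d. \<Sum>j=1..d. u k i * u k j * A (real i / real d) (real j / real d)))) / 2)"
    unfolding Y_def by (rule driving_field_charfn(2)[OF N \<xi> T t])
  finally show ?thesis .
qed simp

section \<open>Pointwise characteristic functions along the limiting sequence\<close>

lemma interp_grid:
  assumes "d > 0" "i \<le> d"
  shows "interp d v (real i / real d) = v i"
  using assms by (simp add: interp_def)

text \<open>At x = 1 the index \<open>Suc i\<close> would leave the grid; there \<mu> = 0, so the
  stray value never counts.\<close>

lemma interp_decompose:
  assumes d: "d > 0" and x: "x \<in> {0..1}"
  obtains i \<mu> where "i \<le> d" "Suc i \<le> d \<or> \<mu> = 0" "0 \<le> \<mu>" "\<mu> \<le> 1" "real d * x = real i + \<mu>"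
    "\<And>v. interp d v x = (1 - \<mu>) * v i + \<mu> * v (Suc i)"
proof -
  define i where "i = nat \<lfloor>real d * x\<rfloor>"
  define \<mu> where "\<mu> = real d * x - real i"
  have dx: "0 \<le> real d * x" "real d * x \<le> d" using x by (auto simp: mult_left_le)
  have i: "real i = of_int \<lfloor>real d * x\<rfloor>" using dx by (simp add: i_def)
  have \<mu>: "0 \<le> \<mu>" "\<mu> \<le> 1" unfolding \<mu>_def i by linarith+
  have "real i \<le> d" using dx(2) \<mu> by (simp add: \<mu>_def)
  then have id: "i \<le> d" by simp
  have "Suc i \<le> d \<or> \<mu> = 0"
  proof (cases "i = d")
    case True
    then show ?thesis using dx(2) \<mu>(1) by (simp add: \<mu>_def)
  qed (use id in simp)
  moreover have "real d * x = real i + \<mu>" by (simp add: \<mu>_def)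
  moreover have "interp d v x = (1 - \<mu>) * v i + \<mu> * v (Suc i)" for v
    unfolding interp_def \<mu>_def i_def[symmetric] i[symmetric] by (simp add: algebra_simps)
  ultimately show thesis by (rule that[OF id _ \<mu>])
qed

text \<open>Written with clipped linear ramps, the interpolant is visibly continuous; no pieces have
  to be glued at the nodes.\<close>

lemma interp_eq_sum_ramps:
  assumes d: "d > 0" and x: "x \<in> {0..1}"
  shows "interp d v x = v 0 + (\<Sum>k<d. (v (Suc k) - v k) * max 0 (min 1 (real d * x - real k)))"
proof -
  obtain i \<mu> where i: "i \<le> d" "Suc i \<le> d \<or> \<mu> = 0" "0 \<le> \<mu>" "\<mu> \<le> 1" "real d * x = real i + \<mu>"
    and eq: "\<And>v. interp d v x = (1 - \<mu>) * v i + \<mu> * v (Suc i)"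
    using interp_decompose[OF d x] by metis
  let ?f = "\<lambda>k. (v (Suc k) - v k) * max 0 (min 1 (real d * x - real k))"
  have "(\<Sum>k<i. ?f k) = (\<Sum>k<i. v (Suc k) - v k)"
    using i by (intro sum.cong refl) (auto simp: max_def min_def)
  then have 1: "(\<Sum>k<i. ?f k) = v i - v 0" by (simp add: sum_lessThan_telescope)
  have 2: "(\<Sum>k\<in>{i..<d}. ?f k) = \<mu> * (v (Suc i) - v i)"
  proof (cases "i < d")
    case True
    have "(\<Sum>k\<in>{i..<d}. ?f k) = ?f i + (\<Sum>k\<in>{Suc i..<d}. ?f k)"
      using True by (rule sum.atLeast_Suc_lessThan)
    also have "(\<Sum>k\<in>{Suc i..<d}. ?f k) = 0"
      using i by (intro sum.neutral) (auto simp: max_def min_def)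
    finally show ?thesis using i by (simp add: max_def min_def)
  qed (use i in auto)
  have "(\<Sum>k<d. ?f k) = (\<Sum>k<i. ?f k) + (\<Sum>k\<in>{i..<d}. ?f k)"
    using i(1) by (simp add: sum.atLeastLessThan_concat lessThan_atLeast0)
  then show ?thesis unfolding eq 1 2 by (simp add: algebra_simps)
qed

lemma continuous_on_interp:
  assumes d: "d > 0" shows "continuous_on {0..1} (interp d v)"
proof -
  have "continuous_on {0..1} (\<lambda>x. v 0 + (\<Sum>k<d. (v (Suc k) - v k) * max 0 (min 1 (real d * x - real k))))"
    by (intro continuous_intros)
  then show ?thesis
    by (rule continuous_on_cong[THEN iffD1, OF refl, rotated]) (simp add: interp_eq_sum_ramps[OF d])
qed

lemma Theta_init_C01: "d > 0 \<Longrightarrow> Theta_init d \<theta>s \<theta> \<omega> \<in> mspace C01"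
  unfolding mspace_C01 Theta_init_def using continuous_on_interp[of d]
  by (auto cong: continuous_on_cong_simp)

text \<open>All members share \<open>M\<close>, \<open>W\<close> and the constant K. The condition
  \<tau> \<le> K keeps every time \<open>t n\<close> within the K T steps for which the moment
  bounds hold.\<close>

locale sgd_sequence =
  fixes M :: "'a measure" and W :: "real \<Rightarrow> real \<Rightarrow> 'a \<Rightarrow> real" and A :: "real \<Rightarrow> real \<Rightarrow> real"
    and B E :: "real list \<Rightarrow> real" and d T :: "nat \<Rightarrow> nat" and \<eta> \<sigma> :: "nat \<Rightarrow> real" and C1 :: real
    and \<theta>s :: "nat \<Rightarrow> nat \<Rightarrow> real" and \<epsilon> :: "nat \<Rightarrow> nat \<Rightarrow> 'a \<Rightarrow> real"
    and \<theta> :: "nat \<Rightarrow> nat \<Rightarrow> nat \<Rightarrow> 'a \<Rightarrow> real" and K \<tau> s :: real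
  assumes sgd: "\<And>n. bounded_sgd M W A B E (d n) (T n) (\<eta> n) (\<sigma> n) C1 (\<theta>s n) (\<epsilon> n) (\<theta> n) K"
    and d_lim: "filterlim d at_top sequentially" and T_lim: "filterlim T at_top sequentially"
    and s: "s \<in> {0..\<tau>}" and \<tau>: "\<tau> \<le> K"
begin

sublocale white_field M W A B E
  using sgd[of 0] unfolding bounded_sgd_def online_sgd_def by blast

lemma d_pos: "d n > 0" and T_pos: "T n > 0" and \<eta>_pos: "\<eta> n > 0" and K_ge_1: "K \<ge> 1" and \<sigma>_nonneg: "\<sigma> n \<ge> 0"
proof -
  interpret bounded_sgd M W A B E "d n" "T n" "\<eta> n" "\<sigma> n" C1 "\<theta>s n" "\<epsilon> n" "\<theta> n" K by (rule sgd)
  show "d n > 0" "T n > 0" "\<eta> n > 0" "K \<ge> 1" "\<sigma> n \<ge> 0" by (rule d_pos T_pos \<eta>_pos K_ge_1 \<sigma>_nonneg)+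
qed

lemma A_bound: "\<lbrakk>y \<in> {0..1}; z \<in> {0..1}\<rbrakk> \<Longrightarrow> \<bar>A y z\<bar> \<le> K"
  and A_lip: "\<lbrakk>x \<in> {0..1}; y \<in> {0..1}; z \<in> {0..1}\<rbrakk> \<Longrightarrow> \<bar>A x z - A y z\<bar> \<le> K * \<bar>x - y\<bar>"
  and drift_le: "\<eta> n * d n * T n \<le> K" and noise_le: "\<sigma> n * \<eta> n * sqrt (T n) \<le> K"
proof -
  interpret bounded_sgd M W A B E "d n" "T n" "\<eta> n" "\<sigma> n" C1 "\<theta>s n" "\<epsilon> n" "\<theta> n" K by (rule sgd)
  show "\<lbrakk>y \<in> {0..1}; z \<in> {0..1}\<rbrakk> \<Longrightarrow> \<bar>A y z\<bar> \<le> K"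
    "\<lbrakk>x \<in> {0..1}; y \<in> {0..1}; z \<in> {0..1}\<rbrakk> \<Longrightarrow> \<bar>A x z - A y z\<bar> \<le> K * \<bar>x - y\<bar>"
    "\<eta> n * d n * T n \<le> K" "\<sigma> n * \<eta> n * sqrt (T n) \<le> K"
    by (rule A_bound A_lip drift_le noise_le; assumption)+
qed

definition t :: "nat \<Rightarrow> nat" where
  "t n = nat \<lfloor>s * T n\<rfloor>"

definition err :: "nat \<Rightarrow> nat \<Rightarrow> nat \<Rightarrow> 'a \<Rightarrow> real" where
  "err n k i \<omega> = \<theta> n k i \<omega> - \<theta>s n i"

definition grid_a :: "nat \<Rightarrow> nat \<Rightarrow> nat \<Rightarrow> real" where
  "grid_a n i j = A (real i / real (d n)) (real j / real (d n))"

definition w :: "nat \<Rightarrow> (nat \<Rightarrow> real) \<Rightarrow> nat \<Rightarrow> nat \<Rightarrow> real" where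
  "w n = dual (grid_a n) (d n) (\<eta> n)"

definition quad :: "nat \<Rightarrow> (nat \<Rightarrow> real) \<Rightarrow> real" where
  "quad n v = (\<Sum>i=1..d n. \<Sum>j=1..d n. v i * v j * grid_a n i j)"

definition init :: "nat \<Rightarrow> 'a \<Rightarrow> real \<Rightarrow> real" where
  "init n = Theta_init (d n) (\<theta>s n) (\<theta> n)"

lemma t_le: "real (t n) \<le> s * T n"
  using s by (simp add: t_def of_nat_nat)

lemma t_le_K: "real (t n) \<le> K * T n"
proof -
  have "s * T n \<le> K * T n" using s \<tau> by (intro mult_right_mono) auto
  then show ?thesis using t_le[of n] by linarith
qed

lemma t_div_le: "real (t n) / T n \<le> s"
  using t_le[of n] T_pos[of n] by (simp add: divide_le_eq)

lemma t_div_in: "real (t n) / T n \<in> {0..\<tau>}"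
  using t_div_le[of n] s by auto

lemma inverse_tendsto: "(\<lambda>n. 1 / real (d n)) \<longlonglongrightarrow> 0" "(\<lambda>n. 1 / real (T n)) \<longlonglongrightarrow> 0"
proof -
  have "(\<lambda>n. 1 / real (f n)) \<longlonglongrightarrow> 0" if "filterlim f at_top sequentially" for f :: "nat \<Rightarrow> nat"
    by (rule tendsto_divide_0[OF tendsto_const filterlim_at_top_imp_at_infinity[OF filterlim_compose[OF filterlim_real_sequentially that]]])
  then show "(\<lambda>n. 1 / real (d n)) \<longlonglongrightarrow> 0" "(\<lambda>n. 1 / real (T n)) \<longlonglongrightarrow> 0" using d_lim T_lim by auto
qed

lemma t_div_tendsto: "(\<lambda>n. real (t n) / T n) \<longlonglongrightarrow> s"
proof (rule tendsto_sandwich[of "\<lambda>n. s - 1 / T n" _ _ "\<lambda>_. s"])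
  have "s - 1 / T n \<le> real (t n) / T n" for n
  proof -
    have "s * T n - 1 \<le> real (t n)" using s by (simp add: t_def of_nat_nat)
    then have "(s * T n - 1) / T n \<le> real (t n) / T n" by (intro divide_right_mono) auto
    then show ?thesis using T_pos[of n] by (simp add: diff_divide_distrib)
  qed
  then show "\<forall>\<^sub>F n in sequentially. s - 1 / T n \<le> real (t n) / T n" by simp
  show "\<forall>\<^sub>F n in sequentially. real (t n) / T n \<le> s" by (simp add: t_div_le)
  show "(\<lambda>n. s - 1 / T n) \<longlonglongrightarrow> s" using tendsto_diff[OF tendsto_const inverse_tendsto(2), of s] by simp
qed simp

lemma init_grid: "i \<in> {1..d n} \<Longrightarrow> init n \<omega> (real i / real (d n)) = err n 0 i \<omega>"
  by (simp add: init_def Theta_init_def interp_grid[OF d_pos] sgd_err_def err_def)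

lemma err_moment:
  assumes "i \<in> {1..d n}"
  shows "square_integrable M (err n (t n) i)" "square_integrable M (err n 0 i)"
    "expectation (\<lambda>\<omega>. (err n (t n) i \<omega>)\<^sup>2) \<le> second_moment_const K"
    "j \<in> {1..d n} \<Longrightarrow> expectation (\<lambda>\<omega>. (err n (t n) i \<omega> - err n (t n) j \<omega>)\<^sup>2)
      \<le> increment_const K * ((real i - real j) / d n)\<^sup>2"
proof -
  interpret S: bounded_sgd M W A B E "d n" "T n" "\<eta> n" "\<sigma> n" C1 "\<theta>s n" "\<epsilon> n" "\<theta> n" K by (rule sgd)
  have D: "S.D = err n" by (simp add: S.D_def err_def fun_eq_iff)
  show "square_integrable M (err n (t n) i)" "square_integrable M (err n 0 i)"
    "expectation (\<lambda>\<omega>. (err n (t n) i \<omega>)\<^sup>2) \<le> second_moment_const K"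
    "j \<in> {1..d n} \<Longrightarrow> expectation (\<lambda>\<omega>. (err n (t n) i \<omega> - err n (t n) j \<omega>)\<^sup>2)
      \<le> increment_const K * ((real i - real j) / d n)\<^sup>2"
    using S.D_square_integrable[of i "t n"] S.D_square_integrable[of i 0] S.D_moment[of i "t n"]
      S.D_increment[of i j "t n"] assms t_le_K[of n] unfolding D by auto
qed

lemma err_measurable: "i \<in> {1..d n} \<Longrightarrow> err n (t n) i \<in> borel_measurable M" "i \<in> {1..d n} \<Longrightarrow> err n 0 i \<in> borel_measurable M"
  by (rule square_integrable_measurable[OF err_moment(1)] square_integrable_measurable[OF err_moment(2)]; assumption)+

lemma l1_w_le: "k \<le> t n \<Longrightarrow> l1 (d n) (w n v k) \<le> exp (K ^ 3) * l1 (d n) v"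
proof -
  assume "k \<le> t n"
  interpret S: bounded_sgd M W A B E "d n" "T n" "\<eta> n" "\<sigma> n" C1 "\<theta>s n" "\<epsilon> n" "\<theta> n" K by (rule sgd)
  have a: "S.a = grid_a n" by (simp add: S.a_def grid_a_def fun_eq_iff)
  show ?thesis
    using S.l1_dual_le_exp[of k v] t_le_K[of n] \<open>k \<le> t n\<close> unfolding a w_def by linarith
qed

lemma quad_bounds:
  assumes "k \<le> t n"
  shows "0 \<le> quad n (w n v k)" "quad n (w n v k) \<le> K * (exp (K ^ 3) * l1 (d n) v)\<^sup>2"
proof -
  interpret S: bounded_sgd M W A B E "d n" "T n" "\<eta> n" "\<sigma> n" C1 "\<theta>s n" "\<epsilon> n" "\<theta> n" K by (rule sgd)
  have a: "S.quad_a = quad n" by (simp add: S.quad_a_def S.a_def quad_def grid_a_def fun_eq_iff)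
  show "0 \<le> quad n (w n v k)" using S.quad_a_nonneg unfolding a .
  have "quad n (w n v k) \<le> K * (l1 (d n) (w n v k))\<^sup>2" using S.quad_a_le unfolding a .
  also have "\<dots> \<le> K * (exp (K ^ 3) * l1 (d n) v)\<^sup>2"
    using l1_w_le[OF assms] l1_nonneg K_ge_1 by (intro mult_left_mono power_mono) auto
  finally show "quad n (w n v k) \<le> K * (exp (K ^ 3) * l1 (d n) v)\<^sup>2" .
qed

lemma err_charfn:
  assumes v: "l1 (d n) v \<le> c" and c: "1 \<le> c"
  shows "norm (expectation (\<lambda>\<omega>. iexp (ip (d n) v (\<lambda>i. err n (t n) i \<omega>)))
      - expectation (\<lambda>\<omega>. iexp (ip (d n) (w n v (t n)) (\<lambda>i. err n 0 i \<omega>)))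
        * exp (- ((\<eta> n * \<sigma> n)\<^sup>2 * (\<Sum>k<t n. quad n (w n v k))) / 2))
    \<le> charfn_error K c / sqrt (T n)"
proof -
  interpret S: bounded_sgd M W A B E "d n" "T n" "\<eta> n" "\<sigma> n" C1 "\<theta>s n" "\<epsilon> n" "\<theta> n" K by (rule sgd)
  have e: "S.D = err n" "S.a = grid_a n" "S.quad_a = quad n"
    by (simp_all add: S.D_def err_def S.quad_a_def S.a_def quad_def grid_a_def fun_eq_iff)
  show ?thesis using S.ipD_charfn[OF v c t_le_K] unfolding S.ipD_def e w_def by simp
qed

text \<open>What separates the error from its propagated start is the noise sum plus the martingale
  sum. The first summand of the bound vanishes together with the noise scale, which serves the
  low-noise regime.\<close>

lemma err_linear_part:
  assumes v: "l1 (d n) v \<le> c"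
  shows "square_integrable M (\<lambda>\<omega>. ip (d n) v (\<lambda>i. err n (t n) i \<omega>) - ip (d n) (w n v (t n)) (\<lambda>i. err n 0 i \<omega>))"
    and "expectation (\<lambda>\<omega>. (ip (d n) v (\<lambda>i. err n (t n) i \<omega>) - ip (d n) (w n v (t n)) (\<lambda>i. err n 0 i \<omega>))\<^sup>2)
      \<le> 2 * (K ^ 3 * (exp (K ^ 3) * c)\<^sup>2) * (\<sigma> n * \<eta> n * sqrt (T n))\<^sup>2
        + 2 * (4 * K ^ 5 * (exp (K ^ 3) * c)\<^sup>2 * second_moment_const K) * (1 / T n)"
proof -
  interpret S: bounded_sgd M W A B E "d n" "T n" "\<eta> n" "\<sigma> n" C1 "\<theta>s n" "\<epsilon> n" "\<theta> n" K by (rule sgd)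
  have e: "S.D = err n" "S.a = grid_a n"
    by (simp_all add: S.D_def err_def S.a_def grid_a_def fun_eq_iff)
  let ?X = "\<lambda>\<omega>. ip (d n) v (\<lambda>i. err n (t n) i \<omega>) - ip (d n) (w n v (t n)) (\<lambda>i. err n 0 i \<omega>)"
  let ?N = "\<lambda>\<omega>. \<Sum>k<t n. S.noise_term (w n v (t n - Suc k)) k \<omega>"
  let ?R = "\<lambda>\<omega>. \<Sum>k<t n. S.mart_term (w n v (t n - Suc k)) k \<omega>"
  note N = S.noise_sum_square[OF v t_le_K, unfolded e, folded w_def]
  note R = S.mart_sum_square[OF v t_le_K, unfolded e, folded w_def]
  have eq: "?X \<omega> = ?N \<omega> + ?R \<omega>" if "\<omega> \<in> space M" for \<omega>
    using S.duhamel[OF that order_refl[of "t n"], of v] unfolding S.ipD_def e w_def by simp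
  show sq: "square_integrable M ?X"
    unfolding ip_def by (intro square_integrable_diff square_integrable_sum square_integrable_cmult err_moment)
  have "expectation (\<lambda>\<omega>. (?X \<omega>)\<^sup>2) \<le> expectation (\<lambda>\<omega>. 2 * (?N \<omega>)\<^sup>2 + 2 * (?R \<omega>)\<^sup>2)"
  proof (rule integral_mono)
    fix \<omega> assume \<omega>: "\<omega> \<in> space M"
    show "(?X \<omega>)\<^sup>2 \<le> 2 * (?N \<omega>)\<^sup>2 + 2 * (?R \<omega>)\<^sup>2"
      unfolding eq[OF \<omega>] using zero_le_power2[of "?N \<omega> - ?R \<omega>"] unfolding power2_sum power2_diff by linarith
  qed (use sq N(1) R(1) in \<open>auto simp: square_integrable_def\<close>)
  also have "\<dots> = 2 * expectation (\<lambda>\<omega>. (?N \<omega>)\<^sup>2) + 2 * expectation (\<lambda>\<omega>. (?R \<omega>)\<^sup>2)"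
    using N(1) R(1) by (simp add: square_integrable_def)
  also have "\<dots> \<le> 2 * (K ^ 3 * (exp (K ^ 3) * c)\<^sup>2 * (\<sigma> n * \<eta> n * sqrt (T n))\<^sup>2)
      + 2 * (4 * K ^ 5 * (exp (K ^ 3) * c)\<^sup>2 * second_moment_const K / T n)"
    by (intro add_mono mult_left_mono N(2) R(2)) auto
  finally show "expectation (\<lambda>\<omega>. (?X \<omega>)\<^sup>2)
      \<le> 2 * (K ^ 3 * (exp (K ^ 3) * c)\<^sup>2) * (\<sigma> n * \<eta> n * sqrt (T n))\<^sup>2
        + 2 * (4 * K ^ 5 * (exp (K ^ 3) * c)\<^sup>2 * second_moment_const K) * (1 / T n)"
    by simp
qed

lemma init_measurable: "x \<in> {0..1} \<Longrightarrow> (\<lambda>\<omega>. init n \<omega> x) \<in> borel_measurable M"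
proof -
  assume x: "x \<in> {0..1}"
  obtain i \<mu> where i: "i \<le> d n" "Suc i \<le> d n \<or> \<mu> = 0"
    and eq: "\<And>v. interp (d n) v x = (1 - \<mu>) * v i + \<mu> * v (Suc i)"
    using interp_decompose[OF d_pos x] by metis
  have m: "(\<lambda>\<omega>. sgd_err (\<theta>s n) (\<theta> n) \<omega> 0 j) \<in> borel_measurable M" if "j \<le> d n" for j
  proof -
    have "(if j = 0 then 1 else j) \<in> {1..d n}" using that d_pos[of n] by auto
    from err_measurable(2)[OF this] show ?thesis
      by (simp add: sgd_err_def err_def[abs_def] Let_def)
  qed
  have "(\<lambda>\<omega>. (1 - \<mu>) * sgd_err (\<theta>s n) (\<theta> n) \<omega> 0 i + \<mu> * sgd_err (\<theta>s n) (\<theta> n) \<omega> 0 (Suc i)) \<in> borel_measurable M"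
    using i m[of i] m[of "Suc i"] by (cases "\<mu> = 0") auto
  then show ?thesis using x by (simp add: init_def Theta_init_def eq)
qed

text \<open>An interpolated value is moved to a node within distance 1 / d; each move costs at most
  K / d in mean, and between nodes the increments are Lipschitz in mean. The leftover 1 / d in the
  last bound is the \<rho> of the coarse approximation.\<close>

lemma init_moments:
  assumes x: "x \<in> {0..1}" and y: "y \<in> {0..1}"
  shows "integrable M (\<lambda>\<omega>. init n \<omega> x)" "expectation (\<lambda>\<omega>. \<bar>init n \<omega> x\<bar>) \<le> 4 * K"
    "expectation (\<lambda>\<omega>. \<bar>init n \<omega> x - init n \<omega> y\<bar>) \<le> 4 * K * (\<bar>x - y\<bar> + 1 / d n)"
proof -
  interpret S: bounded_sgd M W A B E "d n" "T n" "\<eta> n" "\<sigma> n" C1 "\<theta>s n" "\<epsilon> n" "\<theta> n" K by (rule sgd)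
  define V where "V j \<omega> = sgd_err (\<theta>s n) (\<theta> n) \<omega> 0 j" for j \<omega>
  \<comment> \<open>By convention index 0 carries the value at index 1; this map does not increase
    distances of indices.\<close>
  define pos where "pos j = (if j = 0 then 1 else j)" for j :: nat
  have Vp: "V j = S.D 0 (pos j)" for j by (simp add: V_def sgd_err_def S.D_def pos_def fun_eq_iff Let_def)
  have pos: "pos j \<in> {1..d n}" if "j \<le> d n" for j using that d_pos[of n] by (auto simp: pos_def)
  have Ksq: "K \<le> K\<^sup>2" using K_ge_1 by (simp add: self_le_power)
  have K0: "0 \<le> K" using K_ge_1 by simp
  have Vsq: "square_integrable M (V j)" if "j \<le> d n" for j
    unfolding Vp by (rule S.init_square_integrable[OF pos[OF that]])
  have V1: "expectation (\<lambda>\<omega>. \<bar>V j \<omega>\<bar>) \<le> K" if "j \<le> d n" for j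
    using S.init_moment[OF pos[OF that]] Ksq K0 Vsq[OF that] unfolding Vp
    by (intro expectation_abs_le_sqrt) auto
  have V2: "expectation (\<lambda>\<omega>. \<bar>V i \<omega> - V j \<omega>\<bar>) \<le> K * (\<bar>real i - real j\<bar> / d n)" if "i \<le> d n" "j \<le> d n" for i j
  proof (rule expectation_abs_le_sqrt)
    show "square_integrable M (\<lambda>\<omega>. V i \<omega> - V j \<omega>)" by (intro square_integrable_diff Vsq that)
    have "\<bar>real (pos i) - real (pos j)\<bar> \<le> \<bar>real i - real j\<bar>" by (auto simp: pos_def)
    then have p: "(real (pos i) - real (pos j))\<^sup>2 \<le> (real i - real j)\<^sup>2" by (simp add: abs_le_square_iff)
    have "expectation (\<lambda>\<omega>. (V i \<omega> - V j \<omega>)\<^sup>2) \<le> K * ((real (pos i) - real (pos j)) / d n)\<^sup>2"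
      unfolding Vp by (rule S.init_incr[OF pos[OF that(1)] pos[OF that(2)]])
    also have "\<dots> \<le> K\<^sup>2 * ((real i - real j) / d n)\<^sup>2"
      unfolding power_divide using p Ksq K0 by (intro mult_mono divide_right_mono) auto
    also have "\<dots> = (K * (\<bar>real i - real j\<bar> / d n))\<^sup>2" by (simp add: power_mult_distrib power_divide)
    finally show "expectation (\<lambda>\<omega>. (V i \<omega> - V j \<omega>)\<^sup>2) \<le> (K * (\<bar>real i - real j\<bar> / d n))\<^sup>2" .
  qed (use K0 in auto)
  have near: "\<exists>i\<le>d n. \<bar>x - real i / d n\<bar> \<le> 1 / d n \<and> integrable M (\<lambda>\<omega>. init n \<omega> x) \<and>
      expectation (\<lambda>\<omega>. \<bar>init n \<omega> x - V i \<omega>\<bar>) \<le> K * (1 / d n)" if x: "x \<in> {0..1}" for x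
  proof -
    obtain i \<mu> where i: "i \<le> d n" "Suc i \<le> d n \<or> \<mu> = 0" "0 \<le> \<mu>" "\<mu> \<le> 1" "real (d n) * x = real i + \<mu>"
      and eq: "\<And>v. interp (d n) v x = (1 - \<mu>) * v i + \<mu> * v (Suc i)"
      using interp_decompose[OF d_pos x] by metis
    have ini: "init n \<omega> x = V i \<omega> + \<mu> * (V (Suc i) \<omega> - V i \<omega>)" for \<omega>
      using x by (simp add: init_def Theta_init_def eq V_def algebra_simps)
    have "x - real i / d n = \<mu> / d n" using i(5) d_pos[of n] by (simp add: field_simps)
    then have 1: "\<bar>x - real i / d n\<bar> \<le> 1 / d n" using i by (simp add: divide_right_mono)
    have iV: "integrable M (V i)" by (rule square_integrable_integrable[OF Vsq[OF i(1)]])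
    show ?thesis
    proof (cases "\<mu> = 0")
      case True
      then show ?thesis using 1 i(1) iV K0 by (intro exI[of _ i]) (simp add: ini)
    next
      case False
      then have Si: "Suc i \<le> d n" using i by simp
      have iV': "integrable M (V (Suc i))" by (rule square_integrable_integrable[OF Vsq[OF Si]])
      have "expectation (\<lambda>\<omega>. \<bar>init n \<omega> x - V i \<omega>\<bar>) = \<mu> * expectation (\<lambda>\<omega>. \<bar>V (Suc i) \<omega> - V i \<omega>\<bar>)"
        using i by (simp add: ini abs_mult)
      also have "\<dots> \<le> 1 * (K * (\<bar>real (Suc i) - real i\<bar> / d n))"
        using V2[OF Si i(1)] i by (intro mult_mono) auto
      finally show ?thesis using 1 i(1) iV iV' by (intro exI[of _ i]) (simp add: ini)
    qed
  qed
  obtain i where i: "i \<le> d n" "\<bar>x - real i / d n\<bar> \<le> 1 / d n" "integrable M (\<lambda>\<omega>. init n \<omega> x)"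
      "expectation (\<lambda>\<omega>. \<bar>init n \<omega> x - V i \<omega>\<bar>) \<le> K * (1 / d n)" using near[OF x] by blast
  obtain j where j: "j \<le> d n" "\<bar>y - real j / d n\<bar> \<le> 1 / d n" "integrable M (\<lambda>\<omega>. init n \<omega> y)"
      "expectation (\<lambda>\<omega>. \<bar>init n \<omega> y - V j \<omega>\<bar>) \<le> K * (1 / d n)" using near[OF y] by blast
  have iV: "integrable M (V i)" "integrable M (V j)" using square_integrable_integrable[OF Vsq] i(1) j(1) by auto
  show "integrable M (\<lambda>\<omega>. init n \<omega> x)" by (rule i(3))
  have d1: "1 / d n \<le> (1::real)" using d_pos[of n] by simp
  have "expectation (\<lambda>\<omega>. \<bar>init n \<omega> x\<bar>) \<le> expectation (\<lambda>\<omega>. \<bar>init n \<omega> x - V i \<omega>\<bar> + \<bar>V i \<omega>\<bar>)"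
    using i(3) iV by (intro integral_mono) auto
  also have "\<dots> \<le> K * (1 / d n) + K" using i iV V1[OF i(1)] by simp
  also have "\<dots> \<le> 4 * K" using mult_left_mono[OF d1 K0] K0 by linarith
  finally show "expectation (\<lambda>\<omega>. \<bar>init n \<omega> x\<bar>) \<le> 4 * K" .
  have "expectation (\<lambda>\<omega>. \<bar>init n \<omega> x - init n \<omega> y\<bar>)
      \<le> expectation (\<lambda>\<omega>. \<bar>init n \<omega> x - V i \<omega>\<bar> + (\<bar>init n \<omega> y - V j \<omega>\<bar> + \<bar>V i \<omega> - V j \<omega>\<bar>))"
    using i(3) j(3) iV by (intro integral_mono) auto
  also have "\<dots> = expectation (\<lambda>\<omega>. \<bar>init n \<omega> x - V i \<omega>\<bar>) + (expectation (\<lambda>\<omega>. \<bar>init n \<omega> y - V j \<omega>\<bar>) + expectation (\<lambda>\<omega>. \<bar>V i \<omega> - V j \<omega>\<bar>))"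
    using i(3) j(3) iV by simp
  also have "\<dots> \<le> K * (1 / d n) + (K * (1 / d n) + K * (\<bar>real i - real j\<bar> / d n))"
    by (intro add_mono i(4) j(4) V2 i(1) j(1))
  also have "\<dots> = K * (2 / d n + \<bar>real i - real j\<bar> / d n)" by (simp add: algebra_simps)
  also have "\<dots> \<le> K * (4 * (\<bar>x - y\<bar> + 1 / d n))"
  proof (intro mult_left_mono K0)
    have "\<bar>real i - real j\<bar> / d n = \<bar>real i / d n - real j / d n\<bar>" by (simp add: diff_divide_distrib[symmetric] abs_divide)
    also have "\<dots> \<le> \<bar>x - y\<bar> + 2 * (1 / d n)" using i(2) j(2) by linarith
    finally have "\<bar>real i - real j\<bar> / d n \<le> \<bar>x - y\<bar> + 2 * (1 / d n)" .
    then show "2 / d n + \<bar>real i - real j\<bar> / d n \<le> 4 * (\<bar>x - y\<bar> + 1 / d n)"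
    proof -
      have aux: "2 * q + u \<le> 4 * (v + q)" if "u \<le> v + 2 * q" "0 \<le> v" for u v q :: real
        using that by simp
      show ?thesis
        using aux[of "\<bar>real i - real j\<bar> / d n" "\<bar>x - y\<bar>" "1 / d n"]
          \<open>\<bar>real i - real j\<bar> / d n \<le> \<bar>x - y\<bar> + 2 * (1 / d n)\<close> by simp
    qed
  qed
  finally show "expectation (\<lambda>\<omega>. \<bar>init n \<omega> x - init n \<omega> y\<bar>) \<le> 4 * K * (\<bar>x - y\<bar> + 1 / d n)"
    by (simp add: mult_ac)
qed

end

lemma abs_exp_neg_diff_le:
  assumes "0 \<le> a" "0 \<le> (b::real)"
  shows "\<bar>exp (- a) - exp (- b)\<bar> \<le> \<bar>a - b\<bar>"
proof -
  have less: "exp (- a) - exp (- b) \<le> b - a" if "0 \<le> a" "a \<le> b" for a b :: real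
  proof -
    have "exp (- a) - exp (- b) = exp (- a) * (1 - exp (- (b - a)))"
      by (simp add: right_diff_distrib flip: exp_add)
    also have "\<dots> \<le> 1 * (b - a)"
    proof (rule mult_mono)
      show "1 - exp (- (b - a)) \<le> b - a" using exp_ge_add_one_self[of "- (b - a)"] by linarith
    qed (use that in auto)
    finally show ?thesis by simp
  qed
  show ?thesis
    using less[of a b] less[of b a] assms by (cases "a \<le> b") (auto simp: abs_if)
qed

section \<open>Comparison with a solution of the limiting equation\<close>

context sgd_sequence
begin

text \<open>One predicate for the three regimes: (\<alpha>', \<gamma>) is (\<alpha>, 0), (\<alpha>,
  \<alpha> \<beta>) or (0, \<alpha>), with both scales converging in each of them. A driving field
  is demanded only if \<gamma> is nonzero.\<close>

definition solves_limit :: "'b measure \<Rightarrow> real \<Rightarrow> real \<Rightarrow> (real \<Rightarrow> real \<Rightarrow> 'b \<Rightarrow> real) \<Rightarrow>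
    ('b \<Rightarrow> real \<Rightarrow> real) \<Rightarrow> ('b \<Rightarrow> real \<Rightarrow> real \<Rightarrow> real) \<Rightarrow> bool" where
  "solves_limit N \<alpha>' \<gamma> \<xi> \<Theta>0 \<Theta> \<longleftrightarrow> prob_space N \<and> random_element N C01 \<Theta>0 \<and> random_element N (path_space \<tau>) \<Theta> \<and>
     (\<lambda>n. \<eta> n * d n * T n) \<longlonglongrightarrow> \<alpha>' \<and> (\<lambda>n. \<sigma> n * \<eta> n * sqrt (T n)) \<longlonglongrightarrow> \<gamma> \<and>
     (AE \<omega> in N. \<Theta> \<omega> 0 = \<Theta>0 \<omega> \<and> limit_path \<tau> A \<alpha>' \<gamma> (\<lambda>s x. \<xi> s x \<omega>) (\<Theta> \<omega>)) \<and>
     (\<gamma> = 0 \<or> driving_field N \<tau> A \<xi> \<and> init_indep_field N \<tau> \<Theta>0 \<xi>)"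

text \<open>Increments of the field are paired with the same dual vectors that carry the noise terms
  of SGD; this coincidence makes the two Gaussian factors comparable.\<close>

definition gauss :: "(real \<Rightarrow> real \<Rightarrow> 'b \<Rightarrow> real) \<Rightarrow> nat \<Rightarrow> (nat \<Rightarrow> real) \<Rightarrow> 'b \<Rightarrow> real" where
  "gauss \<xi> n v \<omega> = (\<Sum>k<t n. ip (d n) (w n v (t n - Suc k))
     (\<lambda>i. \<xi> (real (Suc k) / real (T n)) (real i / real (d n)) \<omega> - \<xi> (real k / real (T n)) (real i / real (d n)) \<omega>))"

lemma euler_conv:
  assumes lp: "limit_path \<tau> A \<alpha>' \<gamma> (\<lambda>s x. \<xi> s x \<omega>) z" and \<eta>: "(\<lambda>n. \<eta> n * d n * T n) \<longlonglongrightarrow> \<alpha>'"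
    and c: "c \<ge> 0" and e: "e > 0"
  shows "\<forall>\<^sub>F n in sequentially. \<forall>v. l1 (d n) v \<le> c \<longrightarrow>
    \<bar>ip (d n) v (\<lambda>i. z (real (t n) / real (T n)) (real i / real (d n)))
      - (ip (d n) (w n v (t n)) (\<lambda>i. z 0 (real i / real (d n))) + \<gamma> * gauss \<xi> n v \<omega>)\<bar> \<le> e"
  using euler_functional_conv[OF lp K_ge_1 \<tau> A_sym A_bound A_lip d_lim T_lim d_pos T_pos less_imp_le[OF \<eta>_pos] \<eta> drift_le s c e]
  unfolding t_def w_def grid_a_def gauss_def by simp

lemma continuous_eval_tendsto:
  assumes z: "z \<in> mspace (path_space \<tau>)" and y: "y \<longlonglongrightarrow> x" "\<And>n. y n \<in> {0..1}" "x \<in> {0..1}"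
  shows "(\<lambda>n. z (real (t n) / real (T n)) (y n)) \<longlonglongrightarrow> z s x"
proof -
  have "continuous_on ({0..\<tau>} \<times> {0..1}) (\<lambda>p. z (fst p) (snd p))" by (rule path_space_jointly_continuous[OF z])
  moreover have "(\<lambda>n. (real (t n) / real (T n), y n)) \<longlonglongrightarrow> (s, x)" by (intro tendsto_Pair t_div_tendsto y)
  moreover have "(s, x) \<in> {0..\<tau>} \<times> {0..1}" using s y by auto
  moreover have "\<forall>\<^sub>F n in sequentially. (real (t n) / real (T n), y n) \<in> {0..\<tau>} \<times> {0..1}"
    using t_div_in y by auto
  ultimately have "(\<lambda>n. (\<lambda>p. z (fst p) (snd p)) (real (t n) / real (T n), y n)) \<longlonglongrightarrow> (\<lambda>p. z (fst p) (snd p)) (s, x)"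
    by (rule continuous_on_tendsto_compose)
  then show ?thesis by simp
qed

lemma gauss_charfn:
  assumes S: "solves_limit N \<alpha>' \<gamma> \<xi> \<Theta>0 \<Theta>"
  shows "(\<integral>\<omega>. iexp (ip (d n) v' (\<lambda>i. \<Theta>0 \<omega> (real i / real (d n))) + \<gamma> * gauss \<xi> n v \<omega>) \<partial>N)
      = (\<integral>\<omega>. iexp (ip (d n) v' (\<lambda>i. \<Theta>0 \<omega> (real i / real (d n)))) \<partial>N)
        * exp (- (\<gamma>\<^sup>2 * (1 / T n * (\<Sum>k<t n. quad n (w n v k)))) / 2)"
    and "(\<lambda>\<omega>. ip (d n) v' (\<lambda>i. \<Theta>0 \<omega> (real i / real (d n))) + \<gamma> * gauss \<xi> n v \<omega>) \<in> borel_measurable N"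
proof -
  have N: "prob_space N" and \<Theta>0: "random_element N C01 \<Theta>0"
    and \<gamma>: "\<gamma> = 0 \<or> driving_field N \<tau> A \<xi> \<and> init_indep_field N \<tau> \<Theta>0 \<xi>"
    using S unfolding solves_limit_def by auto
  have tT: "real (t n) / real (T n) \<le> \<tau>" using t_div_in[of n] by simp
  have "(\<Sum>k<t n. quad n (w n v (t n - Suc k))) = (\<Sum>k<t n. quad n (w n v k))"
    by (rule sum.nat_diff_reindex)
  then show "(\<integral>\<omega>. iexp (ip (d n) v' (\<lambda>i. \<Theta>0 \<omega> (real i / real (d n))) + \<gamma> * gauss \<xi> n v \<omega>) \<partial>N)
      = (\<integral>\<omega>. iexp (ip (d n) v' (\<lambda>i. \<Theta>0 \<omega> (real i / real (d n)))) \<partial>N)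
        * exp (- (\<gamma>\<^sup>2 * (1 / T n * (\<Sum>k<t n. quad n (w n v k)))) / 2)"
    using limit_charfn[OF N \<Theta>0 T_pos tT \<gamma>, where d="d n" and u="\<lambda>k. w n v (t n - Suc k)" and w=v']
    unfolding gauss_def[abs_def] quad_def grid_a_def by simp
  have g: "real i / real (d n) \<in> {0..1}" if "i \<in> {1..d n}" for i using that by auto
  have 1: "(\<lambda>\<omega>. ip (d n) v' (\<lambda>i. \<Theta>0 \<omega> (real i / real (d n)))) \<in> borel_measurable N"
    unfolding ip_def
    by (intro borel_measurable_sum borel_measurable_times borel_measurable_const C01_eval_measurable[OF \<Theta>0] g)
  have 2: "(\<lambda>\<omega>. \<gamma> * gauss \<xi> n v \<omega>) \<in> borel_measurable N"
  proof (cases "\<gamma> = 0")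
    case False
    then have "driving_field N \<tau> A \<xi>" using \<gamma> by simp
    from driving_field_charfn(1)[OF N this T_pos tT, where d="d n" and u="\<lambda>k. w n v (t n - Suc k)"]
    show ?thesis unfolding gauss_def[abs_def] by (intro borel_measurable_times borel_measurable_const)
  qed simp
  show "(\<lambda>\<omega>. ip (d n) v' (\<lambda>i. \<Theta>0 \<omega> (real i / real (d n))) + \<gamma> * gauss \<xi> n v \<omega>) \<in> borel_measurable N"
    using 1 2 by (rule borel_measurable_add)
qed

text \<open>Both exponents are a scalar times the same average q of quadratic forms. As q is
  bounded, convergence of the scalar to \<gamma>^2 suffices; no limit of q is taken.\<close>

lemma variance_factor_tendsto:
  assumes \<gamma>: "(\<lambda>n. \<sigma> n * \<eta> n * sqrt (T n)) \<longlonglongrightarrow> \<gamma>" and v: "\<And>n. l1 (d n) (v n) \<le> c"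
  shows "(\<lambda>n. exp (- ((\<eta> n * \<sigma> n)\<^sup>2 * (\<Sum>k<t n. quad n (w n (v n) k))) / 2)
    - exp (- (\<gamma>\<^sup>2 * (1 / T n * (\<Sum>k<t n. quad n (w n (v n) k)))) / 2)) \<longlonglongrightarrow> 0"
proof -
  define q where "q n = 1 / T n * (\<Sum>k<t n. quad n (w n (v n) k))" for n
  define b where "b = K * (K * (exp (K ^ 3) * c)\<^sup>2)"
  have q0: "0 \<le> q n" for n
    unfolding q_def using quad_bounds(1) by (intro mult_nonneg_nonneg sum_nonneg) auto
  have qb: "q n \<le> b" for n
  proof -
    have "(\<Sum>k<t n. quad n (w n (v n) k)) \<le> (\<Sum>k<t n. K * (exp (K ^ 3) * c)\<^sup>2)"
    proof (rule sum_mono)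
      fix k assume "k \<in> {..<t n}"
      then have "quad n (w n (v n) k) \<le> K * (exp (K ^ 3) * l1 (d n) (v n))\<^sup>2" by (intro quad_bounds(2)) simp
      also have "\<dots> \<le> K * (exp (K ^ 3) * c)\<^sup>2"
        using v[of n] l1_nonneg[of "d n" "v n"] K_ge_1 by (intro mult_left_mono power_mono) auto
      finally show "quad n (w n (v n) k) \<le> K * (exp (K ^ 3) * c)\<^sup>2" .
    qed
    also have "\<dots> = t n * (K * (exp (K ^ 3) * c)\<^sup>2)" by simp
    also have "\<dots> \<le> (K * T n) * (K * (exp (K ^ 3) * c)\<^sup>2)"
      using t_le_K[of n] K_ge_1 by (intro mult_right_mono) auto
    finally have "q n \<le> 1 / T n * ((K * T n) * (K * (exp (K ^ 3) * c)\<^sup>2))" unfolding q_def by (intro mult_left_mono) auto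
    then show ?thesis using T_pos[of n] by (simp add: b_def)
  qed
  define g where "g n = (\<sigma> n * \<eta> n * sqrt (T n))\<^sup>2" for n
  have eq: "(\<eta> n * \<sigma> n)\<^sup>2 * (\<Sum>k<t n. quad n (w n (v n) k)) = g n * q n" for n
    using T_pos[of n] by (simp add: g_def q_def power_mult_distrib)
  have "\<bar>exp (- (g n * q n) / 2) - exp (- (\<gamma>\<^sup>2 * q n) / 2)\<bar> \<le> \<bar>g n - \<gamma>\<^sup>2\<bar> * b" for n
  proof -
    have "\<bar>exp (- (g n * q n / 2)) - exp (- (\<gamma>\<^sup>2 * q n / 2))\<bar> \<le> \<bar>g n * q n / 2 - \<gamma>\<^sup>2 * q n / 2\<bar>"
      using q0[of n] by (intro abs_exp_neg_diff_le) (auto simp: g_def)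
    also have "g n * q n / 2 - \<gamma>\<^sup>2 * q n / 2 = (g n - \<gamma>\<^sup>2) * (q n / 2)" by (simp add: algebra_simps diff_divide_distrib)
    also have "\<bar>(g n - \<gamma>\<^sup>2) * (q n / 2)\<bar> \<le> \<bar>g n - \<gamma>\<^sup>2\<bar> * b"
      using q0[of n] qb[of n] unfolding abs_mult by (intro mult_left_mono) auto
    finally show ?thesis by simp
  qed
  moreover have "(\<lambda>n. \<bar>g n - \<gamma>\<^sup>2\<bar> * b) \<longlonglongrightarrow> 0"
  proof -
    have "g \<longlonglongrightarrow> \<gamma>\<^sup>2" unfolding g_def by (intro tendsto_power \<gamma>)
    then have "(\<lambda>n. \<bar>g n - \<gamma>\<^sup>2\<bar> * b) \<longlonglongrightarrow> \<bar>\<gamma>\<^sup>2 - \<gamma>\<^sup>2\<bar> * b" by (intro tendsto_intros)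
    then show ?thesis by simp
  qed
  ultimately have "(\<lambda>n. exp (- (g n * q n) / 2) - exp (- (\<gamma>\<^sup>2 * q n) / 2)) \<longlonglongrightarrow> 0"
    unfolding real_norm_def[symmetric] by (rule Lim_null_comparison[OF always_eventually[OF allI]])
  then show ?thesis unfolding eq q_def .
qed

text \<open>A chain of comparisons: law of the error, then propagated start times Gaussian factor,
  then the start replaced by its weak limit, then the variance replaced by that of the field. The
  last product is the characteristic function of \<open>Z n\<close>, the backward expansion of the
  solution without its local errors, which converges almost surely to the solution tested at the
  points \<open>p j\<close>.\<close>

lemma point_charfn_conv:
  fixes \<xi> :: "real \<Rightarrow> real \<Rightarrow> 'b \<Rightarrow> real" and J :: "'j set"
  assumes S: "solves_limit N \<alpha>' \<gamma> \<xi> \<Theta>0 \<Theta>" and wc: "weak_conv_metric C01 M init N \<Theta>0"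
    and J: "finite J" and idx: "\<And>n j. j \<in> J \<Longrightarrow> idx n j \<in> {1..d n}"
    and p: "\<And>j. j \<in> J \<Longrightarrow> p j \<in> {0..1}" "\<And>j. j \<in> J \<Longrightarrow> (\<lambda>n. real (idx n j) / real (d n)) \<longlonglongrightarrow> p j"
  shows "(\<lambda>n. expectation (\<lambda>\<omega>. iexp (\<Sum>j\<in>J. c j * err n (t n) (idx n j) \<omega>)))
    \<longlonglongrightarrow> (\<integral>\<omega>. iexp (\<Sum>j\<in>J. c j * \<Theta> \<omega> s (p j)) \<partial>N)"
proof -
  have N: "prob_space N" and \<Theta>0: "random_element N C01 \<Theta>0" and \<Theta>: "random_element N (path_space \<tau>) \<Theta>"
    and \<eta>: "(\<lambda>n. \<eta> n * d n * T n) \<longlonglongrightarrow> \<alpha>'" and \<gamma>: "(\<lambda>n. \<sigma> n * \<eta> n * sqrt (T n)) \<longlonglongrightarrow> \<gamma>"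
    and ae: "AE \<omega> in N. \<Theta> \<omega> 0 = \<Theta>0 \<omega> \<and> limit_path \<tau> A \<alpha>' \<gamma> (\<lambda>s x. \<xi> s x \<omega>) (\<Theta> \<omega>)"
    using S unfolding solves_limit_def by auto
  interpret N: prob_space N by (rule N)
  define v where "v n = (\<lambda>i. \<Sum>j\<in>J. c j * coord (idx n j) i)" for n
  \<comment> \<open>The added 1 meets the hypothesis \<open>1 \<le> c\<close> of
    \<open>err_charfn\<close>.\<close>
  define C where "C = 1 + (\<Sum>j\<in>J. \<bar>c j\<bar>)"
  have C1: "1 \<le> C" by (simp add: C_def sum_nonneg)
  have ipv: "ip (d n) (v n) y = (\<Sum>j\<in>J. c j * y (idx n j))" for n y
  proof -
    have "ip (d n) (v n) y = (\<Sum>j\<in>J. c j * ip (d n) (coord (idx n j)) y)"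
      unfolding v_def ip_def sum_distrib_left sum_distrib_right by (subst sum.swap) (simp add: mult.assoc)
    then show ?thesis by (simp add: ip_coord[OF idx])
  qed
  have l1v: "l1 (d n) (v n) \<le> C" for n
  proof -
    have "l1 (d n) (v n) \<le> (\<Sum>i=1..d n. \<Sum>j\<in>J. \<bar>c j\<bar> * \<bar>coord (idx n j) i\<bar>)"
      unfolding l1_def v_def by (intro sum_mono order_trans[OF sum_abs]) (simp add: abs_mult)
    also have "\<dots> = (\<Sum>j\<in>J. \<bar>c j\<bar> * l1 (d n) (coord (idx n j)))"
      unfolding l1_def sum_distrib_left by (rule sum.swap)
    also have "\<dots> = (\<Sum>j\<in>J. \<bar>c j\<bar>)" by (intro sum.cong refl) (simp add: l1_coord[OF idx])
    finally show ?thesis by (simp add: C_def)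
  qed
  define \<phi> where "\<phi> n = expectation (\<lambda>\<omega>. iexp (ip (d n) (v n) (\<lambda>i. err n (t n) i \<omega>)))" for n
  define \<phi>0 where "\<phi>0 n = expectation (\<lambda>\<omega>. iexp (ip (d n) (w n (v n) (t n)) (\<lambda>i. err n 0 i \<omega>)))" for n
  define \<psi>0 where "\<psi>0 n = (\<integral>\<omega>. iexp (ip (d n) (w n (v n) (t n)) (\<lambda>i. \<Theta>0 \<omega> (real i / real (d n)))) \<partial>N)" for n
  define g where "g n = exp (- ((\<eta> n * \<sigma> n)\<^sup>2 * (\<Sum>k<t n. quad n (w n (v n) k))) / 2)" for n
  define g' where "g' n = exp (- (\<gamma>\<^sup>2 * (1 / T n * (\<Sum>k<t n. quad n (w n (v n) k)))) / 2)" for n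
  have s1: "(\<lambda>n. \<phi> n - \<phi>0 n * g n) \<longlonglongrightarrow> 0"
  proof (rule Lim_null_comparison)
    show "\<forall>\<^sub>F n in sequentially. norm (\<phi> n - \<phi>0 n * g n) \<le> charfn_error K C / sqrt (T n)"
      using err_charfn[OF l1v C1] unfolding \<phi>_def \<phi>0_def g_def by simp
    have "(\<lambda>n. charfn_error K C * sqrt (1 / T n)) \<longlonglongrightarrow> charfn_error K C * sqrt 0"
      by (intro tendsto_intros inverse_tendsto)
    then show "(\<lambda>n. charfn_error K C / sqrt (T n)) \<longlonglongrightarrow> 0" by (simp add: real_sqrt_divide)
  qed
  have s2: "(\<lambda>n. \<phi>0 n - \<psi>0 n) \<longlonglongrightarrow> 0"
  proof -
    have l1w: "l1 (d n) (w n (v n) (t n)) \<le> exp (K ^ 3) * C" for n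
      by (rule order_trans[OF l1_w_le[OF order_refl] mult_left_mono[OF l1v]]) simp
    have gr: "ip (d n) u (\<lambda>i. init n \<omega> (real i / real (d n))) = ip (d n) u (\<lambda>i. err n 0 i \<omega>)" for n u \<omega>
      unfolding ip_def by (intro sum.cong refl) (simp add: init_grid)
    show ?thesis
      using charfn_varying_functional_conv[OF wc prob_space_axioms N C01_eval_measurable[OF \<Theta>0]
          init_moments(1) init_moments(2) init_moments(3) d_lim d_pos l1w]
      unfolding gr \<phi>0_def \<psi>0_def by simp
  qed
  have g1: "\<bar>g n\<bar> \<le> 1" for n
  proof -
    have "0 \<le> (\<eta> n * \<sigma> n)\<^sup>2 * (\<Sum>k<t n. quad n (w n (v n) k))"
      using quad_bounds(1) by (intro mult_nonneg_nonneg sum_nonneg) auto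
    then show ?thesis by (simp add: g_def)
  qed
  have \<psi>1: "norm (\<psi>0 n) \<le> 1" for n
  proof -
    have "real i / real (d n) \<in> {0..1}" if "i \<in> {1..d n}" for i using that by auto
    then show ?thesis unfolding \<psi>0_def ip_def
      by (intro N.norm_charfn_le_1 borel_measurable_sum borel_measurable_times borel_measurable_const
          C01_eval_measurable[OF \<Theta>0]) auto
  qed
  have s3: "(\<lambda>n. \<phi>0 n * g n - \<psi>0 n * g n) \<longlonglongrightarrow> 0"
  proof (rule Lim_null_comparison)
    show "\<forall>\<^sub>F n in sequentially. norm (\<phi>0 n * g n - \<psi>0 n * g n) \<le> norm (\<phi>0 n - \<psi>0 n)"
    proof (intro always_eventually allI)
      fix n
      have "norm (\<phi>0 n * g n - \<psi>0 n * g n) = norm (\<phi>0 n - \<psi>0 n) * \<bar>g n\<bar>"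
        by (simp add: left_diff_distrib[symmetric] norm_mult)
      also have "\<dots> \<le> norm (\<phi>0 n - \<psi>0 n) * 1" by (intro mult_left_mono g1) auto
      finally show "norm (\<phi>0 n * g n - \<psi>0 n * g n) \<le> norm (\<phi>0 n - \<psi>0 n)" by simp
    qed
    show "(\<lambda>n. norm (\<phi>0 n - \<psi>0 n)) \<longlonglongrightarrow> 0" using s2 by (rule tendsto_norm_zero)
  qed
  have s4: "(\<lambda>n. \<psi>0 n * g n - \<psi>0 n * g' n) \<longlonglongrightarrow> 0"
  proof (rule Lim_null_comparison)
    show "\<forall>\<^sub>F n in sequentially. norm (\<psi>0 n * g n - \<psi>0 n * g' n) \<le> \<bar>g n - g' n\<bar>"
    proof (intro always_eventually allI)
      fix n
      have "norm (\<psi>0 n * g n - \<psi>0 n * g' n) = norm (\<psi>0 n) * \<bar>g n - g' n\<bar>"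
        by (simp add: right_diff_distrib[symmetric] norm_mult del: of_real_diff flip: of_real_diff)
      also have "\<dots> \<le> 1 * \<bar>g n - g' n\<bar>" by (intro mult_right_mono \<psi>1) auto
      finally show "norm (\<psi>0 n * g n - \<psi>0 n * g' n) \<le> \<bar>g n - g' n\<bar>" by simp
    qed
    show "(\<lambda>n. \<bar>g n - g' n\<bar>) \<longlonglongrightarrow> 0"
      using variance_factor_tendsto[OF \<gamma> l1v] unfolding g_def g'_def by (rule tendsto_rabs_zero)
  qed
  define Z where "Z n \<omega> = ip (d n) (w n (v n) (t n)) (\<lambda>i. \<Theta>0 \<omega> (real i / real (d n))) + \<gamma> * gauss \<xi> n (v n) \<omega>" for n \<omega>
  have Zm: "Z n \<in> borel_measurable N" for n unfolding Z_def by (rule gauss_charfn(2)[OF S])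
  have Zc: "(\<integral>\<omega>. iexp (Z n \<omega>) \<partial>N) = \<psi>0 n * g' n" for n
    unfolding Z_def \<psi>0_def g'_def by (rule gauss_charfn(1)[OF S])
  \<comment> \<open>Pathwise: the solution at the grid time \<open>t n / T n\<close> is close to
    \<open>Z n\<close> by the Euler estimate, and converges to its value at s by joint
    continuity.\<close>
  have lim: "AE \<omega> in N. (\<lambda>n. Z n \<omega>) \<longlonglongrightarrow> (\<Sum>j\<in>J. c j * \<Theta> \<omega> s (p j))"
    using ae
  proof eventually_elim
    case (elim \<omega>)
    then have lp: "limit_path \<tau> A \<alpha>' \<gamma> (\<lambda>s x. \<xi> s x \<omega>) (\<Theta> \<omega>)" and \<Theta>\<omega>: "\<Theta> \<omega> \<in> mspace (path_space \<tau>)"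
      by (auto simp: limit_path_def)
    define Y where "Y n = ip (d n) (v n) (\<lambda>i. \<Theta> \<omega> (real (t n) / real (T n)) (real i / real (d n)))" for n
    have Yl: "Y \<longlonglongrightarrow> (\<Sum>j\<in>J. c j * \<Theta> \<omega> s (p j))"
      unfolding Y_def ipv
    proof (intro tendsto_sum tendsto_mult tendsto_const continuous_eval_tendsto[OF \<Theta>\<omega>] p)
      show "real (idx n j) / real (d n) \<in> {0..1}" if "j \<in> J" for n j using idx[OF that, of n] by auto
    qed
    have "(\<lambda>n. Y n - Z n \<omega>) \<longlonglongrightarrow> 0"
    proof (rule LIMSEQ_I)
      fix e :: real assume e: "e > 0"
      have C0: "0 \<le> C" and e2: "0 < e / 2" using C1 e by auto
      have "\<forall>\<^sub>F n in sequentially. \<bar>Y n - Z n \<omega>\<bar> \<le> e / 2"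
        using euler_conv[where \<xi>=\<xi> and \<omega>=\<omega> and c=C and e="e / 2", OF lp \<eta> C0 e2]
      proof eventually_elim
        case (elim n)
        then show ?case using l1v[of n] \<open>\<Theta> \<omega> 0 = \<Theta>0 \<omega> \<and> _\<close> by (simp add: Y_def Z_def)
      qed
      then have "\<forall>\<^sub>F n in sequentially. norm (Y n - Z n \<omega> - 0) < e"
        by eventually_elim (use e in auto)
      then show "\<exists>no. \<forall>n\<ge>no. norm (Y n - Z n \<omega> - 0) < e" by (simp add: eventually_sequentially)
    qed
    from tendsto_diff[OF Yl this] show ?case by simp
  qed
  have "(\<lambda>n. \<integral>\<omega>. iexp (Z n \<omega>) \<partial>N) \<longlonglongrightarrow> (\<integral>\<omega>. iexp (\<Sum>j\<in>J. c j * \<Theta> \<omega> s (p j)) \<partial>N)"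
  proof (rule integral_dominated_convergence[where w="\<lambda>_. 1"])
    have ec: "(\<lambda>y. iexp y) \<in> borel_measurable borel" by measurable
    show "(\<lambda>\<omega>. iexp (Z n \<omega>)) \<in> borel_measurable N" for n by (rule measurable_compose[OF Zm ec])
    have "(\<lambda>\<omega>. \<Sum>j\<in>J. c j * \<Theta> \<omega> s (p j)) \<in> borel_measurable N"
      by (intro borel_measurable_sum borel_measurable_times borel_measurable_const path_eval_measurable[OF \<Theta> s] p)
    then show "(\<lambda>\<omega>. iexp (\<Sum>j\<in>J. c j * \<Theta> \<omega> s (p j))) \<in> borel_measurable N" by (rule measurable_compose[OF _ ec])
    show "AE \<omega> in N. (\<lambda>n. iexp (Z n \<omega>)) \<longlonglongrightarrow> iexp (\<Sum>j\<in>J. c j * \<Theta> \<omega> s (p j))"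
      using lim by eventually_elim (intro tendsto_intros)
  qed auto
  then have "(\<lambda>n. (\<phi> n - \<phi>0 n * g n) + (\<phi>0 n * g n - \<psi>0 n * g n) + (\<psi>0 n * g n - \<psi>0 n * g' n) + \<psi>0 n * g' n)
      \<longlonglongrightarrow> 0 + 0 + 0 + (\<integral>\<omega>. iexp (\<Sum>j\<in>J. c j * \<Theta> \<omega> s (p j)) \<partial>N)"
    unfolding Zc by (intro tendsto_add s1 s3 s4)
  then have "\<phi> \<longlonglongrightarrow> (\<integral>\<omega>. iexp (\<Sum>j\<in>J. c j * \<Theta> \<omega> s (p j)) \<partial>N)" by simp
  then show ?thesis unfolding \<phi>_def ipv .
qed

end

section \<open>Coarse grids and common refinements\<close>

lemma sum_div_blocks:
  fixes f :: "nat \<Rightarrow> real"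
  assumes "m > 0" shows "(\<Sum>l<d * m. f (l div m)) = m * (\<Sum>i<d. f i)"
proof -
  have "(\<Sum>l<d * m. f (l div m)) = (\<Sum>i<d. \<Sum>l\<in>{i * m..<i * m + m}. f (l div m))"
    by (rule sum.nat_group[symmetric])
  also have "\<dots> = (\<Sum>i<d. \<Sum>l\<in>{i * m..<i * m + m}. f i)"
  proof (intro sum.cong refl)
    fix i l assume "l \<in> {i * m..<i * m + m}"
    then have "l div m = i" by (intro div_nat_eqI) (auto simp: algebra_simps)
    then show "f (l div m) = f i" by simp
  qed
  finally show ?thesis by (simp add: sum_distrib_left)
qed

text \<open>Compares averages over d and over m cells when neither number need divide the other:
  both are averages over the d m cells of the common refinement, whose cell l lies in cell
  \<open>l div m\<close> of the first and in cell \<open>l div d\<close> of the second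
  partition.\<close>

lemma average_refinement:
  fixes f g :: "nat \<Rightarrow> real"
  assumes "d > 0" "m > 0"
  shows "1 / d * (\<Sum>i<d. f i) - 1 / m * (\<Sum>j<m. g j) = 1 / (real d * m) * (\<Sum>l<d * m. f (l div m) - g (l div d))"
proof -
  have "(\<Sum>l<d * m. g (l div d)) = d * (\<Sum>j<m. g j)"
    using sum_div_blocks[OF assms(1), of g m] by (simp add: mult.commute)
  then show ?thesis
    using assms by (simp add: sum_subtractf sum_div_blocks[OF assms(2)] field_simps)
qed

lemma double_average_refinement:
  fixes f g :: "nat \<Rightarrow> nat \<Rightarrow> real"
  assumes "d > 0" "m > 0"
  shows "1 / (real d)\<^sup>2 * (\<Sum>i<d. \<Sum>i'<d. f i i') - 1 / (real m)\<^sup>2 * (\<Sum>j<m. \<Sum>j'<m. g j j')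
    = 1 / (real d * m)\<^sup>2 * (\<Sum>l<d * m. \<Sum>l'<d * m. f (l div m) (l' div m) - g (l div d) (l' div d))"
proof -
  have F: "(\<Sum>l<d * m. \<Sum>l'<d * m. f (l div m) (l' div m)) = m * (m * (\<Sum>i<d. \<Sum>i'<d. f i i'))"
    using sum_div_blocks[OF assms(2), of "\<lambda>i. \<Sum>l'<d * m. f i (l' div m)" d]
    by (simp add: sum_div_blocks[OF assms(2)] sum_distrib_left)
  have G: "(\<Sum>l<d * m. \<Sum>l'<d * m. g (l div d) (l' div d)) = d * (d * (\<Sum>j<m. \<Sum>j'<m. g j j'))"
    using sum_div_blocks[OF assms(1), of "\<lambda>j. \<Sum>l'<m * d. g j (l' div d)" m]
    by (simp add: sum_div_blocks[OF assms(1)] sum_distrib_left mult.commute[of d m])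
  show ?thesis
    using assms by (simp add: sum_subtractf F G power2_eq_square field_simps)
qed

lemma real_div_nat_bounds:
  "real (a div b) \<le> real a / real b" "real a / real b \<le> real (a div b) + 1"
proof -
  have eq: "real a = real b * real (a div b) + real (a mod b)"
    unfolding of_nat_mult[symmetric] of_nat_add[symmetric] by simp
  show "real (a div b) \<le> real a / real b"
  proof (cases "b = 0")
    case False
    then show ?thesis using eq by (simp add: field_simps)
  qed simp
  show "real a / real b \<le> real (a div b) + 1"
  proof (cases "b = 0")
    case False
    then have "real (a mod b) \<le> real b" by (simp add: less_imp_le)
    then show ?thesis using eq False by (simp add: field_simps)
  qed simp
qed

text \<open>For a cell of the common refinement, the right data node of its fine cell is within 1 /
  m + 1 / d both of the left node of its coarse cell and of the data node representing that coarse
  node. The \<open>Suc\<close> makes data indices start at 1.\<close>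

lemma refinement_index:
  assumes d: "d > 0" and m: "m > 0" and l: "l < d * m"
  shows "Suc (l div m) \<in> {1..d}" "l div d < m" "Suc (d * (l div d) div m) \<in> {1..d}"
    "\<bar>real (Suc (l div m)) - real (Suc (d * (l div d) div m))\<bar> / d \<le> 1 / m + 1 / d"
    "\<bar>real (Suc (l div m)) / d - real (l div d) / m\<bar> \<le> 1 / m + 1 / d"
proof -
  define i j p where "i = l div m" and "j = l div d" and "p = d * j div m"
  have i: "i < d" using l unfolding i_def by (simp add: less_mult_imp_div_less)
  have j: "j < m" using l unfolding j_def by (simp add: less_mult_imp_div_less mult.commute)
  have p: "p < d"
  proof -
    have "d * j < d * m" using d j by simp
    then show ?thesis unfolding p_def by (simp add: less_mult_imp_div_less)
  qed
  show "Suc (l div m) \<in> {1..d}" "l div d < m" "Suc (d * (l div d) div m) \<in> {1..d}"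
    using i j p by (auto simp: i_def j_def p_def)
  have dv: "real (a div b) \<le> real a / real b" "real a / real b \<le> real (a div b) + 1" for a b :: nat
    by (rule real_div_nat_bounds)+
  have i': "real i \<le> real l / m" "real l / m \<le> real i + 1" unfolding i_def using dv by auto
  have j': "real j \<le> real l / d" "real l / d \<le> real j + 1" unfolding j_def using dv by auto
  have p': "real p \<le> real d * j / m" "real d * j / m \<le> real p + 1" unfolding p_def using dv[of "d * j" m] by auto
  have dj: "real d * j / m \<le> real l / m" "real l / m \<le> real d * j / m + d / m"
    using j' d m by (auto simp: field_simps)
  have "\<bar>real (Suc i) - real (Suc p)\<bar> \<le> d / m + 1"
    using i' p' dj by (simp add: abs_le_iff)
  then have "\<bar>real (Suc i) - real (Suc p)\<bar> / d \<le> (d / m + 1) / d" by (intro divide_right_mono) auto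
  also have "\<dots> = 1 / m + 1 / d" using d by (simp add: add_divide_distrib)
  finally show "\<bar>real (Suc (l div m)) - real (Suc (d * (l div d) div m))\<bar> / d \<le> 1 / m + 1 / d"
    by (simp add: i_def j_def p_def)
  have a1: "real i / d \<le> real l / (real d * m)" "real l / (real d * m) \<le> (real i + 1) / d"
    using i' d m by (auto simp: field_simps)
  have a2: "real j / m \<le> real l / (real d * m)" "real l / (real d * m) \<le> (real j + 1) / m"
    using j' d m by (auto simp: field_simps)
  have "\<bar>real (Suc i) / d - real j / m\<bar> \<le> 1 / m + 1 / d"
    using a1 a2 by (auto simp: abs_le_iff add_divide_distrib)
  then show "\<bar>real (Suc (l div m)) / d - real (l div d) / m\<bar> \<le> 1 / m + 1 / d"
    by (simp add: i_def j_def)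
qed

lemma coarse_index_tendsto:
  assumes d: "filterlim d at_top sequentially" "\<And>n. d n > 0" and m: "m > 0"
  shows "(\<lambda>n. real (Suc (d n * j div m)) / real (d n)) \<longlonglongrightarrow> real j / real m"
proof -
  have inv: "(\<lambda>n. 1 / real (d n)) \<longlonglongrightarrow> 0"
    by (rule tendsto_divide_0[OF tendsto_const filterlim_at_top_imp_at_infinity[OF filterlim_compose[OF filterlim_real_sequentially d(1)]]])
  have "(\<lambda>n. real (Suc (d n * j div m)) / real (d n) - real j / real m) \<longlonglongrightarrow> 0"
  proof (rule Lim_null_comparison[OF always_eventually inv], rule allI)
    fix n
    have "real (d n * j div m) \<le> real (d n * j) / m" "real (d n * j) / m \<le> real (d n * j div m) + 1"
      by (rule real_div_nat_bounds)+
    then have "\<bar>real (Suc (d n * j div m)) - real (d n * j) / m\<bar> \<le> 1" by (simp add: abs_le_iff)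
    then have "\<bar>real (Suc (d n * j div m)) - real (d n * j) / m\<bar> / d n \<le> 1 / d n" by (intro divide_right_mono) auto
    moreover have eq: "(real (Suc (d n * j div m)) - real (d n * j) / m) / d n = real (Suc (d n * j div m)) / real (d n) - real j / real m"
      using d(2)[of n] by (simp add: diff_divide_distrib)
    ultimately show "norm (real (Suc (d n * j div m)) / real (d n) - real j / real m) \<le> 1 / d n"
      by (simp only: real_norm_def eq[symmetric] abs_divide abs_of_nat)
  qed
  then show ?thesis by (rule LIM_zero_cancel)
qed

section \<open>Convergence in distribution of quadratic functionals\<close>

text \<open>Interchange of limits: for fixed m the transforms of the coarse forms converge as n
  grows, for growing m the coarse limits converge, and the coarsening error is small uniformly in n
  up to \<open>\<rho> n\<close>. Nonnegativity makes exp (- p x) Lipschitz with constant p where it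
  is used.\<close>

lemma laplace_conv_by_approx:
  fixes X :: "nat \<Rightarrow> 'a \<Rightarrow> real" and Xc :: "nat \<Rightarrow> nat \<Rightarrow> 'a \<Rightarrow> real" and Z :: "'b \<Rightarrow> real" and Zc :: "nat \<Rightarrow> 'b \<Rightarrow> real"
  assumes M: "prob_space M" and N: "prob_space N" and p: "p \<ge> 0" and C: "C \<ge> 0"
    and X: "\<And>n. X n \<in> borel_measurable M" "\<And>n \<omega>. 0 \<le> X n \<omega>"
    and Xc: "\<And>m n. Xc m n \<in> borel_measurable M" "\<And>m n \<omega>. 0 \<le> Xc m n \<omega>"
    and Z: "Z \<in> borel_measurable N" "\<And>\<omega>. \<omega> \<in> space N \<Longrightarrow> 0 \<le> Z \<omega>"
    and Zc: "\<And>m. Zc m \<in> borel_measurable N" "\<And>m \<omega>. 0 \<le> Zc m \<omega>"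
    and int: "\<And>m n. m > 0 \<Longrightarrow> integrable M (\<lambda>\<omega>. X n \<omega> - Xc m n \<omega>)"
    and le: "\<And>m n. m > 0 \<Longrightarrow> (\<integral>\<omega>. \<bar>X n \<omega> - Xc m n \<omega>\<bar> \<partial>M) \<le> C * (1 / real m + \<rho> n)" and \<rho>: "\<rho> \<longlonglongrightarrow> 0"
    and conv: "\<And>m. m > 0 \<Longrightarrow> (\<lambda>n. \<integral>\<omega>. exp (- (p * Xc m n \<omega>)) \<partial>M) \<longlonglongrightarrow> (\<integral>\<omega>. exp (- (p * Zc m \<omega>)) \<partial>N)"
    and lim: "\<And>\<omega>. \<omega> \<in> space N \<Longrightarrow> (\<lambda>m. Zc m \<omega>) \<longlonglongrightarrow> Z \<omega>"
  shows "(\<lambda>n. \<integral>\<omega>. exp (- (p * X n \<omega>)) \<partial>M) \<longlonglongrightarrow> (\<integral>\<omega>. exp (- (p * Z \<omega>)) \<partial>N)"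
proof (rule LIMSEQ_I)
  fix e :: real assume e: "e > 0"
  interpret M: prob_space M by fact
  interpret N: prob_space N by fact
  note [measurable] = X(1) Xc(1) Z(1) Zc(1)
  have diff: "\<bar>(\<integral>\<omega>. exp (- (p * X n \<omega>)) \<partial>M) - (\<integral>\<omega>. exp (- (p * Xc m n \<omega>)) \<partial>M)\<bar> \<le> p * (C * (1 / real m + \<rho> n))"
    if m: "m > 0" for m n
  proof -
    have i: "integrable M (\<lambda>\<omega>. exp (- (p * X n \<omega>)))" "integrable M (\<lambda>\<omega>. exp (- (p * Xc m n \<omega>)))"
      by (rule M.integrable_bounded_rv[where B=1]; use X Xc p in simp)+
    have "\<bar>(\<integral>\<omega>. exp (- (p * X n \<omega>)) \<partial>M) - (\<integral>\<omega>. exp (- (p * Xc m n \<omega>)) \<partial>M)\<bar>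
        = \<bar>\<integral>\<omega>. exp (- (p * X n \<omega>)) - exp (- (p * Xc m n \<omega>)) \<partial>M\<bar>" using i by simp
    also have "\<dots> \<le> (\<integral>\<omega>. \<bar>exp (- (p * X n \<omega>)) - exp (- (p * Xc m n \<omega>))\<bar> \<partial>M)" by (rule integral_abs_bound)
    also have "\<dots> \<le> (\<integral>\<omega>. p * \<bar>X n \<omega> - Xc m n \<omega>\<bar> \<partial>M)"
    proof (rule integral_mono)
      show "\<bar>exp (- (p * X n \<omega>)) - exp (- (p * Xc m n \<omega>))\<bar> \<le> p * \<bar>X n \<omega> - Xc m n \<omega>\<bar>" for \<omega>
        using abs_exp_neg_diff_le[of "p * X n \<omega>" "p * Xc m n \<omega>"] X Xc p
        by (simp add: abs_mult flip: right_diff_distrib)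
    qed (use i int[OF m] in auto)
    also have "\<dots> = p * (\<integral>\<omega>. \<bar>X n \<omega> - Xc m n \<omega>\<bar> \<partial>M)" by simp
    also have "\<dots> \<le> p * (C * (1 / real m + \<rho> n))" by (intro mult_left_mono le m p)
    finally show ?thesis .
  qed
  have Zlim: "(\<lambda>m. \<integral>\<omega>. exp (- (p * Zc m \<omega>)) \<partial>N) \<longlonglongrightarrow> (\<integral>\<omega>. exp (- (p * Z \<omega>)) \<partial>N)"
  proof (rule integral_dominated_convergence[where w="\<lambda>_. 1"])
    show "AE \<omega> in N. (\<lambda>m. exp (- (p * Zc m \<omega>))) \<longlonglongrightarrow> exp (- (p * Z \<omega>))"
      by (intro AE_I2 tendsto_intros lim)
    show "AE \<omega> in N. norm (exp (- (p * Zc m \<omega>))) \<le> 1" for m using Zc p by simp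
  qed auto
  have inv: "(\<lambda>m. p * C * (1 / real m)) \<longlonglongrightarrow> p * C * 0" by (intro tendsto_intros lim_1_over_n)
  have e4: "0 < e / 4" using e by simp
  have "\<forall>\<^sub>F m in sequentially. dist (\<integral>\<omega>. exp (- (p * Zc m \<omega>)) \<partial>N) (\<integral>\<omega>. exp (- (p * Z \<omega>)) \<partial>N) < e / 4"
    using tendstoD[OF Zlim e4] .
  moreover have "\<forall>\<^sub>F m in sequentially. p * C * (1 / real m) < e / 4" by (rule order_tendstoD(2)[OF inv]) (use e in simp)
  moreover have "\<forall>\<^sub>F m in sequentially. m > (0::nat)" by (rule eventually_gt_at_top)
  ultimately have "\<forall>\<^sub>F m in sequentially. dist (\<integral>\<omega>. exp (- (p * Zc m \<omega>)) \<partial>N) (\<integral>\<omega>. exp (- (p * Z \<omega>)) \<partial>N) < e / 4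
      \<and> p * C * (1 / real m) < e / 4 \<and> m > 0" by eventually_elim simp
  then obtain m where m: "dist (\<integral>\<omega>. exp (- (p * Zc m \<omega>)) \<partial>N) (\<integral>\<omega>. exp (- (p * Z \<omega>)) \<partial>N) < e / 4"
      "p * C * (1 / real m) < e / 4" "m > 0"
    unfolding eventually_sequentially by blast
  have \<rho>': "(\<lambda>n. p * C * \<rho> n) \<longlonglongrightarrow> p * C * 0" by (intro tendsto_intros \<rho>)
  have "\<forall>\<^sub>F n in sequentially. dist (\<integral>\<omega>. exp (- (p * Xc m n \<omega>)) \<partial>M) (\<integral>\<omega>. exp (- (p * Zc m \<omega>)) \<partial>N) < e / 4"
    using tendstoD[OF conv[OF m(3)] e4] .
  moreover have "\<forall>\<^sub>F n in sequentially. p * C * \<rho> n < e / 4" by (rule order_tendstoD(2)[OF \<rho>']) (use e in simp)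
  ultimately have "\<forall>\<^sub>F n in sequentially. norm ((\<integral>\<omega>. exp (- (p * X n \<omega>)) \<partial>M) - (\<integral>\<omega>. exp (- (p * Z \<omega>)) \<partial>N)) < e"
  proof eventually_elim
    case (elim n)
    have "p * (C * (1 / real m + \<rho> n)) = p * C * (1 / real m) + p * C * \<rho> n" by (simp add: algebra_simps)
    then show ?case using diff[OF m(3), of n] elim m unfolding dist_real_def real_norm_def by linarith
  qed
  then show "\<exists>no. \<forall>n\<ge>no. norm ((\<integral>\<omega>. exp (- (p * X n \<omega>)) \<partial>M) - (\<integral>\<omega>. exp (- (p * Z \<omega>)) \<partial>N)) < e"
    by (simp add: eventually_sequentially)
qed

text \<open>Cauchy-Schwarz in the form of Young's inequality with the weights b / (2 a) and a / (2
  b), which is why a and b are taken positive.\<close>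

lemma (in prob_space) expectation_abs_mult_le:
  assumes X: "square_integrable M X" "expectation (\<lambda>\<omega>. (X \<omega>)\<^sup>2) \<le> a\<^sup>2"
    and Y: "square_integrable M Y" "expectation (\<lambda>\<omega>. (Y \<omega>)\<^sup>2) \<le> b\<^sup>2" and pos: "a > 0" "b > 0"
  shows "expectation (\<lambda>\<omega>. \<bar>X \<omega> * Y \<omega>\<bar>) \<le> a * b"
proof -
  have i: "integrable M (\<lambda>\<omega>. (X \<omega>)\<^sup>2)" "integrable M (\<lambda>\<omega>. (Y \<omega>)\<^sup>2)"
    using X Y by (auto simp: square_integrable_def)
  have "expectation (\<lambda>\<omega>. \<bar>X \<omega> * Y \<omega>\<bar>) \<le> expectation (\<lambda>\<omega>. b / (2 * a) * (X \<omega>)\<^sup>2 + a / (2 * b) * (Y \<omega>)\<^sup>2)"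
  proof (rule integral_mono)
    show "\<bar>X \<omega> * Y \<omega>\<bar> \<le> b / (2 * a) * (X \<omega>)\<^sup>2 + a / (2 * b) * (Y \<omega>)\<^sup>2" for \<omega>
    proof -
      have "2 * (b * \<bar>X \<omega>\<bar>) * (a * \<bar>Y \<omega>\<bar>) \<le> (b * \<bar>X \<omega>\<bar>)\<^sup>2 + (a * \<bar>Y \<omega>\<bar>)\<^sup>2" by (rule sum_squares_bound)
      then show ?thesis using pos by (simp add: field_simps power2_eq_square abs_mult)
    qed
  qed (use i square_integrable_mult[OF X(1) Y(1)] in auto)
  also have "\<dots> = b / (2 * a) * expectation (\<lambda>\<omega>. (X \<omega>)\<^sup>2) + a / (2 * b) * expectation (\<lambda>\<omega>. (Y \<omega>)\<^sup>2)" using i by simp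
  also have "\<dots> \<le> b / (2 * a) * a\<^sup>2 + a / (2 * b) * b\<^sup>2" using X Y pos by (intro add_mono mult_left_mono) auto
  also have "\<dots> = a * b" using pos by (simp add: power2_eq_square)
  finally show ?thesis .
qed

lemma (in prob_space) expectation_abs_average_le:
  fixes f :: "'i \<Rightarrow> 'a \<Rightarrow> real"
  assumes int: "\<And>i. i \<in> I \<Longrightarrow> integrable M (f i)" and le: "\<And>i. i \<in> I \<Longrightarrow> expectation (\<lambda>\<omega>. \<bar>f i \<omega>\<bar>) \<le> c"
    and a: "a \<ge> 0" "a * real (card I) = 1"
  shows "integrable M (\<lambda>\<omega>. a * (\<Sum>i\<in>I. f i \<omega>))" "expectation (\<lambda>\<omega>. \<bar>a * (\<Sum>i\<in>I. f i \<omega>)\<bar>) \<le> c"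
proof -
  show i: "integrable M (\<lambda>\<omega>. a * (\<Sum>i\<in>I. f i \<omega>))"
    using int by (intro integrable_mult_right Bochner_Integration.integrable_sum)
  have "expectation (\<lambda>\<omega>. \<bar>a * (\<Sum>i\<in>I. f i \<omega>)\<bar>) \<le> expectation (\<lambda>\<omega>. a * (\<Sum>i\<in>I. \<bar>f i \<omega>\<bar>))"
  proof (rule integral_mono)
    show "integrable M (\<lambda>\<omega>. a * (\<Sum>i\<in>I. \<bar>f i \<omega>\<bar>))"
      using int by (intro integrable_mult_right Bochner_Integration.integrable_sum integrable_abs)
    show "\<bar>a * (\<Sum>i\<in>I. f i \<omega>)\<bar> \<le> a * (\<Sum>i\<in>I. \<bar>f i \<omega>\<bar>)" for \<omega>
      using a by (simp add: abs_mult mult_left_mono)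
  qed (use i in auto)
  also have "\<dots> = a * (\<Sum>i\<in>I. expectation (\<lambda>\<omega>. \<bar>f i \<omega>\<bar>))"
    using int by (simp add: Bochner_Integration.integral_sum)
  also have "\<dots> \<le> a * (\<Sum>i\<in>I. c)" by (intro mult_left_mono sum_mono le a)
  also have "\<dots> = c" using a by (simp add: mult.assoc[symmetric])
  finally show "expectation (\<lambda>\<omega>. \<bar>a * (\<Sum>i\<in>I. f i \<omega>)\<bar>) \<le> c" .
qed

text \<open>\<open>A\<close> is the covariance of \<open>W 0\<close>, so the form is the second
  moment of a linear combination of field values.\<close>

lemma (in white_field) A_psd:
  assumes "\<And>j. j < m \<Longrightarrow> p j \<in> {0..1}"
  shows "0 \<le> (\<Sum>j<(m::nat). \<Sum>k<m. A (p j) (p k) * v j * v k)"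
proof -
  have "has_bochner_integral M (\<lambda>\<omega>. \<Sum>j<m. \<Sum>k<m. v j * v k * (W 0 (p j) \<omega> * W 0 (p k) \<omega>)) (\<Sum>j<m. \<Sum>k<m. v j * v k * A (p j) (p k))"
    using assms by (intro has_bochner_integral_sum has_bochner_integral_mult_right W_moment2) auto
  moreover have "(\<Sum>j<m. \<Sum>k<m. v j * v k * (W 0 (p j) \<omega> * W 0 (p k) \<omega>)) = (\<Sum>j<m. v j * W 0 (p j) \<omega>)\<^sup>2" for \<omega>
    unfolding power2_eq_square sum_product by (intro sum.cong refl) (simp add: mult_ac)
  ultimately have "has_bochner_integral M (\<lambda>\<omega>. (\<Sum>j<m. v j * W 0 (p j) \<omega>)\<^sup>2) (\<Sum>j<m. \<Sum>k<m. v j * v k * A (p j) (p k))"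
    by simp
  then have "(\<Sum>j<m. \<Sum>k<m. v j * v k * A (p j) (p k)) = expectation (\<lambda>\<omega>. (\<Sum>j<m. v j * W 0 (p j) \<omega>)\<^sup>2)"
    by (simp add: has_bochner_integral_iff)
  also have "\<dots> \<ge> 0" by simp
  finally show ?thesis by (simp add: mult_ac)
qed

lemma diagonal_form: "(\<Sum>j<(m::nat). \<Sum>k<m. (if j = k then c else 0) * v j * v k) = c * (\<Sum>j<m. (v j)\<^sup>2)" for c :: real
proof -
  have "(\<Sum>j<m. \<Sum>k<m. (if j = k then c else 0) * v j * v k) = (\<Sum>j<m. \<Sum>k<m. if j = k then c * (v j)\<^sup>2 else 0)"
    by (intro sum.cong refl) (simp add: power2_eq_square)
  then show ?thesis by (simp add: sum_distrib_left)
qed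

lemma Theta_bar_grid:
  assumes "d > 0" "T > 0" "s \<ge> 0" "i \<le> d"
  shows "Theta_bar d T \<Delta> (of_int \<lfloor>s * real T\<rfloor> / real T) (real i / real d) = \<Delta> (nat \<lfloor>s * real T\<rfloor>) i"
  using assms by (simp add: Theta_bar_def Theta_dT_def interp_grid)

section \<open>Coarse quadratic forms for MSE and PE\<close>

context sgd_sequence
begin

text \<open>The summation index starts at 0, with \<open>Suc i\<close> as data index, so that the
  block division of the common refinement applies.\<close>

definition mse :: "nat \<Rightarrow> 'a \<Rightarrow> real" where
  "mse n \<omega> = 1 / real (d n) * (\<Sum>i<d n. (err n (t n) (Suc i) \<omega>)\<^sup>2)"

definition pe :: "nat \<Rightarrow> 'a \<Rightarrow> real" where
  "pe n \<omega> = 1 / (real (d n))\<^sup>2 * (\<Sum>i<d n. \<Sum>i'<d n. A (real (Suc i) / real (d n)) (real (Suc i') / real (d n))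
     * err n (t n) (Suc i) \<omega> * err n (t n) (Suc i') \<omega>)"

lemma sum_Suc_index: "(\<Sum>i=1..d n. f i) = (\<Sum>i<d n. f (Suc i))"
  by (rule sum.reindex_bij_witness[of _ Suc "\<lambda>j. j - 1"]) auto

lemma err_eq: "i \<ge> 1 \<Longrightarrow> sgd_err (\<theta>s n) (\<theta> n) \<omega> k i = err n k i \<omega>"
  by (simp add: sgd_err_def err_def)

lemma MSE_dT_eq: "MSE_dT (d n) (T n) (sgd_err (\<theta>s n) (\<theta> n) \<omega>) s = mse n \<omega>"
proof -
  have "MSE_dT (d n) (T n) (sgd_err (\<theta>s n) (\<theta> n) \<omega>) s = 1 / real (d n) * (\<Sum>i=1..d n. (err n (t n) i \<omega>)\<^sup>2)"
    unfolding MSE_dT_def t_def using s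
    by (intro arg_cong2[where f="(*)"] refl sum.cong) (simp add: Theta_bar_grid[OF d_pos T_pos] err_eq)
  then show ?thesis unfolding mse_def sum_Suc_index .
qed

lemma PE_dT_eq: "PE_dT A (d n) (T n) (sgd_err (\<theta>s n) (\<theta> n) \<omega>) s = pe n \<omega>"
proof -
  have "PE_dT A (d n) (T n) (sgd_err (\<theta>s n) (\<theta> n) \<omega>) s = 1 / (real (d n))\<^sup>2 * (\<Sum>i=1..d n. \<Sum>i'=1..d n.
      A (real i / real (d n)) (real i' / real (d n)) * err n (t n) i \<omega> * err n (t n) i' \<omega>)"
    unfolding PE_dT_def t_def using s
    by (intro arg_cong2[where f="(*)"] refl sum.cong) (simp_all add: Theta_bar_grid[OF d_pos T_pos] err_eq)
  then show ?thesis unfolding pe_def sum_Suc_index .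
qed

text \<open>Data index standing for the coarse node j / m; the successor keeps it in the range from
  1 to d.\<close>

definition ix :: "nat \<Rightarrow> nat \<Rightarrow> nat \<Rightarrow> nat" where
  "ix m n j = Suc (d n * j div m)"

lemma ix_in: "j < m \<Longrightarrow> ix m n j \<in> {1..d n}"
proof -
  assume "j < m"
  then have "d n * j < d n * m" using d_pos[of n] by simp
  then have "d n * j div m < d n" by (simp add: less_mult_imp_div_less)
  then show ?thesis by (simp add: ix_def)
qed

text \<open>At the coarse level both functionals are positive semidefinite quadratic forms in m
  coordinates; treating them through one q leaves a single limit argument.\<close>

definition form :: "(nat \<Rightarrow> nat \<Rightarrow> nat \<Rightarrow> real) \<Rightarrow> nat \<Rightarrow> (nat \<Rightarrow> real) \<Rightarrow> real" where
  "form q m v = (\<Sum>j<m. \<Sum>k<m. q m j k * v j * v k)"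

definition q_mse :: "nat \<Rightarrow> nat \<Rightarrow> nat \<Rightarrow> real" where
  "q_mse m j k = (if j = k then 1 / real m else 0)"

definition q_pe :: "nat \<Rightarrow> nat \<Rightarrow> nat \<Rightarrow> real" where
  "q_pe m j k = A (real j / real m) (real k / real m) / (real m)\<^sup>2"

lemma grid_in: "j < m \<Longrightarrow> real j / real m \<in> {0..1}"
  by auto

lemma form_mse: "form q_mse m v = 1 / real m * (\<Sum>j<m. (v j)\<^sup>2)"
  unfolding form_def q_mse_def by (rule diagonal_form)

lemma form_pe: "form q_pe m v = 1 / (real m)\<^sup>2 * (\<Sum>j<m. \<Sum>k<m. A (real j / real m) (real k / real m) * v j * v k)"
  unfolding form_def q_pe_def sum_distrib_left by (intro sum.cong refl) simp

lemma form_mse_nonneg: "0 \<le> form q_mse m v"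
  unfolding form_mse by (simp add: sum_nonneg)

lemma form_pe_nonneg: "0 \<le> form q_pe m v"
  unfolding form_pe by (intro mult_nonneg_nonneg A_psd grid_in) auto

lemma mse_nonneg: "0 \<le> mse n \<omega>"
  unfolding mse_def by (simp add: sum_nonneg)

lemma pe_nonneg: "0 \<le> pe n \<omega>"
  unfolding pe_def by (intro mult_nonneg_nonneg A_psd) auto

lemma mse_measurable: "mse n \<in> borel_measurable M"
  unfolding mse_def[abs_def]
  by (intro borel_measurable_times borel_measurable_sum borel_measurable_power borel_measurable_const err_measurable) auto

lemma pe_measurable: "pe n \<in> borel_measurable M"
  unfolding pe_def[abs_def]
  by (intro borel_measurable_times borel_measurable_sum borel_measurable_const err_measurable) auto

lemma form_measurable: "(\<lambda>\<omega>. form q m (\<lambda>j. err n (t n) (ix m n j) \<omega>)) \<in> borel_measurable M"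
  unfolding form_def
  by (intro borel_measurable_times borel_measurable_sum borel_measurable_const err_measurable ix_in) auto

text \<open>The added 1, here and in \<open>c_mom\<close>, makes the constants positive, since the
  weighted Young inequality divides by them.\<close>

definition c_incr :: real where "c_incr = sqrt (increment_const K) + 1"
definition c_mom :: real where "c_mom = sqrt (second_moment_const K) + 1"

lemma consts_nonneg: "0 \<le> second_moment_const K" "0 \<le> increment_const K"
  using K_ge_1 unfolding increment_const_def second_moment_const_def by auto

lemma consts_pos: "0 < c_incr" "0 < c_mom"
  using consts_nonneg by (auto simp: c_incr_def c_mom_def add_nonneg_pos)

lemma err_second_moment: "i \<in> {1..d n} \<Longrightarrow> expectation (\<lambda>\<omega>. (err n (t n) i \<omega>)\<^sup>2) \<le> c_mom\<^sup>2"
proof -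
  assume "i \<in> {1..d n}"
  then have "expectation (\<lambda>\<omega>. (err n (t n) i \<omega>)\<^sup>2) \<le> (sqrt (second_moment_const K))\<^sup>2"
    using err_moment(3) consts_nonneg by simp
  also have "\<dots> \<le> c_mom\<^sup>2" unfolding c_mom_def using consts_nonneg by (intro power_mono) auto
  finally show ?thesis .
qed

lemma err_increment:
  assumes "i \<in> {1..d n}" "j \<in> {1..d n}" "\<bar>real i - real j\<bar> / d n \<le> r"
  shows "expectation (\<lambda>\<omega>. (err n (t n) i \<omega> - err n (t n) j \<omega>)\<^sup>2) \<le> (c_incr * r)\<^sup>2"
proof -
  have r: "r \<ge> 0" using assms(3) by (rule order_trans[rotated]) simp
  have "expectation (\<lambda>\<omega>. (err n (t n) i \<omega> - err n (t n) j \<omega>)\<^sup>2) \<le> increment_const K * ((real i - real j) / d n)\<^sup>2"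
    by (rule err_moment(4)[OF assms(1,2)])
  also have "\<dots> = (sqrt (increment_const K))\<^sup>2 * (\<bar>real i - real j\<bar> / d n)\<^sup>2"
    using consts_nonneg by (simp add: power_divide)
  also have "\<dots> \<le> c_incr\<^sup>2 * r\<^sup>2"
    unfolding c_incr_def using consts_nonneg assms(3) by (intro mult_mono power_mono) auto
  finally show ?thesis by (simp add: power_mult_distrib)
qed

text \<open>Large enough for both functionals: changing the kernel costs 2 K times
  \<open>c_mom\<close> squared, changing the two factors costs 2 K times
  \<open>c_incr * c_mom\<close>.\<close>

definition c_coarse :: real where "c_coarse = 2 * K * (c_incr * c_mom + c_mom\<^sup>2)"

text \<open>The difference of squares factors into an increment of order r and a sum of bounded
  second moment.\<close>

lemma err_square_diff:
  assumes i: "i \<in> {1..d n}" and j: "j \<in> {1..d n}" and r: "\<bar>real i - real j\<bar> / d n \<le> r" "r > 0"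
  shows "expectation (\<lambda>\<omega>. \<bar>(err n (t n) i \<omega>)\<^sup>2 - (err n (t n) j \<omega>)\<^sup>2\<bar>) \<le> c_coarse * r"
proof -
  let ?V = "err n (t n)"
  have sq: "square_integrable M (\<lambda>\<omega>. ?V i \<omega> - ?V j \<omega>)" "square_integrable M (\<lambda>\<omega>. ?V i \<omega> + ?V j \<omega>)"
    by (intro square_integrable_diff square_integrable_add err_moment i j)+
  have ii: "integrable M (\<lambda>\<omega>. (?V i \<omega>)\<^sup>2)" "integrable M (\<lambda>\<omega>. (?V j \<omega>)\<^sup>2)"
    using err_moment(1)[OF i] err_moment(1)[OF j] by (auto simp: square_integrable_def)
  have "expectation (\<lambda>\<omega>. (?V i \<omega> + ?V j \<omega>)\<^sup>2) \<le> expectation (\<lambda>\<omega>. 2 * (?V i \<omega>)\<^sup>2 + 2 * (?V j \<omega>)\<^sup>2)"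
  proof (rule integral_mono)
    show "(?V i \<omega> + ?V j \<omega>)\<^sup>2 \<le> 2 * (?V i \<omega>)\<^sup>2 + 2 * (?V j \<omega>)\<^sup>2" for \<omega>
      using zero_le_power2[of "?V i \<omega> - ?V j \<omega>"] unfolding power2_sum power2_diff by linarith
  qed (use ii sq in \<open>auto simp: square_integrable_def\<close>)
  also have "\<dots> = 2 * expectation (\<lambda>\<omega>. (?V i \<omega>)\<^sup>2) + 2 * expectation (\<lambda>\<omega>. (?V j \<omega>)\<^sup>2)" using ii by simp
  also have "\<dots> \<le> (2 * c_mom)\<^sup>2"
    using err_second_moment[OF i] err_second_moment[OF j] by (simp add: power_mult_distrib)
  finally have plus: "expectation (\<lambda>\<omega>. (?V i \<omega> + ?V j \<omega>)\<^sup>2) \<le> (2 * c_mom)\<^sup>2" .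
  have "expectation (\<lambda>\<omega>. \<bar>(?V i \<omega> - ?V j \<omega>) * (?V i \<omega> + ?V j \<omega>)\<bar>) \<le> (c_incr * r) * (2 * c_mom)"
    using consts_pos r by (intro expectation_abs_mult_le sq err_increment i j plus) auto
  also have "\<dots> = 2 * 1 * (c_incr * c_mom) * r" by simp
  also have "\<dots> \<le> 2 * K * (c_incr * c_mom + c_mom\<^sup>2) * r"
    using K_ge_1 consts_pos r by (intro mult_right_mono mult_mono) auto
  finally show ?thesis by (simp add: c_coarse_def power2_eq_square algebra_simps)
qed

lemma mse_coarse_error:
  assumes m: "m > 0"
  shows "integrable M (\<lambda>\<omega>. mse n \<omega> - form q_mse m (\<lambda>j. err n (t n) (ix m n j) \<omega>))"
    and "expectation (\<lambda>\<omega>. \<bar>mse n \<omega> - form q_mse m (\<lambda>j. err n (t n) (ix m n j) \<omega>)\<bar>) \<le> c_coarse * (1 / real m + 1 / d n)"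
proof -
  define f where "f l \<omega> = (err n (t n) (Suc (l div m)) \<omega>)\<^sup>2 - (err n (t n) (ix m n (l div d n)) \<omega>)\<^sup>2" for l \<omega>
  have eq: "mse n \<omega> - form q_mse m (\<lambda>j. err n (t n) (ix m n j) \<omega>) = 1 / (real (d n) * m) * (\<Sum>l\<in>{..<d n * m}. f l \<omega>)" for \<omega>
    unfolding mse_def form_mse f_def
    by (rule average_refinement[OF d_pos m, of n "\<lambda>i. (err n (t n) (Suc i) \<omega>)\<^sup>2" "\<lambda>j. (err n (t n) (ix m n j) \<omega>)\<^sup>2"])
  have r: "1 / real m + 1 / d n > 0" using m d_pos[of n] by (simp add: add_pos_pos)
  have int: "integrable M (f l)" and le: "expectation (\<lambda>\<omega>. \<bar>f l \<omega>\<bar>) \<le> c_coarse * (1 / real m + 1 / d n)"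
    if "l \<in> {..<d n * m}" for l
  proof -
    have l: "l < d n * m" using that by simp
    note R = refinement_index[OF d_pos m l]
    show "integrable M (f l)"
      unfolding f_def ix_def using err_moment(1)[OF R(1)] err_moment(1)[OF R(3)] by (auto simp: square_integrable_def)
    show "expectation (\<lambda>\<omega>. \<bar>f l \<omega>\<bar>) \<le> c_coarse * (1 / real m + 1 / d n)"
      unfolding f_def ix_def by (rule err_square_diff[OF R(1,3,4) r])
  qed
  have "1 / (real (d n) * m) * real (card {..<d n * m}) = 1" using m d_pos[of n] by simp
  from expectation_abs_average_le[OF int le _ this]
  show "integrable M (\<lambda>\<omega>. mse n \<omega> - form q_mse m (\<lambda>j. err n (t n) (ix m n j) \<omega>))"
    "expectation (\<lambda>\<omega>. \<bar>mse n \<omega> - form q_mse m (\<lambda>j. err n (t n) (ix m n j) \<omega>)\<bar>) \<le> c_coarse * (1 / real m + 1 / d n)"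
    unfolding eq by auto
qed

text \<open>The Lipschitz bound concerns the first argument; symmetry of \<open>A\<close> transfers
  it to the second.\<close>

lemma A_diff_le:
  assumes "y \<in> {0..1}" "y' \<in> {0..1}" "z \<in> {0..1}" "z' \<in> {0..1}" "\<bar>y - z\<bar> \<le> r" "\<bar>y' - z'\<bar> \<le> r"
  shows "\<bar>A y y' - A z z'\<bar> \<le> 2 * K * r"
proof -
  have "\<bar>A y y' - A z y'\<bar> \<le> K * \<bar>y - z\<bar>" using assms by (intro A_lip)
  also have "\<dots> \<le> K * r" using assms K_ge_1 by (intro mult_left_mono) auto
  finally have 1: "\<bar>A y y' - A z y'\<bar> \<le> K * r" .
  have "\<bar>A y' z - A z' z\<bar> \<le> K * \<bar>y' - z'\<bar>" using assms by (intro A_lip)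
  also have "\<dots> \<le> K * r" using assms K_ge_1 by (intro mult_left_mono) auto
  finally have "\<bar>A z y' - A z z'\<bar> \<le> K * r" using A_sym[of z y'] A_sym[of z z'] assms by simp
  then show ?thesis using 1 by linarith
qed

lemma pe_coarse_error:
  assumes m: "m > 0"
  shows "integrable M (\<lambda>\<omega>. pe n \<omega> - form q_pe m (\<lambda>j. err n (t n) (ix m n j) \<omega>))"
    and "expectation (\<lambda>\<omega>. \<bar>pe n \<omega> - form q_pe m (\<lambda>j. err n (t n) (ix m n j) \<omega>)\<bar>) \<le> c_coarse * (1 / real m + 1 / d n)"
proof -
  let ?V = "err n (t n)"
  define F where "F \<omega> i i' = A (real (Suc i) / real (d n)) (real (Suc i') / real (d n)) * ?V (Suc i) \<omega> * ?V (Suc i') \<omega>" for \<omega> i i'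
  define H where "H \<omega> j j' = A (real j / real m) (real j' / real m) * ?V (ix m n j) \<omega> * ?V (ix m n j') \<omega>" for \<omega> j j'
  define f where "f l \<omega> = F \<omega> (fst l div m) (snd l div m) - H \<omega> (fst l div d n) (snd l div d n)" for l \<omega>
  define r where "r = 1 / real m + 1 / d n"
  let ?I = "{..<d n * m} \<times> {..<d n * m}"
  have eq: "pe n \<omega> - form q_pe m (\<lambda>j. ?V (ix m n j) \<omega>) = 1 / (real (d n) * m)\<^sup>2 * (\<Sum>l\<in>?I. f l \<omega>)" for \<omega>
    using double_average_refinement[OF d_pos m, of n "F \<omega>" "H \<omega>"]
    unfolding pe_def form_pe f_def F_def[symmetric] H_def[symmetric]
    by (simp add: sum.cartesian_product split_beta)
  have r: "r > 0" using m d_pos[of n] by (simp add: r_def add_pos_pos)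
  have int: "integrable M (f l)" and le: "expectation (\<lambda>\<omega>. \<bar>f l \<omega>\<bar>) \<le> c_coarse * r" if l_in: "l \<in> ?I" for l
  proof -
    obtain a b where l: "l = (a, b)" "a < d n * m" "b < d n * m" using l_in by (cases l) auto
    note Ra = refinement_index[OF d_pos m l(2), folded ix_def r_def] and Rb = refinement_index[OF d_pos m l(3), folded ix_def r_def]
    define i j i' j' where "i = Suc (a div m)" and "j = ix m n (a div d n)" and "i' = Suc (b div m)" and "j' = ix m n (b div d n)"
    define x y x' y' where "x = real i / d n" and "y = real (a div d n) / m" and "x' = real i' / d n" and "y' = real (b div d n) / m"
    have idx: "i \<in> {1..d n}" "j \<in> {1..d n}" "i' \<in> {1..d n}" "j' \<in> {1..d n}"
      using Ra Rb by (simp_all add: i_def j_def i'_def j'_def ix_def)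
    have pts: "x \<in> {0..1}" "x' \<in> {0..1}" "y \<in> {0..1}" "y' \<in> {0..1}"
      using idx Ra(2) Rb(2) by (auto simp: x_def x'_def y_def y'_def)
    have near: "\<bar>x - y\<bar> \<le> r" "\<bar>x' - y'\<bar> \<le> r" "\<bar>real i - real j\<bar> / d n \<le> r" "\<bar>real i' - real j'\<bar> / d n \<le> r"
      using Ra(4,5) Rb(4,5) by (simp_all add: i_def j_def i'_def j'_def x_def y_def x'_def y'_def ix_def)
    \<comment> \<open>Kernel, first factor and second factor are exchanged one at a time.\<close>
    have fl: "f l \<omega> = (A x x' - A y y') * (?V i \<omega> * ?V i' \<omega>) + A y y' * ((?V i \<omega> - ?V j \<omega>) * ?V i' \<omega>)
        + A y y' * ((?V i' \<omega> - ?V j' \<omega>) * ?V j \<omega>)" for \<omega>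
      unfolding f_def l fst_conv snd_conv F_def H_def i_def[symmetric] j_def[symmetric] i'_def[symmetric] j'_def[symmetric]
        x_def[symmetric] y_def[symmetric] x'_def[symmetric] y'_def[symmetric]
      by (simp add: algebra_simps)
    note sq = err_moment(1)[OF idx(1)] err_moment(1)[OF idx(2)] err_moment(1)[OF idx(3)] err_moment(1)[OF idx(4)]
    have i1: "integrable M (\<lambda>\<omega>. ?V i \<omega> * ?V i' \<omega>)" "integrable M (\<lambda>\<omega>. (?V i \<omega> - ?V j \<omega>) * ?V i' \<omega>)"
      "integrable M (\<lambda>\<omega>. (?V i' \<omega> - ?V j' \<omega>) * ?V j \<omega>)"
      by (intro square_integrable_mult square_integrable_diff sq)+
    show "integrable M (f l)" unfolding fl using i1 by (intro Bochner_Integration.integrable_add integrable_mult_right)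
    have b1: "expectation (\<lambda>\<omega>. \<bar>?V i \<omega> * ?V i' \<omega>\<bar>) \<le> c_mom * c_mom"
      by (intro expectation_abs_mult_le sq err_second_moment idx consts_pos)
    have b2: "expectation (\<lambda>\<omega>. \<bar>(?V i \<omega> - ?V j \<omega>) * ?V i' \<omega>\<bar>) \<le> (c_incr * r) * c_mom"
      using consts_pos r
      by (intro expectation_abs_mult_le square_integrable_diff sq err_second_moment err_increment idx near) auto
    have b3: "expectation (\<lambda>\<omega>. \<bar>(?V i' \<omega> - ?V j' \<omega>) * ?V j \<omega>\<bar>) \<le> (c_incr * r) * c_mom"
      using consts_pos r
      by (intro expectation_abs_mult_le square_integrable_diff sq err_second_moment err_increment idx near) auto
    have "expectation (\<lambda>\<omega>. \<bar>f l \<omega>\<bar>) \<le> expectation (\<lambda>\<omega>. (2 * K * r) * \<bar>?V i \<omega> * ?V i' \<omega>\<bar>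
        + (K * \<bar>(?V i \<omega> - ?V j \<omega>) * ?V i' \<omega>\<bar> + K * \<bar>(?V i' \<omega> - ?V j' \<omega>) * ?V j \<omega>\<bar>))"
    proof (rule integral_mono)
      fix \<omega>
      have "\<bar>f l \<omega>\<bar> \<le> \<bar>(A x x' - A y y') * (?V i \<omega> * ?V i' \<omega>)\<bar> + (\<bar>A y y' * ((?V i \<omega> - ?V j \<omega>) * ?V i' \<omega>)\<bar>
        + \<bar>A y y' * ((?V i' \<omega> - ?V j' \<omega>) * ?V j \<omega>)\<bar>)" unfolding fl by linarith
      also have "\<dots> \<le> (2 * K * r) * \<bar>?V i \<omega> * ?V i' \<omega>\<bar>
        + (K * \<bar>(?V i \<omega> - ?V j \<omega>) * ?V i' \<omega>\<bar> + K * \<bar>(?V i' \<omega> - ?V j' \<omega>) * ?V j \<omega>\<bar>)"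
        unfolding abs_mult[of "A x x' - A y y'"] abs_mult[of "A y y'"]
        by (intro add_mono mult_right_mono A_diff_le A_bound pts near) auto
      finally show "\<bar>f l \<omega>\<bar> \<le> (2 * K * r) * \<bar>?V i \<omega> * ?V i' \<omega>\<bar>
        + (K * \<bar>(?V i \<omega> - ?V j \<omega>) * ?V i' \<omega>\<bar> + K * \<bar>(?V i' \<omega> - ?V j' \<omega>) * ?V j \<omega>\<bar>)" .
    next
      show "integrable M (\<lambda>\<omega>. \<bar>f l \<omega>\<bar>)" using \<open>integrable M (f l)\<close> by (rule integrable_abs)
      show "integrable M (\<lambda>\<omega>. (2 * K * r) * \<bar>?V i \<omega> * ?V i' \<omega>\<bar>
        + (K * \<bar>(?V i \<omega> - ?V j \<omega>) * ?V i' \<omega>\<bar> + K * \<bar>(?V i' \<omega> - ?V j' \<omega>) * ?V j \<omega>\<bar>))"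
        by (intro Bochner_Integration.integrable_add integrable_mult_right integrable_abs i1)
    qed
    also have "\<dots> = (2 * K * r) * expectation (\<lambda>\<omega>. \<bar>?V i \<omega> * ?V i' \<omega>\<bar>)
        + (K * expectation (\<lambda>\<omega>. \<bar>(?V i \<omega> - ?V j \<omega>) * ?V i' \<omega>\<bar>) + K * expectation (\<lambda>\<omega>. \<bar>(?V i' \<omega> - ?V j' \<omega>) * ?V j \<omega>\<bar>))"
    proof -
      note ia = i1[THEN integrable_abs]
      show ?thesis
        by (subst Bochner_Integration.integral_add; (subst Bochner_Integration.integral_add)?)
           (intro Bochner_Integration.integrable_add integrable_mult_right ia | simp)+
    qed
    also have "\<dots> \<le> (2 * K * r) * (c_mom * c_mom) + (K * ((c_incr * r) * c_mom) + K * ((c_incr * r) * c_mom))"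
      using K_ge_1 r by (intro add_mono mult_left_mono b1 b2 b3) auto
    also have "\<dots> = c_coarse * r" by (simp add: c_coarse_def power2_eq_square algebra_simps)
    finally show "expectation (\<lambda>\<omega>. \<bar>f l \<omega>\<bar>) \<le> c_coarse * r" .
  qed
  have "1 / (real (d n) * m)\<^sup>2 * real (card ?I) = 1" using m d_pos[of n] by (simp add: power2_eq_square)
  from expectation_abs_average_le[OF int le _ this]
  show "integrable M (\<lambda>\<omega>. pe n \<omega> - form q_pe m (\<lambda>j. ?V (ix m n j) \<omega>))"
    "expectation (\<lambda>\<omega>. \<bar>pe n \<omega> - form q_pe m (\<lambda>j. ?V (ix m n j) \<omega>)\<bar>) \<le> c_coarse * (1 / real m + 1 / d n)"
    unfolding eq r_def[symmetric] by auto
qed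

lemma A_jointly_continuous: "continuous_on ({0..1} \<times> {0..1}) (\<lambda>q. A (fst q) (snd q))"
  unfolding continuous_on_iff
proof (intro ballI allI impI)
  fix q :: "real \<times> real" and e :: real assume q: "q \<in> {0..1} \<times> {0..1}" and e: "e > 0"
  have "dist (A (fst q') (snd q')) (A (fst q) (snd q)) < e"
    if q': "q' \<in> {0..1} \<times> {0..1}" "dist q' q < e / (2 * K + 1)" for q'
  proof -
    have "\<bar>A (fst q') (snd q') - A (fst q) (snd q)\<bar> \<le> 2 * K * dist q' q"
      using q q' dist_fst_le[of q' q] dist_snd_le[of q' q] by (intro A_diff_le) (auto simp: dist_real_def)
    also have "\<dots> \<le> (2 * K + 1) * dist q' q" by (intro mult_right_mono) auto
    also have "\<dots> < e" using q'(2) K_ge_1 by (simp add: field_simps)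
    finally show ?thesis by (simp add: dist_real_def)
  qed
  then show "\<exists>\<delta>>0. \<forall>q'\<in>{0..1} \<times> {0..1}. dist q' q < \<delta> \<longrightarrow> dist (A (fst q') (snd q')) (A (fst q) (snd q)) < e"
    using e K_ge_1 by (intro exI[of _ "e / (2 * K + 1)"]) auto
qed

lemma riemann_MSE:
  assumes z: "continuous_on {0..1} (f s)" and p: "\<And>m j. j < m \<Longrightarrow> p m j \<in> {real j / real m..(real j + 1) / real m}"
  shows "(\<lambda>m. 1 / real m * (\<Sum>j<m. (f s (p m j))\<^sup>2)) \<longlonglongrightarrow> MSE f s"
  unfolding MSE_def by (rule riemann_sum_tendsto[OF _ p]) (intro continuous_intros z)

lemma riemann_PE:
  assumes z: "continuous_on {0..1} (f s)" and p: "\<And>m j. j < m \<Longrightarrow> p m j \<in> {real j / real m..(real j + 1) / real m}"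
  shows "(\<lambda>m. 1 / (real m)\<^sup>2 * (\<Sum>j<m. \<Sum>k<m. A (p m j) (p m k) * f s (p m j) * f s (p m k))) \<longlonglongrightarrow> PE A f s"
proof -
  have "continuous_on ({0..1} \<times> {0..1}) (\<lambda>q. f s (fst q) * A (fst q) (snd q) * f s (snd q))"
    by (intro continuous_on_mult A_jointly_continuous continuous_on_compose2[OF z] continuous_on_fst continuous_on_snd continuous_on_id) auto
  from double_riemann_sum_tendsto[OF this p] show ?thesis
    unfolding PE_def by (simp add: mult_ac)
qed

lemma left_points: "real j / real m \<in> {real j / real m..(real j + 1) / real m}"
  by (simp add: divide_right_mono)

text \<open>Riemann sums of continuous paths express both functionals as limits of forms in finitely
  many coordinates, from which measurability and nonnegativity are inherited.\<close>

lemma MSE_PE_limit: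
  assumes \<Theta>: "random_element N (path_space \<tau>) \<Theta>"
  shows "\<omega> \<in> space N \<Longrightarrow> (\<lambda>m. form q_mse m (\<lambda>j. \<Theta> \<omega> s (real j / real m))) \<longlonglongrightarrow> MSE (\<Theta> \<omega>) s"
    and "\<omega> \<in> space N \<Longrightarrow> (\<lambda>m. form q_pe m (\<lambda>j. \<Theta> \<omega> s (real j / real m))) \<longlonglongrightarrow> PE A (\<Theta> \<omega>) s"
    and "(\<lambda>\<omega>. form q m (\<lambda>j. \<Theta> \<omega> s (real j / real m))) \<in> borel_measurable N"
    and "(\<lambda>\<omega>. MSE (\<Theta> \<omega>) s) \<in> borel_measurable N" and "(\<lambda>\<omega>. PE A (\<Theta> \<omega>) s) \<in> borel_measurable N"
    and "\<omega> \<in> space N \<Longrightarrow> 0 \<le> MSE (\<Theta> \<omega>) s" and "\<omega> \<in> space N \<Longrightarrow> 0 \<le> PE A (\<Theta> \<omega>) s"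
proof -
  have c: "continuous_on {0..1} (\<Theta> \<omega> s)" if "\<omega> \<in> space N" for \<omega>
  proof -
    have "\<Theta> \<omega> \<in> mspace (path_space \<tau>)" using \<Theta> that by (auto simp: random_element_def)
    from path_space_mem[OF this s] show ?thesis by (simp add: mspace_C01)
  qed
  show 1: "(\<lambda>m. form q_mse m (\<lambda>j. \<Theta> \<omega> s (real j / real m))) \<longlonglongrightarrow> MSE (\<Theta> \<omega>) s" if "\<omega> \<in> space N" for \<omega>
    unfolding form_mse by (rule riemann_MSE[where p="\<lambda>m j. real j / real m" and f="\<Theta> \<omega>", OF c[OF that] left_points])
  show 2: "(\<lambda>m. form q_pe m (\<lambda>j. \<Theta> \<omega> s (real j / real m))) \<longlonglongrightarrow> PE A (\<Theta> \<omega>) s" if "\<omega> \<in> space N" for \<omega>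
    unfolding form_pe by (rule riemann_PE[where p="\<lambda>m j. real j / real m" and f="\<Theta> \<omega>", OF c[OF that] left_points])
  show 3: "(\<lambda>\<omega>. form q m (\<lambda>j. \<Theta> \<omega> s (real j / real m))) \<in> borel_measurable N" for q m
    unfolding form_def
    by (intro borel_measurable_sum borel_measurable_times borel_measurable_const path_eval_measurable[OF \<Theta> s] grid_in) auto
  show "(\<lambda>\<omega>. MSE (\<Theta> \<omega>) s) \<in> borel_measurable N" using 1 3 by (rule borel_measurable_LIMSEQ_real)
  show "(\<lambda>\<omega>. PE A (\<Theta> \<omega>) s) \<in> borel_measurable N" using 2 3 by (rule borel_measurable_LIMSEQ_real)
  show "0 \<le> MSE (\<Theta> \<omega>) s" if "\<omega> \<in> space N" for \<omega>
    by (rule LIMSEQ_le_const[OF 1[OF that]]) (simp add: form_mse_nonneg)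
  show "0 \<le> PE A (\<Theta> \<omega>) s" if "\<omega> \<in> space N" for \<omega>
    by (rule LIMSEQ_le_const[OF 2[OF that]]) (simp add: form_pe_nonneg)
qed

lemma quadratic_conv_in_distribution:
  fixes \<xi> :: "real \<Rightarrow> real \<Rightarrow> 'b \<Rightarrow> real"
  assumes S: "solves_limit N \<alpha>' \<gamma> \<xi> \<Theta>0 \<Theta>" and wc: "weak_conv_metric C01 M init N \<Theta>0"
  shows "conv_in_distribution M mse N (\<lambda>\<omega>. MSE (\<Theta> \<omega>) s)" and "conv_in_distribution M pe N (\<lambda>\<omega>. PE A (\<Theta> \<omega>) s)"
proof -
  have N: "prob_space N" and \<Theta>: "random_element N (path_space \<tau>) \<Theta>" using S unfolding solves_limit_def by auto
  note lim = MSE_PE_limit[OF \<Theta>]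
  have cc: "0 \<le> c_coarse" using consts_pos K_ge_1 by (simp add: c_coarse_def)
  \<comment> \<open>For fixed m only finitely many coordinates enter, at data indices converging to
    the coarse nodes.\<close>
  have point: "(\<lambda>n. \<integral>\<omega>. exp (- (p * form q m (\<lambda>j. err n (t n) (ix m n j) \<omega>))) \<partial>M)
      \<longlonglongrightarrow> (\<integral>\<omega>. exp (- (p * form q m (\<lambda>j. \<Theta> \<omega> s (real j / real m)))) \<partial>N)"
    if m: "m > 0" and p: "p \<ge> 0" and q: "\<And>j k. j < m \<Longrightarrow> k < m \<Longrightarrow> q m j k = q m k j" "\<And>v. 0 \<le> form q m v"
    for m :: nat and p :: real and q
    unfolding form_def
  proof (rule charfn_conv_imp_quadratic_laplace_conv[OF prob_space_axioms N])
    show "err n (t n) (ix m n j) \<in> borel_measurable M" if "j < m" for n j by (intro err_measurable ix_in that)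
    show "(\<lambda>\<omega>. \<Theta> \<omega> s (real j / real m)) \<in> borel_measurable N" if "j < m" for j
      by (intro path_eval_measurable[OF \<Theta> s] grid_in that)
    show "(\<lambda>n. \<integral>\<omega>. iexp (\<Sum>j<m. c j * err n (t n) (ix m n j) \<omega>) \<partial>M) \<longlonglongrightarrow> (\<integral>\<omega>. iexp (\<Sum>j<m. c j * \<Theta> \<omega> s (real j / real m)) \<partial>N)" for c
    proof (rule point_charfn_conv[OF S wc])
      show "(\<lambda>n. real (ix m n j) / real (d n)) \<longlonglongrightarrow> real j / real m" if "j \<in> {..<m}" for j
        unfolding ix_def by (rule coarse_index_tendsto[OF d_lim d_pos m])
    qed (use ix_in grid_in in auto)
    show "0 \<le> (\<Sum>j<m. \<Sum>k<m. q m j k * v j * v k)" for v using q(2)[of v] by (simp add: form_def)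
  qed (use q p in auto)
  show "conv_in_distribution M mse N (\<lambda>\<omega>. MSE (\<Theta> \<omega>) s)"
  proof (rule laplace_imp_conv_in_distribution[OF prob_space_axioms N mse_measurable lim(4) mse_nonneg lim(6)])
    fix p :: nat
    show "(\<lambda>n. \<integral>\<omega>. exp (- (real p * mse n \<omega>)) \<partial>M) \<longlonglongrightarrow> (\<integral>\<omega>. exp (- (real p * MSE (\<Theta> \<omega>) s)) \<partial>N)"
      by (rule laplace_conv_by_approx[OF prob_space_axioms N _ cc mse_measurable mse_nonneg form_measurable form_mse_nonneg
            lim(4) lim(6) lim(3) form_mse_nonneg mse_coarse_error inverse_tendsto(1) point lim(1)])
         (auto simp: q_mse_def form_mse_nonneg)
  qed
  show "conv_in_distribution M pe N (\<lambda>\<omega>. PE A (\<Theta> \<omega>) s)"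
  proof (rule laplace_imp_conv_in_distribution[OF prob_space_axioms N pe_measurable lim(5) pe_nonneg lim(7)])
    fix p :: nat
    show "(\<lambda>n. \<integral>\<omega>. exp (- (real p * pe n \<omega>)) \<partial>M) \<longlonglongrightarrow> (\<integral>\<omega>. exp (- (real p * PE A (\<Theta> \<omega>) s)) \<partial>N)"
      by (rule laplace_conv_by_approx[OF prob_space_axioms N _ cc pe_measurable pe_nonneg form_measurable form_pe_nonneg
            lim(5) lim(7) lim(3) form_pe_nonneg pe_coarse_error inverse_tendsto(1) point lim(2)])
         (auto simp: q_pe_def form_pe_nonneg intro!: A_sym grid_in)
  qed
qed

end

section \<open>Convergence in probability in the low-noise regime\<close>

text \<open>By continuity a bound at all rational nodes extends to the whole interval, so countably
  many evaluations decide the event.\<close>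

lemma sup_le_measurable:
  fixes f :: "'a \<Rightarrow> real \<Rightarrow> real"
  assumes m: "\<And>x. x \<in> {0..1} \<Longrightarrow> (\<lambda>\<omega>. f \<omega> x) \<in> borel_measurable M"
    and c: "\<And>\<omega>. \<omega> \<in> space M \<Longrightarrow> continuous_on {0..1} (f \<omega>)"
  shows "{\<omega> \<in> space M. \<forall>x\<in>{0..1}. \<bar>f \<omega> x\<bar> \<le> B} \<in> sets M"
proof -
  have "{\<omega> \<in> space M. \<forall>x\<in>{0..1}. \<bar>f \<omega> x\<bar> \<le> B}
      = {\<omega> \<in> space M. \<forall>m. \<forall>j\<in>{..Suc m}. \<bar>f \<omega> (real j / real (Suc m))\<bar> \<le> B}"
  proof (intro Collect_cong conj_cong refl iffI allI ballI)
    fix \<omega> m j assume "\<forall>x\<in>{0..1}. \<bar>f \<omega> x\<bar> \<le> B" "j \<in> {..Suc m}"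
    then show "\<bar>f \<omega> (real j / real (Suc m))\<bar> \<le> B" by (auto simp: divide_le_eq)
  next
    fix \<omega> and x :: real assume \<omega>: "\<omega> \<in> space M" and x: "x \<in> {0..1}"
      and le: "\<forall>m. \<forall>j\<in>{..Suc m}. \<bar>f \<omega> (real j / real (Suc m))\<bar> \<le> B"
    define y where "y m = real (coarse (Suc m) x) / real (Suc m)" for m
    have y: "coarse (Suc m) x \<le> Suc m" "\<bar>x - y m\<bar> \<le> 1 / real (Suc m)" for m
      using coarse_bounds[OF x, of "Suc m"] by (auto simp: y_def)
    have y01: "y m \<in> {0..1}" for m using y(1)[of m] by (simp add: y_def divide_le_eq)
    have "(\<lambda>m. y m - x) \<longlonglongrightarrow> 0"
    proof (rule Lim_null_comparison)
      show "\<forall>\<^sub>F m in sequentially. norm (y m - x) \<le> 1 / real (Suc m)"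
        using y(2) by (simp add: abs_minus_commute)
      show "(\<lambda>m. 1 / real (Suc m)) \<longlonglongrightarrow> 0" by (rule LIMSEQ_Suc[OF lim_1_over_n])
    qed
    then have "y \<longlonglongrightarrow> x" by (rule LIM_zero_cancel)
    then have "(\<lambda>m. \<bar>f \<omega> (y m)\<bar>) \<longlonglongrightarrow> \<bar>f \<omega> x\<bar>"
      by (intro tendsto_rabs continuous_on_tendsto_compose[OF c[OF \<omega>]] x) (use y01 in auto)
    moreover have "\<bar>f \<omega> (y m)\<bar> \<le> B" for m using le y(1)[of m] by (simp add: y_def)
    ultimately show "\<bar>f \<omega> x\<bar> \<le> B" by (intro LIMSEQ_le_const2) auto
  qed
  also have "\<dots> \<in> sets M"
  proof (intro sets.sets_Collect_countable_All sets.sets_Collect_finite_All')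
    fix m j assume "j \<in> {..Suc m}"
    then have [measurable]: "(\<lambda>\<omega>. f \<omega> (real j / real (Suc m))) \<in> borel_measurable M"
      by (intro m) (auto simp: divide_le_eq)
    show "{\<omega> \<in> space M. \<bar>f \<omega> (real j / real (Suc m))\<bar> \<le> B} \<in> sets M" by measurable
  qed auto
  finally show ?thesis .
qed

text \<open>Meant for the interpolated initial error, whose measurability has been established at
  single points.\<close>

lemma mdist_C01_gt_measurable:
  assumes X: "\<And>x. x \<in> {0..1} \<Longrightarrow> (\<lambda>\<omega>. X \<omega> x) \<in> borel_measurable M" "\<And>\<omega>. \<omega> \<in> space M \<Longrightarrow> X \<omega> \<in> mspace C01"
    and Y: "\<And>x. x \<in> {0..1} \<Longrightarrow> (\<lambda>\<omega>. Y \<omega> x) \<in> borel_measurable M" "\<And>\<omega>. \<omega> \<in> space M \<Longrightarrow> Y \<omega> \<in> mspace C01"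
    and e: "e \<ge> 0"
  shows "{\<omega> \<in> space M. mdist C01 (X \<omega>) (Y \<omega>) > e} \<in> sets M"
proof -
  have "{\<omega> \<in> space M. mdist C01 (X \<omega>) (Y \<omega>) > e} = space M - {\<omega> \<in> space M. \<forall>x\<in>{0..1}. \<bar>X \<omega> x - Y \<omega> x\<bar> \<le> e}"
    using mdist_C01_ge[OF X(2) Y(2)] mdist_C01_le[OF e] by (fastforce intro: order_trans simp: not_le[symmetric])
  moreover have "{\<omega> \<in> space M. \<forall>x\<in>{0..1}. \<bar>X \<omega> x - Y \<omega> x\<bar> \<le> e} \<in> sets M"
    using X Y by (intro sup_le_measurable) (auto simp: mspace_C01 intro!: continuous_intros)
  ultimately show ?thesis by auto
qed

lemma (in prob_space) AE_tendsto_0_imp_prob: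
  fixes X :: "nat \<Rightarrow> 'a \<Rightarrow> real"
  assumes X[measurable]: "\<And>n. X n \<in> borel_measurable M" and ae: "AE \<omega> in M. (\<lambda>n. X n \<omega>) \<longlonglongrightarrow> 0" and e: "e > 0"
  shows "(\<lambda>n. prob {\<omega> \<in> space M. e < X n \<omega>}) \<longlonglongrightarrow> 0"
proof -
  have "(\<lambda>n. expectation (\<lambda>\<omega>. indicator {\<omega> \<in> space M. e < X n \<omega>} \<omega> :: real)) \<longlonglongrightarrow> expectation (\<lambda>\<omega>. 0)"
  proof (rule integral_dominated_convergence[where w="\<lambda>_. 1"])
    show "AE \<omega> in M. (\<lambda>n. indicator {\<omega> \<in> space M. e < X n \<omega>} \<omega> :: real) \<longlonglongrightarrow> 0"
      using ae
    proof eventually_elim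
      case (elim \<omega>)
      have "\<forall>\<^sub>F n in sequentially. X n \<omega> < e" using order_tendstoD(2)[OF elim e] .
      then have "\<forall>\<^sub>F n in sequentially. (indicator {\<omega> \<in> space M. e < X n \<omega>} \<omega> :: real) = 0"
        by eventually_elim (simp add: indicator_def)
      then show ?case by (rule tendsto_eventually)
    qed
  qed (auto simp: indicator_def)
  then show ?thesis by simp
qed

lemma average_abs_le_sqrt:
  fixes e :: "nat \<Rightarrow> real"
  assumes "d > 0"
  shows "1 / real d * (\<Sum>i<d. \<bar>e i\<bar>) \<le> sqrt (1 / real d * (\<Sum>i<d. (e i)\<^sup>2))"
proof (rule real_le_rsqrt)
  have "(\<Sum>i<d. \<bar>e i\<bar>)\<^sup>2 \<le> (\<Sum>i<d. \<bar>e i\<bar>\<^sup>2) * real (card {..<d})"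
    by (rule sum_squared_le_sum_of_squares)
  then show "(1 / real d * (\<Sum>i<d. \<bar>e i\<bar>))\<^sup>2 \<le> 1 / real d * (\<Sum>i<d. (e i)\<^sup>2)"
    using assms by (simp add: power_mult_distrib power_divide power2_eq_square field_simps)
qed

section \<open>Mean square distance to the limiting flow\<close>

context sgd_sequence
begin

text \<open>The distance is taken to the limit at time s itself, while the error sits at the grid
  time. This one quantity controls the errors of both functionals.\<close>

definition deviation :: "('a \<Rightarrow> real \<Rightarrow> real \<Rightarrow> real) \<Rightarrow> nat \<Rightarrow> 'a \<Rightarrow> real" where
  "deviation \<Theta> n \<omega> = 1 / real (d n) * (\<Sum>i<d n. (err n (t n) (Suc i) \<omega> - \<Theta> \<omega> s (real (Suc i) / real (d n)))\<^sup>2)"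

lemma right_in: "i < d n \<Longrightarrow> real (Suc i) / real (d n) \<in> {0..1}"
  by auto

lemma deviation_measurable:
  assumes "random_element M (path_space \<tau>) \<Theta>"
  shows "deviation \<Theta> n \<in> borel_measurable M"
  unfolding deviation_def[abs_def]
  by (intro borel_measurable_times borel_measurable_sum borel_measurable_power borel_measurable_diff borel_measurable_const
      err_measurable path_eval_measurable[OF assms s] right_in) auto

lemma average_const_le:
  assumes "\<And>i. i < d n \<Longrightarrow> f i \<le> c"
  shows "1 / real (d n) * (\<Sum>i<d n. f i) \<le> (c::real)"
proof -
  have "(\<Sum>i<d n. f i) \<le> (\<Sum>i<d n. c)" by (intro sum_mono assms) auto
  then show ?thesis using d_pos[of n] by (simp add: field_simps)
qed

text \<open>Error minus limit splits into \<open>P\<close>, the noise and martingale parts, small in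
  L2; \<open>Q\<close>, the initial discrepancy carried by the dual vectors, bounded by the supremum
  distance \<open>\<mu>\<close>, which is small in probability; and \<open>R\<close>, the Euler and
  time-discretisation error, tending to 0 along almost every path. With \<gamma> = 0 the field drops
  out, so the comparison takes place on the original probability space.\<close>

lemma deviation_tendsto_0:
  fixes \<xi> :: "real \<Rightarrow> real \<Rightarrow> 'a \<Rightarrow> real"
  assumes S: "solves_limit M \<alpha>' 0 \<xi> \<Theta>0 \<Theta>" and cp: "conv_in_prob_metric C01 M init \<Theta>0" and e: "e > 0"
  shows "(\<lambda>n. prob {\<omega> \<in> space M. e < deviation \<Theta> n \<omega>}) \<longlonglongrightarrow> 0"
proof -
  have \<Theta>0: "random_element M C01 \<Theta>0" and \<Theta>: "random_element M (path_space \<tau>) \<Theta>"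
    and \<eta>: "(\<lambda>n. \<eta> n * d n * T n) \<longlonglongrightarrow> \<alpha>'" and \<gamma>: "(\<lambda>n. \<sigma> n * \<eta> n * sqrt (T n)) \<longlonglongrightarrow> 0"
    and ae: "AE \<omega> in M. \<Theta> \<omega> 0 = \<Theta>0 \<omega> \<and> limit_path \<tau> A \<alpha>' 0 (\<lambda>s x. \<xi> s x \<omega>) (\<Theta> \<omega>)"
    using S unfolding solves_limit_def by auto
  define u where "u n i = w n (coord (Suc i)) (t n)" for n i
  define P where "P n i \<omega> = err n (t n) (Suc i) \<omega> - ip (d n) (u n i) (\<lambda>j. err n 0 j \<omega>)" for n i \<omega>
  define Q where "Q n i \<omega> = ip (d n) (u n i) (\<lambda>j. err n 0 j \<omega> - \<Theta>0 \<omega> (real j / real (d n)))" for n i \<omega>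
  define R where "R n i \<omega> = ip (d n) (u n i) (\<lambda>j. \<Theta>0 \<omega> (real j / real (d n))) - \<Theta> \<omega> s (real (Suc i) / real (d n))" for n i \<omega>
  define AP where "AP n \<omega> = 1 / real (d n) * (\<Sum>i<d n. (P n i \<omega>)\<^sup>2)" for n \<omega>
  define AR where "AR n \<omega> = 1 / real (d n) * (\<Sum>i<d n. (R n i \<omega>)\<^sup>2)" for n \<omega>
  define \<mu> where "\<mu> n \<omega> = mdist C01 (init n \<omega>) (\<Theta>0 \<omega>)" for n \<omega>
  have l1c: "l1 (d n) (coord (Suc i)) \<le> 1" and ipc: "ip (d n) (coord (Suc i)) y = y (Suc i)" if "i < d n" for n i y
    using that by (simp_all add: l1_coord ip_coord)
  have l1u: "l1 (d n) (u n i) \<le> exp (K ^ 3)" if "i < d n" for n i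
    using order_trans[OF l1_w_le[OF order_refl] mult_left_mono[OF l1c[OF that], of "exp (K ^ 3)"]] by (simp add: u_def)
  have initC: "init n \<omega> \<in> mspace C01" for n \<omega> unfolding init_def by (rule Theta_init_C01[OF d_pos])
  have \<Theta>0C: "\<Theta>0 \<omega> \<in> mspace C01" if "\<omega> \<in> space M" for \<omega> using \<Theta>0 that by (auto simp: random_element_def)
  have jg: "real j / real (d n) \<in> {0..1}" if "j \<in> {1..d n}" for j n using that by auto
  have Qle: "\<bar>Q n i \<omega>\<bar> \<le> exp (K ^ 3) * \<mu> n \<omega>" if "i < d n" "\<omega> \<in> space M" for n i \<omega>
  proof -
    have "\<bar>Q n i \<omega>\<bar> \<le> l1 (d n) (u n i) * \<mu> n \<omega>"
      unfolding Q_def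
    proof (rule abs_ip_le)
      fix j assume j: "j \<in> {1..d n}"
      show "\<bar>err n 0 j \<omega> - \<Theta>0 \<omega> (real j / real (d n))\<bar> \<le> \<mu> n \<omega>"
        using mdist_C01_ge[OF initC \<Theta>0C[OF that(2)] jg[OF j], of n \<omega>] by (simp add: \<mu>_def init_grid[OF j])
    qed
    also have "\<dots> \<le> exp (K ^ 3) * \<mu> n \<omega>"
      using l1u[OF that(1)] by (intro mult_right_mono) (auto simp: \<mu>_def)
    finally show ?thesis .
  qed
  have dev_le: "deviation \<Theta> n \<omega> \<le> 3 * AP n \<omega> + 3 * (exp (K ^ 3) * \<mu> n \<omega>)\<^sup>2 + 3 * AR n \<omega>" if \<omega>: "\<omega> \<in> space M" for n \<omega>
  proof -
    have pw: "(err n (t n) (Suc i) \<omega> - \<Theta> \<omega> s (real (Suc i) / real (d n)))\<^sup>2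
        \<le> 3 * (P n i \<omega>)\<^sup>2 + 3 * (exp (K ^ 3) * \<mu> n \<omega>)\<^sup>2 + 3 * (R n i \<omega>)\<^sup>2" if i: "i < d n" for i
    proof -
      have "err n (t n) (Suc i) \<omega> - \<Theta> \<omega> s (real (Suc i) / real (d n)) = P n i \<omega> + Q n i \<omega> + R n i \<omega>"
        by (simp add: P_def Q_def R_def ip_def right_diff_distrib sum_subtractf)
      moreover have "(p + q + r)\<^sup>2 \<le> 3 * p\<^sup>2 + 3 * q\<^sup>2 + 3 * r\<^sup>2" for p q r :: real
      proof -
        have "0 \<le> (p - q)\<^sup>2 + (q - r)\<^sup>2 + (p - r)\<^sup>2" by simp
        then show ?thesis by (simp add: power2_eq_square algebra_simps)
      qed
      moreover have "(Q n i \<omega>)\<^sup>2 \<le> (exp (K ^ 3) * \<mu> n \<omega>)\<^sup>2"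
        using Qle[OF i \<omega>] by (intro power2_le_iff_abs_le[THEN iffD2]) (auto simp: \<mu>_def)
      ultimately show ?thesis by (smt (verit))
    qed
    have "deviation \<Theta> n \<omega> \<le> 1 / real (d n) * (\<Sum>i<d n. 3 * (P n i \<omega>)\<^sup>2 + 3 * (exp (K ^ 3) * \<mu> n \<omega>)\<^sup>2 + 3 * (R n i \<omega>)\<^sup>2)"
      unfolding deviation_def by (intro mult_left_mono sum_mono pw) auto
    also have "\<dots> = 3 * AP n \<omega> + 3 * (exp (K ^ 3) * \<mu> n \<omega>)\<^sup>2 + 3 * AR n \<omega>"
      using d_pos[of n] by (simp add: AP_def AR_def sum.distrib sum_distrib_left[symmetric] field_simps)
    finally show ?thesis .
  qed
  have Pm: "P n i \<in> borel_measurable M" and Psq: "square_integrable M (P n i)" if "i < d n" for n i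
    using err_linear_part(1)[OF l1c[OF that]] unfolding ipc[OF that] P_def u_def by (auto simp: square_integrable_def)
  have Rm: "R n i \<in> borel_measurable M" if "i < d n" for n i
    unfolding R_def[abs_def] ip_def
    by (intro borel_measurable_times borel_measurable_sum borel_measurable_diff borel_measurable_const
        path_eval_measurable[OF \<Theta> s] right_in C01_eval_measurable[OF \<Theta>0] jg that)
  have APm: "AP n \<in> borel_measurable M" and ARm: "AR n \<in> borel_measurable M" for n
    unfolding AP_def[abs_def] AR_def[abs_def]
    by (intro borel_measurable_times borel_measurable_sum borel_measurable_power borel_measurable_const Pm Rm; simp)+
  define b where "b n = 2 * (K ^ 3 * (exp (K ^ 3) * 1)\<^sup>2) * (\<sigma> n * \<eta> n * sqrt (T n))\<^sup>2
        + 2 * (4 * K ^ 5 * (exp (K ^ 3) * 1)\<^sup>2 * second_moment_const K) * (1 / T n)" for n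
  have APi: "integrable M (AP n)" and EAP: "expectation (AP n) \<le> b n" for n
  proof -
    have i: "integrable M (\<lambda>\<omega>. (P n i \<omega>)\<^sup>2)" if "i < d n" for i using Psq[OF that] by (simp add: square_integrable_def)
    then show "integrable M (AP n)" unfolding AP_def[abs_def] by (intro integrable_mult_right Bochner_Integration.integrable_sum) auto
    have "expectation (AP n) = 1 / real (d n) * (\<Sum>i<d n. expectation (\<lambda>\<omega>. (P n i \<omega>)\<^sup>2))"
      unfolding AP_def[abs_def] using i by (simp add: Bochner_Integration.integral_sum)
    also have "\<dots> \<le> b n"
    proof (rule average_const_le)
      fix i assume "i < d n"
      show "expectation (\<lambda>\<omega>. (P n i \<omega>)\<^sup>2) \<le> b n"
        using err_linear_part(2)[OF l1c[OF \<open>i < d n\<close>]] unfolding ipc[OF \<open>i < d n\<close>] P_def u_def b_def .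
    qed
    finally show "expectation (AP n) \<le> b n" .
  qed
  have b0: "b \<longlonglongrightarrow> 0"
  proof -
    have "b \<longlonglongrightarrow> 2 * (K ^ 3 * (exp (K ^ 3) * 1)\<^sup>2) * 0\<^sup>2 + 2 * (4 * K ^ 5 * (exp (K ^ 3) * 1)\<^sup>2 * second_moment_const K) * 0"
      unfolding b_def by (intro tendsto_intros \<gamma> inverse_tendsto)
    then show ?thesis by simp
  qed
  \<comment> \<open>Three parts, each entering the square with a factor 3.\<close>
  have e9: "e / 9 > 0" using e by simp
  have AP0: "0 \<le> AP n \<omega>" for n \<omega> by (simp add: AP_def sum_nonneg)
  have p1: "(\<lambda>n. prob {\<omega> \<in> space M. e / 9 \<le> AP n \<omega>}) \<longlonglongrightarrow> 0"
  proof (rule Lim_null_comparison)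
    have "prob {\<omega> \<in> space M. e / 9 \<le> AP n \<omega>} \<le> 1 / (e / 9) * expectation (AP n)" for n
      using integral_Markov_inequality_measure[OF APi, of "space M" n "e / 9"] e9 AP0 by (simp add: mult.commute)
    also have "1 / (e / 9) * expectation (AP n) \<le> 1 / (e / 9) * b n" for n using EAP e9 by (intro mult_left_mono) auto
    finally show "\<forall>\<^sub>F n in sequentially. norm (prob {\<omega> \<in> space M. e / 9 \<le> AP n \<omega>}) \<le> 1 / (e / 9) * b n" by simp
    show "(\<lambda>n. 1 / (e / 9) * b n) \<longlonglongrightarrow> 0" using tendsto_mult_right_zero[OF b0] .
  qed
  \<comment> \<open>Chosen so that the bound exp (K^3) \<delta> on \<open>Q\<close> has square e /
    9.\<close>
  define \<delta> where "\<delta> = sqrt (e / 9) / exp (K ^ 3)"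
  have \<delta>: "\<delta> > 0" using e by (simp add: \<delta>_def)
  have p2: "(\<lambda>n. prob {\<omega> \<in> space M. \<mu> n \<omega> > \<delta>}) \<longlonglongrightarrow> 0"
    using cp \<delta> unfolding conv_in_prob_metric_def \<mu>_def by blast
  have p3: "(\<lambda>n. prob {\<omega> \<in> space M. e / 9 < AR n \<omega>}) \<longlonglongrightarrow> 0"
  proof (rule AE_tendsto_0_imp_prob[OF ARm _ e9])
    show "AE \<omega> in M. (\<lambda>n. AR n \<omega>) \<longlonglongrightarrow> 0"
      using ae
    proof eventually_elim
      case (elim \<omega>)
      then have lp: "limit_path \<tau> A \<alpha>' 0 (\<lambda>s x. \<xi> s x \<omega>) (\<Theta> \<omega>)" and \<Theta>\<omega>: "\<Theta> \<omega> \<in> mspace (path_space \<tau>)"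
        and z0: "\<Theta> \<omega> 0 = \<Theta>0 \<omega>"
        by (auto simp: limit_path_def)
      show ?case
      proof (rule LIMSEQ_I)
        fix e :: real assume e: "e > 0"
        \<comment> \<open>Two errors of size r give |R| \<le> sqrt e / 2, hence a square of at most
          e / 4.\<close>
        define r where "r = sqrt e / 4"
        have r: "r > 0" using e by (simp add: r_def)
        obtain \<delta> where \<delta>: "\<delta> > 0" "\<And>u x. u \<in> {0..\<tau>} \<Longrightarrow> \<bar>u - s\<bar> < \<delta> \<Longrightarrow> x \<in> {0..1} \<Longrightarrow> \<bar>\<Theta> \<omega> u x - \<Theta> \<omega> s x\<bar> < r"
          using path_space_continuous_in_time[OF \<Theta>\<omega> s r] by blast
        have near: "\<forall>\<^sub>F n in sequentially. dist (real (t n) / T n) s < \<delta>" using tendstoD[OF t_div_tendsto \<delta>(1)] .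
        have "\<forall>\<^sub>F n in sequentially. norm (AR n \<omega> - 0) < e"
          using euler_conv[where \<xi>=\<xi> and \<omega>=\<omega> and c=1 and e=r, OF lp \<eta> zero_le_one r] near
        proof eventually_elim
          case (elim n)
          have "(R n i \<omega>)\<^sup>2 \<le> e / 4" if i: "i < d n" for i
          proof -
            have "\<bar>\<Theta> \<omega> (real (t n) / real (T n)) (real (Suc i) / real (d n)) - ip (d n) (u n i) (\<lambda>j. \<Theta>0 \<omega> (real j / real (d n)))\<bar> \<le> r"
              using elim(1)[rule_format, OF l1c[OF i]] by (simp add: ipc[OF i] u_def z0)
            moreover have "\<bar>\<Theta> \<omega> (real (t n) / real (T n)) (real (Suc i) / real (d n)) - \<Theta> \<omega> s (real (Suc i) / real (d n))\<bar> < r"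
              using elim(2) by (intro \<delta>(2) t_div_in right_in i) (simp add: dist_real_def)
            ultimately have "\<bar>R n i \<omega>\<bar> \<le> 2 * r" unfolding R_def by linarith
            then have "(R n i \<omega>)\<^sup>2 \<le> (2 * r)\<^sup>2" using r by (intro power2_le_iff_abs_le[THEN iffD2]) auto
            also have "\<dots> = e / 4" using e by (simp add: r_def power_mult_distrib power_divide)
            finally show ?thesis .
          qed
          then have "AR n \<omega> \<le> e / 4" unfolding AR_def by (rule average_const_le)
          moreover have "0 \<le> AR n \<omega>" by (simp add: AR_def sum_nonneg)
          ultimately show ?case using e by simp
        qed
        then show "\<exists>no. \<forall>n\<ge>no. norm (AR n \<omega> - 0) < e" by (simp add: eventually_sequentially)
      qed
    qed
  qed
  show ?thesis
  proof (rule Lim_null_comparison)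
    have "prob {\<omega> \<in> space M. e < deviation \<Theta> n \<omega>} \<le> prob {\<omega> \<in> space M. e / 9 \<le> AP n \<omega>}
        + prob {\<omega> \<in> space M. \<mu> n \<omega> > \<delta>} + prob {\<omega> \<in> space M. e / 9 < AR n \<omega>}" for n
    proof -
      have s1: "{\<omega> \<in> space M. e / 9 \<le> AP n \<omega>} \<in> events" using APm by measurable
      have s2: "{\<omega> \<in> space M. \<mu> n \<omega> > \<delta>} \<in> events"
        unfolding \<mu>_def using \<delta>
        by (intro mdist_C01_gt_measurable init_measurable initC C01_eval_measurable[OF \<Theta>0] \<Theta>0C) auto
      have s3: "{\<omega> \<in> space M. e / 9 < AR n \<omega>} \<in> events" using ARm by measurable
      have "{\<omega> \<in> space M. e < deviation \<Theta> n \<omega>} \<subseteq> {\<omega> \<in> space M. e / 9 \<le> AP n \<omega>} \<union> {\<omega> \<in> space M. \<mu> n \<omega> > \<delta>} \<union> {\<omega> \<in> space M. e / 9 < AR n \<omega>}"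
      proof (rule subsetI, rule ccontr)
        fix \<omega> assume 1: "\<omega> \<in> {\<omega> \<in> space M. e < deviation \<Theta> n \<omega>}"
          and 2: "\<omega> \<notin> {\<omega> \<in> space M. e / 9 \<le> AP n \<omega>} \<union> {\<omega> \<in> space M. \<mu> n \<omega> > \<delta>} \<union> {\<omega> \<in> space M. e / 9 < AR n \<omega>}"
        then have \<omega>: "\<omega> \<in> space M" and less: "AP n \<omega> \<le> e / 9" "\<mu> n \<omega> \<le> \<delta>" "AR n \<omega> \<le> e / 9" by auto
        have "(exp (K ^ 3) * \<mu> n \<omega>)\<^sup>2 \<le> (exp (K ^ 3) * \<delta>)\<^sup>2"
          using less by (intro power_mono mult_left_mono) (auto simp: \<mu>_def)
        also have "\<dots> = e / 9" using e by (simp add: \<delta>_def)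
        finally show False using dev_le[OF \<omega>, of n] less 1 by simp
      qed
      then have "prob {\<omega> \<in> space M. e < deviation \<Theta> n \<omega>}
          \<le> prob ({\<omega> \<in> space M. e / 9 \<le> AP n \<omega>} \<union> {\<omega> \<in> space M. \<mu> n \<omega> > \<delta>} \<union> {\<omega> \<in> space M. e / 9 < AR n \<omega>})"
        using s1 s2 s3 by (intro finite_measure_mono) auto
      also have "\<dots> \<le> prob ({\<omega> \<in> space M. e / 9 \<le> AP n \<omega>} \<union> {\<omega> \<in> space M. \<mu> n \<omega> > \<delta>}) + prob {\<omega> \<in> space M. e / 9 < AR n \<omega>}"
        using s1 s2 s3 by (intro measure_Un_le) auto
      also have "\<dots> \<le> prob {\<omega> \<in> space M. e / 9 \<le> AP n \<omega>} + prob {\<omega> \<in> space M. \<mu> n \<omega> > \<delta>} + prob {\<omega> \<in> space M. e / 9 < AR n \<omega>}"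
        using s1 s2 by (intro add_right_mono measure_Un_le) auto
      finally show ?thesis .
    qed
    then show "\<forall>\<^sub>F n in sequentially. norm (prob {\<omega> \<in> space M. e < deviation \<Theta> n \<omega>}) \<le> prob {\<omega> \<in> space M. e / 9 \<le> AP n \<omega>}
        + prob {\<omega> \<in> space M. \<mu> n \<omega> > \<delta>} + prob {\<omega> \<in> space M. e / 9 < AR n \<omega>}" by simp
    show "(\<lambda>n. prob {\<omega> \<in> space M. e / 9 \<le> AP n \<omega>} + prob {\<omega> \<in> space M. \<mu> n \<omega> > \<delta>} + prob {\<omega> \<in> space M. e / 9 < AR n \<omega>}) \<longlonglongrightarrow> 0"
      using tendsto_add[OF tendsto_add[OF p1 p2] p3] by simp
  qed
qed

text \<open>The bound on Y - R involves a bound B of a random path. On an event of probability close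
  to 1 the path is bounded by a fixed integer b, and there the difference is small as soon as the
  deviation is. In the applications R is a Riemann sum along the path, so its convergence is
  pathwise.\<close>

lemma conv_in_prob_of_deviation:
  fixes \<xi> :: "real \<Rightarrow> real \<Rightarrow> 'a \<Rightarrow> real"
  assumes S: "solves_limit M \<alpha>' 0 \<xi> \<Theta>0 \<Theta>" and cp: "conv_in_prob_metric C01 M init \<Theta>0"
    and Y: "\<And>n. Y n \<in> borel_measurable M" and R: "\<And>n. R n \<in> borel_measurable M" and Z: "Z \<in> borel_measurable M"
    and lim: "\<And>\<omega>. \<omega> \<in> space M \<Longrightarrow> (\<lambda>n. R n \<omega>) \<longlonglongrightarrow> Z \<omega>"
    and le: "\<And>n \<omega> B. \<omega> \<in> space M \<Longrightarrow> B \<ge> 0 \<Longrightarrow> \<forall>x\<in>{0..1}. \<bar>\<Theta> \<omega> s x\<bar> \<le> B \<Longrightarrow>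
      \<bar>Y n \<omega> - R n \<omega>\<bar> \<le> K * (deviation \<Theta> n \<omega> + 2 * B * sqrt (deviation \<Theta> n \<omega>))"
  shows "conv_in_prob M Y Z"
  unfolding conv_in_prob_def conv_in_prob_metric_def mdist_euclidean_metric
proof (intro allI impI LIMSEQ_I)
  fix e \<epsilon> :: real assume e: "e > 0" and \<epsilon>: "\<epsilon> > 0"
  have \<Theta>: "random_element M (path_space \<tau>) \<Theta>" using S unfolding solves_limit_def by auto
  have \<Theta>c: "continuous_on {0..1} (\<Theta> \<omega> s)" if "\<omega> \<in> space M" for \<omega>
  proof -
    have "\<Theta> \<omega> \<in> mspace (path_space \<tau>)" using \<Theta> that by (auto simp: random_element_def)
    from path_space_mem[OF this s] show ?thesis by (simp add: mspace_C01)
  qed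
  define G where "G b = {\<omega> \<in> space M. \<forall>x\<in>{0..1}. \<bar>\<Theta> \<omega> s x\<bar> \<le> real b}" for b :: nat
  have Gm: "G b \<in> events" for b
    unfolding G_def by (rule sup_le_measurable[OF path_eval_measurable[OF \<Theta> s] \<Theta>c])
  have "(\<lambda>b. prob (G b)) \<longlonglongrightarrow> prob (\<Union>b. G b)"
    using Gm by (intro finite_Lim_measure_incseq) (auto simp: incseq_def G_def intro: order_trans)
  moreover have "(\<Union>b. G b) = space M"
  proof (intro equalityI subsetI)
    fix \<omega> assume \<omega>: "\<omega> \<in> space M"
    have "bounded (\<Theta> \<omega> s ` {0..1})"
      by (rule compact_imp_bounded[OF compact_continuous_image[OF \<Theta>c[OF \<omega>] compact_Icc]])
    then obtain c where "\<forall>x\<in>{0..1}. \<bar>\<Theta> \<omega> s x\<bar> \<le> c" unfolding bounded_iff by auto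
    moreover obtain b :: nat where "c \<le> real b" using real_arch_simple by blast
    ultimately have "\<omega> \<in> G b" using \<omega> by (force simp: G_def)
    then show "\<omega> \<in> (\<Union>b. G b)" by blast
  qed (auto simp: G_def)
  ultimately have "(\<lambda>b. prob (G b)) \<longlonglongrightarrow> 1" by (simp add: prob_space)
  then have "\<forall>\<^sub>F b in sequentially. 1 - \<epsilon> / 4 < prob (G b)" using \<epsilon> by (intro order_tendstoD(1)) auto
  then obtain b where b: "1 - \<epsilon> / 4 < prob (G b)" unfolding eventually_sequentially by blast
  have pG: "prob (space M - G b) \<le> \<epsilon> / 4" using b prob_compl[OF Gm[of b]] by simp
  \<comment> \<open>For v \<le> 1 one has v \<le> sqrt v; if also sqrt v \<le> q, the error is at
    most K (1 + 2 b) q = e / 2.\<close>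
  define q where "q = e / (2 * K * (1 + 2 * real b))"
  have q: "q > 0" using e K_ge_1 by (simp add: q_def)
  define \<delta> where "\<delta> = min 1 (q\<^sup>2)"
  have \<delta>: "\<delta> > 0" using q by (simp add: \<delta>_def)
  have small: "K * (v + 2 * real b * sqrt v) \<le> e / 2" if "0 \<le> v" "v \<le> \<delta>" for v
  proof -
    have v1: "v \<le> sqrt v"
    proof (rule real_le_rsqrt)
      have "v \<le> 1" using that by (simp add: \<delta>_def)
      then show "v\<^sup>2 \<le> v" using that by (simp add: power2_eq_square mult_left_le)
    qed
    have v2: "sqrt v \<le> q" using that q by (intro real_le_lsqrt) (auto simp: \<delta>_def)
    have "v + 2 * real b * sqrt v \<le> (1 + 2 * real b) * sqrt v" using v1 by (simp add: algebra_simps)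
    also have "\<dots> \<le> (1 + 2 * real b) * q" using v2 by (intro mult_left_mono) auto
    finally have "K * (v + 2 * real b * sqrt v) \<le> K * ((1 + 2 * real b) * q)" using K_ge_1 by (intro mult_left_mono) auto
    also have "\<dots> = (K * (1 + 2 * real b)) * q" by simp
    also have "\<dots> = e / 2"
    proof -
      have cancel: "y * (e / (2 * y)) = e / 2" if "y > 0" for y using that by simp
      have "0 < K * (1 + 2 * real b)" using K_ge_1 by (intro mult_pos_pos) auto
      from cancel[OF this] show ?thesis by (simp add: q_def mult.assoc)
    qed
    finally show ?thesis .
  qed
  have r0: "(\<lambda>n. prob {\<omega> \<in> space M. e / 2 < \<bar>R n \<omega> - Z \<omega>\<bar>}) \<longlonglongrightarrow> 0"
  proof (rule AE_tendsto_0_imp_prob)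
    show "(\<lambda>\<omega>. \<bar>R n \<omega> - Z \<omega>\<bar>) \<in> borel_measurable M" for n using R[of n] Z by measurable
    show "AE \<omega> in M. (\<lambda>n. \<bar>R n \<omega> - Z \<omega>\<bar>) \<longlonglongrightarrow> 0"
      using lim by (intro AE_I2 tendsto_rabs_zero) (simp add: LIM_zero)
  qed (use e in auto)
  note d0 = deviation_tendsto_0[OF S cp \<delta>]
  have e4: "0 < \<epsilon> / 4" using \<epsilon> by simp
  from order_tendstoD(2)[OF r0 e4] order_tendstoD(2)[OF d0 e4]
  have "\<forall>\<^sub>F n in sequentially. norm (prob {\<omega> \<in> space M. e < dist (Y n \<omega>) (Z \<omega>)} - 0) < \<epsilon>"
  proof eventually_elim
    case (elim n)
    let ?A = "{\<omega> \<in> space M. e / 2 < \<bar>R n \<omega> - Z \<omega>\<bar>}" and ?D = "{\<omega> \<in> space M. \<delta> < deviation \<Theta> n \<omega>}"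
    note [measurable] = R[of n] Z deviation_measurable[OF \<Theta>, of n]
    have m: "?A \<in> events" "?D \<in> events" by measurable
    have Gc: "space M - G b \<in> events" using Gm[of b] by (rule sets.compl_sets)
    have "{\<omega> \<in> space M. e < dist (Y n \<omega>) (Z \<omega>)} \<subseteq> ?A \<union> ?D \<union> (space M - G b)"
    proof (rule subsetI, rule ccontr)
      fix \<omega> assume 1: "\<omega> \<in> {\<omega> \<in> space M. e < dist (Y n \<omega>) (Z \<omega>)}" and 2: "\<omega> \<notin> ?A \<union> ?D \<union> (space M - G b)"
      then have \<omega>: "\<omega> \<in> space M" "\<omega> \<in> G b" and l: "\<bar>R n \<omega> - Z \<omega>\<bar> \<le> e / 2" "deviation \<Theta> n \<omega> \<le> \<delta>" by auto
      have "0 \<le> deviation \<Theta> n \<omega>" by (simp add: deviation_def sum_nonneg)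
      then have "\<bar>Y n \<omega> - R n \<omega>\<bar> \<le> e / 2"
        using le[OF \<omega>(1), of "real b" n] \<omega>(2) small[OF _ l(2)] by (simp add: G_def)
      moreover have "e < \<bar>Y n \<omega> - Z \<omega>\<bar>" using 1 by (simp add: dist_real_def)
      ultimately show False using l(1) by linarith
    qed
    then have "prob {\<omega> \<in> space M. e < dist (Y n \<omega>) (Z \<omega>)} \<le> prob (?A \<union> ?D \<union> (space M - G b))"
      using m Gc by (intro finite_measure_mono) auto
    also have "\<dots> \<le> prob (?A \<union> ?D) + prob (space M - G b)" using m Gc by (intro measure_Un_le) auto
    also have "\<dots> \<le> prob ?A + prob ?D + prob (space M - G b)" using m Gc by (intro add_right_mono measure_Un_le) auto
    finally show ?case using elim pG \<epsilon> by simp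
  qed
  then show "\<exists>no. \<forall>n\<ge>no. norm (prob {\<omega> \<in> space M. dist (Y n \<omega>) (Z \<omega>) > e} - 0) < \<epsilon>"
    by (simp add: eventually_sequentially)
qed

lemma right_points: "real (Suc j) / real m \<in> {real j / real m..(real j + 1) / real m}"
  by (simp add: divide_right_mono add.commute)

text \<open>Write the error as z + h with z the limiting path at the data nodes. Quadratic
  differences then consist of products of h with itself and of cross terms at most B |h|; averages
  of |h| are at most the root of the deviation by Cauchy-Schwarz. The reference sums use right
  nodes, matching the data grid.\<close>

lemma quadratic_conv_in_prob:
  fixes \<xi> :: "real \<Rightarrow> real \<Rightarrow> 'a \<Rightarrow> real"
  assumes S: "solves_limit M \<alpha>' 0 \<xi> \<Theta>0 \<Theta>" and cp: "conv_in_prob_metric C01 M init \<Theta>0"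
  shows "conv_in_prob M mse (\<lambda>\<omega>. MSE (\<Theta> \<omega>) s)" and "conv_in_prob M pe (\<lambda>\<omega>. PE A (\<Theta> \<omega>) s)"
proof -
  have \<Theta>: "random_element M (path_space \<tau>) \<Theta>" using S unfolding solves_limit_def by auto
  have \<Theta>c: "continuous_on {0..1} (\<Theta> \<omega> s)" if "\<omega> \<in> space M" for \<omega>
  proof -
    have "\<Theta> \<omega> \<in> mspace (path_space \<tau>)" using \<Theta> that by (auto simp: random_element_def)
    from path_space_mem[OF this s] show ?thesis by (simp add: mspace_C01)
  qed
  define z where "z n i \<omega> = \<Theta> \<omega> s (real (Suc i) / real (d n))" for n i \<omega>
  define v where "v n i \<omega> = err n (t n) (Suc i) \<omega>" for n i \<omega>
  define h where "h n i \<omega> = v n i \<omega> - z n i \<omega>" for n i \<omega>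
  have zm: "z n i \<in> borel_measurable M" if "i < d n" for n i
    unfolding z_def[abs_def] by (rule path_eval_measurable[OF \<Theta> s right_in[OF that]])
  have dev: "deviation \<Theta> n \<omega> = 1 / real (d n) * (\<Sum>i<d n. (h n i \<omega>)\<^sup>2)" for n \<omega>
    by (simp add: deviation_def h_def v_def z_def)
  have avg: "1 / real (d n) * (\<Sum>i<d n. \<bar>h n i \<omega>\<bar>) \<le> sqrt (deviation \<Theta> n \<omega>)" for n \<omega>
    unfolding dev by (rule average_abs_le_sqrt[OF d_pos])
  have avg0: "0 \<le> 1 / real (d n) * (\<Sum>i<d n. \<bar>h n i \<omega>\<bar>)" for n \<omega> by (simp add: sum_nonneg)
  have dev0: "0 \<le> deviation \<Theta> n \<omega>" for n \<omega> by (simp add: dev sum_nonneg)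
  show "conv_in_prob M mse (\<lambda>\<omega>. MSE (\<Theta> \<omega>) s)"
  proof (rule conv_in_prob_of_deviation[OF S cp mse_measurable _ MSE_PE_limit(4)[OF \<Theta>]])
    let ?R = "\<lambda>n \<omega>. 1 / real (d n) * (\<Sum>i<d n. (z n i \<omega>)\<^sup>2)"
    show "?R n \<in> borel_measurable M" for n
      by (intro borel_measurable_times borel_measurable_sum borel_measurable_power borel_measurable_const zm) auto
    show "(\<lambda>n. ?R n \<omega>) \<longlonglongrightarrow> MSE (\<Theta> \<omega>) s" if "\<omega> \<in> space M" for \<omega>
      using filterlim_compose[OF riemann_MSE[where p="\<lambda>m j. real (Suc j) / real m" and f="\<Theta> \<omega>", OF \<Theta>c[OF that] right_points] d_lim]
      by (simp add: z_def)
    fix n \<omega> B assume \<omega>: "\<omega> \<in> space M" and B: "0 \<le> (B::real)" "\<forall>x\<in>{0..1}. \<bar>\<Theta> \<omega> s x\<bar> \<le> B"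
    have zB: "\<bar>z n i \<omega>\<bar> \<le> B" if "i < d n" for i using B(2) right_in[OF that] by (simp add: z_def)
    have "mse n \<omega> - ?R n \<omega> = 1 / real (d n) * (\<Sum>i<d n. (h n i \<omega>)\<^sup>2 + 2 * (h n i \<omega> * z n i \<omega>))"
      unfolding mse_def v_def[symmetric] right_diff_distrib[symmetric] sum_subtractf[symmetric]
      by (intro arg_cong2[where f="(*)"] sum.cong refl) (simp add: h_def power2_eq_square algebra_simps)
    then have "\<bar>mse n \<omega> - ?R n \<omega>\<bar> = 1 / real (d n) * \<bar>\<Sum>i<d n. (h n i \<omega>)\<^sup>2 + 2 * (h n i \<omega> * z n i \<omega>)\<bar>"
      by (simp add: abs_mult)
    also have "\<dots> \<le> 1 / real (d n) * (\<Sum>i<d n. (h n i \<omega>)\<^sup>2 + 2 * B * \<bar>h n i \<omega>\<bar>)"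
    proof (intro mult_left_mono order_trans[OF sum_abs sum_mono])
      fix i assume "i \<in> {..<d n}"
      then have "\<bar>h n i \<omega>\<bar> * \<bar>z n i \<omega>\<bar> \<le> \<bar>h n i \<omega>\<bar> * B" by (intro mult_left_mono zB) auto
      then have "2 * \<bar>h n i \<omega> * z n i \<omega>\<bar> \<le> 2 * B * \<bar>h n i \<omega>\<bar>" by (simp add: abs_mult mult_ac)
      then show "\<bar>(h n i \<omega>)\<^sup>2 + 2 * (h n i \<omega> * z n i \<omega>)\<bar> \<le> (h n i \<omega>)\<^sup>2 + 2 * B * \<bar>h n i \<omega>\<bar>"
        using zero_le_power2[of "h n i \<omega>"] by linarith
    qed auto
    also have "\<dots> = deviation \<Theta> n \<omega> + 2 * B * (1 / real (d n) * (\<Sum>i<d n. \<bar>h n i \<omega>\<bar>))"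
      by (simp add: dev sum.distrib sum_distrib_left[symmetric] add_divide_distrib)
    also have "\<dots> \<le> 1 * (deviation \<Theta> n \<omega> + 2 * B * sqrt (deviation \<Theta> n \<omega>))"
      unfolding mult_1 by (intro add_left_mono mult_left_mono avg) (use B in auto)
    also have "\<dots> \<le> K * (deviation \<Theta> n \<omega> + 2 * B * sqrt (deviation \<Theta> n \<omega>))"
      using K_ge_1 B dev0[of n \<omega>] by (intro mult_right_mono) auto
    finally show "\<bar>mse n \<omega> - ?R n \<omega>\<bar> \<le> K * (deviation \<Theta> n \<omega> + 2 * B * sqrt (deviation \<Theta> n \<omega>))" .
  qed
  show "conv_in_prob M pe (\<lambda>\<omega>. PE A (\<Theta> \<omega>) s)"
  proof (rule conv_in_prob_of_deviation[OF S cp pe_measurable _ MSE_PE_limit(5)[OF \<Theta>]])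
    let ?A = "\<lambda>n i i'. A (real (Suc i) / real (d n)) (real (Suc i') / real (d n))"
    let ?R = "\<lambda>n \<omega>. 1 / (real (d n))\<^sup>2 * (\<Sum>i<d n. \<Sum>i'<d n. ?A n i i' * z n i \<omega> * z n i' \<omega>)"
    show "?R n \<in> borel_measurable M" for n
      by (intro borel_measurable_times borel_measurable_sum borel_measurable_const zm) auto
    show "(\<lambda>n. ?R n \<omega>) \<longlonglongrightarrow> PE A (\<Theta> \<omega>) s" if "\<omega> \<in> space M" for \<omega>
      using filterlim_compose[OF riemann_PE[where p="\<lambda>m j. real (Suc j) / real m" and f="\<Theta> \<omega>", OF \<Theta>c[OF that] right_points] d_lim]
      by (simp add: z_def)
    fix n \<omega> B assume \<omega>: "\<omega> \<in> space M" and B: "0 \<le> (B::real)" "\<forall>x\<in>{0..1}. \<bar>\<Theta> \<omega> s x\<bar> \<le> B"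
    have zB: "\<bar>z n i \<omega>\<bar> \<le> B" if "i < d n" for i using B(2) right_in[OF that] by (simp add: z_def)
    have K0: "0 \<le> K" using K_ge_1 by simp
    define H where "H = (\<Sum>i<d n. \<bar>h n i \<omega>\<bar>)"
    have dn: "real (d n) > 0" using d_pos[of n] by simp
    have "pe n \<omega> - ?R n \<omega> = 1 / (real (d n))\<^sup>2 * (\<Sum>i<d n. \<Sum>i'<d n. ?A n i i' * (v n i \<omega> * v n i' \<omega> - z n i \<omega> * z n i' \<omega>))"
      unfolding pe_def v_def[symmetric] right_diff_distrib[symmetric] sum_subtractf[symmetric]
      by (intro arg_cong2[where f="(*)"] sum.cong refl) (simp add: algebra_simps)
    then have "\<bar>pe n \<omega> - ?R n \<omega>\<bar> = 1 / (real (d n))\<^sup>2 * \<bar>\<Sum>i<d n. \<Sum>i'<d n. ?A n i i' * (v n i \<omega> * v n i' \<omega> - z n i \<omega> * z n i' \<omega>)\<bar>"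
      by (simp add: abs_mult)
    also have "\<dots> \<le> 1 / (real (d n))\<^sup>2 * (\<Sum>i<d n. \<Sum>i'<d n. K * (\<bar>h n i \<omega>\<bar> * \<bar>h n i' \<omega>\<bar> + \<bar>h n i \<omega>\<bar> * B + B * \<bar>h n i' \<omega>\<bar>))"
    proof (intro mult_left_mono order_trans[OF sum_abs sum_mono] order_trans[OF sum_abs sum_mono])
      fix i i' assume ii: "i \<in> {..<d n}" "i' \<in> {..<d n}"
      have "v n i \<omega> * v n i' \<omega> - z n i \<omega> * z n i' \<omega> = h n i \<omega> * h n i' \<omega> + h n i \<omega> * z n i' \<omega> + z n i \<omega> * h n i' \<omega>"
        by (simp add: h_def algebra_simps)
      then have "\<bar>v n i \<omega> * v n i' \<omega> - z n i \<omega> * z n i' \<omega>\<bar> \<le> \<bar>h n i \<omega> * h n i' \<omega>\<bar> + \<bar>h n i \<omega> * z n i' \<omega>\<bar> + \<bar>z n i \<omega> * h n i' \<omega>\<bar>"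
        by linarith
      also have "\<dots> \<le> \<bar>h n i \<omega>\<bar> * \<bar>h n i' \<omega>\<bar> + \<bar>h n i \<omega>\<bar> * B + B * \<bar>h n i' \<omega>\<bar>"
        unfolding abs_mult using ii by (intro add_mono mult_left_mono mult_right_mono zB) auto
      finally show "\<bar>?A n i i' * (v n i \<omega> * v n i' \<omega> - z n i \<omega> * z n i' \<omega>)\<bar> \<le> K * (\<bar>h n i \<omega>\<bar> * \<bar>h n i' \<omega>\<bar> + \<bar>h n i \<omega>\<bar> * B + B * \<bar>h n i' \<omega>\<bar>)"
        unfolding abs_mult[of "?A n i i'"] using ii K0 by (intro mult_mono A_bound right_in) auto
    qed auto
    also have "(\<Sum>i<d n. \<Sum>i'<d n. K * (\<bar>h n i \<omega>\<bar> * \<bar>h n i' \<omega>\<bar> + \<bar>h n i \<omega>\<bar> * B + B * \<bar>h n i' \<omega>\<bar>)) = K * (H * H + 2 * real (d n) * B * H)"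
    proof -
      have "(\<Sum>i<d n. \<Sum>i'<d n. \<bar>h n i \<omega>\<bar> * \<bar>h n i' \<omega>\<bar>) = H * H" unfolding H_def sum_product ..
      moreover have "(\<Sum>i<d n. \<Sum>i'<d n. \<bar>h n i \<omega>\<bar> * B) = real (d n) * B * H" by (simp add: H_def sum_distrib_left mult_ac)
      moreover have "(\<Sum>i<d n. \<Sum>i'<d n. B * \<bar>h n i' \<omega>\<bar>) = real (d n) * B * H" by (simp add: H_def sum_distrib_left[symmetric] mult_ac)
      ultimately show ?thesis by (simp only: sum_distrib_left[symmetric] sum.distrib) simp
    qed
    also have "1 / (real (d n))\<^sup>2 * (K * (H * H + 2 * real (d n) * B * H)) = K * ((1 / real (d n) * H)\<^sup>2 + 2 * B * (1 / real (d n) * H))"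
      using dn by (simp add: power2_eq_square field_simps)
    also have "\<dots> \<le> K * ((sqrt (deviation \<Theta> n \<omega>))\<^sup>2 + 2 * B * sqrt (deviation \<Theta> n \<omega>))"
      using avg[of n \<omega>, folded H_def] avg0[of n \<omega>, folded H_def] B K0
      by (intro mult_left_mono add_mono power_mono) auto
    finally show "\<bar>pe n \<omega> - ?R n \<omega>\<bar> \<le> K * (deviation \<Theta> n \<omega> + 2 * B * sqrt (deviation \<Theta> n \<omega>))"
      using dev0[of n \<omega>] by simp
  qed
qed

end

section \<open>The limit theorem\<close>

text \<open>Jensen's inequality applied to Z^2; downstream the initial condition enters through
  second moments.\<close>

lemma (in prob_space) fourth_moment_imp_second_moment:
  assumes Z: "Z \<in> borel_measurable M" and i: "integrable M (\<lambda>\<omega>. \<bar>Z \<omega>\<bar> ^ 4)" and le: "expectation (\<lambda>\<omega>. \<bar>Z \<omega>\<bar> ^ 4) \<le> c ^ 4"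
  shows "square_integrable M Z" and "expectation (\<lambda>\<omega>. (Z \<omega>)\<^sup>2) \<le> c\<^sup>2"
proof -
  have eq: "\<bar>z\<bar> ^ 4 = (z\<^sup>2)\<^sup>2" for z :: real by (simp add: power_mult[symmetric])
  have sq: "square_integrable M (\<lambda>\<omega>. (Z \<omega>)\<^sup>2)" using Z i unfolding square_integrable_def eq by simp
  show "square_integrable M Z"
    using Z square_integrable_integrable[OF sq] by (simp add: square_integrable_def)
  have "c ^ 4 = (c\<^sup>2)\<^sup>2" by (simp add: power_mult[symmetric])
  then show "expectation (\<lambda>\<omega>. (Z \<omega>)\<^sup>2) \<le> c\<^sup>2"
    using expectation_abs_le_sqrt[OF sq, of "c\<^sup>2"] le unfolding eq by simp
qed

text \<open>The hypotheses control increments between neighbours. Cauchy-Schwarz over the j - i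
  terms of the telescoping sum gives a bound quadratic in the distance, with no independence across
  space.\<close>

lemma (in prob_space) second_moment_of_increments:
  fixes Y :: "nat \<Rightarrow> 'a \<Rightarrow> real"
  assumes sq: "\<And>k. \<lbrakk>i \<le> k; k < j\<rbrakk> \<Longrightarrow> square_integrable M (\<lambda>\<omega>. Y (Suc k) \<omega> - Y k \<omega>)"
    and le: "\<And>k. \<lbrakk>i \<le> k; k < j\<rbrakk> \<Longrightarrow> expectation (\<lambda>\<omega>. (Y (Suc k) \<omega> - Y k \<omega>)\<^sup>2) \<le> c"
    and "i \<le> j"
  shows "expectation (\<lambda>\<omega>. (Y j \<omega> - Y i \<omega>)\<^sup>2) \<le> c * (real j - real i)\<^sup>2"
proof -
  let ?S = "\<lambda>\<omega>. \<Sum>k=i..<j. (Y (Suc k) \<omega> - Y k \<omega>)\<^sup>2"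
  have int: "integrable M (\<lambda>\<omega>. (Y (Suc k) \<omega> - Y k \<omega>)\<^sup>2)" if "k \<in> {i..<j}" for k
    using sq that by (simp add: square_integrable_def)
  have tele: "Y j \<omega> - Y i \<omega> = (\<Sum>k=i..<j. Y (Suc k) \<omega> - Y k \<omega>)" for \<omega>
    using sum_Suc_diff'[OF \<open>i \<le> j\<close>, of "\<lambda>k. Y k \<omega>"] by simp
  have "square_integrable M (\<lambda>\<omega>. Y j \<omega> - Y i \<omega>)"
    unfolding tele by (rule square_integrable_sum) (use sq in auto)
  then have "expectation (\<lambda>\<omega>. (Y j \<omega> - Y i \<omega>)\<^sup>2) \<le> expectation (\<lambda>\<omega>. ?S \<omega> * real (j - i))"
    using int
  proof (intro integral_mono)
    show "(Y j \<omega> - Y i \<omega>)\<^sup>2 \<le> ?S \<omega> * real (j - i)" for \<omega>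
      unfolding tele using sum_squared_le_sum_of_squares[of "\<lambda>k. Y (Suc k) \<omega> - Y k \<omega>" "{i..<j}"] by simp
  qed (auto simp: square_integrable_def intro!: integrable_mult_left Bochner_Integration.integrable_sum)
  also have "\<dots> = (\<Sum>k=i..<j. expectation (\<lambda>\<omega>. (Y (Suc k) \<omega> - Y k \<omega>)\<^sup>2)) * real (j - i)"
    using int by (simp add: Bochner_Integration.integral_sum)
  also have "\<dots> \<le> (real (j - i) * c) * real (j - i)"
    using sum_bounded_above[of "{i..<j}" "\<lambda>k. expectation (\<lambda>\<omega>. (Y (Suc k) \<omega> - Y k \<omega>)\<^sup>2)" c] le
    by (intro mult_right_mono) auto
  also have "\<dots> = c * (real j - real i)\<^sup>2" using \<open>i \<le> j\<close> by (simp add: power2_eq_square of_nat_diff)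
  finally show ?thesis .
qed

context online_sgd
begin

text \<open>Turns the fourth moment hypotheses on the initial error into the second moment inputs of
  \<open>bounded_sgd\<close>. From index 1 on, the extended error agrees with
  \<open>D 0\<close>.\<close>

lemma initial_second_moments:
  assumes m: "\<And>i. i \<le> d \<Longrightarrow> integrable M (\<lambda>\<omega>. \<bar>sgd_err \<theta>s \<theta> \<omega> 0 i\<bar> ^ 4) \<and>
      expectation (\<lambda>\<omega>. \<bar>sgd_err \<theta>s \<theta> \<omega> 0 i\<bar> ^ 4) \<le> R ^ 4"
    and incr: "\<And>i. \<lbrakk>1 \<le> i; i \<le> d\<rbrakk> \<Longrightarrow>
      integrable M (\<lambda>\<omega>. \<bar>sgd_err \<theta>s \<theta> \<omega> 0 i - sgd_err \<theta>s \<theta> \<omega> 0 (i - 1)\<bar> ^ 4) \<and>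
      expectation (\<lambda>\<omega>. \<bar>sgd_err \<theta>s \<theta> \<omega> 0 i - sgd_err \<theta>s \<theta> \<omega> 0 (i - 1)\<bar> ^ 4) \<le> L ^ 4 / real d ^ 4"
  shows "i \<in> {1..d} \<Longrightarrow> square_integrable M (D 0 i)"
    and "i \<in> {1..d} \<Longrightarrow> expectation (\<lambda>\<omega>. (D 0 i \<omega>)\<^sup>2) \<le> R\<^sup>2"
    and "\<lbrakk>i \<in> {1..d}; j \<in> {1..d}\<rbrakk> \<Longrightarrow>
      expectation (\<lambda>\<omega>. (D 0 i \<omega> - D 0 j \<omega>)\<^sup>2) \<le> L\<^sup>2 * ((real i - real j) / real d)\<^sup>2"
proof -
  have Dm: "D 0 i \<in> borel_measurable M" if "i \<in> {1..d}" for i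
    by (rule alg_measurable[OF D0_measurable_alg[OF that UNIV_I]])
  have D: "sgd_err \<theta>s \<theta> \<omega> 0 i = D 0 i \<omega>" if "i \<in> {1..d}" for \<omega> i
    using that by (simp add: sgd_err_def D_def)
  have sq: "square_integrable M (D 0 i)" "expectation (\<lambda>\<omega>. (D 0 i \<omega>)\<^sup>2) \<le> R\<^sup>2" if i: "i \<in> {1..d}" for i
    using fourth_moment_imp_second_moment[OF Dm[OF i], of R] m[of i] i unfolding D[OF i] by auto
  show "i \<in> {1..d} \<Longrightarrow> square_integrable M (D 0 i)"
    "i \<in> {1..d} \<Longrightarrow> expectation (\<lambda>\<omega>. (D 0 i \<omega>)\<^sup>2) \<le> R\<^sup>2" by (rule sq; assumption)+
  have step: "square_integrable M (\<lambda>\<omega>. D 0 (Suc k) \<omega> - D 0 k \<omega>)"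
    "expectation (\<lambda>\<omega>. (D 0 (Suc k) \<omega> - D 0 k \<omega>)\<^sup>2) \<le> (L / real d)\<^sup>2" if k: "1 \<le> k" "k < d" for k
  proof -
    have 1: "Suc k \<in> {1..d}" "k \<in> {1..d}" using k by auto
    show "square_integrable M (\<lambda>\<omega>. D 0 (Suc k) \<omega> - D 0 k \<omega>)" by (rule square_integrable_diff[OF sq(1)[OF 1(1)] sq(1)[OF 1(2)]])
    then have "(\<lambda>\<omega>. D 0 (Suc k) \<omega> - D 0 k \<omega>) \<in> borel_measurable M" by (rule square_integrable_measurable)
    from fourth_moment_imp_second_moment(2)[OF this, of "L / real d"]
    show "expectation (\<lambda>\<omega>. (D 0 (Suc k) \<omega> - D 0 k \<omega>)\<^sup>2) \<le> (L / real d)\<^sup>2"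
      using incr[of "Suc k"] k unfolding D[OF 1(1)] by (simp add: D[OF 1(2)] power_divide)
  qed
  have up: "expectation (\<lambda>\<omega>. (D 0 j \<omega> - D 0 i \<omega>)\<^sup>2) \<le> L\<^sup>2 * ((real j - real i) / real d)\<^sup>2"
    if "i \<in> {1..d}" "j \<in> {1..d}" "i \<le> j" for i j
    using second_moment_of_increments[of i j "D 0" "(L / real d)\<^sup>2"] step that by (simp add: power_divide)
  show "expectation (\<lambda>\<omega>. (D 0 i \<omega> - D 0 j \<omega>)\<^sup>2) \<le> L\<^sup>2 * ((real i - real j) / real d)\<^sup>2"
    if ij: "i \<in> {1..d}" "j \<in> {1..d}"
  proof (cases "i \<le> j")
    case True
    have c: "(x - y)\<^sup>2 = (y - x)\<^sup>2" for x y :: real by (rule power2_commute)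
    have "((real i - real j) / real d)\<^sup>2 = ((real j - real i) / real d)\<^sup>2" by (simp add: power_divide c[of "real i"])
    then show ?thesis using up[OF ij True] unfolding c[of "D 0 i _"] by simp
  next
    case False
    then show ?thesis using up[OF ij(2,1)] by simp
  qed
qed

end

section \<open>From the three regimes to one limiting equation\<close>

context sgd_sequence
begin

text \<open>Fundamental theorem of calculus in time at each fixed y. The field \<xi> is arbitrary,
  as its coefficient is 0.\<close>

lemma limit_path_of_derivative:
  fixes z :: "real \<Rightarrow> real \<Rightarrow> real"
  assumes z: "z \<in> mspace (path_space \<tau>)"
    and deriv: "\<And>u y. \<lbrakk>u \<in> {0..\<tau>}; y \<in> {0..1}\<rbrakk> \<Longrightarrow>
      ((\<lambda>u. z u y) has_real_derivative - \<alpha> * (LBINT y':{0..1}. A y y' * z u y')) (at u within {0..\<tau>})"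
  shows "limit_path \<tau> A \<alpha> 0 \<xi> z"
  unfolding limit_path_def
proof (intro conjI ballI z)
  fix v y :: real assume v: "v \<in> {0..\<tau>}" and y: "y \<in> {0..1}"
  let ?F = "\<lambda>u. LBINT y':{0..1}. A y y' * z u y'"
  have "continuous_on {0..1} (\<lambda>y'. A (fst (y, y')) (snd (y, y')))"
    by (rule continuous_on_compose2[OF A_jointly_continuous]) (use y in \<open>auto intro!: continuous_intros\<close>)
  then have "continuous_on {0..\<tau>} ?F" by (intro drift_continuous[OF z]) simp
  then have c: "continuous_on {0..v} ?F" by (rule continuous_on_subset) (use v in auto)
  have "((\<lambda>u. - \<alpha> * ?F u) has_integral (z v y - z 0 y)) {0..v}"
  proof (rule fundamental_theorem_of_calculus)
    show "((\<lambda>u. z u y) has_vector_derivative - \<alpha> * ?F u) (at u within {0..v})" if "u \<in> {0..v}" for u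
      using deriv[of u y] that v y
      by (auto simp: has_real_derivative_iff_has_vector_derivative intro: has_vector_derivative_within_subset)
  qed (use v in auto)
  then have "z v y - z 0 y = integral {0..v} (\<lambda>u. - \<alpha> * ?F u)" by (rule integral_unique[symmetric])
  also have "\<dots> = - \<alpha> * (LBINT u:{0..v}. ?F u)"
    unfolding LBINT_eq_integral[OF c] by (rule Henstock_Kurzweil_Integration.integral_mult_right)
  finally show "z v y - z 0 y = - \<alpha> * (LBINT u:{0..v}. ?F u) + 0 * (\<xi> v y - \<xi> 0 y)" by simp
qed

lemma solves_limit_low_noise:
  assumes "prob_space N" "random_element N C01 \<Theta>0" "low_noise_solution N \<tau> \<alpha> A \<Theta>0 \<Theta>"
    "(\<lambda>n. \<eta> n * d n * T n) \<longlonglongrightarrow> \<alpha>" "(\<lambda>n. \<sigma> n * \<eta> n * sqrt (T n)) \<longlonglongrightarrow> 0"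
  shows "solves_limit N \<alpha> 0 \<xi> \<Theta>0 \<Theta>"
proof -
  have \<Theta>: "random_element N (path_space \<tau>) \<Theta>" and sol: "AE \<omega> in N. \<Theta> \<omega> 0 = \<Theta>0 \<omega> \<and>
        (\<forall>s\<in>{0..\<tau>}. \<forall>x\<in>{0..1}.
           ((\<lambda>u. \<Theta> \<omega> u x) has_real_derivative - \<alpha> * (LBINT y:{0..1}. A x y * \<Theta> \<omega> s y))
             (at s within {0..\<tau>}))"
    using assms(3) unfolding low_noise_solution_def by auto
  have "AE \<omega> in N. \<Theta> \<omega> \<in> mspace (path_space \<tau>)"
    using \<Theta> by (intro AE_I2) (auto simp: random_element_def)
  with sol have "AE \<omega> in N. \<Theta> \<omega> 0 = \<Theta>0 \<omega> \<and> limit_path \<tau> A \<alpha> 0 (\<lambda>s x. \<xi> s x \<omega>) (\<Theta> \<omega>)"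
  proof eventually_elim
    case (elim \<omega>)
    then show ?case by (intro conjI limit_path_of_derivative) auto
  qed
  then show ?thesis using assms \<Theta> unfolding solves_limit_def by simp
qed

lemma solves_limit_noisy:
  assumes "prob_space N" "random_element N C01 \<Theta>0" and \<Theta>: "random_element N (path_space \<tau>) \<Theta>"
    "(\<lambda>n. \<eta> n * d n * T n) \<longlonglongrightarrow> \<alpha>" "(\<lambda>n. \<sigma> n * \<eta> n * sqrt (T n)) \<longlonglongrightarrow> \<gamma>"
    "driving_field N \<tau> A \<xi>" "init_indep_field N \<tau> \<Theta>0 \<xi>"
    and sol: "AE \<omega> in N. \<Theta> \<omega> 0 = \<Theta>0 \<omega> \<and> (\<forall>s\<in>{0..\<tau>}. \<forall>x\<in>{0..1}.
           \<Theta> \<omega> s x - \<Theta> \<omega> 0 x = - \<alpha> * (LBINT u:{0..s}. LBINT y:{0..1}. A x y * \<Theta> \<omega> u y) + \<gamma> * (\<xi> s x \<omega> - \<xi> 0 x \<omega>))"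
  shows "solves_limit N \<alpha> \<gamma> \<xi> \<Theta>0 \<Theta>"
proof -
  have "AE \<omega> in N. \<Theta> \<omega> \<in> mspace (path_space \<tau>)"
    using \<Theta> by (intro AE_I2) (auto simp: random_element_def)
  with sol have "AE \<omega> in N. \<Theta> \<omega> 0 = \<Theta>0 \<omega> \<and> limit_path \<tau> A \<alpha> \<gamma> (\<lambda>s x. \<xi> s x \<omega>) (\<Theta> \<omega>)"
    unfolding limit_path_def by eventually_elim blast
  then show ?thesis using assms unfolding solves_limit_def by simp
qed

end

text \<open>The noise scale \<sigma> \<eta> T^(1/2) is the product of the drift scale \<eta> d T and
  the ratio \<sigma> d^(-1) T^(-1/2). The value \<beta> = 0 is included and serves the low-noise
  regime.\<close>

lemma noise_scale_tendsto:
  fixes \<eta> \<sigma> :: "nat \<Rightarrow> real" and d T :: "nat \<Rightarrow> nat"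
  assumes pos: "\<And>n. d n > 0" "\<And>n. T n > 0"
    and "(\<lambda>n. \<sigma> n / (d n * sqrt (T n))) \<longlonglongrightarrow> \<beta>" "(\<lambda>n. \<eta> n * d n * T n) \<longlonglongrightarrow> \<alpha>"
  shows "(\<lambda>n. \<sigma> n * \<eta> n * sqrt (T n)) \<longlonglongrightarrow> \<alpha> * \<beta>"
proof -
  have "\<eta> n * d n * T n * (\<sigma> n / (d n * sqrt (T n))) = \<sigma> n * \<eta> n * sqrt (T n)" for n
  proof -
    have "real (T n) = sqrt (T n) * sqrt (T n)" by simp
    then show ?thesis using pos[of n] by (simp add: field_simps)
  qed
  then show ?thesis using tendsto_mult[OF assms(4,3)] by simp
qed

text \<open>The drift scale is the convergent noise scale divided by a diverging ratio; the ratio is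
  eventually positive, so the division is legitimate.\<close>

lemma drift_scale_tendsto_0:
  fixes \<eta> \<sigma> :: "nat \<Rightarrow> real" and d T :: "nat \<Rightarrow> nat"
  assumes pos: "\<And>n. d n > 0" "\<And>n. T n > 0"
    and q: "filterlim (\<lambda>n. \<sigma> n / (d n * sqrt (T n))) at_top sequentially"
    and \<alpha>: "(\<lambda>n. \<eta> n * \<sigma> n * sqrt (T n)) \<longlonglongrightarrow> \<alpha>"
  shows "(\<lambda>n. \<eta> n * d n * T n) \<longlonglongrightarrow> 0"
proof -
  have "(\<lambda>n. \<eta> n * \<sigma> n * sqrt (T n) * inverse (\<sigma> n / (d n * sqrt (T n)))) \<longlonglongrightarrow> \<alpha> * 0"
    by (intro tendsto_mult \<alpha> filterlim_compose[OF tendsto_inverse_0_at_top q]) (rule filterlim_ident)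
  moreover have "\<forall>\<^sub>F n in sequentially. \<eta> n * \<sigma> n * sqrt (T n) * inverse (\<sigma> n / (d n * sqrt (T n))) = \<eta> n * d n * T n"
    using filterlim_at_top_dense[THEN iffD1, OF q, rule_format, of 0]
  proof eventually_elim
    case (elim n)
    have "real (T n) = sqrt (T n) * sqrt (T n)" by simp
    then show ?case using elim pos[of n] by (auto simp: field_simps)
  qed
  ultimately show ?thesis by (simp add: tendsto_cong)
qed

theorem proposition2p1:
  fixes M :: "'a measure" and N :: "'b measure"
    and W :: "real \<Rightarrow> real \<Rightarrow> 'a \<Rightarrow> real"
    and A :: "real \<Rightarrow> real \<Rightarrow> real" and B E :: "real list \<Rightarrow> real"
    and d T :: "nat \<Rightarrow> nat" and \<eta> \<sigma> :: "nat \<Rightarrow> real"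
    and \<theta>s :: "nat \<Rightarrow> nat \<Rightarrow> real"
    and \<epsilon> :: "nat \<Rightarrow> nat \<Rightarrow> 'a \<Rightarrow> real"
    and \<theta> :: "nat \<Rightarrow> nat \<Rightarrow> nat \<Rightarrow> 'a \<Rightarrow> real"
    and \<Delta> :: "nat \<Rightarrow> 'a \<Rightarrow> nat \<Rightarrow> nat \<Rightarrow> real"
    and \<Theta>d :: "nat \<Rightarrow> 'a \<Rightarrow> real \<Rightarrow> real"
    and C1 Cs1 R L \<tau> s \<alpha> \<beta> :: real
    and r :: "nat \<Rightarrow> nat"
  assumes "\<tau> > 0" and "s \<in> {0..\<tau>}"
    and sgd: "\<And>n. online_sgd M W A B E (d n) (T n) (\<eta> n) (\<sigma> n) C1 (\<theta>s n) (\<epsilon> n) (\<theta> n)"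
    and smooth: "smooth_A A" "smooth_B B" "smooth_E E"
    and \<Delta>_def: "\<And>n. \<Delta> n = sgd_err (\<theta>s n) (\<theta> n)"
    and \<Theta>d_def: "\<And>n. \<Theta>d n = Theta_init (d n) (\<theta>s n) (\<theta> n)"
    and init_moment: "\<And>n i. i \<le> d n \<Longrightarrow>
          integrable M (\<lambda>\<omega>. \<bar>\<Delta> n \<omega> 0 i\<bar> ^ 4) \<and> (\<integral>\<omega>. \<bar>\<Delta> n \<omega> 0 i\<bar> ^ 4 \<partial>M) \<le> R ^ 4"
    and init_increment: "\<And>n i. \<lbrakk>1 \<le> i; i \<le> d n\<rbrakk> \<Longrightarrow>
          integrable M (\<lambda>\<omega>. \<bar>\<Delta> n \<omega> 0 i - \<Delta> n \<omega> 0 (i - 1)\<bar> ^ 4) \<and>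
          (\<integral>\<omega>. \<bar>\<Delta> n \<omega> 0 i - \<Delta> n \<omega> 0 (i - 1)\<bar> ^ 4 \<partial>M) \<le> L ^ 4 / real (d n) ^ 4"
    and step_size: "\<And>n. max (\<eta> n * d n * T n) (\<sigma> n * \<eta> n * sqrt (T n)) \<le> Cs1"
    and d_lim: "filterlim d at_top sequentially"
    and T_lim: "filterlim T at_top sequentially"
    and subseq: "strict_mono r"
    and N: "prob_space N"
    and "\<alpha> > 0" and "\<beta> > 0"
  shows
    "((\<lambda>n. \<sigma> n / (d n * sqrt (T n))) \<longlonglongrightarrow> 0 \<and> (\<lambda>n. \<eta> n * d n * T n) \<longlonglongrightarrow> \<alpha> \<longrightarrow>
         (\<forall>\<Theta>0 \<Theta>.
            random_element M C01 \<Theta>0 \<and>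
            conv_in_prob_metric C01 M (\<lambda>k. \<Theta>d (r k)) \<Theta>0 \<and>
            low_noise_solution M \<tau> \<alpha> A \<Theta>0 \<Theta> \<longrightarrow>
            conv_in_prob M (\<lambda>k \<omega>. MSE_dT (d (r k)) (T (r k)) (\<Delta> (r k) \<omega>) s) (\<lambda>\<omega>. MSE (\<Theta> \<omega>) s) \<and>
            conv_in_prob M (\<lambda>k \<omega>. PE_dT A (d (r k)) (T (r k)) (\<Delta> (r k) \<omega>) s) (\<lambda>\<omega>. PE A (\<Theta> \<omega>) s)) \<and>
         (\<forall>\<Theta>0 \<Theta>.
            random_element N C01 \<Theta>0 \<and>
            weak_conv_metric C01 M (\<lambda>k. \<Theta>d (r k)) N \<Theta>0 \<and>
            low_noise_solution N \<tau> \<alpha> A \<Theta>0 \<Theta> \<longrightarrow>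
            conv_in_distribution M (\<lambda>k \<omega>. MSE_dT (d (r k)) (T (r k)) (\<Delta> (r k) \<omega>) s)
              N (\<lambda>\<omega>. MSE (\<Theta> \<omega>) s) \<and>
            conv_in_distribution M (\<lambda>k \<omega>. PE_dT A (d (r k)) (T (r k)) (\<Delta> (r k) \<omega>) s)
              N (\<lambda>\<omega>. PE A (\<Theta> \<omega>) s))) \<and>
     ((\<lambda>n. \<sigma> n / (d n * sqrt (T n))) \<longlonglongrightarrow> \<beta> \<and> (\<lambda>n. \<eta> n * d n * T n) \<longlonglongrightarrow> \<alpha> \<longrightarrow>
         (\<forall>\<Theta>0 \<xi> \<Theta>.
            random_element N C01 \<Theta>0 \<and>
            weak_conv_metric C01 M (\<lambda>k. \<Theta>d (r k)) N \<Theta>0 \<and>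
            driving_field N \<tau> A \<xi> \<and> init_indep_field N \<tau> \<Theta>0 \<xi> \<and>
            moderate_noise_solution N \<tau> \<alpha> \<beta> A \<xi> \<Theta>0 \<Theta> \<longrightarrow>
            conv_in_distribution M (\<lambda>k \<omega>. MSE_dT (d (r k)) (T (r k)) (\<Delta> (r k) \<omega>) s)
              N (\<lambda>\<omega>. MSE (\<Theta> \<omega>) s) \<and>
            conv_in_distribution M (\<lambda>k \<omega>. PE_dT A (d (r k)) (T (r k)) (\<Delta> (r k) \<omega>) s)
              N (\<lambda>\<omega>. PE A (\<Theta> \<omega>) s))) \<and>
     (filterlim (\<lambda>n. \<sigma> n / (d n * sqrt (T n))) at_top sequentially \<and>
        (\<lambda>n. \<eta> n * \<sigma> n * sqrt (T n)) \<longlonglongrightarrow> \<alpha> \<longrightarrow>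
         (\<forall>\<Theta>0 \<xi> \<Theta>.
            random_element N C01 \<Theta>0 \<and>
            weak_conv_metric C01 M (\<lambda>k. \<Theta>d (r k)) N \<Theta>0 \<and>
            driving_field N \<tau> A \<xi> \<and> init_indep_field N \<tau> \<Theta>0 \<xi> \<and>
            high_noise_solution N \<tau> \<alpha> \<xi> \<Theta>0 \<Theta> \<longrightarrow>
            conv_in_distribution M (\<lambda>k \<omega>. MSE_dT (d (r k)) (T (r k)) (\<Delta> (r k) \<omega>) s)
              N (\<lambda>\<omega>. MSE (\<Theta> \<omega>) s) \<and>
            conv_in_distribution M (\<lambda>k \<omega>. PE_dT A (d (r k)) (T (r k)) (\<Delta> (r k) \<omega>) s)
              N (\<lambda>\<omega>. PE A (\<Theta> \<omega>) s)))"
proof -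
  interpret O: online_sgd M W A B E "d 0" "T 0" "\<eta> 0" "\<sigma> 0" C1 "\<theta>s 0" "\<epsilon> 0" "\<theta> 0" by (rule sgd)
  obtain C2 where C2: "\<And>x y. \<lbrakk>x \<in> {0..1}; y \<in> {0..1}\<rbrakk> \<Longrightarrow> \<bar>A x y\<bar> \<le> C2"
    using smooth(1) unfolding smooth_A_def by blast
  obtain C3 where C3: "\<And>x y z. \<lbrakk>x \<in> {0..1}; y \<in> {0..1}; z \<in> {0..1}\<rbrakk> \<Longrightarrow> \<bar>A x z - A y z\<bar> \<le> C3 * \<bar>x - y\<bar>"
    using smooth(1) unfolding smooth_A_def by blast
  obtain C4 where C4: "\<And>x y. \<lbrakk>x \<in> {0..1}; y \<in> {0..1}\<rbrakk> \<Longrightarrow> \<bar>A x x + A y y - 2 * A x y\<bar> \<le> C4\<^sup>2 * \<bar>x - y\<bar>\<^sup>2"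
    using smooth(1) unfolding smooth_A_def by blast
  obtain C5 where C5: "\<And>xs. xs \<in> points 4 \<Longrightarrow> \<bar>B xs\<bar> \<le> C5"
    using smooth(2) unfolding smooth_B_def by blast
  obtain C6 where C6: "\<And>x1 x2 x3. \<lbrakk>x1 \<in> {0..1}; x2 \<in> {0..1}; x3 \<in> {0..1}\<rbrakk> \<Longrightarrow>
      \<bar>B [x1, x3, x1, x3] + B [x2, x3, x2, x3] - 2 * B [x1, x3, x2, x3]\<bar> \<le> C6\<^sup>2 * \<bar>x1 - x2\<bar>\<^sup>2"
    using smooth(2) unfolding smooth_B_def by blast
  \<comment> \<open>One constant above all others: absolute values because C2, C3, C5 and Cs1 carry
    no sign, the 1 for \<open>1 \<le> K\<close>, and \<tau> for the time horizon.\<close>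
  define K where "K = 1 + \<bar>C2\<bar> + \<bar>C3\<bar> + C4\<^sup>2 + \<bar>C5\<bar> + C6\<^sup>2 + \<bar>Cs1\<bar> + C1 + R\<^sup>2 + L\<^sup>2 + \<tau>"
  have nonneg: "0 \<le> \<bar>C2\<bar>" "0 \<le> \<bar>C3\<bar>" "0 \<le> C4\<^sup>2" "0 \<le> \<bar>C5\<bar>" "0 \<le> C6\<^sup>2" "0 \<le> \<bar>Cs1\<bar>" "0 \<le> C1" "0 \<le> R\<^sup>2" "0 \<le> L\<^sup>2" "0 \<le> \<tau>"
    using O.C1_pos \<open>\<tau> > 0\<close> by auto
  have K: "1 \<le> K" "C2 \<le> K" "C3 \<le> K" "C4\<^sup>2 \<le> K" "C5 \<le> K" "C6\<^sup>2 \<le> K" "Cs1 \<le> K" "C1 \<le> K" "R\<^sup>2 \<le> K" "L\<^sup>2 \<le> K" "\<tau> \<le> K"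
    using nonneg abs_ge_self[of C2] abs_ge_self[of C3] abs_ge_self[of C5] abs_ge_self[of Cs1] unfolding K_def by linarith+
  have bsgd: "bounded_sgd M W A B E (d n) (T n) (\<eta> n) (\<sigma> n) C1 (\<theta>s n) (\<epsilon> n) (\<theta> n) K" for n
  proof -
    interpret online_sgd M W A B E "d n" "T n" "\<eta> n" "\<sigma> n" C1 "\<theta>s n" "\<epsilon> n" "\<theta> n" by (rule sgd)
    note init = initial_second_moments[OF init_moment[of _ n, unfolded \<Delta>_def] init_increment[of _ n, unfolded \<Delta>_def]]
    have mono: "c * u \<le> K * u" if "c \<le> K" "0 \<le> u" for c u :: real using that by (rule mult_right_mono)
    show ?thesis
    proof unfold_locales
      show "1 \<le> K" "C1 \<le> K" by fact+
      show "\<bar>A y z\<bar> \<le> K" if "y \<in> {0..1}" "z \<in> {0..1}" for y z using C2[OF that] K by linarith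
      show "\<bar>A y z - A y' z\<bar> \<le> K * \<bar>y - y'\<bar>" if "y \<in> {0..1}" "y' \<in> {0..1}" "z \<in> {0..1}" for y y' z
        using C3[OF that] mono[OF K(3) abs_ge_zero] by (rule order_trans)
      show "\<bar>A y y + A z z - 2 * A y z\<bar> \<le> K * \<bar>y - z\<bar>\<^sup>2" if "y \<in> {0..1}" "z \<in> {0..1}" for y z
        using C4[OF that] mono[OF K(4) zero_le_power2] by (rule order_trans)
      show "\<bar>B ys\<bar> \<le> K" if "ys \<in> points 4" for ys using C5[OF that] K by linarith
      show "\<bar>B [y, z, y, z] + B [y', z, y', z] - 2 * B [y, z, y', z]\<bar> \<le> K * \<bar>y - y'\<bar>\<^sup>2"
        if "y \<in> {0..1}" "y' \<in> {0..1}" "z \<in> {0..1}" for y y' z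
        using C6[OF that] mono[OF K(6) zero_le_power2] by (rule order_trans)
      show "\<eta> n * d n * T n \<le> K" "\<sigma> n * \<eta> n * sqrt (T n) \<le> K" using step_size[of n] K(7) by auto
      show "square_integrable M (D 0 i)" if "i \<in> {1..d n}" for i by (rule init(1)) (use that in auto)
      show "O.expectation (\<lambda>\<omega>. (D 0 i \<omega>)\<^sup>2) \<le> K" if "i \<in> {1..d n}" for i
        by (rule order_trans[OF _ K(9)], rule init(2)) (use that in auto)
      show "O.expectation (\<lambda>\<omega>. (D 0 i \<omega> - D 0 j \<omega>)\<^sup>2) \<le> K * ((real i - real j) / d n)\<^sup>2"
        if "i \<in> {1..d n}" "j \<in> {1..d n}" for i j
        by (rule order_trans[OF _ mono[OF K(10) zero_le_power2]], rule init(3)) (use that in auto)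
    qed
  qed
  \<comment> \<open>The results on the limiting sequence are applied along the subsequence selected
    by r.\<close>
  interpret S: sgd_sequence M W A B E "\<lambda>k. d (r k)" "\<lambda>k. T (r k)" "\<lambda>k. \<eta> (r k)" "\<lambda>k. \<sigma> (r k)" C1
      "\<lambda>k. \<theta>s (r k)" "\<lambda>k. \<epsilon> (r k)" "\<lambda>k. \<theta> (r k)" K \<tau> s
    by (rule sgd_sequence.intro[OF bsgd filterlim_compose[OF d_lim filterlim_subseq[OF subseq]]
          filterlim_compose[OF T_lim filterlim_subseq[OF subseq]] \<open>s \<in> {0..\<tau>}\<close> K(11)])
  have eqs: "(\<lambda>k. \<Theta>d (r k)) = S.init"
    "(\<lambda>k \<omega>. MSE_dT (d (r k)) (T (r k)) (\<Delta> (r k) \<omega>) s) = S.mse"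
    "(\<lambda>k \<omega>. PE_dT A (d (r k)) (T (r k)) (\<Delta> (r k) \<omega>) s) = S.pe"
    by (intro ext; simp add: \<Theta>d_def \<Delta>_def S.init_def S.MSE_dT_eq S.PE_dT_eq)+
  have pos: "d n > 0" "T n > 0" for n
    using online_sgd.d_pos[OF sgd[of n]] online_sgd.T_pos[OF sgd[of n]] by auto
  have along: "(\<lambda>k. f (r k)) \<longlonglongrightarrow> l" if "f \<longlonglongrightarrow> l" for f :: "nat \<Rightarrow> real" and l
    using LIMSEQ_subseq_LIMSEQ[OF that subseq] by (simp add: o_def)
  show ?thesis
    unfolding eqs
  proof (intro conjI impI allI; elim conjE)
    assume lim: "(\<lambda>n. \<sigma> n / (d n * sqrt (T n))) \<longlonglongrightarrow> 0" "(\<lambda>n. \<eta> n * d n * T n) \<longlonglongrightarrow> \<alpha>"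
    note l = along[OF lim(2)] along[OF noise_scale_tendsto[OF pos lim]]
    \<comment> \<open>With \<gamma> = 0 any field will do; the zero field is taken.\<close>
    note low = S.solves_limit_low_noise[OF _ _ _ l(1) l(2)[simplified], where \<xi>="\<lambda>_ _ _. 0"]
    fix \<Theta>0 \<Theta>
    assume "random_element M C01 \<Theta>0" "conv_in_prob_metric C01 M S.init \<Theta>0" "low_noise_solution M \<tau> \<alpha> A \<Theta>0 \<Theta>"
    note S.quadratic_conv_in_prob[OF low[OF O.prob_space_axioms this(1,3)] this(2)]
    then show "conv_in_prob M S.mse (\<lambda>\<omega>. MSE (\<Theta> \<omega>) s)" "conv_in_prob M S.pe (\<lambda>\<omega>. PE A (\<Theta> \<omega>) s)" by blast+
  next
    assume lim: "(\<lambda>n. \<sigma> n / (d n * sqrt (T n))) \<longlonglongrightarrow> 0" "(\<lambda>n. \<eta> n * d n * T n) \<longlonglongrightarrow> \<alpha>"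
    note l = along[OF lim(2)] along[OF noise_scale_tendsto[OF pos lim]]
    note low = S.solves_limit_low_noise[OF _ _ _ l(1) l(2)[simplified], where \<xi>="\<lambda>_ _ _. 0"]
    fix \<Theta>0 \<Theta>
    assume "random_element N C01 \<Theta>0" "weak_conv_metric C01 M S.init N \<Theta>0" "low_noise_solution N \<tau> \<alpha> A \<Theta>0 \<Theta>"
    note S.quadratic_conv_in_distribution[OF low[OF N this(1,3)] this(2)]
    then show "conv_in_distribution M S.mse N (\<lambda>\<omega>. MSE (\<Theta> \<omega>) s)" "conv_in_distribution M S.pe N (\<lambda>\<omega>. PE A (\<Theta> \<omega>) s)" by blast+
  next
    assume lim: "(\<lambda>n. \<sigma> n / (d n * sqrt (T n))) \<longlonglongrightarrow> \<beta>" "(\<lambda>n. \<eta> n * d n * T n) \<longlonglongrightarrow> \<alpha>"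
    note l = along[OF lim(2)] along[OF noise_scale_tendsto[OF pos lim]]
    fix \<Theta>0 \<xi> \<Theta>
    assume 0: "random_element N C01 \<Theta>0" "weak_conv_metric C01 M S.init N \<Theta>0" "driving_field N \<tau> A \<xi>"
      "init_indep_field N \<tau> \<Theta>0 \<xi>" and sol: "moderate_noise_solution N \<tau> \<alpha> \<beta> A \<xi> \<Theta>0 \<Theta>"
    \<comment> \<open>By \<open>noise_scale_tendsto\<close> the noise scale converges to \<alpha>
      \<beta>, which is the coefficient of the field in the equation.\<close>
    have "S.solves_limit N \<alpha> (\<alpha> * \<beta>) \<xi> \<Theta>0 \<Theta>"
      using sol unfolding moderate_noise_solution_def by (intro S.solves_limit_noisy N 0 l) auto
    note S.quadratic_conv_in_distribution[OF this 0(2)]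
    then show "conv_in_distribution M S.mse N (\<lambda>\<omega>. MSE (\<Theta> \<omega>) s)" "conv_in_distribution M S.pe N (\<lambda>\<omega>. PE A (\<Theta> \<omega>) s)" by blast+
  next
    assume lim: "filterlim (\<lambda>n. \<sigma> n / (d n * sqrt (T n))) at_top sequentially" "(\<lambda>n. \<eta> n * \<sigma> n * sqrt (T n)) \<longlonglongrightarrow> \<alpha>"
    have "(\<lambda>n. \<sigma> n * \<eta> n * sqrt (T n)) \<longlonglongrightarrow> \<alpha>" using lim(2) by (simp add: mult.commute[of "\<sigma> _"])
    note l = along[OF drift_scale_tendsto_0[OF pos lim]] along[OF this]
    fix \<Theta>0 \<xi> \<Theta>
    assume 0: "random_element N C01 \<Theta>0" "weak_conv_metric C01 M S.init N \<Theta>0" "driving_field N \<tau> A \<xi>"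
      "init_indep_field N \<tau> \<Theta>0 \<xi>" and sol: "high_noise_solution N \<tau> \<alpha> \<xi> \<Theta>0 \<Theta>"
    \<comment> \<open>The drift scale tends to 0, so the driftless equation is the case \<alpha>' =
      0 of the common one.\<close>
    have "S.solves_limit N 0 \<alpha> \<xi> \<Theta>0 \<Theta>"
      using sol unfolding high_noise_solution_def by (intro S.solves_limit_noisy N 0 l) auto
    note S.quadratic_conv_in_distribution[OF this 0(2)]
    then show "conv_in_distribution M S.mse N (\<lambda>\<omega>. MSE (\<Theta> \<omega>) s)" "conv_in_distribution M S.pe N (\<lambda>\<omega>. PE A (\<Theta> \<omega>) s)" by blast+
  qed
qed

end
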